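(* Let $\alpha\in\mathbb N$, $n\in\mathbb N$ and $k\in\{1,\ldots,n\}$ be such that $\alpha k$ is even. Then $$ \tilde{\mathbf J}_{n,k}\Big(\frac{\alpha+n-1}{2}\Big)=\binom nk\tilde c_{\frac{\alpha n}{2}}\big(\tilde c_{\frac{\alpha+1}{2}}\big)^{n-k}\pi\operatorname{Res}_{x=0}\left[\frac{\big(\int_0^x(\sin y)^{\alpha-1}dy\big)^{n-k}}{(\sin x)^{\alpha n-1}}\right]. $$
   Context: $\operatorname{Res}_{x=0}g(x)$ is the coefficient of $x^{-1}$ in the Laurent expansion of $g$ at $0$. For $d\in\mathbb N$ and $\beta>d/2$ the $d$-dimensional beta' distribution has density $\tilde f_{d,\beta}(x)=\tilde c_{d,\beta}(1+\|x\|^2)^{-\beta}$ with $\tilde c_{d,\beta}=\Gamma(\beta)/(\pi^{d/2}\Gamma(\beta-\frac d2))$; $\tilde c_\beta=\Gamma(\beta)/(\sqrt\pi\,\Gamma(\beta-\frac12))$. The internal angle $\beta(F,T)$ of a simplex $T\subset\mathbb R^d$ at a face $F$ is $\lim_{r\downarrow0}\mathrm{Vol}_d(B_r(z)\cap T)/\mathrm{Vol}_d(B_r(z))$, $z$ in the relative interior of $F$. For $n\ge2$, $\beta>\frac{n-1}{2}$ and $\tilde X_1,\ldots,\tilde X_n$ i.i.d. in $\mathbb R^{n-1}$ with density $\tilde f_{n-1,\beta}$, $\tilde{\mathbf J}_{n,k}(\beta)=\binom nk\,\mathbb E\,\beta([\tilde X_1,\ldots,\tilde X_k],[\tilde X_1,\ldots,\tilde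 X_n])$; by convention $\tilde{\mathbf J}_{n,n}(\beta)=1$ for all $n\in\mathbb N$. *)

theory Defs
  imports "HOL-Analysis.Analysis" "HOL-Probability.Probability" "HOL-Complex_Analysis.Complex_Analysis"
begin

text \<open>Points of R^d are modelled as extensional functions nat => real supported on {..<d};
  Lebesgue measure on R^d is the product measure PiM {..<d} (lambda _. lborel).\<close>

definition eucl_norm :: "nat \<Rightarrow> (nat \<Rightarrow> real) \<Rightarrow> real" where
  "eucl_norm d x = sqrt (\<Sum>i<d. (x i)^2)"

definition lebesgue_d :: "nat \<Rightarrow> (nat \<Rightarrow> real) measure" where
  "lebesgue_d d = PiM {..<d} (\<lambda>_. lborel)"

definition ball_d :: "nat \<Rightarrow> (nat \<Rightarrow> real) \<Rightarrow> real \<Rightarrow> (nat \<Rightarrow> real) set" where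
  "ball_d d z r = {y \<in> PiE {..<d} (\<lambda>_. UNIV). eucl_norm d (\<lambda>j. y j - z j) < r}"

definition conv_pts :: "(nat \<Rightarrow> nat \<Rightarrow> real) \<Rightarrow> nat set \<Rightarrow> (nat \<Rightarrow> real) set" where
  "conv_pts X I = {y. \<exists>l. (\<forall>i\<in>I. l i \<ge> 0) \<and> (\<Sum>i\<in>I. l i) = 1 \<and> y = (\<lambda>j. \<Sum>i\<in>I. l i * X i j)}"

definition aff_pts :: "(nat \<Rightarrow> nat \<Rightarrow> real) \<Rightarrow> nat set \<Rightarrow> (nat \<Rightarrow> real) set" where
  "aff_pts X I = {y. \<exists>l. (\<Sum>i\<in>I. l i) = 1 \<and> y = (\<lambda>j. \<Sum>i\<in>I. l i * X i j)}"

definition relint_pts :: "nat \<Rightarrow> (nat \<Rightarrow> nat \<Rightarrow> real) \<Rightarrow> nat set \<Rightarrow> (nat \<Rightarrow> real) set" where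
  "relint_pts d X I = {z \<in> conv_pts X I. \<exists>e>0. \<forall>y\<in>aff_pts X I.
      eucl_norm d (\<lambda>j. y j - z j) < e \<longrightarrow> y \<in> conv_pts X I}"

definition internal_angle :: "nat \<Rightarrow> (nat \<Rightarrow> nat \<Rightarrow> real) \<Rightarrow> nat set \<Rightarrow> nat set \<Rightarrow> real" where
  "internal_angle d X I J =
     (let z = (SOME z. z \<in> relint_pts d X I) in
      Lim (at_right (0::real))
        (\<lambda>r. measure (lebesgue_d d) (ball_d d z r \<inter> conv_pts X J) / measure (lebesgue_d d) (ball_d d z r)))"

definition c_tilde_d :: "nat \<Rightarrow> real \<Rightarrow> real" where
  "c_tilde_d d \<beta> = Gamma \<beta> / (pi powr (real d / 2) * Gamma (\<beta> - real d / 2))"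

definition c_tilde :: "real \<Rightarrow> real" where
  "c_tilde \<beta> = Gamma \<beta> / (sqrt pi * Gamma (\<beta> - 1/2))"

definition f_tilde :: "nat \<Rightarrow> real \<Rightarrow> (nat \<Rightarrow> real) \<Rightarrow> real" where
  "f_tilde d \<beta> x = c_tilde_d d \<beta> * (1 + (eucl_norm d x)^2) powr (-\<beta>)"

definition beta_prime_d :: "nat \<Rightarrow> real \<Rightarrow> (nat \<Rightarrow> real) measure" where
  "beta_prime_d d \<beta> = density (lebesgue_d d) (\<lambda>x. ennreal (f_tilde d \<beta> x))"

text \<open>J tilde_{n,k}(beta): X_0,...,X_{n-1} i.i.d. beta' in R^{n-1} (joint law = product measure);
  face = conv of the first k points. Convention J_{n,n} = 1.\<close>
definition J_tilde :: "nat \<Rightarrow> nat \<Rightarrow> real \<Rightarrow> real" where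
  "J_tilde n k \<beta> = (if k = n then 1 else
     real (n choose k) *
       integral\<^sup>L (PiM {..<n} (\<lambda>_. beta_prime_d (n - 1) \<beta>))
         (\<lambda>X. internal_angle (n - 1) X {..<k} {..<n}))"

end

theory Submission
  imports Defs "Jordan_Normal_Form.Char_Poly"
begin

text \<open>
  A beta' point is \<open>N / R\<close> with \<open>N\<close> standard Gaussian and \<open>R\<close> chi distributed with \<open>\<alpha>\<close> degrees of
  freedom. For fixed radii \<open>R\<^sub>i\<close> the law of the affine dependencies of the points is invariant under the
  reflections that fix the vector \<open>R\<close>, so the expected angle is the Gaussian measure of the cone of all
  \<open>v\<close> orthogonal to \<open>R\<close> with \<open>v\<^sub>j \<ge> 0\<close> for \<open>j > k\<close>. Averaging over the radii turns this into the
  probability that \<open>Y\<^sub>j > 0\<close> for all \<open>j > k\<close> given \<open>Y\<^sub>1 + \<dots> + Y\<^sub>n = 0\<close>, where the \<open>Y\<^sub>i\<close> are independent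
  variance-gamma variables (a product of a Gaussian and a chi variable). As \<open>\<alpha> k\<close> is even, the density of
  \<open>Y\<^sub>1 + \<dots> + Y\<^sub>k\<close> at \<open>s \<ge> 0\<close> is half the residue at \<open>0\<close> of \<open>exp (- s cos x) / (sin x)\<^bsup>\<alpha> k - 1\<^esup>\<close>. The
  remaining variables contribute the Laplace transform of their positive part at \<open>cos x\<close>, each of which is a
  constant times the integral of \<open>sin\<^bsup>\<alpha> - 1\<^esup>\<close> over \<open>[0, x]\<close>, divided by \<open>(sin x)\<^bsup>\<alpha>\<^esup>\<close>.
\<close>

section \<open>Translation-invariant measures\<close>

text \<open>The angle is the volume of a random cone. In the space of coefficients \<open>l\<close>
  of an affine dependency the cone is fixed (\<open>cone_set\<close>), and the points enter only
  through the weight \<open>radial\<close>; the Jacobian of this passage cancels in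
  \<open>angle_ratio\<close>, so only its existence, from uniqueness of invariant measures, is used.
  Reflections fixing the radii act transitively on zero-sum vectors of equal weighted norm, hence
  \<open>radial\<close> is a function of that norm and can be exchanged for a Gaussian. The
  normalisation is then the density at 0 of a Gaussian sum; its reciprocal is proportional to the
  length of the vector of radii and does not factor over the points. It multiplies a quantity of
  degree -1 in the radii, so the product has degree 0 and separates from the length in polar form;
  this leaves the quotient of chi moments contained in \<open>c_tilde\<close>. Evenness enters
  because the densities obey a recursion from index \<open>a\<close> to \<open>a + 2\<close>
  starting from the Laplace density at index 2, and the \<open>k\<close> variables of the face
  convolve to index \<open>\<alpha> * k\<close>. The \<open>2 * pi\<close> of the density at 0 and
  the 1/2 of the residue combine to \<open>pi\<close>.\<close>

locale inv_measure = sigma_finite_measure M for M :: "'a measure" +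
  fixes pl :: "'a \<Rightarrow> 'a \<Rightarrow> 'a" and ng :: "'a \<Rightarrow> 'a"
  assumes pl_measurable: "(\<lambda>p. pl (fst p) (snd p)) \<in> M \<Otimes>\<^sub>M M \<rightarrow>\<^sub>M M"
    and ng_measurable: "ng \<in> M \<rightarrow>\<^sub>M M"
    and pl_commute: "x \<in> space M \<Longrightarrow> y \<in> space M \<Longrightarrow> pl x y = pl y x"
    and pl_assoc: "x \<in> space M \<Longrightarrow> y \<in> space M \<Longrightarrow> z \<in> space M \<Longrightarrow> pl (pl x y) z = pl x (pl y z)"
    and pl_ng_cancel: "x \<in> space M \<Longrightarrow> y \<in> space M \<Longrightarrow> pl (ng y) (pl y x) = x"
    and pl_invariant: "a \<in> space M \<Longrightarrow> distr M M (pl a) = M"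
    and fin_pos: "\<exists>E\<in>sets M. emeasure M E \<noteq> 0 \<and> emeasure M E \<noteq> \<infinity>"
begin

lemma pl_closed: "x \<in> space M \<Longrightarrow> y \<in> space M \<Longrightarrow> pl x y \<in> space M"
  using measurable_space[OF pl_measurable, of "(x, y)"] by (simp add: space_pair_measure)

lemma ng_closed: "x \<in> space M \<Longrightarrow> ng x \<in> space M"
  using measurable_space[OF ng_measurable] by simp

lemma measurable_pl [measurable (raw)]:
  assumes "f \<in> N \<rightarrow>\<^sub>M M" "g \<in> N \<rightarrow>\<^sub>M M"
  shows "(\<lambda>x. pl (f x) (g x)) \<in> N \<rightarrow>\<^sub>M M"
  using measurable_compose[OF measurable_Pair[OF assms] pl_measurable] by simp

lemma measurable_ng [measurable (raw)]: "f \<in> N \<rightarrow>\<^sub>M M \<Longrightarrow> (\<lambda>x. ng (f x)) \<in> N \<rightarrow>\<^sub>M M"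
  using measurable_compose[OF _ ng_measurable] .

lemma pl_left_cancel: 
  assumes "a \<in> space M" "b \<in> space M" "x \<in> space M" "pl x a = pl x b" shows "a = b"
proof -
  have "a = pl (ng x) (pl x a)" using assms(1,3) by (rule pl_ng_cancel[symmetric])
  also have "\<dots> = pl (ng x) (pl x b)" by (simp only: assms(4))
  also have "\<dots> = b" using assms(2,3) by (rule pl_ng_cancel)
  finally show ?thesis .
qed

text \<open>In additive notation, -(z + x) + z = -x. The locale names no neutral element, so both
  sides are compared after adding \<open>x\<close>, where each becomes
  \<open>pl (ng x) x\<close>.\<close>

lemma ng_pl_pl:
  assumes "x \<in> space M" "z \<in> space M"
  shows "pl (ng (pl z x)) z = ng x"
proof -
  note [simp] = assms pl_closed ng_closed
  have "pl x (pl (ng (pl z x)) z) = pl (pl (ng (pl z x)) z) x" by (rule pl_commute) auto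
  also have "\<dots> = pl (ng (pl z x)) (pl z x)" by (rule pl_assoc) auto
  also have "\<dots> = pl (ng (pl z x)) (pl (pl z x) (pl (ng x) x))"
  proof -
    have "pl x (pl (ng x) x) = pl (pl (ng x) x) x" by (rule pl_commute) auto
    also have "\<dots> = pl (ng x) (pl x x)" by (rule pl_assoc) auto
    also have "\<dots> = x" by (rule pl_ng_cancel) auto
    finally show ?thesis by (simp add: pl_assoc)
  qed
  also have "\<dots> = pl (ng x) x" by (rule pl_ng_cancel) auto
  also have "\<dots> = pl x (ng x)" by (simp add: pl_commute)
  finally show ?thesis by (rule pl_left_cancel[of _ _ x, rotated 3]) auto
qed

lemma nn_integral_translate:
  assumes "sets N = sets M" "\<And>a. a \<in> space M \<Longrightarrow> distr N N (pl a) = N"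
    "f \<in> borel_measurable M" "a \<in> space M"
  shows "(\<integral>\<^sup>+x. f (pl a x) \<partial>N) = (\<integral>\<^sup>+x. f x \<partial>N)"
proof -
  have [measurable_cong]: "sets N = sets M" by fact
  note [measurable] = assms(3,4)
  have "(\<integral>\<^sup>+x. f x \<partial>N) = (\<integral>\<^sup>+x. f x \<partial>distr N N (pl a))"
    using assms(2,4) by simp
  also have "\<dots> = (\<integral>\<^sup>+x. f (pl a x) \<partial>N)"
    by (rule nn_integral_distr) measurable
  finally show ?thesis by simp
qed

text \<open>The classical argument for uniqueness of Haar measure: the double integral of
  \<open>g y * f (pl y x)\<close>, with \<open>g\<close> the indicator of a set of positive finite
  measure, is evaluated by Tonelli with one translation in each of the two measures.\<close>

lemma invariant_unique:
  assumes "sigma_finite_measure N" "sets N = sets M"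
    and inv: "\<And>a. a \<in> space M \<Longrightarrow> distr N N (pl a) = N"
  shows "\<exists>c. \<forall>f\<in>borel_measurable M. (\<integral>\<^sup>+x. f x \<partial>N) = c * (\<integral>\<^sup>+x. f x \<partial>M)"
proof -
  interpret N: sigma_finite_measure N by fact
  interpret NM: pair_sigma_finite N M ..
  have sN [measurable_cong]: "sets N = sets M" by fact
  have spN: "space N = space M" using sets_eq_imp_space_eq[OF sN] .
  obtain E where E [measurable]: "E \<in> sets M" and e: "emeasure M E \<noteq> 0" "emeasure M E \<noteq> \<infinity>"
    using fin_pos by auto
  define e where "e = emeasure M E"
  define c where "c = (\<integral>\<^sup>+x. indicator E (ng x) \<partial>N)"
  have "(\<integral>\<^sup>+x. f x \<partial>N) * e = c * (\<integral>\<^sup>+x. f x \<partial>M)" if f [measurable]: "f \<in> borel_measurable M" for f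
  proof -
    define g :: "'a \<Rightarrow> ennreal" where "g = indicator E"
    have g [measurable]: "g \<in> borel_measurable M" unfolding g_def by measurable
    have "(\<integral>\<^sup>+x. f x \<partial>N) * e = (\<integral>\<^sup>+y. g y * (\<integral>\<^sup>+x. f x \<partial>N) \<partial>M)"
      by (subst nn_integral_multc) (auto simp: g_def e_def mult.commute)
    also have "\<dots> = (\<integral>\<^sup>+y. g y * (\<integral>\<^sup>+x. f (pl y x) \<partial>N) \<partial>M)"
      by (intro nn_integral_cong) (simp add: nn_integral_translate[OF sN inv f])
    also have "\<dots> = (\<integral>\<^sup>+y. (\<integral>\<^sup>+x. g y * f (pl y x) \<partial>N) \<partial>M)"
      by (intro nn_integral_cong, subst nn_integral_cmult) auto
    also have "\<dots> = (\<integral>\<^sup>+x. (\<integral>\<^sup>+y. g y * f (pl y x) \<partial>M) \<partial>N)"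
      by (rule NM.Fubini') measurable
    \<comment> \<open>Translating \<open>y\<close> by \<open>ng x\<close> in \<open>M\<close> frees
      the argument of \<open>f\<close> from \<open>x\<close>.\<close>
    also have "\<dots> = (\<integral>\<^sup>+x. (\<integral>\<^sup>+z. g (pl (ng x) z) * f z \<partial>M) \<partial>N)"
    proof (rule nn_integral_cong)
      fix x assume "x \<in> space N"
      then have x [measurable]: "x \<in> space M" "ng x \<in> space M" by (auto simp: spN ng_closed)
      have "(\<integral>\<^sup>+y. g y * f (pl y x) \<partial>M) = (\<integral>\<^sup>+z. g (pl (ng x) z) * f (pl (pl (ng x) z) x) \<partial>M)"
        by (rule nn_integral_translate[OF refl pl_invariant, symmetric]) (use x in measurable)
      also have "\<dots> = (\<integral>\<^sup>+z. g (pl (ng x) z) * f z \<partial>M)"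
      proof (intro nn_integral_cong)
        fix z assume z: "z \<in> space M"
        have "pl (pl (ng x) z) x = pl (ng x) (pl z x)" using x z by (intro pl_assoc)
        also have "pl z x = pl x z" using x z by (intro pl_commute)
        also have "pl (ng x) (pl x z) = z" using x z by (intro pl_ng_cancel)
        finally have "pl (pl (ng x) z) x = z" .
        then show "g (pl (ng x) z) * f (pl (pl (ng x) z) x) = g (pl (ng x) z) * f z" by simp
      qed
      finally show "(\<integral>\<^sup>+y. g y * f (pl y x) \<partial>M) = (\<integral>\<^sup>+z. g (pl (ng x) z) * f z \<partial>M)" .
    qed
    also have "\<dots> = (\<integral>\<^sup>+z. (\<integral>\<^sup>+x. g (pl (ng x) z) * f z \<partial>N) \<partial>M)"
      by (rule NM.Fubini'[symmetric]) measurable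
    also have "\<dots> = (\<integral>\<^sup>+z. (\<integral>\<^sup>+x. g (pl (ng x) z) \<partial>N) * f z \<partial>M)"
      by (intro nn_integral_cong, subst nn_integral_multc) auto
    also have "\<dots> = (\<integral>\<^sup>+z. c * f z \<partial>M)"
    proof (intro nn_integral_cong)
      fix z assume z [measurable]: "z \<in> space M"
      \<comment> \<open>Translating \<open>x\<close> by \<open>z\<close> in \<open>N\<close> shows
        that the inner integral is the same constant for every \<open>z\<close>.\<close>
      have "(\<integral>\<^sup>+x. g (pl (ng x) z) \<partial>N) = (\<integral>\<^sup>+x. g (pl (ng (pl z x)) z) \<partial>N)"
        by (rule nn_integral_translate[OF sN inv, symmetric]) (use z in measurable)
      also have "\<dots> = c" unfolding c_def
        by (intro nn_integral_cong) (simp add: spN z ng_pl_pl g_def)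
      finally show "(\<integral>\<^sup>+x. g (pl (ng x) z) \<partial>N) * f z = c * f z" by simp
    qed
    also have "\<dots> = c * (\<integral>\<^sup>+x. f x \<partial>M)"
      by (rule nn_integral_cmult) measurable
    finally show ?thesis .
  qed
  then have "(\<integral>\<^sup>+x. f x \<partial>N) = (c / e) * (\<integral>\<^sup>+x. f x \<partial>M)" if "f \<in> borel_measurable M" for f
    using that e unfolding e_def[symmetric]
    by (metis ennreal_times_divide infinity_ennreal_def mult.commute mult_divide_eq_ennreal)
  then show ?thesis by blast
qed

text \<open>The push-forward under an additive bijection is again translation invariant, so
  uniqueness supplies a constant, which plays the role of a Jacobian. Applying the same to the
  inverse gives a second constant with product 1, so neither is 0 or infinite.\<close>

lemma additive_automorphism:
  assumes T [measurable]: "T \<in> M \<rightarrow>\<^sub>M M" and S [measurable]: "S \<in> M \<rightarrow>\<^sub>M M"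
    and TS: "\<And>x. x \<in> space M \<Longrightarrow> T (S x) = x" and ST: "\<And>x. x \<in> space M \<Longrightarrow> S (T x) = x"
    and add: "\<And>x y. x \<in> space M \<Longrightarrow> y \<in> space M \<Longrightarrow> T (pl x y) = pl (T x) (T y)"
  shows "\<exists>c. c \<noteq> 0 \<and> c \<noteq> \<infinity> \<and> (\<forall>f\<in>borel_measurable M. (\<integral>\<^sup>+x. f (T x) \<partial>M) = c * (\<integral>\<^sup>+x. f x \<partial>M))"
proof -
  have *: "\<exists>c. \<forall>f\<in>borel_measurable M. (\<integral>\<^sup>+x. f (T x) \<partial>M) = c * (\<integral>\<^sup>+x. f x \<partial>M)"
    if T [measurable]: "T \<in> M \<rightarrow>\<^sub>M M" and S [measurable]: "S \<in> M \<rightarrow>\<^sub>M M"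
    and TS: "\<And>x. x \<in> space M \<Longrightarrow> T (S x) = x" and ST: "\<And>x. x \<in> space M \<Longrightarrow> S (T x) = x"
    and add: "\<And>x y. x \<in> space M \<Longrightarrow> y \<in> space M \<Longrightarrow> T (pl x y) = pl (T x) (T y)" for T S
  proof -
    let ?N = "distr M M T"
    \<comment> \<open>Push-forwards can fail to be sigma-finite; here the preimages of an exhausting
      sequence under the inverse \<open>S\<close> have the original measures.\<close>
    have sf: "sigma_finite_measure ?N"
    proof -
      obtain F :: "nat \<Rightarrow> 'a set" where F: "range F \<subseteq> sets M" "(\<Union>i. F i) = space M" "\<And>i. emeasure M (F i) \<noteq> \<infinity>"
        using sigma_finite by metis
      then have [measurable]: "F i \<in> sets M" for i by auto
      let ?A = "\<lambda>i. S -` F i \<inter> space M"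
      have "emeasure ?N (?A i) = emeasure M (F i)" for i
      proof -
        have "emeasure ?N (?A i) = emeasure M (T -` ?A i \<inter> space M)"
          by (rule emeasure_distr) measurable
        also have "T -` ?A i \<inter> space M = F i"
          using ST measurable_space[OF T] sets.sets_into_space[of "F i" M] F(1) by (auto simp: set_eq_iff)
        finally show ?thesis .
      qed
      moreover have "(\<Union>i. ?A i) = space M"
        using F(2) measurable_space[OF S] by blast
      ultimately show ?thesis
        using F(3) by (intro sigma_finite_measure.intro exI[of _ "range ?A"]) (auto simp: infinity_ennreal_def)
    qed
    have "distr ?N ?N (pl a) = ?N" if [measurable]: "a \<in> space M" for a
    proof -
      have Sa: "S a \<in> space M" using measurable_space[OF S] that by auto
      have "distr ?N ?N (pl a) = distr M M (\<lambda>x. pl a (T x))"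
        by (subst distr_distr) (auto simp: comp_def cong: distr_cong)
      also have "\<dots> = distr M M (\<lambda>x. T (pl (S a) x))"
        using Sa by (intro distr_cong) (auto simp: add TS that)
      also have "\<dots> = distr (distr M M (pl (S a))) M T"
        by (subst distr_distr) (use Sa in \<open>auto simp: comp_def\<close>)
      also have "\<dots> = ?N" using pl_invariant[OF Sa] by simp
      finally show ?thesis .
    qed
    from invariant_unique[OF sf _ this] obtain c where
      c: "\<And>f. f \<in> borel_measurable M \<Longrightarrow> (\<integral>\<^sup>+x. f x \<partial>?N) = c * (\<integral>\<^sup>+x. f x \<partial>M)" by auto
    have "(\<integral>\<^sup>+x. f (T x) \<partial>M) = c * (\<integral>\<^sup>+x. f x \<partial>M)" if [measurable]: "f \<in> borel_measurable M" for f
      using c[of f] by (simp add: nn_integral_distr)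
    then show ?thesis by blast
  qed
  have Sadd: "S (pl x y) = pl (S x) (S y)" if "x \<in> space M" "y \<in> space M" for x y
    using add[of "S x" "S y"] ST[of "pl (S x) (S y)"] measurable_space[OF S] that by (simp add: TS pl_closed)
  obtain c where c: "\<And>f. f \<in> borel_measurable M \<Longrightarrow> (\<integral>\<^sup>+x. f (T x) \<partial>M) = c * (\<integral>\<^sup>+x. f x \<partial>M)"
    using *[OF T S TS ST add] by blast
  obtain c' where c': "\<And>f. f \<in> borel_measurable M \<Longrightarrow> (\<integral>\<^sup>+x. f (S x) \<partial>M) = c' * (\<integral>\<^sup>+x. f x \<partial>M)"
    using *[OF S T ST TS Sadd] by blast
  obtain E where E [measurable]: "E \<in> sets M" and e: "emeasure M E \<noteq> 0" "emeasure M E \<noteq> \<infinity>"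
    using fin_pos by auto
  let ?g = "indicator E :: 'a \<Rightarrow> ennreal"
  have "emeasure M E = (\<integral>\<^sup>+x. ?g x \<partial>M)" by simp
  also have "\<dots> = (\<integral>\<^sup>+x. ?g (T (S x)) \<partial>M)" by (intro nn_integral_cong) (simp add: TS)
  also have "\<dots> = c' * (\<integral>\<^sup>+x. ?g (T x) \<partial>M)" by (rule c'[of "\<lambda>x. ?g (T x)"]) measurable
  also have "\<dots> = c' * (c * (\<integral>\<^sup>+x. ?g x \<partial>M))" by (subst c) auto
  also have "\<dots> = c' * c * emeasure M E" by (simp add: mult.assoc)
  finally have "emeasure M E = c' * c * emeasure M E" .
  with e have "c' * c = 1"
    by (metis mult_divide_eq_ennreal ennreal_divide_self infinity_ennreal_def top.not_eq_extremum)
  then have "c \<noteq> 0" "c \<noteq> \<infinity>" by (auto simp: ennreal_mult_top split: if_splits)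
  with c show ?thesis by blast
qed

text \<open>The constant satisfies \<open>c * c = 1\<close>, and in \<open>[0, \<infinity>]\<close>
  this forces \<open>c = 1\<close>. This gives measure preservation of reflections.\<close>

lemma additive_involution:
  assumes T [measurable]: "T \<in> M \<rightarrow>\<^sub>M M"
    and TT: "\<And>x. x \<in> space M \<Longrightarrow> T (T x) = x"
    and add: "\<And>x y. x \<in> space M \<Longrightarrow> y \<in> space M \<Longrightarrow> T (pl x y) = pl (T x) (T y)"
    and f [measurable]: "f \<in> borel_measurable M"
  shows "(\<integral>\<^sup>+x. f (T x) \<partial>M) = (\<integral>\<^sup>+x. f x \<partial>M)"
proof -
  obtain c where c0: "c \<noteq> 0" "c \<noteq> \<infinity>"
    and c: "\<And>f. f \<in> borel_measurable M \<Longrightarrow> (\<integral>\<^sup>+x. f (T x) \<partial>M) = c * (\<integral>\<^sup>+x. f x \<partial>M)"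
    using additive_automorphism[OF T T TT TT add] by blast
  obtain E where E [measurable]: "E \<in> sets M" and e: "emeasure M E \<noteq> 0" "emeasure M E \<noteq> \<infinity>"
    using fin_pos by auto
  let ?g = "indicator E :: 'a \<Rightarrow> ennreal"
  have "emeasure M E = (\<integral>\<^sup>+x. ?g (T (T x)) \<partial>M)" 
    by (subst nn_integral_indicator[symmetric], simp, intro nn_integral_cong) (simp add: TT)
  also have "\<dots> = c * (\<integral>\<^sup>+x. ?g (T x) \<partial>M)" by (rule c[of "\<lambda>x. ?g (T x)"]) measurable
  also have "\<dots> = c * (c * (\<integral>\<^sup>+x. ?g x \<partial>M))" by (subst c) auto
  also have "\<dots> = c * c * emeasure M E" by (simp add: mult.assoc)
  finally have "emeasure M E = c * c * emeasure M E" .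
  with e have "c * c = 1"
    by (metis mult_divide_eq_ennreal ennreal_divide_self infinity_ennreal_def top.not_eq_extremum)
  with c0 have "c = 1"
  proof (cases c)
    case (real r)
    then have "r * r = 1" using \<open>c * c = 1\<close> by (simp add: ennreal_mult[symmetric] ennreal_eq_1)
    then show ?thesis using real by (auto simp: square_eq_1_iff)
  qed auto
  then show ?thesis using c[OF f] by simp
qed

text \<open>The measure of \<open>A\<close> is averaged over its translates along the curve
  \<open>\<phi> t\<close> with \<open>t\<close> in \<open>[0, 1]\<close>. After Tonelli the inner
  integral runs over a countable set of parameters and vanishes. It serves to show that singular
  configurations and hyperplanes are null.\<close>

lemma null_set_by_translates:
  assumes A [measurable]: "A \<in> sets M" and \<phi> [measurable]: "\<phi> \<in> borel \<rightarrow>\<^sub>M M"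
    and cnt: "\<And>x. x \<in> space M \<Longrightarrow> countable {t::real. pl (\<phi> t) x \<in> A}"
  shows "emeasure M A = 0"
proof -
  interpret P: pair_sigma_finite M lborel ..
  have ph: "\<phi> t \<in> space M" for t using measurable_space[OF \<phi>] by simp
  have "emeasure M A = (\<integral>\<^sup>+t. indicator {0..1::real} t * emeasure M A \<partial>lborel)"
    by (subst nn_integral_multc) auto
  also have "\<dots> = (\<integral>\<^sup>+t. indicator {0..1::real} t * (\<integral>\<^sup>+x. indicator A (pl (\<phi> t) x) \<partial>M) \<partial>lborel)"
    by (intro nn_integral_cong)
       (subst nn_integral_translate[OF refl pl_invariant, where f = "indicator A"], auto simp: ph)
  also have "\<dots> = (\<integral>\<^sup>+t. (\<integral>\<^sup>+x. indicator {0..1::real} t * indicator A (pl (\<phi> t) x) \<partial>M) \<partial>lborel)"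
    by (intro nn_integral_cong, subst nn_integral_cmult) auto
  also have "\<dots> = (\<integral>\<^sup>+x. (\<integral>\<^sup>+t. indicator {0..1::real} t * indicator A (pl (\<phi> t) x) \<partial>lborel) \<partial>M)"
    by (rule P.Fubini') measurable
  also have "\<dots> = (\<integral>\<^sup>+x. 0 \<partial>M)"
  proof (intro nn_integral_cong)
    fix x assume x: "x \<in> space M"
    have "(\<integral>\<^sup>+t. indicator {0..1::real} t * indicator A (pl (\<phi> t) x) \<partial>lborel) = (\<integral>\<^sup>+t. 0 \<partial>(lborel::real measure))"
    proof (rule nn_integral_cong_AE)
      have "AE t in lborel. t \<notin> {t. pl (\<phi> t) x \<in> A}"
        by (rule AE_not_in) (rule countable_imp_null_set_lborel[OF cnt[OF x]])
      then show "AE t in lborel. indicator {0..1::real} t * indicator A (pl (\<phi> t) x) = (0::ennreal)"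
        by eventually_elim auto
    qed
    then show "(\<integral>\<^sup>+t. indicator {0..1::real} t * indicator A (pl (\<phi> t) x) \<partial>lborel) = 0" by simp
  qed
  finally show ?thesis by simp
qed

end

text \<open>Used twice: from \<open>lborel\<close> to points, and from points to tuples of points.
  Invariance is checked on boxes, where translation acts coordinatewise.\<close>

lemma inv_measure_PiM:
  fixes M :: "'a measure" and I :: "'i set"
  assumes "inv_measure M pl ng" and I: "finite I"
  shows "inv_measure (PiM I (\<lambda>_. M)) (\<lambda>x y. \<lambda>i\<in>I. pl (x i) (y i)) (\<lambda>x. \<lambda>i\<in>I. ng (x i))"
proof -
  interpret inv_measure M pl ng by fact
  interpret P: product_sigma_finite "\<lambda>_::'i. M" ..
  interpret F: finite_product_sigma_finite "\<lambda>_::'i. M" I by standard fact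
  show ?thesis
  proof (unfold_locales, goal_cases)
    case 1 then show ?case by measurable
  next
    case 2 then show ?case by measurable
  next
    case (3 x y) then show ?case by (auto simp: space_PiM PiE_iff intro!: restrict_ext pl_commute)
  next
    case (4 x y z) then show ?case by (auto simp: space_PiM PiE_iff intro!: restrict_ext pl_assoc)
  next
    case (5 x y) then show ?case
      by (auto simp: space_PiM PiE_iff pl_ng_cancel restrict_def extensional_def fun_eq_iff)
  next
    case (6 a)
    then have a: "\<And>i. i \<in> I \<Longrightarrow> a i \<in> space M" by (auto simp: space_PiM)
    show ?case
    proof (rule P.PiM_eqI[OF I])
      fix A :: "'i \<Rightarrow> 'a set" assume A: "\<And>i. i \<in> I \<Longrightarrow> A i \<in> sets M"
      let ?T = "\<lambda>y. \<lambda>i\<in>I. pl (a i) (y i)"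
      have [measurable]: "?T \<in> PiM I (\<lambda>_. M) \<rightarrow>\<^sub>M PiM I (\<lambda>_. M)" 
        using a by (intro measurable_restrict) measurable
      have "emeasure (distr (PiM I (\<lambda>_. M)) (PiM I (\<lambda>_. M)) ?T) (Pi\<^sub>E I A)
        = emeasure (PiM I (\<lambda>_. M)) (?T -` (Pi\<^sub>E I A) \<inter> space (PiM I (\<lambda>_. M)))"
        by (rule emeasure_distr) (use A I in \<open>auto intro!: sets_PiM_I_finite\<close>)
      also have "?T -` (Pi\<^sub>E I A) \<inter> space (PiM I (\<lambda>_. M)) = Pi\<^sub>E I (\<lambda>i. pl (a i) -` A i \<inter> space M)"
        by (auto simp: space_PiM PiE_iff)
      also have "emeasure (PiM I (\<lambda>_. M)) \<dots> = (\<Prod>i\<in>I. emeasure M (pl (a i) -` A i \<inter> space M))"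
        by (rule P.emeasure_PiM[OF I]) (use A a in measurable)
      also have "\<dots> = (\<Prod>i\<in>I. emeasure M (A i))"
      proof (intro prod.cong refl)
        fix i assume i: "i \<in> I"
        have "emeasure M (A i) = emeasure (distr M M (pl (a i))) (A i)" 
          using a i by (simp add: pl_invariant)
        also have "\<dots> = emeasure M (pl (a i) -` A i \<inter> space M)"
          using a[OF i] A[OF i] by (intro emeasure_distr) measurable
        finally show "emeasure M (pl (a i) -` A i \<inter> space M) = emeasure M (A i)" by simp
      qed
      finally show "emeasure (distr (PiM I (\<lambda>_. M)) (PiM I (\<lambda>_. M)) ?T) (Pi\<^sub>E I A) = (\<Prod>i\<in>I. emeasure M (A i))" .
    qed simp
  next
    case 7
    obtain E where E [measurable]: "E \<in> sets M" and e: "emeasure M E \<noteq> 0" "emeasure M E \<noteq> \<infinity>"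
      using fin_pos by auto
    have "emeasure (PiM I (\<lambda>_. M)) (Pi\<^sub>E I (\<lambda>_. E)) = emeasure M E ^ card I"
      by (subst P.emeasure_PiM[OF I]) auto
    then show ?case using e I
      by (intro bexI[of _ "Pi\<^sub>E I (\<lambda>_. E)"]) (auto simp: power_eq_top_ennreal intro!: sets_PiM_I_finite)
  qed
qed

lemma inv_measure_lborel: "inv_measure (lborel :: real measure) (+) uminus"
proof (unfold_locales, goal_cases)
  case 1 then show ?case by measurable
next
  case 2 then show ?case by measurable
next
  case (6 a) 
  have "(+) a = (\<lambda>x. a + x)" by auto
  then show ?case using lborel_distr_plus[of a] by (simp cong: distr_cong)
next
  case 7 
  show ?case by (rule bexI[of _ "{0..1::real}"]) auto
next
  case (3 x y) show ?case by simp
next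
  case (4 x y z) show ?case by simp
next
  case (5 x y) show ?case by simp
qed

section \<open>Substitutions and integration in polar form\<close>

text \<open>The change of variables formula says that absolute integrability on the two sides is
  equivalent, with equal integrals. Hence the values agree when finite, and if one is infinite so is
  the other.\<close>

lemma nn_integral_abs_deriv_eq_emeasure_image:
  fixes g g' :: "real \<Rightarrow> real"
  assumes T [measurable]: "T \<in> sets borel" and gT [measurable]: "g ` T \<in> sets borel"
    and [measurable]: "g' \<in> borel_measurable borel"
    and der: "\<And>x. x \<in> T \<Longrightarrow> (g has_field_derivative g' x) (at x within T)" and inj: "inj_on g T"
  shows "(\<integral>\<^sup>+x. ennreal \<bar>g' x\<bar> * indicator T x \<partial>lborel) = emeasure lborel (g ` T)"
proof -
  have cv: "(\<lambda>x. \<bar>g' x\<bar>) absolutely_integrable_on T \<and> integral T (\<lambda>x. \<bar>g' x\<bar>) = b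
     \<longleftrightarrow> (\<lambda>_. 1::real) absolutely_integrable_on (g ` T) \<and> integral (g ` T) (\<lambda>_. 1::real) = b" for b
    using has_absolute_integral_change_of_variables_1'[of T g g' "\<lambda>_. 1" b] der inj by simp
  have nnT: "(\<integral>\<^sup>+x. ennreal \<bar>g' x\<bar> * indicator T x \<partial>lborel) = (\<integral>\<^sup>+x. ennreal (indicator T x * \<bar>g' x\<bar>) \<partial>lborel)"
    by (simp add:  ennreal_mult' ennreal_indicator mult.commute)
  have nng: "emeasure lborel (g ` T) = (\<integral>\<^sup>+x. ennreal (indicator (g ` T) x * 1) \<partial>lborel)"
    by (simp add:  ennreal_indicator)
  show ?thesis
  proof (cases "(\<lambda>x. \<bar>g' x\<bar>) absolutely_integrable_on T")
    case True
    define b where "b = integral T (\<lambda>x. \<bar>g' x\<bar>)"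
    from True cv[of b] have g: "(\<lambda>_. 1::real) absolutely_integrable_on (g ` T)" "integral (g ` T) (\<lambda>_. 1::real) = b"
      by (auto simp: b_def)
    have 1: "((\<lambda>x. \<bar>g' x\<bar>) has_integral b) T" 
      using set_lebesgue_integral_eq_integral(1)[OF True] by (simp add: b_def has_integral_iff)
    have 2: "((\<lambda>x. 1::real) has_integral b) (g ` T)" 
      using set_lebesgue_integral_eq_integral(1)[OF g(1)] g(2) by (simp add: has_integral_iff)
    show ?thesis unfolding nnT nng
      using nn_integral_has_integral_lebesgue[OF _ 1] nn_integral_has_integral_lebesgue[OF _ 2] by simp
  next
    case False
    then have nb: "\<not> (\<lambda>_. 1::real) absolutely_integrable_on (g ` T)" using cv by blast
    have "(\<integral>\<^sup>+x. ennreal \<bar>g' x\<bar> * indicator T x \<partial>lborel) = \<infinity>"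
    proof (rule ccontr)
      assume *: "(\<integral>\<^sup>+x. ennreal \<bar>g' x\<bar> * indicator T x \<partial>lborel) \<noteq> \<infinity>"
      have "integrable lborel (\<lambda>x. indicator T x *\<^sub>R \<bar>g' x\<bar>)"
        using * by (intro integrableI_bounded) (auto simp: top.not_eq_extremum ennreal_mult' ennreal_indicator mult.commute)
      then have "set_integrable lebesgue T (\<lambda>x. \<bar>g' x\<bar>)"
        unfolding set_integrable_def by (subst integrable_completion) auto
      with False show False by simp
    qed
    moreover have "emeasure lborel (g ` T) = \<infinity>"
    proof (rule ccontr)
      assume *: "emeasure lborel (g ` T) \<noteq> \<infinity>"
      have "integrable lborel (\<lambda>x. indicator (g ` T) x *\<^sub>R (1::real))"
        using * by (simp add: top.not_eq_extremum)
      then have "set_integrable lebesgue (g ` T) (\<lambda>x. 1::real)"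
        unfolding set_integrable_def by (subst integrable_completion) auto
      with nb show False by simp
    qed
    ultimately show ?thesis by simp
  qed
qed

text \<open>The preceding lemma, applied to subsets of \<open>S\<close>, identifies the push-forward
  of the density \<open>\<bar>g' x\<bar>\<close> on \<open>S\<close> with Lebesgue measure on the
  image of \<open>S\<close>. Integrating \<open>f\<close> against two equal measures then covers
  infinite values as well.\<close>

lemma nn_integral_substitution_inj:
  fixes g g' :: "real \<Rightarrow> real" and f :: "real \<Rightarrow> ennreal"
  assumes S [measurable]: "S \<in> sets borel" and gS [measurable]: "g ` S \<in> sets borel"
    and [measurable]: "g \<in> borel_measurable borel" "g' \<in> borel_measurable borel" "f \<in> borel_measurable borel"
    and der: "\<And>x. x \<in> S \<Longrightarrow> (g has_field_derivative g' x) (at x within S)" and inj: "inj_on g S"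
  shows "(\<integral>\<^sup>+x. f x * indicator (g ` S) x \<partial>lborel) = (\<integral>\<^sup>+x. f (g x) * ennreal \<bar>g' x\<bar> * indicator S x \<partial>lborel)"
proof -
  let ?N = "density lborel (\<lambda>x. ennreal \<bar>g' x\<bar> * indicator S x)"
  have eq: "distr ?N borel g = density lborel (indicator (g ` S))"
  proof (rule measure_eqI)
    fix A assume "A \<in> sets (distr ?N borel g)"
    then have A [measurable]: "A \<in> sets borel" by simp
    let ?T = "S \<inter> g -` A"
    have im: "g ` ?T = A \<inter> g ` S" by auto
    have T: "?T \<in> sets borel" 
    proof -
      have "{x\<in>space borel. x \<in> S \<and> g x \<in> A} \<in> sets borel" by measurable
      then show ?thesis by (simp add: Int_def vimage_def)
    qed
    have "emeasure (distr ?N borel g) A = emeasure ?N (g -` A)"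
      by (subst emeasure_distr) (auto simp: )
    also have "\<dots> = (\<integral>\<^sup>+x. ennreal \<bar>g' x\<bar> * indicator S x * indicator (g -` A) x \<partial>lborel)"
      by (rule emeasure_density) (use measurable_sets[of g borel borel A] in auto)
    also have "\<dots> = (\<integral>\<^sup>+x. ennreal \<bar>g' x\<bar> * indicator ?T x \<partial>lborel)"
      by (intro nn_integral_cong) (auto split: split_indicator)
    also have "\<dots> = emeasure lborel (g ` ?T)"
    proof (rule nn_integral_abs_deriv_eq_emeasure_image[OF T])
      show "g ` ?T \<in> sets borel" unfolding im by measurable
      show "inj_on g ?T" using inj by (auto simp: inj_on_def)
    qed (auto intro: DERIV_subset[OF der])
    also have "\<dots> = emeasure (density lborel (indicator (g ` S))) A"
      unfolding im by (subst emeasure_density) (auto simp: indicator_inter_arith[symmetric] Int_commute)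
    finally show "emeasure (distr ?N borel g) A = emeasure (density lborel (indicator (g ` S))) A" .
  qed simp
  have "(\<integral>\<^sup>+x. f x * indicator (g ` S) x \<partial>lborel) = (\<integral>\<^sup>+x. f x \<partial>density lborel (indicator (g ` S)))"
    by (subst nn_integral_density) (auto simp: mult.commute)
  also have "\<dots> = (\<integral>\<^sup>+x. f (g x) \<partial>?N)"
    unfolding eq[symmetric] by (rule nn_integral_distr) auto
  also have "\<dots> = (\<integral>\<^sup>+x. f (g x) * ennreal \<bar>g' x\<bar> * indicator S x \<partial>lborel)"
    by (subst nn_integral_density) (auto simp: mult_ac)
  finally show ?thesis .
qed

text \<open>The integral of \<open>r\<^bsup>a - 1\<^esup> exp (- r\<^sup>2 / 2)\<close> over \<open>r > 0\<close>.\<close>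

definition chi_moment :: "nat \<Rightarrow> real" where
  "chi_moment a = 2 powr (real a / 2 - 1) * Gamma (real a / 2)"

lemma chi_moment_pos: "a \<ge> 1 \<Longrightarrow> chi_moment a > 0"
  by (simp add: chi_moment_def Gamma_real_pos)

lemma image_times_greaterThan_0:
  fixes g :: "real \<Rightarrow> real"
  assumes "\<And>x. x > 0 \<Longrightarrow> g x > 0" "\<And>y. y > 0 \<Longrightarrow> h y > 0" "\<And>y. y > 0 \<Longrightarrow> g (h y) = y"
  shows "g ` {0<..} = {0<..}"
  using assms by (auto simp: image_iff) (metis greaterThan_iff)

text \<open>The substitution \<open>t = c * r^2 / 2\<close> in the Gamma integral at
  \<open>a / 2\<close>; the powers of \<open>c\<close> and 2 are what it leaves behind.\<close>

lemma gauss_moment: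
  assumes a: "a \<ge> 1" and c: "c > 0"
  shows "(\<integral>\<^sup>+r. ennreal (r ^ (a - 1) * exp (- (c * r\<^sup>2 / 2))) * indicator {0<..} r \<partial>lborel)
    = ennreal (chi_moment a * c powr (- real a / 2))"
proof -
  define b where "b = real a / 2"
  have b: "b > 0" using a by (simp add: b_def)
  have im: "(\<lambda>r. c * r\<^sup>2 / 2) ` {0<..} = {0<..}"
    by (rule image_times_greaterThan_0[where h = "\<lambda>y. sqrt (2 * y / c)"]) (use c in \<open>auto simp: field_simps\<close>)
  have "ennreal (Gamma b) = (\<integral>\<^sup>+t. ennreal (indicator {0..} t * (t powr (b - 1) / exp t)) \<partial>lborel)"
    using nn_integral_has_integral_lebesgue[OF _ Gamma_integral_real[OF b]] by simp
  also have "\<dots> = (\<integral>\<^sup>+t. ennreal (t powr (b - 1) / exp t) * indicator {0<..} t \<partial>lborel)"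
    by (auto intro!: nn_integral_cong split: split_indicator)
  also have "\<dots> = (\<integral>\<^sup>+r. ennreal ((c * r\<^sup>2 / 2) powr (b - 1) / exp (c * r\<^sup>2 / 2)) * ennreal \<bar>c * r\<bar> * indicator {0<..} r \<partial>lborel)"
  proof (rule nn_integral_substitution_inj[of "{0<..}" "\<lambda>r. c * r\<^sup>2 / 2" "\<lambda>r. c * r" "\<lambda>t. ennreal (t powr (b - 1) / exp t)", unfolded im])
    show "inj_on (\<lambda>r. c * r\<^sup>2 / 2) {0<..}" using c by (auto simp: inj_on_def)
    show "((\<lambda>r. c * r\<^sup>2 / 2) has_real_derivative c * x) (at x within {0<..})" for x
      by (auto intro!: derivative_eq_intros)
  qed auto
  also have "\<dots> = (\<integral>\<^sup>+r. ennreal (c powr b * 2 powr (1 - b)) * (ennreal (r ^ (a - 1) * exp (- (c * r\<^sup>2 / 2))) * indicator {0<..} r) \<partial>lborel)"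
  proof (intro nn_integral_cong)
    fix r :: real
    show "ennreal ((c * r\<^sup>2 / 2) powr (b - 1) / exp (c * r\<^sup>2 / 2)) * ennreal \<bar>c * r\<bar> * indicator {0<..} r
      = ennreal (c powr b * 2 powr (1 - b)) * (ennreal (r ^ (a - 1) * exp (- (c * r\<^sup>2 / 2))) * indicator {0<..} r)"
    proof (cases "r > 0")
      case True
      have r2: "(r\<^sup>2) powr (b - 1) = r powr (2 * (b - 1))"
      proof -
        have "(r\<^sup>2) powr (b - 1) = (r powr 2) powr (b - 1)" using True by simp
        then show ?thesis by (simp add: powr_powr)
      qed
      have ra: "r ^ (a - 1) = r powr (2 * (b - 1)) * r"
      proof -
        have "r ^ (a - 1) = r powr (real (a - 1))" using True by (simp add: powr_realpow)
        also have "real (a - 1) = 2 * (b - 1) + 1" using a by (simp add: b_def of_nat_diff)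
        also have "r powr \<dots> = r powr (2 * (b - 1)) * r" using True by (subst powr_add) simp
        finally show ?thesis .
      qed
      have p: "(c * r\<^sup>2 / 2) powr (b - 1) = c powr (b - 1) * r powr (2 * (b - 1)) * 2 powr (1 - b)"
        using powr_minus_divide[of 2 "b - 1"] True c by (simp add: powr_divide powr_mult r2)
      have cc: "c powr (b - 1) * c = c powr b" using c by (simp add: powr_diff)
      have "(c * r\<^sup>2 / 2) powr (b - 1) / exp (c * r\<^sup>2 / 2) * \<bar>c * r\<bar>
         = (c powr (b-1) * c) * 2 powr (1 - b) * (r ^ (a - 1) * exp (- (c * r\<^sup>2 / 2)))"
        using True c unfolding p ra by (simp add: exp_minus field_simps)
      then show ?thesis using True c
        by (simp add: cc ennreal_mult'[symmetric])
    qed auto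
  qed
  also have "\<dots> = ennreal (c powr b * 2 powr (1 - b)) * (\<integral>\<^sup>+r. ennreal (r ^ (a - 1) * exp (- (c * r\<^sup>2 / 2))) * indicator {0<..} r \<partial>lborel)"
    by (rule nn_integral_cmult) measurable
  finally have eq: "ennreal (Gamma b) = ennreal (c powr b * 2 powr (1 - b)) * (\<integral>\<^sup>+r. ennreal (r ^ (a - 1) * exp (- (c * r\<^sup>2 / 2))) * indicator {0<..} r \<partial>lborel)"
    (is "_ = _ * ?I") .
  have "ennreal (chi_moment a * c powr (- real a / 2)) = ennreal (c powr (-b) * 2 powr (b - 1)) * ennreal (Gamma b)"
    using b by (subst ennreal_mult'[symmetric]) (auto simp: chi_moment_def b_def mult_ac)
  also have "\<dots> = ennreal (c powr (-b) * 2 powr (b - 1)) * ennreal (c powr b * 2 powr (1 - b)) * ?I"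
    unfolding eq by (simp add: mult.assoc)
  also have "ennreal (c powr (-b) * 2 powr (b - 1)) * ennreal (c powr b * 2 powr (1 - b)) = 1"
  proof -
    have "c powr (-b) * 2 powr (b - 1) * (c powr b * 2 powr (1 - b)) = 1"
      using c by (simp add: powr_minus powr_diff field_simps)
    then show ?thesis by (subst ennreal_mult'[symmetric]) auto
  qed
  finally show ?thesis by simp
qed

section \<open>Polar integration for homogeneous measures\<close>

lemma square_powr_minus_half:
  fixes r :: real
  assumes "r > 0"
  shows "r\<^sup>2 powr (- real D / 2) = inverse (r ^ D)"
proof -
  have "r\<^sup>2 powr (- real D / 2) = (r powr 2) powr (- real D / 2)" using assms by simp
  also have "\<dots> = r powr (- real D)" by (subst powr_powr) simp
  also have "\<dots> = inverse (r ^ D)" using assms by (simp add: powr_minus powr_realpow)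
  finally show ?thesis .
qed

lemma gauss_moment1:
  assumes a: "a \<ge> 1"
  shows "(\<integral>\<^sup>+r. ennreal (r ^ (a - 1) * exp (- (r\<^sup>2 / 2))) * indicator {0<..} r \<partial>lborel) = ennreal (chi_moment a)"
  using gauss_moment[OF a, of 1] by simp

lemma nn_integral_inversion:
  fixes w :: "real \<Rightarrow> ennreal"
  assumes [measurable]: "w \<in> borel_measurable borel" and s: "s > 0"
  shows "(\<integral>\<^sup>+t. w t * indicator {0<..} t \<partial>lborel)
    = (\<integral>\<^sup>+t. w (s / t) * ennreal (s / t\<^sup>2) * indicator {0<..} t \<partial>lborel)"
proof -
  have im: "(\<lambda>t. s / t) ` {0<..} = {0<..}"
    by (rule image_times_greaterThan_0[where h = "\<lambda>t. s / t"]) (use s in \<open>auto simp: field_simps\<close>)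
  have "(\<integral>\<^sup>+t. w t * indicator {0<..} t \<partial>lborel) = 
    (\<integral>\<^sup>+t. w (s / t) * ennreal \<bar>- s / t\<^sup>2\<bar> * indicator {0<..} t \<partial>lborel)"
  proof (rule nn_integral_substitution_inj[of "{0<..}" "\<lambda>t. s / t" "\<lambda>t. - s / t\<^sup>2" w, unfolded im])
    show "inj_on ((/) s) {0<..}" using s by (auto simp: inj_on_def)
    show "((/) s has_real_derivative - s / x\<^sup>2) (at x within {0<..})" if "x \<in> {0<..}" for x
      using that by (auto intro!: derivative_eq_intros simp: power2_eq_square)
  qed auto
  then show ?thesis using s by simp
qed

text \<open>Polar coordinates with a Gaussian in place of a surface measure. The constant
  \<open>chi_moment D\<close> is written as the integral over \<open>t > 0\<close> of
  \<open>t^(D-1) * \<rho>^D * exp (- t^2 * \<rho>^2 / 2)\<close>. After exchanging integrals and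
  rescaling \<open>x\<close> by \<open>1 / t\<close>, the Gaussian depends on
  \<open>\<rho> x\<close> alone and \<open>w\<close> on \<open>\<rho> x / t\<close>; inverting
  \<open>t\<close> separates them. Here \<open>M\<close> has degree \<open>D\<close>,
  \<open>\<rho>\<close> degree 1 and \<open>f\<close> degree 0.\<close>

lemma homogeneous_polar:
  fixes f :: "'a \<Rightarrow> ennreal" and w :: "real \<Rightarrow> ennreal" and \<rho> :: "'a \<Rightarrow> real"
  assumes "sigma_finite_measure M" and D: "D \<ge> 1"
    and [measurable]: "(\<lambda>p. S (fst p) (snd p)) \<in> borel \<Otimes>\<^sub>M M \<rightarrow>\<^sub>M M" "\<rho> \<in> borel_measurable M"
      "f \<in> borel_measurable M" "w \<in> borel_measurable borel"
    and hom: "\<And>t h. t > 0 \<Longrightarrow> h \<in> borel_measurable M \<Longrightarrow>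
        ennreal (t ^ D) * (\<integral>\<^sup>+x. h (S t x) \<partial>M) = (\<integral>\<^sup>+x. h x \<partial>M)"
    and \<rho>: "\<And>t x. t > 0 \<Longrightarrow> x \<in> space M \<Longrightarrow> \<rho> (S t x) = t * \<rho> x" 
    and \<rho>_pos: "AE x in M. \<rho> x > 0"
    and f: "\<And>t x. t > 0 \<Longrightarrow> x \<in> space M \<Longrightarrow> f (S t x) = f x"
  shows "ennreal (chi_moment D) * (\<integral>\<^sup>+x. f x * w (\<rho> x) \<partial>M)
    = (\<integral>\<^sup>+x. f x * ennreal (exp (- ((\<rho> x)\<^sup>2 / 2))) \<partial>M) * (\<integral>\<^sup>+t. ennreal (t ^ (D - 1)) * w t * indicator {0<..} t \<partial>lborel)"
proof -
  interpret sigma_finite_measure M by fact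
  interpret P: pair_sigma_finite M lborel ..
  have S [measurable]: "S t \<in> M \<rightarrow>\<^sub>M M" for t
  proof -
    have "(\<lambda>x. S (fst (t, x)) (snd (t, x))) \<in> M \<rightarrow>\<^sub>M M"
      by (rule measurable_compose[where g = "\<lambda>p. S (fst p) (snd p)", of "\<lambda>x. (t, x)" M "borel \<Otimes>\<^sub>M M"]) measurable
    then show ?thesis by simp
  qed
  let ?k = "\<lambda>t x. ennreal (t ^ (D - 1)) * (f x * w (\<rho> x) * ennreal (\<rho> x ^ D * exp (- (t\<^sup>2 * (\<rho> x)\<^sup>2 / 2)))) * indicator {0<..} t"
  let ?W = "\<integral>\<^sup>+t. ennreal (t ^ (D - 1)) * w t * indicator {0<..} t \<partial>lborel"
  have "ennreal (chi_moment D) * (\<integral>\<^sup>+x. f x * w (\<rho> x) \<partial>M) = (\<integral>\<^sup>+x. f x * w (\<rho> x) * ennreal (chi_moment D) \<partial>M)"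
    by (subst nn_integral_multc) (auto simp: mult.commute)
  also have "\<dots> = (\<integral>\<^sup>+x. (\<integral>\<^sup>+t. ?k t x \<partial>lborel) \<partial>M)"
  proof (rule nn_integral_cong_AE)
    show "AE x in M. f x * w (\<rho> x) * ennreal (chi_moment D) = (\<integral>\<^sup>+t. ?k t x \<partial>lborel)"
      using \<rho>_pos AE_space
    proof eventually_elim
      case (elim x)
      have "(\<integral>\<^sup>+t. ?k t x \<partial>lborel) = (\<integral>\<^sup>+t. (f x * w (\<rho> x) * ennreal (\<rho> x ^ D)) *
            (ennreal (t ^ (D - 1) * exp (- ((\<rho> x)\<^sup>2 * t\<^sup>2 / 2))) * indicator {0<..} t) \<partial>lborel)"
        using elim by (intro nn_integral_cong) (auto simp: ennreal_mult mult_ac split: split_indicator)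
      also have "\<dots> = f x * w (\<rho> x) * ennreal (\<rho> x ^ D) * ennreal (chi_moment D * (\<rho> x)\<^sup>2 powr (- real D / 2))"
        using elim gauss_moment[OF D, of "(\<rho> x)\<^sup>2"] by (subst nn_integral_cmult) auto
      also have "\<dots> = f x * w (\<rho> x) * ennreal (\<rho> x ^ D * (chi_moment D * (\<rho> x)\<^sup>2 powr (- real D / 2)))"
        using elim by (subst ennreal_mult') (auto simp: mult.assoc)
      also have "(\<rho> x)\<^sup>2 powr (- real D / 2) = inverse (\<rho> x ^ D)"
        using elim by (intro square_powr_minus_half) auto
      also have "\<rho> x ^ D * (chi_moment D * inverse (\<rho> x ^ D)) = chi_moment D"
        using elim by (simp add: field_simps)
      finally show ?case by simp
    qed
  qed
  also have "\<dots> = (\<integral>\<^sup>+t. (\<integral>\<^sup>+x. ?k t x \<partial>M) \<partial>lborel)"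
    by (rule P.Fubini'[symmetric]) measurable
  \<comment> \<open>Rescaling by \<open>1 / t\<close> keeps \<open>f\<close> and divides
    \<open>\<rho>\<close> by \<open>t\<close>; the powers \<open>t^(-D)\<close>,
    \<open>t^(D-1)\<close> and \<open>(\<rho> / t)^D\<close> collect to
    \<open>\<rho>^D / t^(D+1)\<close>.\<close>
  also have "\<dots> = (\<integral>\<^sup>+t. (\<integral>\<^sup>+x. f x * ennreal (exp (- ((\<rho> x)\<^sup>2 / 2))) * (w (\<rho> x / t) * ennreal (\<rho> x ^ D / t ^ (D + 1))) * indicator {0<..} t \<partial>M) \<partial>lborel)"
  proof (rule nn_integral_cong)
    fix t :: real
    show "(\<integral>\<^sup>+x. ?k t x \<partial>M) = (\<integral>\<^sup>+x. f x * ennreal (exp (- ((\<rho> x)\<^sup>2 / 2))) * (w (\<rho> x / t) * ennreal (\<rho> x ^ D / t ^ (D + 1))) * indicator {0<..} t \<partial>M)"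
    proof (cases "t > 0")
      case True
      have "(\<integral>\<^sup>+x. ?k t x \<partial>M) = ennreal ((1 / t) ^ D) * (\<integral>\<^sup>+x. ?k t (S (1 / t) x) \<partial>M)"
        by (rule hom[symmetric]) (use True in auto)
      also have "\<dots> = (\<integral>\<^sup>+x. ennreal ((1 / t) ^ D) * ?k t (S (1 / t) x) \<partial>M)"
        by (rule nn_integral_cmult[symmetric]) measurable
      also have "\<dots> = (\<integral>\<^sup>+x. f x * ennreal (exp (- ((\<rho> x)\<^sup>2 / 2))) * (w (\<rho> x / t) * ennreal (\<rho> x ^ D / t ^ (D + 1))) * indicator {0<..} t \<partial>M)"
      proof (rule nn_integral_cong_AE)
        show "AE x in M. ennreal ((1 / t) ^ D) * ?k t (S (1 / t) x) = f x * ennreal (exp (- ((\<rho> x)\<^sup>2 / 2))) * (w (\<rho> x / t) * ennreal (\<rho> x ^ D / t ^ (D + 1))) * indicator {0<..} t"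
          using \<rho>_pos AE_space
        proof eventually_elim
          case (elim x)
          have r: "\<rho> (S (1 / t) x) = \<rho> x / t" "f (S (1 / t) x) = f x" 
            using True elim by (auto simp: \<rho> f)
          have e: "t\<^sup>2 * (\<rho> x / t)\<^sup>2 = (\<rho> x)\<^sup>2" using True by (simp add: field_simps)
          have D': "t ^ D = t * t ^ (D - 1)" using D by (simp add: power_eq_if)
          have "ennreal ((1 / t) ^ D) * (ennreal (t ^ (D - 1)) * ennreal ((\<rho> x / t) ^ D)) = ennreal (\<rho> x ^ D / t ^ (D + 1))"
            using True elim by (simp add: ennreal_mult'[symmetric] field_simps D')
          moreover have "ennreal ((1 / t) ^ D) * ?k t (S (1 / t) x) = 
            (ennreal ((1 / t) ^ D) * (ennreal (t ^ (D - 1)) * ennreal ((\<rho> x / t) ^ D))) * (f x * ennreal (exp (- ((\<rho> x)\<^sup>2 / 2))) * w (\<rho> x / t))"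
            using True elim unfolding r e by (simp add: ennreal_mult' mult_ac)
          ultimately show ?case using True by (simp add: mult_ac)
        qed
      qed
      finally show ?thesis .
    qed simp
  qed
  also have "\<dots> = (\<integral>\<^sup>+x. (\<integral>\<^sup>+t. f x * ennreal (exp (- ((\<rho> x)\<^sup>2 / 2))) * (w (\<rho> x / t) * ennreal (\<rho> x ^ D / t ^ (D + 1))) * indicator {0<..} t \<partial>lborel) \<partial>M)"
    by (rule P.Fubini') measurable
  also have "\<dots> = (\<integral>\<^sup>+x. f x * ennreal (exp (- ((\<rho> x)\<^sup>2 / 2))) * ?W \<partial>M)"
  proof (rule nn_integral_cong_AE)
    show "AE x in M. (\<integral>\<^sup>+t. f x * ennreal (exp (- ((\<rho> x)\<^sup>2 / 2))) * (w (\<rho> x / t) * ennreal (\<rho> x ^ D / t ^ (D + 1))) * indicator {0<..} t \<partial>lborel)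
       = f x * ennreal (exp (- ((\<rho> x)\<^sup>2 / 2))) * ?W"
      using \<rho>_pos
    proof eventually_elim
      case (elim x)
      \<comment> \<open>Inversion at \<open>s = \<rho> x\<close>: the inner integral over
        \<open>t\<close> is the same number \<open>?W\<close> for every \<open>x\<close>.\<close>
      have "?W = (\<integral>\<^sup>+t. ennreal ((\<rho> x / t) ^ (D - 1)) * w (\<rho> x / t) * ennreal (\<rho> x / t\<^sup>2) * indicator {0<..} t \<partial>lborel)"
        by (rule nn_integral_inversion) (use elim in auto)
      also have "\<dots> = (\<integral>\<^sup>+t. (w (\<rho> x / t) * ennreal (\<rho> x ^ D / t ^ (D + 1))) * indicator {0<..} t \<partial>lborel)"
      proof (rule nn_integral_cong)
        fix t :: real
        have "ennreal ((\<rho> x / t) ^ (D - 1)) * ennreal (\<rho> x / t\<^sup>2) = ennreal (\<rho> x ^ D / t ^ (D + 1))" if "t > 0"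
        proof -
          have D': "t ^ D = t * t ^ (D - 1)" "\<rho> x ^ D = \<rho> x * \<rho> x ^ (D - 1)" using D by (auto simp: power_eq_if)
          show ?thesis using that elim by (simp add: ennreal_mult'[symmetric] field_simps D' power2_eq_square)
        qed
        then show "ennreal ((\<rho> x / t) ^ (D - 1)) * w (\<rho> x / t) * ennreal (\<rho> x / t\<^sup>2) * indicator {0<..} t = (w (\<rho> x / t) * ennreal (\<rho> x ^ D / t ^ (D + 1))) * indicator {0<..} t"
          by (cases "t > 0") (auto simp: mult_ac)
      qed
      finally show ?case by (simp add: mult.assoc nn_integral_cmult)
    qed
  qed
  also have "\<dots> = (\<integral>\<^sup>+x. f x * ennreal (exp (- ((\<rho> x)\<^sup>2 / 2))) \<partial>M) * ?W"
    by (rule nn_integral_multc) measurable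
  finally show ?thesis .
qed

text \<open>On boxes scaling acts coordinatewise, so degree \<open>a\<close> in each variable
  becomes degree \<open>a * card I\<close>.\<close>

lemma PiM_homogeneous:
  fixes \<mu> :: "real measure" and I :: "'i set"
  assumes "sigma_finite_measure \<mu>" and sets [measurable_cong]: "sets \<mu> = sets borel" and I: "finite I"
    and t: "t > 0"
    and hom: "\<And>A. A \<in> sets borel \<Longrightarrow> ennreal (t ^ a) * emeasure \<mu> ((\<lambda>x. t * x) -` A) = emeasure \<mu> A"
    and h [measurable]: "h \<in> borel_measurable (PiM I (\<lambda>_. \<mu>))"
  shows "ennreal (t ^ (a * card I)) * (\<integral>\<^sup>+x. h (\<lambda>i\<in>I. t * x i) \<partial>PiM I (\<lambda>_. \<mu>)) = (\<integral>\<^sup>+x. h x \<partial>PiM I (\<lambda>_. \<mu>))"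
proof -
  interpret P: product_sigma_finite "\<lambda>_::'i. \<mu>" using assms(1) by (simp add: product_sigma_finite_def)
  let ?M = "PiM I (\<lambda>_. \<mu>)" and ?T = "\<lambda>x. \<lambda>i\<in>I. t * x i"
  have sp: "space \<mu> = UNIV" using sets_eq_imp_space_eq[OF sets] by simp
  have T [measurable]: "?T \<in> ?M \<rightarrow>\<^sub>M ?M" by measurable
  have "scale_measure (ennreal (t ^ (a * card I))) (distr ?M ?M ?T) = ?M"
  proof (rule P.PiM_eqI[OF I])
    fix A :: "'i \<Rightarrow> real set" assume A: "\<And>i. i \<in> I \<Longrightarrow> A i \<in> sets \<mu>"
    have A': "(\<lambda>x. t * x) -` A i \<in> sets \<mu>" if "i \<in> I" for i
      using measurable_sets[of "\<lambda>x. t * x" borel borel "A i"] A[OF that] by (simp add: sets)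
    have "emeasure (distr ?M ?M ?T) (Pi\<^sub>E I A) = emeasure ?M (?T -` (Pi\<^sub>E I A) \<inter> space ?M)"
      by (rule emeasure_distr) (use A I in \<open>auto intro!: sets_PiM_I_finite\<close>)
    also have "?T -` (Pi\<^sub>E I A) \<inter> space ?M = Pi\<^sub>E I (\<lambda>i. (\<lambda>x. t * x) -` A i)"
      by (auto simp: space_PiM PiE_iff sp)
    also have "emeasure ?M \<dots> = (\<Prod>i\<in>I. emeasure \<mu> ((\<lambda>x. t * x) -` A i))"
      by (rule P.emeasure_PiM[OF I A'])
    finally have e: "emeasure (distr ?M ?M ?T) (Pi\<^sub>E I A) = (\<Prod>i\<in>I. emeasure \<mu> ((\<lambda>x. t * x) -` A i))" .
    have "ennreal (t ^ (a * card I)) = (\<Prod>i\<in>I. ennreal (t ^ a))"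
      using t by (simp add: power_mult ennreal_power)
    then show "emeasure (scale_measure (ennreal (t ^ (a * card I))) (distr ?M ?M ?T)) (Pi\<^sub>E I A) = (\<Prod>i\<in>I. emeasure \<mu> (A i))"
      using A unfolding emeasure_scale_measure e by (simp only: prod.distrib[symmetric]) (auto simp: hom sets intro!: prod.cong)
  qed simp
  then have "(\<integral>\<^sup>+x. h x \<partial>?M) = (\<integral>\<^sup>+x. h x \<partial>scale_measure (ennreal (t ^ (a * card I))) (distr ?M ?M ?T))"
    by simp
  also have "\<dots> = ennreal (t ^ (a * card I)) * (\<integral>\<^sup>+x. h (?T x) \<partial>?M)"
    by (subst nn_integral_scale_measure) (auto simp: nn_integral_distr)
  finally show ?thesis by simp
qed

lemma AE_PiM_nonzero:
  fixes \<mu> :: "real measure" and I :: "'i set"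
  assumes "sigma_finite_measure \<mu>" and sets [measurable_cong]: "sets \<mu> = sets borel" and I: "finite I" "I \<noteq> {}"
    and z: "emeasure \<mu> {0} = 0"
  shows "AE x in PiM I (\<lambda>_. \<mu>). \<exists>i\<in>I. x i \<noteq> 0"
proof (rule AE_I)
  interpret P: product_sigma_finite "\<lambda>_::'i. \<mu>" using assms(1) by (simp add: product_sigma_finite_def)
  show "emeasure (PiM I (\<lambda>_. \<mu>)) (Pi\<^sub>E I (\<lambda>_. {0})) = 0"
    using I z by (subst P.emeasure_PiM) (auto simp: sets)
  show "{x \<in> space (PiM I (\<lambda>_. \<mu>)). \<not> (\<exists>i\<in>I. x i \<noteq> 0)} \<subseteq> Pi\<^sub>E I (\<lambda>_. {0})"
    by (intro subsetI PiE_I) (auto simp: space_PiM PiE_iff extensional_def)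
  show "Pi\<^sub>E I (\<lambda>_. {0}) \<in> PiM I (\<lambda>_. \<mu>)" using I by (intro sets_PiM_I_finite) (auto simp: sets)
qed

section \<open>Measures for the radii, and convolution of centred Gaussians\<close>

text \<open>The chi distribution with \<open>a\<close> degrees of freedom, stripped of its constant
  and of the factor \<open>exp (- (r^2 / 2))\<close>. Without that factor the measure is homogeneous
  of degree \<open>a\<close>, as the polar formula requires.\<close>

definition power_measure :: "nat \<Rightarrow> real measure" where
  "power_measure a = density lborel (\<lambda>r. ennreal (r ^ (a - 1)) * indicator {0<..} r)"

lemma sets_power_measure [simp, measurable_cong]: "sets (power_measure a) = sets borel"
  by (simp add: power_measure_def)

lemma space_power_measure [simp]: "space (power_measure a) = UNIV"
  by (simp add: power_measure_def)

lemma sigma_finite_power_measure: "sigma_finite_measure (power_measure a)"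
proof -
  have eq: "power_measure a = density lborel (\<lambda>r. ennreal (r ^ (a - 1) * indicator {0<..} r))"
    unfolding power_measure_def by (intro density_cong) (auto split: split_indicator)
  show ?thesis unfolding eq
    by (rule sigma_finite_measure.sigma_finite_iff_density_finite[OF lborel.sigma_finite_measure_axioms, THEN iffD2]) auto
qed

lemma nn_integral_power_measure:
  assumes [measurable]: "f \<in> borel_measurable borel"
  shows "(\<integral>\<^sup>+r. f r \<partial>power_measure a) = (\<integral>\<^sup>+r. ennreal (r ^ (a - 1)) * indicator {0<..} r * f r \<partial>lborel)"
  unfolding power_measure_def by (rule nn_integral_density) auto

lemma emeasure_power_measure_0: "emeasure (power_measure a) {0} = 0"
  unfolding power_measure_def by (subst emeasure_density) (auto simp: nn_integral_0_iff_AE)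

lemma AE_power_measure_pos: "AE r in power_measure a. r > 0"
  unfolding power_measure_def by (subst AE_density) (auto split: split_indicator)

lemma lborel_homogeneous:
  assumes "t > 0" "A \<in> sets borel"
  shows "ennreal (t ^ 1) * emeasure lborel ((\<lambda>x::real. t * x) -` A) = emeasure lborel A"
proof -
  have m: "(\<lambda>x::real. t * x) -` A \<in> sets borel"
    using measurable_sets[of "\<lambda>x. t * x" borel borel A] assms by simp
  have "emeasure lborel A = (\<integral>\<^sup>+x. indicator A x \<partial>lborel)" using assms by simp
  also have "\<dots> = ennreal \<bar>t\<bar> * (\<integral>\<^sup>+x. indicator A (0 + t * x) \<partial>lborel)"
    by (rule nn_integral_real_affine) (use assms in auto)
  also have "(\<integral>\<^sup>+x. indicator A (0 + t * x) \<partial>lborel) = (\<integral>\<^sup>+x. indicator ((\<lambda>x::real. t * x) -` A) x \<partial>lborel)"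
    by (intro nn_integral_cong) (auto split: split_indicator)
  finally show ?thesis using assms m by simp
qed

lemma power_measure_homogeneous:
  assumes a: "a \<ge> 1" and t: "t > 0" and A [measurable]: "A \<in> sets borel"
  shows "ennreal (t ^ a) * emeasure (power_measure a) ((\<lambda>x::real. t * x) -` A) = emeasure (power_measure a) A"
proof -
  let ?h = "\<lambda>r. ennreal (r ^ (a - 1)) * indicator {0<..} r * indicator A r"
  have m [measurable]: "(\<lambda>x::real. t * x) -` A \<in> sets borel"
    using measurable_sets[of "\<lambda>x. t * x" borel borel A] assms by simp
  have "emeasure (power_measure a) A = (\<integral>\<^sup>+r. ?h r \<partial>lborel)"
    unfolding power_measure_def by (rule emeasure_density) auto
  also have "\<dots> = ennreal \<bar>t\<bar> * (\<integral>\<^sup>+x. ?h (0 + t * x) \<partial>lborel)"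
    by (rule nn_integral_real_affine) (use assms in auto)
  also have "(\<integral>\<^sup>+x. ?h (0 + t * x) \<partial>lborel) = (\<integral>\<^sup>+x. ennreal (t ^ (a - 1)) * 
      (ennreal (x ^ (a - 1)) * indicator {0<..} x * indicator ((\<lambda>x::real. t * x) -` A) x) \<partial>lborel)"
    using t by (intro nn_integral_cong) (auto simp: power_mult_distrib ennreal_mult zero_less_mult_iff split: split_indicator)
  also have "\<dots> = ennreal (t ^ (a - 1)) * emeasure (power_measure a) ((\<lambda>x::real. t * x) -` A)"
    unfolding power_measure_def by (subst nn_integral_cmult) (auto simp: emeasure_density)
  finally have "emeasure (power_measure a) A = ennreal \<bar>t\<bar> * (ennreal (t ^ (a - 1)) * emeasure (power_measure a) ((\<lambda>x::real. t * x) -` A))" .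
  moreover have "t ^ a = t * t ^ (a - 1)" using a by (simp add: power_eq_if)
  ultimately show ?thesis using t by (simp add: ennreal_mult mult.assoc)
qed

lemma power_measure_polar:
  fixes f :: "('i \<Rightarrow> real) \<Rightarrow> ennreal"
  assumes a: "a \<ge> 1" and I: "finite I" "I \<noteq> {}"
    and [measurable]: "f \<in> borel_measurable (PiM I (\<lambda>_. power_measure a))" "w \<in> borel_measurable borel"
    and f: "\<And>t x. t > 0 \<Longrightarrow> x \<in> space (PiM I (\<lambda>_. power_measure a)) \<Longrightarrow> f (\<lambda>i\<in>I. t * x i) = f x"
  shows "ennreal (chi_moment (a * card I)) * (\<integral>\<^sup>+x. f x * w (sqrt (\<Sum>i\<in>I. (x i)\<^sup>2)) \<partial>PiM I (\<lambda>_. power_measure a))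
    = (\<integral>\<^sup>+x. f x * ennreal (exp (- ((\<Sum>i\<in>I. (x i)\<^sup>2) / 2))) \<partial>PiM I (\<lambda>_. power_measure a)) *
      (\<integral>\<^sup>+t. ennreal (t ^ (a * card I - 1)) * w t * indicator {0<..} t \<partial>lborel)"
proof -
  interpret P: finite_product_sigma_finite "\<lambda>_::'i. power_measure a" I
    using I by (simp add: finite_product_sigma_finite_def finite_product_sigma_finite_axioms_def product_sigma_finite_def sigma_finite_power_measure)
  let ?M = "PiM I (\<lambda>_. power_measure a)"
  have "ennreal (chi_moment (a * card I)) * (\<integral>\<^sup>+x. f x * w (sqrt (\<Sum>i\<in>I. (x i)\<^sup>2)) \<partial>?M)
    = (\<integral>\<^sup>+x. f x * ennreal (exp (- ((sqrt (\<Sum>i\<in>I. (x i)\<^sup>2))\<^sup>2 / 2))) \<partial>?M) *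
      (\<integral>\<^sup>+t. ennreal (t ^ (a * card I - 1)) * w t * indicator {0<..} t \<partial>lborel)"
  proof (rule homogeneous_polar[where S = "\<lambda>t x. \<lambda>i\<in>I. t * x i"])
    show "sigma_finite_measure ?M" by (rule P.sigma_finite_measure_axioms)
    show "1 \<le> a * card I" using a I by (simp add: Suc_le_eq card_gt_0_iff)
    show "(\<lambda>p. \<lambda>i\<in>I. fst p * snd p i) \<in> borel \<Otimes>\<^sub>M ?M \<rightarrow>\<^sub>M ?M" by measurable
    show "ennreal (t ^ (a * card I)) * (\<integral>\<^sup>+x. h (\<lambda>i\<in>I. t * x i) \<partial>?M) = (\<integral>\<^sup>+x. h x \<partial>?M)"
      if "t > 0" "h \<in> borel_measurable ?M" for t h
      by (rule PiM_homogeneous) (use that I a in \<open>auto simp: sigma_finite_power_measure power_measure_homogeneous\<close>)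
    show "sqrt (\<Sum>i\<in>I. ((\<lambda>i\<in>I. t * x i) i)\<^sup>2) = t * sqrt (\<Sum>i\<in>I. (x i)\<^sup>2)" if "t > 0" for t x
      using that by (simp add: power_mult_distrib sum_distrib_left[symmetric] real_sqrt_mult)
    show "AE x in ?M. 0 < sqrt (\<Sum>i\<in>I. (x i)\<^sup>2)"
      using AE_PiM_nonzero[OF sigma_finite_power_measure sets_power_measure I emeasure_power_measure_0]
    proof eventually_elim
      case (elim x)
      then obtain i where "i \<in> I" "x i \<noteq> 0" by auto
      then have "0 < (\<Sum>i\<in>I. (x i)\<^sup>2)" using I by (intro sum_pos2[of _ i]) auto
      then show ?case by simp
    qed
    show "f (\<lambda>i\<in>I. t * x i) = f x" if "t > 0" "x \<in> space ?M" for t x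
      using f[OF that] .
  qed measurable
  then show ?thesis by (simp add: sum_nonneg)
qed

text \<open>A convolution of centred Gaussians, evaluated at \<open>y\<close>. The last factor
  absorbs one variable at a time, so its deviation \<open>s\<close> must stay arbitrary in the
  induction.\<close>

lemma normal_density_multi_conv:
  fixes \<sigma> :: "'i \<Rightarrow> real"
  assumes I: "finite I" and pos: "\<And>i. i \<in> I \<Longrightarrow> \<sigma> i > 0" and "s > 0"
  shows "(\<integral>\<^sup>+l. (\<Prod>i\<in>I. ennreal (normal_density 0 (\<sigma> i) (l i))) * ennreal (normal_density 0 s (y - (\<Sum>i\<in>I. l i))) \<partial>PiM I (\<lambda>_. lborel))
    = ennreal (normal_density 0 (sqrt (s\<^sup>2 + (\<Sum>i\<in>I. (\<sigma> i)\<^sup>2))) y)"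
  using I pos \<open>s > 0\<close>
proof (induction I arbitrary: s y rule: finite_induct)
  case empty
  then show ?case by (simp add: PiM_empty nn_integral_count_space_finite)
next
  case (insert j I)
  interpret P: product_sigma_finite "\<lambda>_::'i. lborel :: real measure" ..
  let ?g = "\<lambda>l. \<Prod>i\<in>I. ennreal (normal_density 0 (\<sigma> i) (l i))"
  have "(\<integral>\<^sup>+l. (\<Prod>i\<in>insert j I. ennreal (normal_density 0 (\<sigma> i) (l i))) * ennreal (normal_density 0 s (y - (\<Sum>i\<in>insert j I. l i))) \<partial>PiM (insert j I) (\<lambda>_. lborel))
    = (\<integral>\<^sup>+l. \<integral>\<^sup>+z. (\<Prod>i\<in>insert j I. ennreal (normal_density 0 (\<sigma> i) ((l(j := z)) i))) * ennreal (normal_density 0 s (y - (\<Sum>i\<in>insert j I. (l(j := z)) i))) \<partial>lborel \<partial>PiM I (\<lambda>_. lborel))"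
    using insert by (intro P.product_nn_integral_insert) auto
  also have "\<dots> = (\<integral>\<^sup>+l. ?g l * (\<integral>\<^sup>+z. ennreal (normal_density 0 s ((y - (\<Sum>i\<in>I. l i)) - z) * normal_density 0 (\<sigma> j) z) \<partial>lborel) \<partial>PiM I (\<lambda>_. lborel))"
  proof (rule nn_integral_cong)
    fix l :: "'i \<Rightarrow> real"
    have "(\<Prod>i\<in>I. ennreal (normal_density 0 (\<sigma> i) ((l(j := z)) i))) = ?g l" "(\<Sum>i\<in>I. (l(j := z)) i) = (\<Sum>i\<in>I. l i)" for z
      using insert(2) by (auto intro!: prod.cong sum.cong)
    then show "(\<integral>\<^sup>+z. (\<Prod>i\<in>insert j I. ennreal (normal_density 0 (\<sigma> i) ((l(j := z)) i))) * ennreal (normal_density 0 s (y - (\<Sum>i\<in>insert j I. (l(j := z)) i))) \<partial>lborel)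
      = ?g l * (\<integral>\<^sup>+z. ennreal (normal_density 0 s ((y - (\<Sum>i\<in>I. l i)) - z) * normal_density 0 (\<sigma> j) z) \<partial>lborel)"
      using insert(1,2) by (subst nn_integral_cmult[symmetric]) (auto simp: ennreal_mult' mult_ac algebra_simps)
  qed
  also have "\<dots> = (\<integral>\<^sup>+l. ?g l * ennreal (normal_density 0 (sqrt (s\<^sup>2 + (\<sigma> j)\<^sup>2)) (y - (\<Sum>i\<in>I. l i))) \<partial>PiM I (\<lambda>_. lborel))"
    using fun_cong[OF conv_normal_density_zero_mean[of s "\<sigma> j"]] insert by simp
  also have "\<dots> = ennreal (normal_density 0 (sqrt ((sqrt (s\<^sup>2 + (\<sigma> j)\<^sup>2))\<^sup>2 + (\<Sum>i\<in>I. (\<sigma> i)\<^sup>2))) y)"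
    using insert by (intro insert.IH) (auto simp: sum_power2_gt_zero_iff)
  also have "(sqrt (s\<^sup>2 + (\<sigma> j)\<^sup>2))\<^sup>2 + (\<Sum>i\<in>I. (\<sigma> i)\<^sup>2) = s\<^sup>2 + (\<Sum>i\<in>insert j I. (\<sigma> i)\<^sup>2)"
    using insert by simp
  finally show ?case .
qed

section \<open>Variance-gamma densities\<close>

lemma PiM_density:
  fixes M :: "'i \<Rightarrow> 'a measure"
  assumes I: "finite I" and sf: "\<And>i. sigma_finite_measure (M i)" "\<And>i. sigma_finite_measure (density (M i) (f i))"
    and f [measurable]: "\<And>i. f i \<in> borel_measurable (M i)"
  shows "PiM I (\<lambda>i. density (M i) (f i)) = density (PiM I M) (\<lambda>x. \<Prod>i\<in>I. f i (x i))"
proof -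
  interpret P: product_sigma_finite M using sf by (simp add: product_sigma_finite_def)
  interpret D: product_sigma_finite "\<lambda>i. density (M i) (f i)" using sf by (simp add: product_sigma_finite_def)
  have [measurable]: "(\<lambda>x. \<Prod>i\<in>I. f i (x i)) \<in> borel_measurable (PiM I M)" 
    by (rule borel_measurable_prod_ennreal) measurable
  show ?thesis
  proof (rule D.PiM_eqI[OF I, symmetric])
    show "sets (density (PiM I M) (\<lambda>x. \<Prod>i\<in>I. f i (x i))) = sets (PiM I (\<lambda>i. density (M i) (f i)))"
      by (simp cong: sets_PiM_cong)
    fix A assume A: "\<And>i. i \<in> I \<Longrightarrow> A i \<in> sets (density (M i) (f i))"
    then have A' [measurable]: "\<And>i. i \<in> I \<Longrightarrow> A i \<in> sets (M i)" by simp
    have "emeasure (density (PiM I M) (\<lambda>x. \<Prod>i\<in>I. f i (x i))) (Pi\<^sub>E I A)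
      = (\<integral>\<^sup>+x. (\<Prod>i\<in>I. f i (x i)) * indicator (Pi\<^sub>E I A) x \<partial>PiM I M)"
      by (rule emeasure_density) (use A' I in \<open>auto intro!: sets_PiM_I_finite\<close>)
    also have "\<dots> = (\<integral>\<^sup>+x. (\<Prod>i\<in>I. f i (x i) * indicator (A i) (x i)) \<partial>PiM I M)"
    proof (rule nn_integral_cong)
      fix x assume "x \<in> space (PiM I M)"
      then have "indicator (Pi\<^sub>E I A) x = (\<Prod>i\<in>I. indicator (A i) (x i) :: ennreal)"
        using I by (auto simp: indicator_def space_PiM PiE_iff)
      then show "(\<Prod>i\<in>I. f i (x i)) * indicator (Pi\<^sub>E I A) x = (\<Prod>i\<in>I. f i (x i) * indicator (A i) (x i))"
        by (simp add: prod.distrib)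
    qed
    also have "\<dots> = (\<Prod>i\<in>I. \<integral>\<^sup>+x. f i x * indicator (A i) x \<partial>M i)"
      by (rule P.product_nn_integral_prod[OF I]) measurable
    also have "\<dots> = (\<Prod>i\<in>I. emeasure (density (M i) (f i)) (A i))"
      by (intro prod.cong refl) (simp add: emeasure_density)
    finally show "emeasure (density (PiM I M) (\<lambda>x. \<Prod>i\<in>I. f i (x i))) (Pi\<^sub>E I A) = (\<Prod>i\<in>I. emeasure (density (M i) (f i)) (A i))" .
  qed
qed

lemma AE_PiM_all:
  fixes M :: "'a measure" and I :: "'i set"
  assumes "sigma_finite_measure M" and I: "finite I" and P: "AE x in M. P x"
  shows "AE x in PiM I (\<lambda>_. M). \<forall>i\<in>I. P (x i)"
proof -
  interpret P: product_sigma_finite "\<lambda>_::'i. M" using assms(1) by (simp add: product_sigma_finite_def)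
  obtain N where N: "N \<in> null_sets M" "{x\<in>space M. \<not> P x} \<subseteq> N" using P by (auto elim!: AE_E simp: null_sets_def)
  have "AE x in PiM I (\<lambda>_. M). P (x i)" if i: "i \<in> I" for i
  proof (rule AE_I)
    let ?B = "Pi\<^sub>E I (\<lambda>k. if k = i then N else space M)"
    show "?B \<in> sets (PiM I (\<lambda>_. M))" using I N by (intro sets_PiM_I_finite) auto
    have "emeasure (PiM I (\<lambda>_. M)) ?B = (\<Prod>k\<in>I. emeasure M (if k = i then N else space M))"
      using I N by (intro P.emeasure_PiM) auto
    also have "\<dots> = 0" using I i N by (intro prod_zero) auto
    finally show "emeasure (PiM I (\<lambda>_. M)) ?B = 0" .
    show "{x \<in> space (PiM I (\<lambda>_. M)). \<not> P (x i)} \<subseteq> ?B"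
      using N(2) i by (intro subsetI PiE_I) (auto simp: space_PiM PiE_iff extensional_def)
  qed
  then show ?thesis using I by (simp add: AE_finite_all)
qed

text \<open>Density of a standard Gaussian times an independent chi variable with \<open>a\<close>
  degrees of freedom, as a mixture over the radius \<open>r\<close>. It takes values in
  \<open>ennreal\<close> because it is infinite at 0 for \<open>a = 1\<close>.\<close>

definition vg_density :: "nat \<Rightarrow> real \<Rightarrow> ennreal" where
  "vg_density a y = ennreal (1 / chi_moment a) * (\<integral>\<^sup>+r. ennreal (exp (- (r\<^sup>2 / 2)) * normal_density 0 r y) \<partial>power_measure a)"

lemma measurable_normal_density2 [measurable (raw)]:
  assumes [measurable]: "f \<in> borel_measurable M" "g \<in> borel_measurable M"
  shows "(\<lambda>x. normal_density 0 (f x) (g x)) \<in> borel_measurable M"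
  unfolding normal_density_def by measurable

lemma vg_density_measurable [measurable]: "vg_density a \<in> borel_measurable borel"
proof -
  interpret sigma_finite_measure "power_measure a" by (rule sigma_finite_power_measure)
  show ?thesis unfolding vg_density_def[abs_def] by measurable
qed

lemma vg_density_minus: "vg_density a (- y) = vg_density a y"
  by (simp add: vg_density_def normal_density_def)

lemma nn_integral_exp_power_measure:
  assumes "a \<ge> 1"
  shows "(\<integral>\<^sup>+r. ennreal (exp (- (r\<^sup>2 / 2))) \<partial>power_measure a) = ennreal (chi_moment a)"
proof -
  have "(\<integral>\<^sup>+r. ennreal (exp (- (r\<^sup>2 / 2))) \<partial>power_measure a)
     = (\<integral>\<^sup>+r. ennreal (r ^ (a - 1) * exp (- (r\<^sup>2 / 2))) * indicator {0<..} r \<partial>lborel)"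
    by (subst nn_integral_power_measure) (auto intro!: nn_integral_cong simp: ennreal_mult split: split_indicator)
  then show ?thesis using gauss_moment1[OF assms] by simp
qed

text \<open>For given radii the sum is Gaussian with variance the sum of the squared radii. Only the
  length of the vector of radii enters, and by the polar formula this length behaves like a chi
  variable with \<open>a * (card I + 1)\<close> degrees of freedom. The index \<open>j\<close>
  labels the summand that is determined by \<open>y\<close> and the others.\<close>

lemma vg_density_multi_conv:
  fixes I :: "'i set"
  assumes a: "a \<ge> 1" and I: "finite I" and j: "j \<notin> I"
  shows "(\<integral>\<^sup>+l. (\<Prod>i\<in>I. vg_density a (l i)) * vg_density a (y - (\<Sum>i\<in>I. l i)) \<partial>PiM I (\<lambda>_. lborel)) = vg_density (a * (card I + 1)) y"
proof -
  let ?\<mu> = "power_measure a" and ?K = "insert j I"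
  let ?m = "\<lambda>l i. if i = j then y - (\<Sum>i\<in>I. l i) else l i"
  let ?e = "\<lambda>r. exp (- (r\<^sup>2 / 2))"
  let ?c = "ennreal (1 / chi_moment a)" 
  have K: "finite ?K" "?K \<noteq> {}" "card ?K = card I + 1" using I j by auto
  interpret P: product_sigma_finite "\<lambda>_::'i. ?\<mu>" by (simp add: product_sigma_finite_def sigma_finite_power_measure)
  interpret L: product_sigma_finite "\<lambda>_::'i. lborel :: real measure" ..
  interpret PK: finite_product_sigma_finite "\<lambda>_::'i. ?\<mu>" ?K by standard (use K in auto)
  interpret LI: finite_product_sigma_finite "\<lambda>_::'i. lborel :: real measure" I by standard (use I in auto)
  interpret PL: pair_sigma_finite "PiM ?K (\<lambda>_. ?\<mu>)" "PiM I (\<lambda>_. lborel :: real measure)" ..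
  have chi_moment: "chi_moment a > 0" "chi_moment (a * card ?K) > 0" using a K by (auto intro!: chi_moment_pos)
  have "(\<Prod>i\<in>I. vg_density a (l i)) * vg_density a (y - (\<Sum>i\<in>I. l i)) = ?c ^ card ?K *
      (\<integral>\<^sup>+r. (\<Prod>i\<in>?K. ennreal (?e (r i) * normal_density 0 (r i) (?m l i))) \<partial>PiM ?K (\<lambda>_. ?\<mu>))" for l
  proof -
    have "(\<Prod>i\<in>I. vg_density a (l i)) * vg_density a (y - (\<Sum>i\<in>I. l i)) = (\<Prod>i\<in>?K. vg_density a (?m l i))"
    proof -
      have "(\<Prod>i\<in>I. vg_density a (?m l i)) = (\<Prod>i\<in>I. vg_density a (l i))" using j by (intro prod.cong) auto
      then show ?thesis using I j by (simp add: mult.commute)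
    qed
    also have "\<dots> = ?c ^ card ?K * (\<Prod>i\<in>?K. \<integral>\<^sup>+r. ennreal (?e r * normal_density 0 r (?m l i)) \<partial>?\<mu>)"
      unfolding vg_density_def prod.distrib by simp
    also have "(\<Prod>i\<in>?K. \<integral>\<^sup>+r. ennreal (?e r * normal_density 0 r (?m l i)) \<partial>?\<mu>)
      = (\<integral>\<^sup>+r. (\<Prod>i\<in>?K. ennreal (?e (r i) * normal_density 0 (r i) (?m l i))) \<partial>PiM ?K (\<lambda>_. ?\<mu>))"
      by (rule P.product_nn_integral_prod[symmetric, OF K(1)]) measurable
    finally show ?thesis .
  qed
  then have "(\<integral>\<^sup>+l. (\<Prod>i\<in>I. vg_density a (l i)) * vg_density a (y - (\<Sum>i\<in>I. l i)) \<partial>PiM I (\<lambda>_. lborel))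
     = (\<integral>\<^sup>+l. ?c ^ card ?K * (\<integral>\<^sup>+r. (\<Prod>i\<in>?K. ennreal (?e (r i) * normal_density 0 (r i) (?m l i))) \<partial>PiM ?K (\<lambda>_. ?\<mu>)) \<partial>PiM I (\<lambda>_. lborel))"
    by simp
  also have "\<dots> = ?c ^ card ?K * (\<integral>\<^sup>+l. (\<integral>\<^sup>+r. (\<Prod>i\<in>?K. ennreal (?e (r i) * normal_density 0 (r i) (?m l i))) \<partial>PiM ?K (\<lambda>_. ?\<mu>)) \<partial>PiM I (\<lambda>_. lborel))"
  proof (rule nn_integral_cmult)
    have *: "(\<lambda>x. if i = j then y - (\<Sum>i\<in>I. fst x i) else fst x i) \<in> borel_measurable (PiM I (\<lambda>_. lborel) \<Otimes>\<^sub>M PiM ?K (\<lambda>_. ?\<mu>))" if "i \<in> ?K" for i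
      using that by (cases "i = j") auto
    show "(\<lambda>l. \<integral>\<^sup>+r. (\<Prod>i\<in>?K. ennreal (?e (r i) * normal_density 0 (r i) (?m l i))) \<partial>PiM ?K (\<lambda>_. ?\<mu>)) \<in> borel_measurable (PiM I (\<lambda>_. lborel))"
      by (rule PK.borel_measurable_nn_integral)
         (auto simp: split_beta' intro!: borel_measurable_prod_ennreal measurable_normal_density2 * borel_measurable_times borel_measurable_exp measurable_compose[OF _ measurable_ennreal])
  qed
  also have "(\<integral>\<^sup>+l. (\<integral>\<^sup>+r. (\<Prod>i\<in>?K. ennreal (?e (r i) * normal_density 0 (r i) (?m l i))) \<partial>PiM ?K (\<lambda>_. ?\<mu>)) \<partial>PiM I (\<lambda>_. lborel))
     = (\<integral>\<^sup>+r. (\<integral>\<^sup>+l. (\<Prod>i\<in>?K. ennreal (?e (r i) * normal_density 0 (r i) (?m l i))) \<partial>PiM I (\<lambda>_. lborel)) \<partial>PiM ?K (\<lambda>_. ?\<mu>))"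
  proof (rule PL.Fubini')
    have *: "(\<lambda>x. if i = j then y - (\<Sum>i\<in>I. snd x i) else snd x i) \<in> borel_measurable (PiM ?K (\<lambda>_. ?\<mu>) \<Otimes>\<^sub>M PiM I (\<lambda>_. lborel))" if "i \<in> ?K" for i
      using that by (cases "i = j") auto
    show "(\<lambda>(r, l). (\<Prod>i\<in>?K. ennreal (?e (r i) * normal_density 0 (r i) (?m l i)))) \<in> borel_measurable (PiM ?K (\<lambda>_. ?\<mu>) \<Otimes>\<^sub>M PiM I (\<lambda>_. lborel))"
      by (auto simp: split_beta' intro!: borel_measurable_prod_ennreal measurable_normal_density2 * borel_measurable_times borel_measurable_exp measurable_compose[OF _ measurable_ennreal])
  qed
  also have "\<dots> = (\<integral>\<^sup>+r. 1 * ennreal (?e (sqrt (\<Sum>i\<in>?K. (r i)\<^sup>2)) * normal_density 0 (sqrt (\<Sum>i\<in>?K. (r i)\<^sup>2)) y) \<partial>PiM ?K (\<lambda>_. ?\<mu>))"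
  proof (rule nn_integral_cong_AE)
    show "AE r in PiM ?K (\<lambda>_. ?\<mu>). (\<integral>\<^sup>+l. (\<Prod>i\<in>?K. ennreal (?e (r i) * normal_density 0 (r i) (?m l i))) \<partial>PiM I (\<lambda>_. lborel))
       = 1 * ennreal (?e (sqrt (\<Sum>i\<in>?K. (r i)\<^sup>2)) * normal_density 0 (sqrt (\<Sum>i\<in>?K. (r i)\<^sup>2)) y)"
      using AE_PiM_all[OF sigma_finite_power_measure K(1) AE_power_measure_pos]
    proof eventually_elim
      case (elim r)
      have "(\<integral>\<^sup>+l. (\<Prod>i\<in>?K. ennreal (?e (r i) * normal_density 0 (r i) (?m l i))) \<partial>PiM I (\<lambda>_. lborel))
        = (\<integral>\<^sup>+l. ennreal (\<Prod>i\<in>?K. ?e (r i)) * ((\<Prod>i\<in>I. ennreal (normal_density 0 (r i) (l i))) * ennreal (normal_density 0 (r j) (y - (\<Sum>i\<in>I. l i)))) \<partial>PiM I (\<lambda>_. lborel))"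
      proof (rule nn_integral_cong)
        fix l :: "'i \<Rightarrow> real"
        have "(\<Prod>i\<in>?K. ennreal (?e (r i) * normal_density 0 (r i) (?m l i))) = (\<Prod>i\<in>?K. ennreal (?e (r i))) * (\<Prod>i\<in>?K. ennreal (normal_density 0 (r i) (?m l i)))"
          by (simp add: ennreal_mult' prod.distrib[symmetric])
        also have "(\<Prod>i\<in>?K. ennreal (normal_density 0 (r i) (?m l i))) = ennreal (normal_density 0 (r j) (y - (\<Sum>i\<in>I. l i))) * (\<Prod>i\<in>I. ennreal (normal_density 0 (r i) (l i)))"
          using I j by (auto intro!: arg_cong2[where f = "(*)"] prod.cong)
        also have "(\<Prod>i\<in>?K. ennreal (?e (r i))) = ennreal (\<Prod>i\<in>?K. ?e (r i))" by (rule prod_ennreal) auto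
        finally show "(\<Prod>i\<in>?K. ennreal (?e (r i) * normal_density 0 (r i) (?m l i))) = ennreal (\<Prod>i\<in>?K. ?e (r i)) * ((\<Prod>i\<in>I. ennreal (normal_density 0 (r i) (l i))) * ennreal (normal_density 0 (r j) (y - (\<Sum>i\<in>I. l i))))"
          by (simp add: mult_ac)
      qed
      also have "\<dots> = ennreal (\<Prod>i\<in>?K. ?e (r i)) * (\<integral>\<^sup>+l. (\<Prod>i\<in>I. ennreal (normal_density 0 (r i) (l i))) * ennreal (normal_density 0 (r j) (y - (\<Sum>i\<in>I. l i))) \<partial>PiM I (\<lambda>_. lborel))"
        by (rule nn_integral_cmult) measurable
      also have "\<dots> = ennreal (\<Prod>i\<in>?K. ?e (r i)) * ennreal (normal_density 0 (sqrt ((r j)\<^sup>2 + (\<Sum>i\<in>I. (r i)\<^sup>2))) y)"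
        using elim I by (subst normal_density_multi_conv) auto
      also have "(r j)\<^sup>2 + (\<Sum>i\<in>I. (r i)\<^sup>2) = (\<Sum>i\<in>?K. (r i)\<^sup>2)" using I j by simp
      also have "(\<Prod>i\<in>?K. ?e (r i)) = ?e (sqrt (\<Sum>i\<in>?K. (r i)\<^sup>2))"
        using K(1) by (simp add: exp_sum[symmetric] sum_nonneg sum_negf sum_divide_distrib del: prod.insert sum.insert insert_iff)
      finally show ?case by (simp add: ennreal_mult')
    qed
  qed
  also have "?c ^ card ?K * (\<integral>\<^sup>+r. 1 * ennreal (?e (sqrt (\<Sum>i\<in>?K. (r i)\<^sup>2)) * normal_density 0 (sqrt (\<Sum>i\<in>?K. (r i)\<^sup>2)) y) \<partial>PiM ?K (\<lambda>_. ?\<mu>))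
     = vg_density (a * card ?K) y"
  proof -
    let ?D = "a * card ?K"
    let ?X = "\<integral>\<^sup>+r. 1 * ennreal (?e (sqrt (\<Sum>i\<in>?K. (r i)\<^sup>2)) * normal_density 0 (sqrt (\<Sum>i\<in>?K. (r i)\<^sup>2)) y) \<partial>PiM ?K (\<lambda>_. ?\<mu>)"
    let ?Y = "\<integral>\<^sup>+t. ennreal (t ^ (?D - 1)) * ennreal (?e t * normal_density 0 t y) * indicator {0<..} t \<partial>lborel"
    \<comment> \<open>The polar formula with \<open>f = 1\<close>: its Gaussian integral factors
      into \<open>chi_moment a\<close> for each variable and cancels the normalisations.\<close>
    have "ennreal (chi_moment ?D) * ?X = (\<integral>\<^sup>+x. 1 * ennreal (exp (- ((\<Sum>i\<in>?K. (x i)\<^sup>2) / 2))) \<partial>PiM ?K (\<lambda>_. ?\<mu>)) * ?Y"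
      by (rule power_measure_polar[OF a K(1,2), where f = "\<lambda>_. 1" and w = "\<lambda>t. ennreal (?e t * normal_density 0 t y)"]) measurable
    also have "(\<integral>\<^sup>+x. 1 * ennreal (exp (- ((\<Sum>i\<in>?K. (x i)\<^sup>2) / 2))) \<partial>PiM ?K (\<lambda>_. ?\<mu>)) = (\<integral>\<^sup>+x. (\<Prod>i\<in>?K. ennreal (?e (x i))) \<partial>PiM ?K (\<lambda>_. ?\<mu>))"
      using K(1) by (intro nn_integral_cong) (simp add: exp_sum[symmetric] prod_ennreal sum_negf sum_divide_distrib del: prod.insert sum.insert)
    also have "\<dots> = (\<Prod>i\<in>?K. \<integral>\<^sup>+r. ennreal (?e r) \<partial>?\<mu>)"
      by (rule P.product_nn_integral_prod[OF K(1)]) measurable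
    also have "\<dots> = ennreal (chi_moment a) ^ card ?K" using a by (simp add: nn_integral_exp_power_measure)
    also have "?Y = (\<integral>\<^sup>+r. ennreal (?e r * normal_density 0 r y) \<partial>power_measure ?D)"
      by (subst nn_integral_power_measure) (auto simp: mult_ac)
    finally have eq: "ennreal (chi_moment ?D) * ?X = ennreal (chi_moment a) ^ card ?K * (\<integral>\<^sup>+r. ennreal (?e r * normal_density 0 r y) \<partial>power_measure ?D)" .
    have cM: "?c * ennreal (chi_moment a) = 1" "ennreal (1 / chi_moment ?D) * ennreal (chi_moment ?D) = 1"
      using chi_moment by (auto simp: ennreal_mult'[symmetric] simp del: card_insert_disjoint)
    have "?c ^ card ?K * ?X = ?c ^ card ?K * (ennreal (1 / chi_moment ?D) * ennreal (chi_moment ?D) * ?X)" unfolding cM by simp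
    also have "\<dots> = ?c ^ card ?K * ennreal (1 / chi_moment ?D) * (ennreal (chi_moment ?D) * ?X)" by (simp only: mult_ac)
    also have "\<dots> = (?c * ennreal (chi_moment a)) ^ card ?K * vg_density ?D y" 
      unfolding eq vg_density_def by (simp only: mult_ac power_mult_distrib)
    finally show ?thesis unfolding cM by simp
  qed
  finally show ?thesis using K by simp
qed

section \<open>Normalising constants, the recursion and the Laplace transform of the
  densities\<close>

text \<open>Integrations over radii produce quotients of consecutive chi moments; this recognises
  such a quotient as the constant of the one-dimensional beta' law.\<close>

lemma c_tilde_eq_chi_moment:
  assumes "a \<ge> 2"
  shows "c_tilde (real a / 2) = chi_moment a / (sqrt (2 * pi) * chi_moment (a - 1))"
proof -
  have 1: "real a / 2 - 1 / 2 = real (a - 1) / 2" using assms by (simp add: of_nat_diff field_simps)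
  have 2: "2 powr (real a / 2 - 1) = sqrt 2 * 2 powr (real (a - 1) / 2 - 1)"
  proof -
    have "real a / 2 - 1 = 1 / 2 + (real (a - 1) / 2 - 1)" using assms by (simp add: of_nat_diff field_simps)
    then have "2 powr (real a / 2 - 1) = 2 powr (1 / 2) * 2 powr (real (a - 1) / 2 - 1)" by (simp only: powr_add)
    then show ?thesis by (simp add: powr_half_sqrt)
  qed
  show ?thesis unfolding c_tilde_def chi_moment_def 1 2 by (simp add: real_sqrt_mult)
qed

lemma chi_moment_Suc_Suc:
  assumes "a \<ge> 1"
  shows "chi_moment (a + 2) = real a * chi_moment a"
proof -
  have "Gamma (real (a + 2) / 2) = Gamma (real a / 2 + 1)" by (simp add: field_simps)
  also have "\<dots> = real a / 2 * Gamma (real a / 2)" using assms by (intro Gamma_plus1) (auto simp: nonpos_Ints_def)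
  finally have G: "Gamma (real (a + 2) / 2) = real a / 2 * Gamma (real a / 2)" .
  have "2 powr (real (a + 2) / 2 - 1) = 2 powr (1 + (real a / 2 - 1))" by (simp add: field_simps)
  also have "\<dots> = 2 * 2 powr (real a / 2 - 1)" by (simp only: powr_add) simp
  finally show ?thesis unfolding chi_moment_def G by simp
qed

lemma chi_moment_1: "chi_moment 1 = sqrt (pi / 2)"
proof -
  have "2 powr (- (1 / 2)) = 1 / sqrt (2::real)" by (simp add: powr_minus_divide powr_half_sqrt)
  then show ?thesis by (simp add: chi_moment_def Gamma_one_half_real real_sqrt_divide)
qed

lemma chi_moment_2: "chi_moment 2 = 1"
  by (simp add: chi_moment_def)

lemma vg_density_lborel: "vg_density a y = ennreal (1 / chi_moment a) * (\<integral>\<^sup>+r. ennreal (r ^ (a - 1) * exp (- (r\<^sup>2 / 2)) * normal_density 0 r y) * indicator {0<..} r \<partial>lborel)"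
proof -
  have "(\<integral>\<^sup>+r. ennreal (exp (- (r\<^sup>2 / 2)) * normal_density 0 r y) \<partial>power_measure a)
    = (\<integral>\<^sup>+r. ennreal (r ^ (a - 1) * exp (- (r\<^sup>2 / 2)) * normal_density 0 r y) * indicator {0<..} r \<partial>lborel)"
  proof (subst nn_integral_power_measure, measurable, rule nn_integral_cong)
    fix r :: real
    show "ennreal (r ^ (a - 1)) * indicator {0<..} r * ennreal (exp (- (r\<^sup>2 / 2)) * normal_density 0 r y)
      = ennreal (r ^ (a - 1) * exp (- (r\<^sup>2 / 2)) * normal_density 0 r y) * indicator {0<..} r"
      by (cases "r > 0") (auto simp: ennreal_mult'[symmetric] mult_ac)
  qed
  then show ?thesis unfolding vg_density_def by simp
qed

text \<open>At 0 the Gaussian contributes \<open>1 / (sqrt (2 * pi) * r)\<close>, which lowers the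
  power of \<open>r\<close> by one. Convergence therefore asks for \<open>a \<ge> 2\<close>.\<close>

lemma vg_density_at_0:
  assumes a: "a \<ge> 2"
  shows "vg_density a 0 = ennreal (1 / (2 * pi * c_tilde (real a / 2)))"
proof -
  have "vg_density a 0 = ennreal (1 / chi_moment a) * (\<integral>\<^sup>+r. ennreal (1 / sqrt (2 * pi)) * (ennreal (r ^ (a - 1 - 1) * exp (- (r\<^sup>2 / 2))) * indicator {0<..} r) \<partial>lborel)"
    unfolding vg_density_lborel
  proof (rule arg_cong2[where f = "(*)", OF refl], rule nn_integral_cong)
    fix r :: real
    have "r ^ (a - 1) = r * r ^ (a - 1 - 1)" using a by (simp add: power_eq_if)
    then have "r ^ (a - 1) * exp (- (r\<^sup>2 / 2)) * normal_density 0 r 0 = 1 / sqrt (2 * pi) * (r ^ (a - 1 - 1) * exp (- (r\<^sup>2 / 2)))" if "r > 0"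
      using that by (simp add: normal_density_def real_sqrt_mult)
    then show "ennreal (r ^ (a - 1) * exp (- (r\<^sup>2 / 2)) * normal_density 0 r 0) * indicator {0<..} r = ennreal (1 / sqrt (2 * pi)) * (ennreal (r ^ (a - 1 - 1) * exp (- (r\<^sup>2 / 2))) * indicator {0<..} r)"
      by (cases "r > 0") (auto simp: ennreal_mult'[symmetric])
  qed
  also have "\<dots> = ennreal (1 / chi_moment a) * (ennreal (1 / sqrt (2 * pi)) * ennreal (chi_moment (a - 1)))"
    using a by (subst nn_integral_cmult, measurable, subst gauss_moment1) simp_all
  also have "\<dots> = ennreal (1 / chi_moment a * (1 / sqrt (2 * pi) * chi_moment (a - 1)))"
    using chi_moment_pos[of a] chi_moment_pos[of "a - 1"] a by (simp add: ennreal_mult'[symmetric])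
  also have "1 / chi_moment a * (1 / sqrt (2 * pi) * chi_moment (a - 1)) = 1 / (2 * pi * c_tilde (real a / 2))"
  proof -
    have "sqrt (2 * pi) * sqrt (2 * pi) = 2 * pi" by simp
    then show ?thesis
      using chi_moment_pos[of a] chi_moment_pos[of "a - 1"] a by (simp add: c_tilde_eq_chi_moment field_simps)
  qed
  finally show ?thesis .
qed

lemma normal_density_tail_moment:
  assumes r: "r > 0" and that: "y \<ge> 0"
  shows "(\<integral>\<^sup>+u. ennreal (u * normal_density 0 r u) * indicator {y..} u \<partial>lborel) = ennreal (r\<^sup>2 * normal_density 0 r y)"
proof -
  have "(\<integral>\<^sup>+u. ennreal (u * normal_density 0 r u) * indicator {y..} u \<partial>lborel) = ennreal (0 - (- r\<^sup>2 * normal_density 0 r y))"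
  proof (rule nn_integral_FTC_atLeast[where F = "\<lambda>u. - r\<^sup>2 * normal_density 0 r u"])
    show "((\<lambda>u. - r\<^sup>2 * normal_density 0 r u) has_real_derivative u * normal_density 0 r u) (at u)" for u
      unfolding normal_density_def using r by (auto intro!: derivative_eq_intros simp: field_simps power2_eq_square)
    have *: "((\<lambda>u. exp (- (u\<^sup>2 / (2 * r\<^sup>2)))) \<longlongrightarrow> 0) at_top"
    proof (rule filterlim_compose[OF exp_at_bot])
      have "filterlim (\<lambda>u. inverse (2 * r\<^sup>2) * u\<^sup>2) at_top at_top"
        using r by (intro filterlim_tendsto_pos_mult_at_top[OF tendsto_const] filterlim_pow_at_top filterlim_ident) auto
      then have "filterlim (\<lambda>u. - (inverse (2 * r\<^sup>2) * u\<^sup>2)) at_bot at_top"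
        by (rule filterlim_uminus_at_top[THEN iffD1])
      moreover have "inverse (2 * r\<^sup>2) * u\<^sup>2 = u\<^sup>2 / (2 * r\<^sup>2)" for u by (rule divide_inverse_commute[symmetric])
      ultimately show "filterlim (\<lambda>u. - (u\<^sup>2 / (2 * r\<^sup>2))) at_bot at_top"
        by (simp only:)
    qed
    have "((\<lambda>u. - r\<^sup>2 * (1 / sqrt (2 * pi * r\<^sup>2) * exp (- (u\<^sup>2 / (2 * r\<^sup>2))))) \<longlongrightarrow> - r\<^sup>2 * (1 / sqrt (2 * pi * r\<^sup>2) * 0)) at_top"
      by (intro tendsto_mult tendsto_const *)
    then show "((\<lambda>u. - r\<^sup>2 * normal_density 0 r u) \<longlongrightarrow> 0) at_top"
      by (simp add: normal_density_def)
  qed (use that in auto)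
  then show ?thesis by simp
qed

text \<open>The function \<open>u * normal_density 0 r u\<close> is the derivative of
  \<open>- r^2 * normal_density 0 r u\<close>, and the factor \<open>r^2\<close> raises the index of
  the mixing measure by two. The divisor \<open>a\<close> comes from
  \<open>chi_moment (a + 2) = a * chi_moment a\<close>. This drives the induction over even
  indices.\<close>

lemma vg_density_recursion:
  assumes a: "a \<ge> 1" and y: "y \<ge> 0"
  shows "vg_density (a + 2) y = (\<integral>\<^sup>+u. ennreal (u / real a) * vg_density a u * indicator {y..} u \<partial>lborel)"
proof -
  interpret sigma_finite_measure "power_measure a" by (rule sigma_finite_power_measure)
  interpret P: pair_sigma_finite "power_measure a" "lborel :: real measure" ..
  have chi_moment: "chi_moment a > 0" "chi_moment (a + 2) > 0" using a by (auto intro!: chi_moment_pos)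
  have "(\<integral>\<^sup>+u. ennreal (u / real a) * vg_density a u * indicator {y..} u \<partial>lborel)
    = (\<integral>\<^sup>+u. (\<integral>\<^sup>+r. ennreal (1 / (a * chi_moment a)) * (ennreal (exp (- (r\<^sup>2 / 2))) * (ennreal (u * normal_density 0 r u) * indicator {y..} u)) \<partial>power_measure a) \<partial>lborel)"
  proof (rule nn_integral_cong)
    fix u :: real
    show "ennreal (u / real a) * vg_density a u * indicator {y..} u = (\<integral>\<^sup>+r. ennreal (1 / (a * chi_moment a)) * (ennreal (exp (- (r\<^sup>2 / 2))) * (ennreal (u * normal_density 0 r u) * indicator {y..} u)) \<partial>power_measure a)"
    proof (cases "u \<ge> y")
      case True
      then have u: "u \<ge> 0" using y by simp
      have "(\<integral>\<^sup>+r. ennreal (1 / (a * chi_moment a)) * (ennreal (exp (- (r\<^sup>2 / 2))) * (ennreal (u * normal_density 0 r u) * indicator {y..} u)) \<partial>power_measure a)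
        = (\<integral>\<^sup>+r. ennreal (u / a * (1 / chi_moment a)) * ennreal (exp (- (r\<^sup>2 / 2)) * normal_density 0 r u) \<partial>power_measure a)"
        using True u chi_moment by (intro nn_integral_cong) (auto simp: ennreal_mult'[symmetric] mult_ac)
      also have "\<dots> = ennreal (u / a * (1 / chi_moment a)) * (\<integral>\<^sup>+r. ennreal (exp (- (r\<^sup>2 / 2)) * normal_density 0 r u) \<partial>power_measure a)"
        by (rule nn_integral_cmult) measurable
      also have "\<dots> = ennreal (u / a) * vg_density a u"
        unfolding vg_density_def using u chi_moment by (subst ennreal_mult) (auto simp: mult.assoc)
      finally show ?thesis using True by simp
    qed simp
  qed
  also have "\<dots> = (\<integral>\<^sup>+r. (\<integral>\<^sup>+u. ennreal (1 / (a * chi_moment a)) * (ennreal (exp (- (r\<^sup>2 / 2))) * (ennreal (u * normal_density 0 r u) * indicator {y..} u)) \<partial>lborel) \<partial>power_measure a)"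
    by (rule P.Fubini') measurable
  also have "\<dots> = (\<integral>\<^sup>+r. ennreal (1 / (a * chi_moment a)) * (ennreal (exp (- (r\<^sup>2 / 2))) * (\<integral>\<^sup>+u. (ennreal (u * normal_density 0 r u) * indicator {y..} u) \<partial>lborel)) \<partial>power_measure a)"
    by (simp add: nn_integral_cmult)
  also have "\<dots> = (\<integral>\<^sup>+r. ennreal (1 / (a * chi_moment a)) * (ennreal (exp (- (r\<^sup>2 / 2))) * ennreal (r\<^sup>2 * normal_density 0 r y)) \<partial>power_measure a)"
  proof (rule nn_integral_cong_AE)
    show "AE r in power_measure a. ennreal (1 / (a * chi_moment a)) * (ennreal (exp (- (r\<^sup>2 / 2))) * (\<integral>\<^sup>+u. (ennreal (u * normal_density 0 r u) * indicator {y..} u) \<partial>lborel))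
      = ennreal (1 / (a * chi_moment a)) * (ennreal (exp (- (r\<^sup>2 / 2))) * ennreal (r\<^sup>2 * normal_density 0 r y))"
      using AE_power_measure_pos by eventually_elim (subst normal_density_tail_moment, use y in auto)
  qed
  also have "\<dots> = ennreal (1 / (a * chi_moment a)) * (\<integral>\<^sup>+r. ennreal (exp (- (r\<^sup>2 / 2))) * ennreal (r\<^sup>2 * normal_density 0 r y) \<partial>power_measure a)"
    by (rule nn_integral_cmult) measurable
  also have "(\<integral>\<^sup>+r. ennreal (exp (- (r\<^sup>2 / 2))) * ennreal (r\<^sup>2 * normal_density 0 r y) \<partial>power_measure a)
     = (\<integral>\<^sup>+r. ennreal (r ^ (a + 2 - 1) * exp (- (r\<^sup>2 / 2)) * normal_density 0 r y) * indicator {0<..} r \<partial>lborel)"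
  proof (subst nn_integral_power_measure, measurable, rule nn_integral_cong)
    fix r :: real
    have "r ^ (a + 2 - 1) = r ^ (a - 1) * r\<^sup>2" using a by (simp add: power_add[symmetric])
    then show "ennreal (r ^ (a - 1)) * indicator {0<..} r * (ennreal (exp (- (r\<^sup>2 / 2))) * ennreal (r\<^sup>2 * normal_density 0 r y)) = ennreal (r ^ (a + 2 - 1) * exp (- (r\<^sup>2 / 2)) * normal_density 0 r y) * indicator {0<..} r"
      by (cases "r > 0") (auto simp: ennreal_mult'[symmetric] mult_ac)
  qed
  also have "real a * chi_moment a = chi_moment (a + 2)" using chi_moment_Suc_Suc[OF a] by simp
  finally show ?thesis unfolding vg_density_lborel[of "a + 2"] by simp
qed

text \<open>Completing the square leaves a function of \<open>r - y / r\<close>, which the Cauchy-Schloemilch substitution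
  \<open>r \<mapsto> y / r\<close> integrates.\<close>

lemma vg_density_2:
  assumes y: "y \<ge> 0"
  shows "vg_density 2 y = ennreal (exp (- y) / 2)"
proof (cases "y = 0")
  case True
  \<comment> \<open>The substitution below requires \<open>y > 0\<close>; at 0 the value follows
    from \<open>c_tilde 1 = 1 / pi\<close>.\<close>
  have "chi_moment 1 * sqrt 2 = sqrt pi" unfolding chi_moment_1 by (simp add: real_sqrt_divide)
  then have "c_tilde (real 2 / 2) = 1 / pi" using c_tilde_eq_chi_moment[of 2] by (simp add: chi_moment_2 real_sqrt_mult mult_ac)
  then show ?thesis using True vg_density_at_0[of 2] by simp
next
  case False
  with y have y: "y > 0" by simp
  let ?w = "\<lambda>r. ennreal (exp (- ((r - y / r)\<^sup>2 / 2)))"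
  let ?I = "\<integral>\<^sup>+r. ?w r * indicator {0<..} r \<partial>lborel"
  have P: "vg_density 2 y = ennreal (exp (- y) / sqrt (2 * pi)) * ?I"
  proof -
    have "vg_density 2 y = (\<integral>\<^sup>+r. ennreal (exp (- y) / sqrt (2 * pi)) * (?w r * indicator {0<..} r) \<partial>lborel)"
      unfolding vg_density_lborel chi_moment_2
    proof (simp, rule nn_integral_cong)
      fix r :: real
      have "r * exp (- (r\<^sup>2 / 2)) * normal_density 0 r y = exp (- y) / sqrt (2 * pi) * exp (- ((r - y / r)\<^sup>2 / 2))" if "r > 0"
      proof -
        have "r\<^sup>2 / 2 + y\<^sup>2 / (2 * r\<^sup>2) = y + (r - y / r)\<^sup>2 / 2"
          using that by (simp add: power2_eq_square field_simps)
        then have "exp (- (r\<^sup>2 / 2)) * exp (- (y\<^sup>2 / (2 * r\<^sup>2))) = exp (- y) * exp (- ((r - y / r)\<^sup>2 / 2))"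
          unfolding exp_add[symmetric] by (simp only: minus_add_distrib[symmetric])
        then show ?thesis using that by (simp add: normal_density_def real_sqrt_mult)
      qed
      then show "ennreal (r * exp (- (r\<^sup>2 / 2)) * normal_density 0 r y) * indicator {0<..} r = ennreal (exp (- y) / sqrt (2 * pi)) * (?w r * indicator {0<..} r)"
        by (cases "r > 0") (auto simp: ennreal_mult'[symmetric])
    qed
    then show ?thesis by (simp add: nn_integral_cmult)
  qed
  have I2: "?I = (\<integral>\<^sup>+r. ?w r * ennreal (y / r\<^sup>2) * indicator {0<..} r \<partial>lborel)"
  proof -
    have "?I = (\<integral>\<^sup>+r. ?w (y / r) * ennreal (y / r\<^sup>2) * indicator {0<..} r \<partial>lborel)"
      by (rule nn_integral_inversion) (use y in auto)
    also have "\<dots> = (\<integral>\<^sup>+r. ?w r * ennreal (y / r\<^sup>2) * indicator {0<..} r \<partial>lborel)"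
    proof (rule nn_integral_cong)
      fix r :: real
      have "(y / r - y / (y / r))\<^sup>2 = (r - y / r)\<^sup>2" using y by (simp add: power2_commute)
      then show "?w (y / r) * ennreal (y / r\<^sup>2) * indicator {0<..} r = ?w r * ennreal (y / r\<^sup>2) * indicator {0<..} r" by simp
    qed
    finally show ?thesis .
  qed
  \<comment> \<open>Adding the integral to its image under \<open>r \<mapsto> y / r\<close> produces
    the weight \<open>1 + y / r^2\<close>, which is the derivative of
    \<open>r - y / r\<close>.\<close>
  have "2 * ?I = (\<integral>\<^sup>+r. ?w r * indicator {0<..} r + ?w r * ennreal (y / r\<^sup>2) * indicator {0<..} r \<partial>lborel)"
    by (subst nn_integral_add) (auto simp: I2[symmetric] mult_2)
  also have "\<dots> = (\<integral>\<^sup>+r. ?w r * ennreal \<bar>1 + y / r\<^sup>2\<bar> * indicator {0<..} r \<partial>lborel)"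
    using y by (intro nn_integral_cong) (auto split: split_indicator simp: distrib_left abs_of_nonneg)
  also have "\<dots> = (\<integral>\<^sup>+v. ennreal (exp (- (v\<^sup>2 / 2))) \<partial>lborel)"
  proof -
    have im: "(\<lambda>r. r - y / r) ` {0<..} = UNIV"
    proof -
      have "v \<in> (\<lambda>r. r - y / r) ` {0<..}" for v
      proof
        \<comment> \<open>\<open>(v + D) / 2\<close> is the positive root of
          \<open>r^2 - v * r - y\<close>.\<close>
        define D where "D = sqrt (v\<^sup>2 + 4 * y)"
        have D: "D\<^sup>2 = v\<^sup>2 + 4 * y" using y by (simp add: D_def)
        have "\<bar>v\<bar> < D" unfolding D_def using y by (intro real_less_rsqrt) auto
        then show pos: "(v + D) / 2 \<in> {0<..}" by auto
        have "(v + D) / 2 * ((v + D) / 2) - y = v * ((v + D) / 2)" using D by (simp add: power2_eq_square field_simps)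
        then show "v = (v + D) / 2 - y / ((v + D) / 2)" using pos by (simp add: field_simps)
      qed
      then show ?thesis by auto
    qed
    have "(\<integral>\<^sup>+v. ennreal (exp (- (v\<^sup>2 / 2))) * indicator UNIV v \<partial>lborel) = (\<integral>\<^sup>+r. ?w r * ennreal \<bar>1 + y / r\<^sup>2\<bar> * indicator {0<..} r \<partial>lborel)"
    proof (rule nn_integral_substitution_inj[where g = "\<lambda>r. r - y / r" and S = "{0<..}", unfolded im])
      show "((\<lambda>r. r - y / r) has_real_derivative 1 + y / x\<^sup>2) (at x within {0<..})" if "x \<in> {0<..}" for x
        using that by (auto intro!: derivative_eq_intros simp: power2_eq_square)
      show "inj_on (\<lambda>r. r - y / r) {0<..}"
      proof (rule inj_onI)
        fix a b :: real assume *: "a \<in> {0<..}" "b \<in> {0<..}" "a - y / a = b - y / b"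
        then have "(a - b) * (1 + y / (a * b)) = 0" by (simp add: field_simps)
        moreover have "1 + y / (a * b) > 0" using * y by (intro add_pos_nonneg) auto
        ultimately show "a = b" by simp
      qed
    qed auto
    then show ?thesis by simp
  qed
  also have "\<dots> = ennreal (sqrt (2 * pi)) * (\<integral>\<^sup>+v. ennreal (normal_density 0 1 v) \<partial>lborel)"
    by (subst nn_integral_cmult[symmetric]) (auto simp: std_normal_density_def ennreal_mult'[symmetric])
  also have "(\<integral>\<^sup>+v. ennreal (normal_density 0 1 v) \<partial>lborel) = 1"
    using integral_normal_density[of 1 0] integrable_normal_density[of 1 0] by (subst nn_integral_eq_integral) auto
  finally have I: "2 * ?I = ennreal (sqrt (2 * pi))" by simp
  have "?I = ennreal (1 / 2) * (2 * ?I)"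
  proof -
    have "ennreal (1 / 2) * ennreal 2 = ennreal 1" by (subst ennreal_mult'[symmetric]) auto
    then show ?thesis by (simp only: mult.assoc[symmetric] ennreal_numeral ennreal_1 mult_1)
  qed
  also have "\<dots> = ennreal (sqrt (2 * pi) / 2)" unfolding I by (subst ennreal_mult'[symmetric]) auto
  finally show ?thesis unfolding P by (simp add: ennreal_mult'[symmetric])
qed

text \<open>With \<open>y = r^2 * w\<close> the radius can be integrated first and leaves a power of
  the quadratic \<open>?Q w\<close>; a trigonometric substitution turns this into a power of
  \<open>sin t / sin x\<close>. The range of \<open>x\<close> keeps \<open>cos x\<close> and
  \<open>sin x\<close> positive; complex \<open>x\<close> is reached later by analytic
  continuation.\<close>

lemma laplace_vg_density:
  assumes a: "a \<ge> 1" and x: "0 < x" "x < pi / 2"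
  shows "(\<integral>\<^sup>+y. ennreal (exp (- cos x * y)) * vg_density a y * indicator {0<..} y \<partial>lborel)
    = ennreal (c_tilde ((real a + 1) / 2) * integral {0..x} (\<lambda>t. sin t ^ (a - 1)) / sin x ^ a)"
proof -
  interpret sigma_finite_measure "power_measure a" by (rule sigma_finite_power_measure)
  interpret P: pair_sigma_finite "power_measure a" "lborel :: real measure" ..
  define c where "c = cos x"
  have c: "c > 0" using x by (auto simp: c_def intro!: cos_gt_zero_pi)
  have s: "sin x > 0" using x by (intro sin_gt_zero) auto
  have chi_moment: "chi_moment a > 0" "chi_moment (a + 1) > 0" using a by (auto intro!: chi_moment_pos)
  let ?Q = "\<lambda>w. 1 + 2 * c * w + w\<^sup>2"
  have Q: "?Q w > 0" if "w > 0" for w using that c by (auto intro!: add_pos_pos)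
  have "(\<integral>\<^sup>+y. ennreal (exp (- c * y)) * vg_density a y * indicator {0<..} y \<partial>lborel)
    = (\<integral>\<^sup>+y. (\<integral>\<^sup>+r. ennreal (1 / chi_moment a) * (ennreal (exp (- c * y) * exp (- (r\<^sup>2 / 2)) * normal_density 0 r y) * indicator {0<..} y) \<partial>power_measure a) \<partial>lborel)"
  proof (rule nn_integral_cong)
    fix y :: real
    have "(\<integral>\<^sup>+r. ennreal (1 / chi_moment a) * (ennreal (exp (- c * y) * exp (- (r\<^sup>2 / 2)) * normal_density 0 r y) * indicator {0<..} y) \<partial>power_measure a)
      = (\<integral>\<^sup>+r. (ennreal (exp (- c * y)) * ennreal (1 / chi_moment a) * indicator {0<..} y) * ennreal (exp (- (r\<^sup>2 / 2)) * normal_density 0 r y) \<partial>power_measure a)"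
      by (intro nn_integral_cong) (simp add: ennreal_mult' mult_ac)
    also have "\<dots> = (ennreal (exp (- c * y)) * ennreal (1 / chi_moment a) * indicator {0<..} y) * (\<integral>\<^sup>+r. ennreal (exp (- (r\<^sup>2 / 2)) * normal_density 0 r y) \<partial>power_measure a)"
      by (rule nn_integral_cmult) measurable
    finally show "ennreal (exp (- c * y)) * vg_density a y * indicator {0<..} y = (\<integral>\<^sup>+r. ennreal (1 / chi_moment a) * (ennreal (exp (- c * y) * exp (- (r\<^sup>2 / 2)) * normal_density 0 r y) * indicator {0<..} y) \<partial>power_measure a)"
      by (simp add: vg_density_def mult_ac)
  qed
  also have "\<dots> = (\<integral>\<^sup>+r. (\<integral>\<^sup>+y. ennreal (1 / chi_moment a) * (ennreal (exp (- c * y) * exp (- (r\<^sup>2 / 2)) * normal_density 0 r y) * indicator {0<..} y) \<partial>lborel) \<partial>power_measure a)"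
    by (rule P.Fubini') measurable
  also have "\<dots> = (\<integral>\<^sup>+r. (\<integral>\<^sup>+w. ennreal (1 / (sqrt (2 * pi) * chi_moment a)) * (ennreal (r * exp (- (?Q w * r\<^sup>2 / 2))) * indicator {0<..} w) \<partial>lborel) \<partial>power_measure a)"
  proof (rule nn_integral_cong_AE)
    show "AE r in power_measure a. (\<integral>\<^sup>+y. ennreal (1 / chi_moment a) * (ennreal (exp (- c * y) * exp (- (r\<^sup>2 / 2)) * normal_density 0 r y) * indicator {0<..} y) \<partial>lborel)
      = (\<integral>\<^sup>+w. ennreal (1 / (sqrt (2 * pi) * chi_moment a)) * (ennreal (r * exp (- (?Q w * r\<^sup>2 / 2))) * indicator {0<..} w) \<partial>lborel)"
      using AE_power_measure_pos
    proof eventually_elim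
      case (elim r)
      \<comment> \<open>The scale \<open>r^2\<close> is chosen so that all three exponents, from the
        Laplace kernel, the chi weight and the Gaussian, become multiples of
        \<open>r^2\<close>.\<close>
      have "(\<integral>\<^sup>+y. ennreal (1 / chi_moment a) * (ennreal (exp (- c * y) * exp (- (r\<^sup>2 / 2)) * normal_density 0 r y) * indicator {0<..} y) \<partial>lborel)
        = ennreal \<bar>r\<^sup>2\<bar> * (\<integral>\<^sup>+w. ennreal (1 / chi_moment a) * (ennreal (exp (- c * (0 + r\<^sup>2 * w)) * exp (- (r\<^sup>2 / 2)) * normal_density 0 r (0 + r\<^sup>2 * w)) * indicator {0<..} (0 + r\<^sup>2 * w)) \<partial>lborel)"
        by (rule nn_integral_real_affine) (use elim in auto)
      also have "\<dots> = (\<integral>\<^sup>+w. ennreal \<bar>r\<^sup>2\<bar> * (ennreal (1 / chi_moment a) * (ennreal (exp (- c * (0 + r\<^sup>2 * w)) * exp (- (r\<^sup>2 / 2)) * normal_density 0 r (0 + r\<^sup>2 * w)) * indicator {0<..} (0 + r\<^sup>2 * w))) \<partial>lborel)"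
        by (rule nn_integral_cmult[symmetric]) measurable
      also have "\<dots> = (\<integral>\<^sup>+w. ennreal (1 / (sqrt (2 * pi) * chi_moment a)) * (ennreal (r * exp (- (?Q w * r\<^sup>2 / 2))) * indicator {0<..} w) \<partial>lborel)"
      proof (rule nn_integral_cong)
        fix w :: real
        have "(r\<^sup>2 * w)\<^sup>2 / (2 * r\<^sup>2) = r\<^sup>2 * w\<^sup>2 / 2" using elim by (simp add: power2_eq_square)
        then have "c * (r\<^sup>2 * w) + r\<^sup>2 / 2 + (r\<^sup>2 * w)\<^sup>2 / (2 * r\<^sup>2) = ?Q w * r\<^sup>2 / 2" by (simp add: algebra_simps)
        then have "exp (- (c * (r\<^sup>2 * w))) * exp (- (r\<^sup>2 / 2)) * exp (- ((r\<^sup>2 * w)\<^sup>2 / (2 * r\<^sup>2))) = exp (- (?Q w * r\<^sup>2 / 2))"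
          unfolding exp_add[symmetric] by (simp only: minus_add_distrib[symmetric])
        then have "r\<^sup>2 * (1 / chi_moment a * (exp (- (c * (r\<^sup>2 * w))) * exp (- (r\<^sup>2 / 2)) * normal_density 0 r (r\<^sup>2 * w)))
          = 1 / (sqrt (2 * pi) * chi_moment a) * (r * exp (- (?Q w * r\<^sup>2 / 2)))"
          using elim chi_moment by (simp add: normal_density_def real_sqrt_mult power2_eq_square)
        moreover have "0 < r\<^sup>2 * w \<longleftrightarrow> 0 < w" using elim by (simp add: zero_less_mult_iff)
        ultimately show "ennreal \<bar>r\<^sup>2\<bar> * (ennreal (1 / chi_moment a) * (ennreal (exp (- c * (0 + r\<^sup>2 * w)) * exp (- (r\<^sup>2 / 2)) * normal_density 0 r (0 + r\<^sup>2 * w)) * indicator {0<..} (0 + r\<^sup>2 * w)))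
          = ennreal (1 / (sqrt (2 * pi) * chi_moment a)) * (ennreal (r * exp (- (?Q w * r\<^sup>2 / 2))) * indicator {0<..} w)"
          using chi_moment elim by (cases "w > 0") (auto simp: ennreal_mult'[symmetric])
      qed
      finally show ?case .
    qed
  qed
  also have "\<dots> = (\<integral>\<^sup>+w. (\<integral>\<^sup>+r. ennreal (1 / (sqrt (2 * pi) * chi_moment a)) * (ennreal (r * exp (- (?Q w * r\<^sup>2 / 2))) * indicator {0<..} w) \<partial>power_measure a) \<partial>lborel)"
    by (rule P.Fubini'[symmetric]) measurable
  also have "\<dots> = (\<integral>\<^sup>+w. ennreal (c_tilde ((real a + 1) / 2)) * (ennreal (?Q w powr (- real (a + 1) / 2)) * indicator {0<..} w) \<partial>lborel)"
  proof (rule nn_integral_cong)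
    fix w :: real
    show "(\<integral>\<^sup>+r. ennreal (1 / (sqrt (2 * pi) * chi_moment a)) * (ennreal (r * exp (- (?Q w * r\<^sup>2 / 2))) * indicator {0<..} w) \<partial>power_measure a)
      = ennreal (c_tilde ((real a + 1) / 2)) * (ennreal (?Q w powr (- real (a + 1) / 2)) * indicator {0<..} w)"
    proof (cases "w > 0")
      case True
      have "(\<integral>\<^sup>+r. ennreal (1 / (sqrt (2 * pi) * chi_moment a)) * (ennreal (r * exp (- (?Q w * r\<^sup>2 / 2))) * indicator {0<..} w) \<partial>power_measure a)
        = ennreal (1 / (sqrt (2 * pi) * chi_moment a)) * (\<integral>\<^sup>+r. ennreal (r * exp (- (?Q w * r\<^sup>2 / 2))) \<partial>power_measure a)"
        using True by (simp add: nn_integral_cmult)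
      also have "(\<integral>\<^sup>+r. ennreal (r * exp (- (?Q w * r\<^sup>2 / 2))) \<partial>power_measure a) = 
          (\<integral>\<^sup>+r. ennreal (r ^ (a + 1 - 1) * exp (- (?Q w * r\<^sup>2 / 2))) * indicator {0<..} r \<partial>lborel)"
      proof (subst nn_integral_power_measure, measurable, rule nn_integral_cong)
        fix r :: real
        have "r ^ (a + 1 - 1) = r ^ (a - 1) * r" using a by (simp add: power_eq_if)
        then show "ennreal (r ^ (a - 1)) * indicator {0<..} r * ennreal (r * exp (- (?Q w * r\<^sup>2 / 2))) = ennreal (r ^ (a + 1 - 1) * exp (- (?Q w * r\<^sup>2 / 2))) * indicator {0<..} r"
          by (cases "r > 0") (auto simp: ennreal_mult'[symmetric] mult_ac)
      qed
      also have "\<dots> = ennreal (chi_moment (a + 1) * ?Q w powr (- real (a + 1) / 2))"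
        by (rule gauss_moment) (use Q[OF True] in auto)
      also have "ennreal (1 / (sqrt (2 * pi) * chi_moment a)) * \<dots> = ennreal (chi_moment (a + 1) / (sqrt (2 * pi) * chi_moment a)) * ennreal (?Q w powr (- real (a + 1) / 2))"
        using chi_moment by (simp add: ennreal_mult'[symmetric])
      also have "chi_moment (a + 1) / (sqrt (2 * pi) * chi_moment a) = c_tilde ((real a + 1) / 2)"
        using c_tilde_eq_chi_moment[of "a + 1"] a by (simp add: add.commute)
      finally show ?thesis using True by simp
    qed simp
  qed
  also have "\<dots> = ennreal (c_tilde ((real a + 1) / 2)) * (\<integral>\<^sup>+w. ennreal (?Q w powr (- real (a + 1) / 2)) * indicator {0<..} w \<partial>lborel)"
    by (rule nn_integral_cmult) measurable
  \<comment> \<open>Since \<open>?Q w = (w + cos x)^2 + (sin x)^2\<close>, the natural parameter is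
    the angle \<open>t\<close> with \<open>cot t = (w + cos x) / sin x\<close>. It decreases from
    \<open>x\<close> to 0 as \<open>w\<close> runs through the positive axis, and
    \<open>?Q w = (sin x / sin t)^2\<close>.\<close>
  also have "(\<integral>\<^sup>+w. ennreal (?Q w powr (- real (a + 1) / 2)) * indicator {0<..} w \<partial>lborel) = 
     (\<integral>\<^sup>+t. ennreal (?Q (sin x * cot t - cos x) powr (- real (a + 1) / 2)) * ennreal \<bar>- (sin x / (sin t)\<^sup>2)\<bar> * indicator {0<..<x} t \<partial>lborel)"
  proof -
    have st: "sin t > 0" if "t \<in> {0<..<x}" for t using that x by (intro sin_gt_zero) auto
    have im: "(\<lambda>t. sin x * cot t - cos x) ` {0<..<x} = {0<..}"
    proof safe
      fix t assume t: "t \<in> {0<..<x}"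
      have "sin x * cot t - cos x = sin (x - t) / sin t" using st[OF t] by (simp add: cot_def sin_diff field_simps)
      moreover have "sin (x - t) > 0" using t x by (intro sin_gt_zero) auto
      ultimately show "sin x * cot t - cos x > 0" using st[OF t] by simp
    next
      fix w :: real assume w: "w > 0"
      define u where "u = (w + c) / sin x"
      have u: "u > 0" using w c s by (simp add: u_def)
      define t where "t = arctan (1 / u)"
      have t: "0 < t" "t < pi / 2" using u arctan_ubound[of "1 / u"] by (auto simp: t_def)
      have "tan t = 1 / u" by (simp add: t_def tan_arctan)
      then have ct: "cot t = u" by (simp add: cot_altdef)
      have "t < x"
      proof -
        have "tan t < tan x" unfolding \<open>tan t = 1 / u\<close> using s c w by (auto simp: u_def tan_def c_def[symmetric] field_simps)
        then show ?thesis using t x by (subst (asm) tan_mono_lt_eq) auto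
      qed
      with t have "t \<in> {0<..<x}" by simp
      moreover have "w = sin x * cot t - cos x" unfolding ct using s by (simp add: u_def c_def)
      ultimately show "w \<in> (\<lambda>t. sin x * cot t - cos x) ` {0<..<x}" by blast
    qed
    show ?thesis
    proof (rule nn_integral_substitution_inj[where g = "\<lambda>t. sin x * cot t - cos x" and S = "{0<..<x}", unfolded im])
      show "((\<lambda>t. sin x * cot t - cos x) has_real_derivative - (sin x / (sin t)\<^sup>2)) (at t within {0<..<x})" if "t \<in> {0<..<x}" for t
      proof (rule has_field_derivative_at_within)
        have "((\<lambda>t. sin x * cot t - cos x) has_real_derivative sin x * (- inverse ((sin t)\<^sup>2)) - 0) (at t)"
          using st[OF that] by (intro DERIV_diff DERIV_const DERIV_cmult DERIV_cot) auto
        then show "((\<lambda>t. sin x * cot t - cos x) has_real_derivative - (sin x / (sin t)\<^sup>2)) (at t)"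
          by (simp add: divide_inverse)
      qed
      show "inj_on (\<lambda>t. sin x * cot t - cos x) {0<..<x}"
      proof (rule inj_onI)
        fix u v assume *: "u \<in> {0<..<x}" "v \<in> {0<..<x}" "sin x * cot u - cos x = sin x * cot v - cos x"
        then have "cot u = cot v" using s by simp
        then have "tan u = tan v" by (metis cot_altdef inverse_inverse_eq)
        then show "u = v" using * x tan_mono_lt_eq[of u v] tan_mono_lt_eq[of v u] by (cases u v rule: linorder_cases) auto
      qed
      show "(\<lambda>t. sin x * cot t - cos x) \<in> borel_measurable borel" unfolding cot_def by measurable
    qed auto
  qed
  also have "\<dots> = (\<integral>\<^sup>+t. ennreal (1 / sin x ^ a) * (ennreal (sin t ^ (a - 1)) * indicator {0..x} t) \<partial>lborel)"
  proof (rule nn_integral_cong_AE)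
    have "AE t in lborel. t \<notin> {0, x}" by (rule AE_not_in) (auto intro: countable_imp_null_set_lborel)
    then show "AE t in lborel. ennreal (?Q (sin x * cot t - cos x) powr (- real (a + 1) / 2)) * ennreal \<bar>- (sin x / (sin t)\<^sup>2)\<bar> * indicator {0<..<x} t
       = ennreal (1 / sin x ^ a) * (ennreal (sin t ^ (a - 1)) * indicator {0..x} t)"
    proof eventually_elim
      case (elim t)
      show ?case
      proof (cases "t \<in> {0<..<x}")
        case True
        have st: "sin t > 0" using True x by (intro sin_gt_zero) auto
        have "?Q (sin x * cot t - cos x) = 1 - c\<^sup>2 + (sin x)\<^sup>2 * (cot t)\<^sup>2"
          by (simp add: c_def power2_eq_square algebra_simps)
        also have "\<dots> = (sin x)\<^sup>2 * (1 + (cot t)\<^sup>2)" using sin_cos_squared_add[of x] by (simp add: c_def algebra_simps)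
        also have "1 + (cot t)\<^sup>2 = ((sin t)\<^sup>2 + (cos t)\<^sup>2) / (sin t)\<^sup>2" using st by (simp add: cot_def power_divide field_simps)
        finally have "?Q (sin x * cot t - cos x) = (sin x / sin t)\<^sup>2" by (simp add: power_divide)
        then have "?Q (sin x * cot t - cos x) powr (- real (a + 1) / 2) = inverse ((sin x / sin t) ^ (a + 1))"
          using s st square_powr_minus_half[of "sin x / sin t" "a + 1"] by simp
        moreover have "inverse ((sin x / sin t) ^ (a + 1)) * (sin x / (sin t)\<^sup>2) = 1 / sin x ^ a * sin t ^ (a - 1)"
        proof -
          have "sin t ^ (a + 1) = sin t ^ (a - 1) * (sin t)\<^sup>2" using a by (simp add: power_add[symmetric])
          then show ?thesis using s st by (simp add: power_divide field_simps)
        qed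
        moreover have "indicator {0..x} t = (1 :: ennreal)" using True by auto
        ultimately show ?thesis using True s st by (simp add: ennreal_mult'[symmetric] del: of_nat_add power_Suc)
      qed (use elim in \<open>auto simp: indicator_def\<close>)
    qed
  qed
  also have "\<dots> = ennreal (1 / sin x ^ a) * (\<integral>\<^sup>+t. ennreal (sin t ^ (a - 1)) * indicator {0..x} t \<partial>lborel)"
    by (rule nn_integral_cmult) measurable
  also have "(\<integral>\<^sup>+t. ennreal (sin t ^ (a - 1)) * indicator {0..x} t \<partial>lborel) = ennreal (integral {0..x} (\<lambda>t. sin t ^ (a - 1)))"
  proof -
    have *: "((\<lambda>t. sin t ^ (a - 1)) has_integral integral {0..x} (\<lambda>t. sin t ^ (a - 1))) {0..x}"
      by (intro integrable_integral integrable_continuous_real continuous_intros)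
    have sn: "sin t \<ge> 0" if "t \<in> {0..x}" for t using that x by (intro sin_ge_zero) auto
    have "((\<lambda>t. indicator {0..x} t * sin t ^ (a - 1)) has_integral integral {0..x} (\<lambda>t. sin t ^ (a - 1))) UNIV"
    proof -
      have "(\<lambda>t. indicator {0..x} t * sin t ^ (a - 1)) = (\<lambda>t. if t \<in> {0..x} then sin t ^ (a - 1) else 0)"
        by (auto simp: fun_eq_iff indicator_def)
      then show ?thesis using * has_integral_restrict_UNIV[of "{0..x}" "\<lambda>t. sin t ^ (a - 1)"] by (simp only:)
    qed
    then have "(\<integral>\<^sup>+t. ennreal (indicator UNIV t * (indicator {0..x} t * sin t ^ (a - 1))) \<partial>lborel) = ennreal (integral {0..x} (\<lambda>t. sin t ^ (a - 1)))"
      using sn by (intro nn_integral_has_integral_lebesgue) (auto simp: indicator_def)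
    then show ?thesis by (simp add: ennreal_mult' ennreal_indicator mult.commute)
  qed
  finally have eq: "(\<integral>\<^sup>+y. ennreal (exp (- c * y)) * vg_density a y * indicator {0<..} y \<partial>lborel) = ennreal (c_tilde ((real a + 1) / 2)) * (ennreal (1 / sin x ^ a) * ennreal (integral {0..x} (\<lambda>t. sin t ^ (a - 1))))" .
  have ct: "c_tilde ((real a + 1) / 2) \<ge> 0" using c_tilde_eq_chi_moment[of "a + 1"] a chi_moment by (simp add: add.commute)
  show ?thesis unfolding eq[unfolded c_def] using s ct by (simp add: ennreal_mult'[symmetric])
qed

section \<open>The residue representation\<close>

text \<open>The remainder after the linear Taylor polynomial is at most
  \<open>exp (1/2) * (1/2)^2\<close>, and \<open>exp (1/2) \<le> 2\<close>. On this disc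
  \<open>cos x\<close> has real part at least 1/2, which makes \<open>exp (- s * cos x)\<close>
  decay, and for \<open>norm x < 1/2\<close> it lies in the unit disc around 1 where the Laplace
  transform is a power series.\<close>

lemma norm_cos_minus_1_le:
  assumes "norm (z::complex) \<le> 1/2"
  shows "norm (cos z - 1) \<le> 1/2"
proof -
  have "exp (1/2 :: real) ^ 2 = exp 1" by (simp add: exp_double[symmetric] power2_eq_square exp_add[symmetric])
  also have "\<dots> < 2\<^sup>2" using exp_le by simp
  finally have e: "exp (1/2 :: real) \<le> 2" using power_less_imp_less_base[of "exp (1/2::real)" 2 2] by simp
  have "norm (cos z - (\<Sum>k\<le>1. complex_of_real (cos_coeff k) * z ^ k)) \<le> exp \<bar>Im z\<bar> * cmod z ^ Suc 1 / fact 1"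
    by (rule Taylor_cos)
  also have "(\<Sum>k\<le>1. complex_of_real (cos_coeff k) * z ^ k) = 1" by (simp add: cos_coeff_def)
  also have "exp \<bar>Im z\<bar> * cmod z ^ Suc 1 / fact 1 \<le> 2 * (1/2)^2"
  proof -
    have "exp \<bar>Im z\<bar> \<le> exp (1/2)" using abs_Im_le_cmod[of z] assms by simp
    then have "exp \<bar>Im z\<bar> \<le> 2" using e by (rule order_trans)
    moreover have "cmod z ^ 2 \<le> (1/2)^2" using assms by (intro power_mono) auto
    ultimately have "exp \<bar>Im z\<bar> * cmod z ^ 2 \<le> 2 * (1/2)^2" by (intro mult_mono) auto
    then show ?thesis by (simp add: power2_eq_square)
  qed
  finally show ?thesis by (simp add: power2_eq_square)
qed

lemma Re_cos_ge:
  assumes "norm (z::complex) \<le> 1/2"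
  shows "Re (cos z) \<ge> 1/2"
  using norm_cos_minus_1_le[OF assms] abs_Re_le_cmod[of "cos z - 1"] by simp

lemma sin_nonzero:
  assumes "norm (z::complex) \<le> 1/2" "z \<noteq> 0"
  shows "sin z \<noteq> 0"
proof
  assume "sin z = 0"
  then obtain n :: int where n: "z = complex_of_real (real_of_int n * pi)" by (auto simp: sin_eq_0)
  then have "\<bar>real_of_int n\<bar> * pi \<le> 1/2" using assms by (simp add: norm_mult abs_mult)
  moreover have "n \<noteq> 0" using n assms by auto
  then have "\<bar>real_of_int n\<bar> \<ge> 1" by linarith
  then have "\<bar>real_of_int n\<bar> * pi \<ge> 1 * pi" by (intro mult_right_mono) auto
  ultimately show False using pi_gt3 by simp
qed

text \<open>The circle has to lie inside the disc of radius 1/2, where 0 is the only zero of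
  \<open>sin\<close> and \<open>Re (cos x) \<ge> 1/2\<close>.\<close>

abbreviation small_circle :: "real \<Rightarrow> complex" where "small_circle \<equiv> circlepath 0 (1/4)"

text \<open>On the circle the integrand is dominated by a constant times
  \<open>exp (- (s u / 2))\<close>, because \<open>Re (cos x) \<ge> 1/2\<close>. The function
  \<open>s\<close> must be nonnegative on the whole space, which explains the absolute values in its
  applications.\<close>

lemma circle_Fubini:
  fixes s :: "'a \<Rightarrow> real" and g :: "complex \<Rightarrow> complex"
  assumes "sigma_finite_measure M" and [measurable]: "s \<in> borel_measurable M"
    and s: "\<And>u. u \<in> space M \<Longrightarrow> s u \<ge> 0"
    and fin: "(\<integral>\<^sup>+u. ennreal (exp (- (s u / 2))) \<partial>M) < \<infinity>"
    and g: "continuous_on (sphere 0 (1/4)) g"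
  shows "integrable M (\<lambda>u. contour_integral small_circle (\<lambda>x. exp (- (of_real (s u) * cos x)) * g x))" (is ?int)
    and "(LINT u|M. contour_integral small_circle (\<lambda>x. exp (- (of_real (s u) * cos x)) * g x))
       = contour_integral small_circle (\<lambda>x. (LINT u|M. exp (- (of_real (s u) * cos x))) * g x)" (is ?eq)
proof -
  interpret sigma_finite_measure M by fact
  interpret P: pair_sigma_finite M "lborel :: real measure" ..
  define \<gamma> :: "real \<Rightarrow> complex" where "\<gamma> = small_circle"
  have \<gamma>: "\<gamma> = (\<lambda>t. of_real (1/4) * exp (2 * of_real pi * \<i> * of_real t))"
    by (simp add: \<gamma>_def circlepath)
  define \<gamma>' where "\<gamma>' = (\<lambda>t. vector_derivative \<gamma> (at t))"
  have \<gamma>': "\<gamma>' = (\<lambda>t. of_real (2 * pi) * \<i> * of_real (1/4) * exp (2 * of_real pi * \<i> * of_real t))"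
    unfolding \<gamma>'_def \<gamma>_def by (intro ext) (simp only: vector_derivative_circlepath)
  have [simp]: "norm (\<gamma> t) = 1/4" for t by (simp add: \<gamma> norm_mult norm_divide)
  have c\<gamma> [continuous_intros]: "continuous_on A \<gamma>" and c\<gamma>': "continuous_on A \<gamma>'" for A
    unfolding \<gamma> \<gamma>' by (auto intro!: continuous_intros)
  have [measurable]: "\<gamma> \<in> borel_measurable borel" by (rule borel_measurable_continuous_onI) (rule c\<gamma>)
  have cg: "continuous_on A (\<lambda>t. g (\<gamma> t) * \<gamma>' t)" for A
    by (intro continuous_intros continuous_on_compose2[OF g c\<gamma>] c\<gamma>') auto
  \<comment> \<open>Cutting off at the parameter interval turns the contour integral into a Lebesgue
    integral over the whole line, to which Fubini applies.\<close>
  define h where "h = (\<lambda>t. indicator {0..1} t *\<^sub>R (g (\<gamma> t) * \<gamma>' t))"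
  have h [measurable]: "h \<in> borel_measurable borel"
    unfolding h_def by (rule borel_measurable_continuous_on_indicator) (auto intro: cg)
  have "bounded ((\<lambda>t. g (\<gamma> t) * \<gamma>' t) ` {0..1})"
    by (intro compact_imp_bounded compact_continuous_image cg) auto
  then obtain B where B: "B > 0" "\<And>t. t \<in> {0..1} \<Longrightarrow> norm (g (\<gamma> t) * \<gamma>' t) \<le> B"
    unfolding bounded_pos by auto
  have hB: "norm (h t) \<le> B * indicator {0..1} t" for t
    using B by (auto simp: h_def indicator_def)
  define k where "k = (\<lambda>u t. exp (- (of_real (s u) * cos (\<gamma> t))) * h t)"
  have eb: "norm (exp (- (of_real (s u) * cos (\<gamma> t)))) \<le> exp (- (s u / 2))" if "u \<in> space M" for u t
  proof -
    have "s u * (1/2) \<le> s u * Re (cos (\<gamma> t))" using s[OF that] by (intro mult_left_mono Re_cos_ge) auto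
    then show ?thesis by simp
  qed
  have cosm: "(\<lambda>t. cos (\<gamma> t)) \<in> borel_measurable borel"
    by (rule borel_measurable_continuous_onI) (intro continuous_intros)
  have expm: "(\<lambda>z::complex. exp z) \<in> borel_measurable borel"
    by (rule borel_measurable_continuous_onI) (intro continuous_intros)
  have km [measurable]: "(\<lambda>p. k (fst p) (snd p)) \<in> borel_measurable (M \<Otimes>\<^sub>M lborel)"
    unfolding k_def
    by (intro borel_measurable_times measurable_compose[OF _ expm] borel_measurable_uminus measurable_compose[OF _ cosm] measurable_compose[OF _ h]) measurable
  have int: "integrable (M \<Otimes>\<^sub>M lborel) (\<lambda>(u, t). k u t)"
  proof (rule integrableI_bounded)
    show "(\<lambda>(u, t). k u t) \<in> borel_measurable (M \<Otimes>\<^sub>M lborel)" using km by (simp add: split_beta')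
    have "(\<integral>\<^sup>+p. ennreal (norm (case p of (u, t) \<Rightarrow> k u t)) \<partial>(M \<Otimes>\<^sub>M lborel))
      \<le> (\<integral>\<^sup>+p. ennreal (exp (- (s (fst p) / 2))) * (ennreal B * indicator {0..1::real} (snd p)) \<partial>(M \<Otimes>\<^sub>M lborel))"
    proof (rule nn_integral_mono)
      fix p assume p: "p \<in> space (M \<Otimes>\<^sub>M (lborel :: real measure))"
      obtain u t where ut: "p = (u, t)" by (cases p)
      have u: "u \<in> space M" using p ut by (simp add: space_pair_measure)
      have "norm (k u t) \<le> exp (- (s u / 2)) * (B * indicator {0..1} t)"
        unfolding k_def norm_mult using eb[OF u] hB[of t] by (intro mult_mono) auto
      then have "ennreal (norm (k u t)) \<le> ennreal (exp (- (s u / 2)) * (B * indicator {0..1} t))" by (rule ennreal_leI)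
      also have "\<dots> = ennreal (exp (- (s u / 2))) * (ennreal B * indicator {0..1} t)"
        using B by (auto simp: ennreal_mult' ennreal_indicator)
      finally show "ennreal (norm (case p of (u, t) \<Rightarrow> k u t)) \<le> ennreal (exp (- (s (fst p) / 2))) * (ennreal B * indicator {0..1} (snd p))"
        by (simp add: ut)
    qed
    also have "\<dots> = (\<integral>\<^sup>+u. \<integral>\<^sup>+t. ennreal (exp (- (s u / 2))) * (ennreal B * indicator {0..1::real} t) \<partial>lborel \<partial>M)"
      by (subst lborel.nn_integral_fst[symmetric]) auto
    also have "\<dots> = (\<integral>\<^sup>+u. ennreal (exp (- (s u / 2))) * ennreal B \<partial>M)"
      by (intro nn_integral_cong) (simp add: nn_integral_cmult)
    also have "\<dots> = (\<integral>\<^sup>+u. ennreal (exp (- (s u / 2))) \<partial>M) * ennreal B"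
      by (rule nn_integral_multc) measurable
    also have "\<dots> < \<infinity>" using fin by (simp add: ennreal_mult_less_top)
    finally show "(\<integral>\<^sup>+p. ennreal (norm (case p of (u, t) \<Rightarrow> k u t)) \<partial>(M \<Otimes>\<^sub>M lborel)) < \<infinity>" .
  qed
  have ci: "contour_integral small_circle (\<lambda>x. exp (- (of_real (s u) * cos x)) * g x) = (LINT t|lborel. k u t)" for u
  proof -
    have "set_integrable lborel {0..1} (\<lambda>t. exp (- (of_real (s u) * cos (\<gamma> t))) * (g (\<gamma> t) * \<gamma>' t))"
      unfolding set_integrable_def
      by (rule borel_integrable_compact) (auto intro!: continuous_intros cg)
    then have "set_lebesgue_integral lborel {0..1} (\<lambda>t. exp (- (of_real (s u) * cos (\<gamma> t))) * (g (\<gamma> t) * \<gamma>' t)) = integral {0..1} (\<lambda>t. exp (- (of_real (s u) * cos (\<gamma> t))) * (g (\<gamma> t) * \<gamma>' t))"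
      by (rule set_borel_integral_eq_integral)
    then show ?thesis unfolding contour_integral_integral k_def h_def set_lebesgue_integral_def
      by (simp add: \<gamma>_def[symmetric] \<gamma>'_def mult.assoc)
  qed
  show ?int unfolding ci using P.integrable_fst[OF int] .
  have *: "(LINT u|M. k u t) = indicator {0..1} t *\<^sub>R ((LINT u|M. exp (- (of_real (s u) * cos (\<gamma> t)))) * (g (\<gamma> t) * \<gamma>' t))" for t
    unfolding k_def h_def by (simp add: )
  have "(LINT u|M. LINT t|lborel. k u t) = (LINT t|lborel. LINT u|M. k u t)"
    by (rule P.Fubini_integral[OF int, symmetric])
  also have "\<dots> = integral {0..1} (\<lambda>t. (LINT u|M. exp (- (of_real (s u) * cos (\<gamma> t)))) * (g (\<gamma> t) * \<gamma>' t))"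
    using P.integrable_snd[OF int] unfolding * 
    by (subst set_borel_integral_eq_integral(2)[symmetric]) (auto simp: set_integrable_def set_lebesgue_integral_def)
  also have "\<dots> = contour_integral small_circle (\<lambda>x. (LINT u|M. exp (- (of_real (s u) * cos x))) * g x)"
    unfolding contour_integral_integral by (simp add: \<gamma>_def[symmetric] \<gamma>'_def mult.assoc)
  finally show ?eq unfolding ci .
qed

lemma nn_integral_linear_exp_finite:
  assumes y: "y \<ge> 0"
  shows "(\<integral>\<^sup>+u. ennreal (u * exp (- (u / 2))) * indicator {y..} u \<partial>lborel) < \<infinity>"
proof -
  have "(\<integral>\<^sup>+u. ennreal (u * exp (- (u / 2))) * indicator {y..} u \<partial>lborel)
     \<le> (\<integral>\<^sup>+u. ennreal (4 * exp (- (u / 4))) * indicator {y..} u \<partial>lborel)"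
  proof (rule nn_integral_mono)
    fix u :: real
    have "u \<le> 4 * exp (u / 4)" using exp_ge_add_one_self[of "u / 4"] by linarith
    then have "u * exp (- (u / 2)) \<le> 4 * exp (u / 4) * exp (- (u / 2))" by (intro mult_right_mono) auto
    also have "\<dots> = 4 * exp (- (u / 4))" by (simp add: exp_add[symmetric])
    finally show "ennreal (u * exp (- (u / 2))) * indicator {y..} u \<le> ennreal (4 * exp (- (u / 4))) * indicator {y..} u"
      by (intro mult_right_mono ennreal_leI) auto
  qed
  also have "\<dots> = ennreal (0 - (- 16 * exp (- (y / 4))))"
  proof (rule nn_integral_FTC_atLeast)
    have "((\<lambda>u::real. exp (- (u / 4))) \<longlongrightarrow> 0) at_top"
    proof (rule filterlim_compose[OF exp_at_bot])
      have "filterlim (\<lambda>u::real. (1/4) * u) at_top at_top"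
        by (rule filterlim_tendsto_pos_mult_at_top[OF tendsto_const _ filterlim_ident]) simp
      then have "filterlim (\<lambda>u::real. - ((1/4) * u)) at_bot at_top" by (rule filterlim_uminus_at_top[THEN iffD1])
      then show "filterlim (\<lambda>u::real. - (u / 4)) at_bot at_top" by simp
    qed
    from tendsto_mult[OF tendsto_const this, of "-16"] show "((\<lambda>u. - 16 * exp (- (u / 4)) :: real) \<longlongrightarrow> 0) at_top" by simp
  qed (auto intro!: derivative_eq_intros)
  finally show ?thesis by (rule le_less_trans) simp
qed

text \<open>The antiderivative is \<open>?F\<close>, found by partial integration. The absolute
  value matches the shape asked for by \<open>circle_Fubini\<close> and changes nothing for
  \<open>u \<ge> y \<ge> 0\<close>.\<close>

lemma integral_linear_exp:
  fixes c :: complex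
  assumes y: "y \<ge> 0" and c: "Re c \<ge> 1/2"
  shows "(LINT u|lborel. (u * indicator {y..} u) *\<^sub>R exp (- (of_real \<bar>u\<bar> * c))) = (of_real y / c + 1 / c^2) * exp (- (of_real y * c))"
proof -
  have c0: "c \<noteq> 0" using c by auto
  let ?f = "\<lambda>u. of_real u * exp (- (of_real u * c))"
  let ?F = "\<lambda>u. - ((of_real u / c + 1 / c^2) * exp (- (of_real u * c)))"
  have nf: "norm (?f u) \<le> u * exp (- (u / 2))" if "u \<ge> 0" for u
  proof -
    have "u * (1/2) \<le> u * Re c" using that c by (intro mult_left_mono) auto
    then have "norm (exp (- (of_real u * c))) \<le> exp (- (u / 2))" by simp
    then show ?thesis unfolding norm_mult using that by (intro mult_mono) auto
  qed
  have cf: "isCont ?f u" for u by (intro continuous_intros)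
  have int: "set_integrable lborel {y<..} ?f"
    unfolding set_integrable_def
  proof (rule integrableI_bounded)
    show "(\<lambda>u. indicator {y<..} u *\<^sub>R ?f u) \<in> borel_measurable lborel"
      using cf by (intro borel_measurable_scaleR borel_measurable_indicator) (auto intro!: borel_measurable_continuous_onI continuous_at_imp_continuous_on)
    have "(\<integral>\<^sup>+u. ennreal (norm (indicator {y<..} u *\<^sub>R ?f u)) \<partial>lborel) \<le> (\<integral>\<^sup>+u. ennreal (u * exp (- (u / 2))) * indicator {y..} u \<partial>lborel)"
      using nf y by (intro nn_integral_mono) (auto split: split_indicator intro!: ennreal_leI)
    then show "(\<integral>\<^sup>+u. ennreal (norm (indicator {y<..} u *\<^sub>R ?f u)) \<partial>lborel) < \<infinity>"
      using nn_integral_linear_exp_finite[OF y] by (rule le_less_trans)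
  qed
  have eint: "einterval (ereal y) \<infinity> = {y<..}" by (auto simp: einterval_def)
  have "interval_lebesgue_integral lborel (ereal y) \<infinity> ?f = 0 - ?F y"
  proof (rule interval_integral_FTC_integrable)
    show "(?F has_vector_derivative ?f u) (at u)" for u
    proof -
      have "((\<lambda>z. - ((z / c + 1 / c^2) * exp (- (z * c)))) has_field_derivative of_real u * exp (- (of_real u * c))) (at (of_real u))"
        using c0 by (auto intro!: derivative_eq_intros simp: field_simps power2_eq_square)
      then show ?thesis by (rule has_vector_derivative_real_field)
    qed
    show "set_integrable lborel (einterval (ereal y) \<infinity>) ?f" unfolding eint by (rule int)
    have "isCont ?F y" using c0 by (intro continuous_intros) auto
    then have "(?F \<longlongrightarrow> ?F y) (at_right y)" by (rule tendsto_within_subset[OF isContD]) auto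
    then show "((?F \<circ> real_of_ereal) \<longlongrightarrow> ?F y) (at_right (ereal y))"
      by (simp add: ereal_tendsto_simps)
    have e: "((\<lambda>u. (of_real u / c + 1 / c^2) * exp (- (of_real u * c))) \<longlongrightarrow> 0) at_top"
    proof (rule Lim_null_comparison)
      show "\<forall>\<^sub>F u in at_top. norm ((of_real u / c + 1 / c^2) * exp (- (of_real u * c))) \<le> (u * 2 + 4) * exp (- (u / 2))"
        using eventually_ge_at_top[of 0]
      proof eventually_elim
        case (elim u)
        have nc: "norm c \<ge> 1/2" using c complex_Re_le_cmod[of c] by linarith
        have "norm (of_real u / c) \<le> u * 2"
          using nc elim by (simp add: norm_divide divide_le_eq) (metis mult_left_mono mult.commute mult.left_commute mult_1 mult.assoc divide_le_eq_1_pos numeral_One one_le_numeral order_trans mult_2 field_sum_of_halves)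
        moreover have "norm (1 / c^2) \<le> 4"
        proof -
          have "(1/2)^2 \<le> norm c ^ 2" using nc by (intro power_mono) auto
          then show ?thesis using c0 by (simp add: norm_divide norm_power power2_eq_square divide_le_eq norm_mult)
        qed
        ultimately have "norm (of_real u / c + 1 / c^2) \<le> u * 2 + 4" by (rule norm_triangle_mono)
        moreover have "u * (1/2) \<le> u * Re c" using elim c by (intro mult_left_mono) auto
        then have "norm (exp (- (of_real u * c))) \<le> exp (- (u / 2))" by simp
        ultimately show ?case unfolding norm_mult using elim by (intro mult_mono) auto
      qed
      show "((\<lambda>u::real. (u * 2 + 4) * exp (- (u / 2))) \<longlongrightarrow> 0) at_top" by real_asymp
    qed
    from tendsto_minus[OF e] show "((?F \<circ> real_of_ereal) \<longlongrightarrow> 0) (at_left \<infinity>)"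
      by (simp add: ereal_tendsto_simps)
  qed (auto simp: cf)
  moreover have "interval_lebesgue_integral lborel (ereal y) \<infinity> ?f = (LINT u|lborel. indicator {y<..} u *\<^sub>R ?f u)"
    by (simp add: interval_lebesgue_integral_def eint set_lebesgue_integral_def)
  moreover have "(LINT u|lborel. indicator {y<..} u *\<^sub>R ?f u) = (LINT u|lborel. (u * indicator {y..} u) *\<^sub>R exp (- (of_real \<bar>u\<bar> * c)))"
  proof (rule integral_cong_AE)
    show "(\<lambda>u. indicator {y<..} u *\<^sub>R ?f u) \<in> borel_measurable lborel"
      using int by (simp add: set_integrable_def)
    show "(\<lambda>u. (u * indicator {y..} u) *\<^sub>R exp (- (of_real \<bar>u\<bar> * c))) \<in> borel_measurable lborel"
      by (intro borel_measurable_scaleR) (auto intro!: borel_measurable_continuous_onI continuous_intros)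
    show "AE u in lborel. indicator {y<..} u *\<^sub>R ?f u = (u * indicator {y..} u) *\<^sub>R exp (- (of_real \<bar>u\<bar> * c))"
      using AE_lborel_singleton[of y] by eventually_elim (use y in \<open>auto simp: indicator_def scaleR_conv_of_real\<close>)
  qed
  ultimately show ?thesis by simp
qed

section \<open>The contour formula for densities of even index\<close>

text \<open>Half of a residue at 0, hence \<open>4 * pi * \<i>\<close> instead of
  \<open>2 * pi * \<i>\<close>; the contour form allows exchange with integrals over
  \<open>s\<close>. For \<open>m = 1\<close> it equals \<open>exp (- s) / 2\<close>, so agreement
  with the even function \<open>vg_density (2 * m)\<close> can hold only for
  \<open>s \<ge> 0\<close>.\<close>

definition vg_contour :: "nat \<Rightarrow> real \<Rightarrow> complex" where
  "vg_contour m s = contour_integral small_circle (\<lambda>x. exp (- (of_real s * cos x)) * (1 / sin x ^ (2 * m - 1))) / (4 * of_real pi * \<i>)"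

lemma sin_sphere_nonzero: "x \<in> sphere 0 (1/4) \<Longrightarrow> sin (x::complex) \<noteq> 0"
  by (rule sin_nonzero) auto

lemma cos_sphere_nonzero: "x \<in> cball 0 (1/2) \<Longrightarrow> cos (x::complex) \<noteq> 0"
  using Re_cos_ge[of x] by auto

lemma path_image_small_circle [simp]: "path_image small_circle = sphere 0 (1/4)"
  by simp

lemma continuous_on_inverse_sin: "continuous_on (sphere 0 (1/4)) (\<lambda>x::complex. 1 / sin x ^ j)"
  by (intro continuous_intros) (use sin_sphere_nonzero in auto)

lemma vg_contour_1: "vg_contour 1 s = of_real (exp (- s) / 2)"
proof -
  let ?f = "\<lambda>x::complex. exp (- (of_real s * cos x))"
  have "(\<lambda>x. ?f x / sin x) holomorphic_on ball 0 (1/2) - {0}"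
    by (intro holomorphic_intros) (use sin_nonzero in \<open>auto intro: less_imp_le\<close>)
  then have "((\<lambda>x. ?f x / sin x) has_contour_integral complex_of_real (2 * pi) * \<i> * residue (\<lambda>x. ?f x / sin x) 0) small_circle"
    by (intro base_residue[where s = "ball 0 (1/2)"]) (auto simp: subset_eq)
  moreover have "residue (\<lambda>x. ?f x / sin x) 0 = ?f 0 / 1"
    by (rule residue_simple_pole_deriv[where s = "ball 0 (1/2)"])
       (auto intro!: holomorphic_intros derivative_eq_intros)
  ultimately have "contour_integral small_circle (\<lambda>x. ?f x * (1 / sin x)) = complex_of_real (2 * pi) * \<i> * of_real (exp (- s))"
    by (simp add: contour_integral_unique exp_of_real[symmetric])
  then show ?thesis by (simp add: vg_contour_def)
qed

text \<open>The left integrand contains the value of the integral of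
  \<open>u / (2 * m) * exp (- u * cos x)\<close> over \<open>u \<ge> y\<close>, that is, the
  recursion of the densities carried out under the contour. Its difference from the right one is the
  derivative of \<open>exp (- y * cos x) / (2 * m * cos x * sin x ^ (2 * m))\<close>, a
  single-valued function on the punctured disc, so the difference integrates to 0.\<close>

lemma vg_contour_recursion_contour:
  assumes m: "m \<ge> 1"
  shows "contour_integral small_circle (\<lambda>x. (of_real (1 / real (2 * m)) * ((of_real y / cos x + 1 / (cos x)^2) * exp (- (of_real y * cos x)))) * (1 / sin x ^ (2 * m - 1)))
    = contour_integral small_circle (\<lambda>x. exp (- (of_real y * cos x)) * (1 / sin x ^ (2 * Suc m - 1)))"
proof -
  let ?A = "\<lambda>x. (of_real (1 / real (2 * m)) * ((of_real y / cos x + 1 / (cos x)^2) * exp (- (of_real y * cos x)))) * (1 / sin x ^ (2 * m - 1)) :: complex"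
  let ?B = "\<lambda>x. exp (- (of_real y * cos x)) * (1 / sin x ^ (2 * Suc m - 1)) :: complex"
  let ?H = "\<lambda>x. of_real (1 / real (2 * m)) * (exp (- (of_real y * cos x)) / cos x * (1 / sin x ^ (2 * m))) :: complex"
  have "((\<lambda>x. ?A x - ?B x) has_contour_integral 0) small_circle"
  proof (rule Cauchy_theorem_primitive[where S = "ball 0 (1/2) - {0}"])
    fix x :: complex assume x: "x \<in> ball 0 (1/2) - {0}"
    have s: "sin x \<noteq> 0" and c: "cos x \<noteq> 0" 
      using x sin_nonzero[of x] cos_sphere_nonzero[of x] by auto
    \<comment> \<open>Expressing all powers of \<open>sin x\<close> through \<open>S\<close> removes
      the subtraction in the exponents before the fractions are compared.\<close>
    define S where "S = sin x ^ (2 * m - 1)"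
    have S0: "S \<noteq> 0" using s by (simp add: S_def)
    have S1: "sin x ^ (2 * m) = S * sin x" using m by (simp add: S_def power_eq_if mult.commute)
    have S2: "sin x ^ (2 * Suc m - 1) = S * sin x * sin x" using S1 by simp
    have "((\<lambda>x. exp (- (of_real y * cos x)) / cos x) has_field_derivative ((of_real y / cos x + 1 / (cos x)^2) * exp (- (of_real y * cos x)) * sin x)) (at x)"
      using c by (auto intro!: derivative_eq_intros simp: field_simps power2_eq_square)
    moreover have "((\<lambda>x. 1 / sin x ^ (2 * m)) has_field_derivative (- (of_nat (2 * m) * cos x / (S * sin x * sin x)))) (at x)"
    proof -
      have "((\<lambda>x. 1 / sin x ^ (2 * m)) has_field_derivative ((0 * sin x ^ (2 * m) - 1 * (of_nat (2 * m) * (cos x * sin x ^ (2 * m - Suc 0)))) / (sin x ^ (2 * m) * sin x ^ (2 * m)))) (at x)"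
        using s by (intro DERIV_divide DERIV_const DERIV_power DERIV_sin) auto
      moreover have "sin x ^ (2 * m - Suc 0) = S" by (simp add: S_def)
      ultimately have "((\<lambda>x. 1 / sin x ^ (2 * m)) has_field_derivative ((0 * (S * sin x) - 1 * (of_nat (2 * m) * (cos x * S))) / ((S * sin x) * (S * sin x)))) (at x)"
        by (simp only: S1)
      moreover have "(0 * (S * sin x) - 1 * (of_nat (2 * m) * (cos x * S))) / ((S * sin x) * (S * sin x)) = - (of_nat (2 * m) * cos x / (S * sin x * sin x))"
        using s S0 by (simp add: field_simps)
      ultimately show ?thesis by (simp only:)
    qed
    ultimately have "(?H has_field_derivative of_real (1 / real (2 * m)) * (((of_real y / cos x + 1 / (cos x)^2) * exp (- (of_real y * cos x)) * sin x) * (1 / sin x ^ (2 * m)) + (- (of_nat (2 * m) * cos x / (S * sin x * sin x))) * (exp (- (of_real y * cos x)) / cos x))) (at x)"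
      by (intro DERIV_cmult DERIV_mult) 
    moreover have "of_real (1 / real (2 * m)) * (((of_real y / cos x + 1 / (cos x)^2) * exp (- (of_real y * cos x)) * sin x) * (1 / sin x ^ (2 * m)) + (- (of_nat (2 * m) * cos x / (S * sin x * sin x))) * (exp (- (of_real y * cos x)) / cos x)) = ?A x - ?B x"
    proof -
      have m0: "(of_nat m :: complex) \<noteq> 0" using m by simp
      show ?thesis unfolding S1 S2 S_def[symmetric] right_diff_distrib distrib_left
        using s c S0 m0 by (simp add: divide_simps)
    qed
    ultimately show "(?H has_field_derivative ?A x - ?B x) (at x within ball 0 (1/2) - {0})"
      by (simp add: has_field_derivative_at_within)
  qed auto
  moreover have "?A contour_integrable_on small_circle"
    by (rule contour_integrable_continuous_circlepath) (use sin_sphere_nonzero cos_sphere_nonzero m in \<open>auto intro!: continuous_intros\<close>)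
  moreover have "?B contour_integrable_on small_circle"
    by (rule contour_integrable_continuous_circlepath) (use sin_sphere_nonzero in \<open>auto intro!: continuous_intros\<close>)
  ultimately show ?thesis using contour_integral_diff[of ?A small_circle ?B] by (simp add: contour_integral_unique)
qed

text \<open>Both sides agree for \<open>m = 1\<close> and obey the same recursion in
  \<open>m\<close>. A real witness \<open>q\<close> is carried along because one side lives in
  \<open>ennreal\<close> and the other in the complex numbers; it also records that the density is
  finite and the contour integral real.\<close>

lemma vg_density_eq_vg_contour:
  assumes "m \<ge> 1" "s \<ge> 0"
  shows "\<exists>q\<ge>0. vg_density (2 * m) s = ennreal q \<and> of_real q = vg_contour m s"
  using assms
proof (induction m arbitrary: s rule: nat_induct_at_least)
  case base
  then show ?case using vg_density_2[of s] vg_contour_1[of s] by (intro exI[of _ "exp (- s) / 2"]) auto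
next
  case (Suc m y)
  \<comment> \<open>The kernel of the recursion becomes the density of a measure on the whole line,
    which is why \<open>\<bar>u\<bar>\<close> replaces \<open>u\<close> below.\<close>
  define D where "D = (\<lambda>u. u / real (2 * m) * indicator {y..} u)"
  have D: "D u \<ge> 0" for u using Suc.prems by (auto simp: D_def indicator_def)
  have [measurable]: "D \<in> borel_measurable borel" unfolding D_def by measurable
  define M where "M = density lborel (\<lambda>u. ennreal (D u))"
  have sf: "sigma_finite_measure M" unfolding M_def
    by (rule sigma_finite_measure.sigma_finite_iff_density_finite[OF lborel.sigma_finite_measure_axioms, THEN iffD2]) auto
  have [measurable_cong, simp]: "sets M = sets borel" "space M = UNIV" by (auto simp: M_def)
  have AEy: "AE u in M. u \<ge> y" unfolding M_def by (subst AE_density) (auto simp: D_def indicator_def)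
  have fin: "(\<integral>\<^sup>+u. ennreal (exp (- (\<bar>u\<bar> / 2))) \<partial>M) < \<infinity>"
  proof -
    have "(\<integral>\<^sup>+u. ennreal (exp (- (\<bar>u\<bar> / 2))) \<partial>M) = (\<integral>\<^sup>+u. ennreal (D u) * ennreal (exp (- (\<bar>u\<bar> / 2))) \<partial>lborel)"
      unfolding M_def by (rule nn_integral_density) auto
    also have "\<dots> = (\<integral>\<^sup>+u. ennreal (1 / real (2 * m)) * (ennreal (u * exp (- (u / 2))) * indicator {y..} u) \<partial>lborel)"
      using Suc.prems by (intro nn_integral_cong) (auto simp: D_def indicator_def ennreal_mult'[symmetric])
    also have "\<dots> = ennreal (1 / real (2 * m)) * (\<integral>\<^sup>+u. ennreal (u * exp (- (u / 2))) * indicator {y..} u \<partial>lborel)"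
      by (rule nn_integral_cmult) auto
    also have "\<dots> < \<infinity>" using nn_integral_linear_exp_finite[OF Suc.prems] by (simp add: ennreal_mult_less_top)
    finally show ?thesis .
  qed
  have cF: "integrable M (\<lambda>u. contour_integral small_circle (\<lambda>x. exp (- (of_real \<bar>u\<bar> * cos x)) * (1 / sin x ^ (2 * m - 1))))"
    "(LINT u|M. contour_integral small_circle (\<lambda>x. exp (- (of_real \<bar>u\<bar> * cos x)) * (1 / sin x ^ (2 * m - 1))))
       = contour_integral small_circle (\<lambda>x. (LINT u|M. exp (- (of_real \<bar>u\<bar> * cos x))) * (1 / sin x ^ (2 * m - 1)))"
    by (rule circle_Fubini[OF sf _ _ fin continuous_on_inverse_sin]; simp)+
  have intQ: "integrable M (\<lambda>u. vg_contour m \<bar>u\<bar>)" unfolding vg_contour_def using cF(1) by simp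
  have L: "(LINT u|M. exp (- (of_real \<bar>u\<bar> * cos x))) = of_real (1 / real (2 * m)) * ((of_real y / cos x + 1 / (cos x)^2) * exp (- (of_real y * cos x)))"
    if "x \<in> sphere 0 (1/4)" for x :: complex
  proof -
    have "(LINT u|M. exp (- (of_real \<bar>u\<bar> * cos x))) = (LINT u|lborel. D u *\<^sub>R exp (- (of_real \<bar>u\<bar> * cos x)))"
      unfolding M_def by (rule integral_density) (auto intro!: borel_measurable_continuous_onI continuous_intros simp: D)
    also have "\<dots> = (LINT u|lborel. of_real (1 / real (2 * m)) * ((u * indicator {y..} u) *\<^sub>R exp (- (of_real \<bar>u\<bar> * cos x))))"
      by (intro Bochner_Integration.integral_cong) (auto simp: D_def scaleR_conv_of_real)
    also have "\<dots> = of_real (1 / real (2 * m)) * (LINT u|lborel. (u * indicator {y..} u) *\<^sub>R exp (- (of_real \<bar>u\<bar> * cos x)))"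
      by (rule integral_mult_right_zero)
    also have "\<dots> = of_real (1 / real (2 * m)) * ((of_real y / cos x + 1 / (cos x)^2) * exp (- (of_real y * cos x)))"
      using that by (subst integral_linear_exp[OF Suc.prems Re_cos_ge]) auto
    finally show ?thesis .
  qed
  have "(LINT u|M. vg_contour m \<bar>u\<bar>) = contour_integral small_circle (\<lambda>x. (LINT u|M. exp (- (of_real \<bar>u\<bar> * cos x))) * (1 / sin x ^ (2 * m - 1))) / (4 * of_real pi * \<i>)"
    unfolding vg_contour_def using cF(2) by simp
  also have "contour_integral small_circle (\<lambda>x. (LINT u|M. exp (- (of_real \<bar>u\<bar> * cos x))) * (1 / sin x ^ (2 * m - 1)))
    = contour_integral small_circle (\<lambda>x. (of_real (1 / real (2 * m)) * ((of_real y / cos x + 1 / (cos x)^2) * exp (- (of_real y * cos x)))) * (1 / sin x ^ (2 * m - 1)))"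
    by (rule contour_integral_cong) (auto simp: L simp del: of_real_divide)
  also have "\<dots> = contour_integral small_circle (\<lambda>x. exp (- (of_real y * cos x)) * (1 / sin x ^ (2 * Suc m - 1)))"
    by (rule vg_contour_recursion_contour) fact
  also have "\<dots> / (4 * of_real pi * \<i>) = vg_contour (Suc m) y" unfolding vg_contour_def ..
  finally have LQ: "(LINT u|M. vg_contour m \<bar>u\<bar>) = vg_contour (Suc m) y" .
  define q where "q = (\<lambda>u. Re (vg_contour m \<bar>u\<bar>))"
  have q: "q u \<ge> 0 \<and> vg_density (2 * m) u = ennreal (q u) \<and> vg_contour m \<bar>u\<bar> = of_real (q u)" if "u \<ge> y" for u
  proof -
    have u: "u \<ge> 0" using that Suc.prems by simp
    obtain q' where "q' \<ge> 0" "vg_density (2 * m) u = ennreal q'" "of_real q' = vg_contour m u" using Suc.IH[OF u] by auto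
    moreover from this have e: "vg_contour m \<bar>u\<bar> = of_real q'" using u by simp
    moreover have "q u = q'" unfolding q_def e by simp
    ultimately show ?thesis by simp
  qed
  have iq: "integrable M q" unfolding q_def using intQ by (rule integrable_Re)
  have "vg_density (2 * Suc m) y = (\<integral>\<^sup>+u. ennreal (u / real (2 * m)) * vg_density (2 * m) u * indicator {y..} u \<partial>lborel)"
    using vg_density_recursion[of "2 * m" y] Suc.hyps Suc.prems by (simp add: add.commute)
  also have "\<dots> = (\<integral>\<^sup>+u. ennreal (D u) * vg_density (2 * m) u \<partial>lborel)"
    by (intro nn_integral_cong) (auto simp: D_def indicator_def)
  also have "\<dots> = (\<integral>\<^sup>+u. vg_density (2 * m) u \<partial>M)" unfolding M_def by (rule nn_integral_density[symmetric]) auto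
  also have "\<dots> = (\<integral>\<^sup>+u. ennreal (q u) \<partial>M)"
    using AEy by (intro nn_integral_cong_AE) (auto elim!: eventually_mono simp: q)
  also have "\<dots> = ennreal (LINT u|M. q u)"
    using AEy by (intro nn_integral_eq_integral iq) (auto elim!: eventually_mono simp: q)
  finally have 1: "vg_density (2 * Suc m) y = ennreal (LINT u|M. q u)" .
  have "complex_of_real (LINT u|M. q u) = (LINT u|M. complex_of_real (q u))" by simp
  also have "\<dots> = (LINT u|M. vg_contour m \<bar>u\<bar>)"
    using AEy intQ iq by (intro integral_cong_AE) (auto elim!: eventually_mono simp: q)
  finally have 2: "complex_of_real (LINT u|M. q u) = vg_contour (Suc m) y" unfolding LQ .
  have "0 \<le> (LINT u|M. q u)" using AEy by (intro integral_nonneg_AE) (auto elim!: eventually_mono simp: q)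
  with 1 2 show ?case by blast
qed

section \<open>The Laplace transform of the positive part as a holomorphic function\<close>

definition vg_pos_part :: "nat \<Rightarrow> real measure" where
  "vg_pos_part a = density lborel (\<lambda>y. vg_density a y * indicator {0<..} y)"

lemma sets_vg_pos_part [simp, measurable_cong]: "sets (vg_pos_part a) = sets borel"
  and space_vg_pos_part [simp]: "space (vg_pos_part a) = UNIV"
  by (auto simp: vg_pos_part_def)

lemma nn_integral_vg_density: "a \<ge> 1 \<Longrightarrow> (\<integral>\<^sup>+y. vg_density a y \<partial>lborel) = 1"
proof -
  assume a: "a \<ge> 1"
  interpret sigma_finite_measure "power_measure a" by (rule sigma_finite_power_measure)
  interpret P: pair_sigma_finite "power_measure a" "lborel :: real measure" ..
  have chi_moment: "chi_moment a > 0" using a by (rule chi_moment_pos)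
  have "(\<integral>\<^sup>+y. vg_density a y \<partial>lborel) = ennreal (1 / chi_moment a) * (\<integral>\<^sup>+y. (\<integral>\<^sup>+r. ennreal (exp (- (r\<^sup>2 / 2)) * normal_density 0 r y) \<partial>power_measure a) \<partial>lborel)"
    unfolding vg_density_def by (rule nn_integral_cmult) measurable
  also have "(\<integral>\<^sup>+y. (\<integral>\<^sup>+r. ennreal (exp (- (r\<^sup>2 / 2)) * normal_density 0 r y) \<partial>power_measure a) \<partial>lborel)
    = (\<integral>\<^sup>+r. (\<integral>\<^sup>+y. ennreal (exp (- (r\<^sup>2 / 2)) * normal_density 0 r y) \<partial>lborel) \<partial>power_measure a)"
    by (rule P.Fubini') measurable
  also have "\<dots> = (\<integral>\<^sup>+r. ennreal (exp (- (r\<^sup>2 / 2))) \<partial>power_measure a)"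
  proof (rule nn_integral_cong_AE)
    show "AE r in power_measure a. (\<integral>\<^sup>+y. ennreal (exp (- (r\<^sup>2 / 2)) * normal_density 0 r y) \<partial>lborel) = ennreal (exp (- (r\<^sup>2 / 2)))"
      using AE_power_measure_pos
    proof eventually_elim
      case (elim r)
      have "(\<integral>\<^sup>+y. ennreal (normal_density 0 r y) \<partial>lborel) = 1"
        using elim integral_normal_density[of r 0] integrable_normal_density[of r 0] by (subst nn_integral_eq_integral) auto
      then show ?case by (simp add: ennreal_mult' nn_integral_cmult)
    qed
  qed
  also have "\<dots> = ennreal (chi_moment a)" using a by (rule nn_integral_exp_power_measure)
  finally show ?thesis using chi_moment by (simp add: ennreal_mult'[symmetric])
qed

lemma emeasure_vg_pos_part_le: "a \<ge> 1 \<Longrightarrow> emeasure (vg_pos_part a) UNIV \<le> 1"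
proof -
  assume a: "a \<ge> 1"
  have "emeasure (vg_pos_part a) UNIV = (\<integral>\<^sup>+y. vg_density a y * indicator {0<..} y \<partial>lborel)"
    unfolding vg_pos_part_def by (subst emeasure_density) auto
  also have "\<dots> \<le> (\<integral>\<^sup>+y. vg_density a y \<partial>lborel)" by (intro nn_integral_mono) (auto simp: indicator_def)
  finally show ?thesis using nn_integral_vg_density[OF a] by simp
qed

lemma finite_measure_vg_pos_part: "a \<ge> 1 \<Longrightarrow> finite_measure (vg_pos_part a)"
  using emeasure_vg_pos_part_le[of a] by (intro finite_measureI) (auto simp: top_unique)

lemma AE_vg_pos_part: "AE y in vg_pos_part a. y > 0"
  unfolding vg_pos_part_def by (subst AE_density) (auto simp: indicator_def)

text \<open>Almost everywhere \<open>\<bar>y\<bar> = y\<close>; the absolute value makes the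
  integrand bounded everywhere for \<open>Re c \<ge> 0\<close>.\<close>

definition vg_laplace :: "nat \<Rightarrow> complex \<Rightarrow> complex" where
  "vg_laplace a c = (LINT y|vg_pos_part a. exp (- (of_real \<bar>y\<bar> * c)))"

lemma integrable_vg_laplace:
  assumes a: "a \<ge> 1" and c: "Re c \<ge> 0"
  shows "integrable (vg_pos_part a) (\<lambda>y. exp (- (of_real \<bar>y\<bar> * c)))"
proof -
  interpret finite_measure "vg_pos_part a" using a by (rule finite_measure_vg_pos_part)
  have "(\<lambda>y. exp (- (of_real \<bar>y\<bar> * c))) \<in> borel_measurable borel"
    by (intro borel_measurable_continuous_onI continuous_intros)
  then show ?thesis using c by (intro integrable_const_bound[where B = 1]) auto
qed

text \<open>Expanding \<open>exp (- y * c)\<close> around \<open>c = 1\<close> keeps the weight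
  \<open>exp (- y)\<close>, and the absolute values of the terms sum to
  \<open>exp (- y) * exp (y * norm (c - 1)) \<le> 1\<close>. On a finite measure this bound
  justifies integrating term by term and exhibits the transform as a power series.\<close>

lemma vg_laplace_sums:
  assumes a: "a \<ge> 1" and c: "norm (c - 1) \<le> 1"
  shows "(\<lambda>j. (LINT y|vg_pos_part a. of_real (exp (- \<bar>y\<bar>) * (- \<bar>y\<bar>) ^ j / fact j)) * (c - 1) ^ j) sums vg_laplace a c"
proof -
  interpret finite_measure "vg_pos_part a" using a by (rule finite_measure_vg_pos_part)
  define f where "f = (\<lambda>j y. complex_of_real (exp (- \<bar>y\<bar>) * (- \<bar>y\<bar>) ^ j / fact j) * (c - 1) ^ j)"
  have fm [measurable]: "f j \<in> borel_measurable borel" for j 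
    unfolding f_def by (intro borel_measurable_continuous_onI continuous_intros) auto
  have nf: "norm (f j y) = exp (- \<bar>y\<bar>) * (\<bar>y\<bar> * norm (c - 1)) ^ j / fact j" for j y
    by (simp add: f_def norm_mult norm_divide norm_power power_mult_distrib abs_mult power_abs)
  have su: "(\<lambda>j. exp (- \<bar>y\<bar>) * (\<bar>y\<bar> * norm (c - 1)) ^ j / fact j) sums (exp (- \<bar>y\<bar>) * exp (\<bar>y\<bar> * norm (c - 1)))" for y :: real
    using sums_mult[OF exp_converges[of "\<bar>y\<bar> * norm (c - 1)"], of "exp (- \<bar>y\<bar>)"] by (simp add: field_simps)
  have part: "(\<Sum>j<N. norm (f j y)) \<le> 1" for N y
  proof -
    have "(\<Sum>j<N. norm (f j y)) \<le> exp (- \<bar>y\<bar>) * exp (\<bar>y\<bar> * norm (c - 1))"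
      unfolding nf by (rule sum_le_suminf[OF sums_summable[OF su], unfolded sums_unique[OF su, symmetric]]) auto
    also have "\<dots> \<le> 1" using c mult_left_mono[OF c, of "\<bar>y\<bar>"] by (simp add: exp_add[symmetric])
    finally show ?thesis .
  qed
  have nf1: "norm (f j y) \<le> 1" for j y
    using part[where N = "Suc j" and y = y] sum_nonneg[of "{..<j}" "\<lambda>j. norm (f j y)"] by simp
  have int: "integrable (vg_pos_part a) (f j)" for j
    by (rule integrable_const_bound[where B = 1]) (auto simp: nf1)
  have "(\<lambda>j. LINT y|vg_pos_part a. f j y) sums (LINT y|vg_pos_part a. (\<Sum>j. f j y))"
  proof (rule sums_integral[OF int])
    show "AE y in vg_pos_part a. summable (\<lambda>j. norm (f j y))" unfolding nf using sums_summable[OF su] by simp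
    show "summable (\<lambda>j. LINT y|vg_pos_part a. norm (f j y))"
    proof (rule summableI_nonneg_bounded[where x = "measure (vg_pos_part a) (space (vg_pos_part a))"])
      fix N
      have "(\<Sum>j<N. LINT y|vg_pos_part a. norm (f j y)) = (LINT y|vg_pos_part a. (\<Sum>j<N. norm (f j y)))"
        using int by (subst Bochner_Integration.integral_sum) auto
      also have "\<dots> \<le> (LINT y|vg_pos_part a. 1)"
        using int part by (intro integral_mono) auto
      finally show "(\<Sum>j<N. LINT y|vg_pos_part a. norm (f j y)) \<le> measure (vg_pos_part a) (space (vg_pos_part a))" by simp
    qed auto
  qed
  moreover have "(\<Sum>j. f j y) = exp (- (of_real \<bar>y\<bar> * c))" for y
  proof -
    have "(\<lambda>j. of_real (exp (- \<bar>y\<bar>)) * (((- of_real \<bar>y\<bar>) * (c - 1)) ^ j /\<^sub>R fact j)) sums (of_real (exp (- \<bar>y\<bar>)) * exp ((- of_real \<bar>y\<bar>) * (c - 1)))"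
      by (intro sums_mult exp_converges)
    moreover have "of_real (exp (- \<bar>y\<bar>)) * (((- of_real \<bar>y\<bar>) * (c - 1)) ^ j /\<^sub>R fact j) = f j y" for j
      unfolding power_mult_distrib by (simp add: f_def scaleR_conv_of_real field_simps)
    moreover have "of_real (exp (- \<bar>y\<bar>)) * exp ((- of_real \<bar>y\<bar>) * (c - 1)) = exp (- (of_real \<bar>y\<bar> * c))"
      unfolding exp_of_real[symmetric] exp_add[symmetric] by (simp add: algebra_simps)
    ultimately show ?thesis by (simp add: sums_unique[symmetric])
  qed
  moreover have "(LINT y|vg_pos_part a. f j y) = (LINT y|vg_pos_part a. of_real (exp (- \<bar>y\<bar>) * (- \<bar>y\<bar>) ^ j / fact j)) * (c - 1) ^ j" for j
    unfolding f_def by (rule integral_mult_left_zero)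
  ultimately show ?thesis unfolding vg_laplace_def by simp
qed

lemma holomorphic_vg_laplace: "a \<ge> 1 \<Longrightarrow> vg_laplace a holomorphic_on ball 1 1"
  by (rule power_series_holomorphic, rule vg_laplace_sums) (auto simp: dist_norm norm_minus_commute)

lemma vg_laplace_cos_real:
  assumes a: "a \<ge> 1" and x: "0 < x" "x < pi / 2"
  shows "vg_laplace a (of_real (cos x)) = of_real (c_tilde ((real a + 1) / 2) * integral {0..x} (\<lambda>t. sin t ^ (a - 1)) / sin x ^ a)"
proof -
  let ?q = "c_tilde ((real a + 1) / 2) * integral {0..x} (\<lambda>t. sin t ^ (a - 1)) / sin x ^ a"
  have q: "?q \<ge> 0"
  proof -
    have "integral {0..x} (\<lambda>t. sin t ^ (a - 1)) \<ge> 0"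
      using x by (intro Henstock_Kurzweil_Integration.integral_nonneg integrable_continuous_real continuous_intros) (auto intro!: zero_le_power sin_ge_zero)
    moreover have "sin x \<ge> 0" using x by (intro sin_ge_zero) auto
    moreover have "c_tilde ((real a + 1) / 2) \<ge> 0" 
      using c_tilde_eq_chi_moment[of "a + 1"] chi_moment_pos[of a] chi_moment_pos[of "a + 1"] a by (simp add: add.commute)
    ultimately show ?thesis by simp
  qed
  have c: "cos x > 0" using x by (auto intro!: cos_gt_zero_pi)
  have "(\<integral>\<^sup>+y. ennreal (exp (- (\<bar>y\<bar> * cos x))) \<partial>vg_pos_part a) = (\<integral>\<^sup>+y. vg_density a y * indicator {0<..} y * ennreal (exp (- (\<bar>y\<bar> * cos x))) \<partial>lborel)"
    unfolding vg_pos_part_def by (rule nn_integral_density) auto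
  also have "\<dots> = (\<integral>\<^sup>+y. ennreal (exp (- cos x * y)) * vg_density a y * indicator {0<..} y \<partial>lborel)"
    by (intro nn_integral_cong) (auto simp: indicator_def mult_ac)
  also have "\<dots> = ennreal ?q" using a x by (rule laplace_vg_density)
  finally have nn: "(\<integral>\<^sup>+y. ennreal (exp (- (\<bar>y\<bar> * cos x))) \<partial>vg_pos_part a) = ennreal ?q" .
  have "(LINT y|vg_pos_part a. exp (- (\<bar>y\<bar> * cos x))) = enn2real (\<integral>\<^sup>+y. ennreal (exp (- (\<bar>y\<bar> * cos x))) \<partial>vg_pos_part a)"
    by (rule integral_eq_nn_integral) auto
  then have "(LINT y|vg_pos_part a. exp (- (\<bar>y\<bar> * cos x))) = ?q" unfolding nn using enn2real_ennreal[OF q] by (simp only:)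
  then have "complex_of_real (LINT y|vg_pos_part a. exp (- (\<bar>y\<bar> * cos x))) = of_real ?q" by simp
  moreover have "complex_of_real (LINT y|vg_pos_part a. exp (- (\<bar>y\<bar> * cos x))) = vg_laplace a (of_real (cos x))"
    unfolding vg_laplace_def by (subst integral_complex_of_real[symmetric]) (simp add: exp_of_real[symmetric])
  ultimately show ?thesis by simp
qed

text \<open>An entire primitive shows that the path integral from 0 is holomorphic in its
  endpoint.\<close>

lemma sin_primitive:
  obtains G where "\<And>x. (G has_field_derivative (sin x :: complex) ^ j) (at x)"
    "\<And>x. contour_integral (linepath 0 x) (\<lambda>y. sin y ^ j) = G x - G 0"
proof -
  obtain G where G: "\<And>x. x \<in> UNIV \<Longrightarrow> (G has_field_derivative (sin x :: complex) ^ j) (at x within UNIV)"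
    by (rule holomorphic_convex_primitive'[where S = UNIV and f = "\<lambda>x. sin x ^ j"]) (auto intro!: holomorphic_intros)
  have "contour_integral (linepath 0 x) (\<lambda>y. sin y ^ j) = G x - G 0" for x
    using contour_integral_primitive[of UNIV G "\<lambda>y. sin y ^ j" "linepath 0 x"] G by (simp add: contour_integral_unique)
  with G show ?thesis by (intro that[of G]) auto
qed

text \<open>By the real computation the identity holds on the segment from 0 to 1/2, which
  accumulates at 0; analytic continuation extends it to the disc. The factor
  \<open>sin x ^ a\<close> is kept on the left so that both sides are holomorphic at 0.\<close>

lemma vg_laplace_cos:
  assumes a: "a \<ge> 1" and x: "norm x < 1/2"
  shows "vg_laplace a (cos x) * sin x ^ a = of_real (c_tilde ((real a + 1) / 2)) * contour_integral (linepath 0 x) (\<lambda>y. sin y ^ (a - 1))"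
proof -
  obtain G where G: "\<And>x. (G has_field_derivative (sin x :: complex) ^ (a - 1)) (at x)"
    "\<And>x. contour_integral (linepath 0 x) (\<lambda>y. sin y ^ (a - 1)) = G x - G 0"
    using sin_primitive[of "a - 1"] by blast
  have hG: "G holomorphic_on A" for A
    using G(1) by (intro holomorphic_onI) (meson DERIV_subset field_differentiable_def has_field_derivative_at_within)
  define h where "h = (\<lambda>x. vg_laplace a (cos x) * sin x ^ a - of_real (c_tilde ((real a + 1) / 2)) * (G x - G 0))"
  have "h x = 0"
  proof (rule analytic_continuation[where f = h and S = "ball 0 (1/2)" and U = "of_real ` {0<..<1/2}" and \<xi> = 0])
    have "(vg_laplace a \<circ> cos) holomorphic_on ball 0 (1/2)"
    proof (rule holomorphic_on_compose_gen[OF _ holomorphic_vg_laplace[OF a]])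
      show "cos ` ball 0 (1/2) \<subseteq> ball (1::complex) 1"
      proof (safe, unfold mem_ball dist_norm)
        fix z :: complex assume "norm (0 - z) < 1/2"
        then show "norm (1 - cos z) < 1"
          using norm_cos_minus_1_le[of z] norm_minus_commute[of "cos z" 1] by simp
      qed
    qed (intro holomorphic_intros)
    then have [holomorphic_intros]: "(\<lambda>x. vg_laplace a (cos x)) holomorphic_on ball 0 (1/2)" by (simp add: comp_def)
    show "h holomorphic_on ball 0 (1/2)" unfolding h_def by (intro holomorphic_intros hG)
    show "complex_of_real ` {0<..<1/2} \<subseteq> ball 0 (1/2)" by auto
    show "(0::complex) islimpt complex_of_real ` {0<..<1/2}"
      unfolding islimpt_approachable
    proof safe
      fix e :: real assume e: "e > 0"
      let ?t = "min (e/2) (1/4)"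
      have "?t \<in> {0<..<1/2}" using e by auto
      then show "\<exists>x'\<in>complex_of_real ` {0<..<1/2}. x' \<noteq> 0 \<and> dist x' 0 < e"
        using e by (intro bexI[of _ "of_real ?t"] conjI) auto
    qed
    fix z :: complex assume "z \<in> of_real ` {0<..<1/2}"
    then obtain t :: real where t: "z = of_real t" "0 < t" "t < 1/2" by auto
    have tp: "t < pi / 2" using t pi_gt3 by simp
    have st: "sin t > 0" using t tp by (intro sin_gt_zero) auto
    have "G z - G 0 = contour_integral (linepath 0 z) (\<lambda>y. sin y ^ (a - 1))" using G(2) by simp
    also have "\<dots> = integral {0..t} (\<lambda>x. sin (complex_of_real x) ^ (a - 1))"
      using contour_integral_linepath_Reals_eq[of 0 "of_real t" "\<lambda>y. sin y ^ (a - 1)"] t by simp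
    also have "\<dots> = of_real (integral {0..t} (\<lambda>x. sin x ^ (a - 1)))"
    proof (rule integral_unique)
      have "((\<lambda>x. sin x ^ (a - 1)) has_integral integral {0..t} (\<lambda>x. sin x ^ (a - 1))) {0..t}"
        by (intro integrable_integral integrable_continuous_real continuous_intros)
      from has_integral_linear[OF this bounded_linear_of_real[where 'a = complex]]
      show "((\<lambda>x. sin (complex_of_real x) ^ (a - 1)) has_integral of_real (integral {0..t} (\<lambda>x. sin x ^ (a - 1)))) {0..t}"
        by (simp add: comp_def sin_of_real)
    qed
    finally have Gz: "G z - G 0 = of_real (integral {0..t} (\<lambda>x. sin x ^ (a - 1)))" .
    show "h z = 0" unfolding h_def Gz using vg_laplace_cos_real[OF a t(2) tp] st
      by (simp add: t(1) cos_of_real sin_of_real)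
  qed (use x in auto)
  then show ?thesis unfolding h_def G(2) by simp
qed

text \<open>The contour formula for the density is integrated over the variables in \<open>J\<close>
  under the contour. The exponential of a sum factors, so each variable contributes
  \<open>vg_laplace a (cos x)\<close>, and the exponents \<open>a\<close> per variable add to
  \<open>2 * m - 1\<close>. The circle integral is \<open>2 * pi * \<i>\<close> times the residue,
  against \<open>4 * pi * \<i>\<close> in \<open>vg_contour\<close>, which leaves 1/2.\<close>

lemma residue_formula:
  fixes J :: "'i set"
  assumes a: "a \<ge> 1" and m: "m \<ge> 1" and J: "finite J"
  shows "\<exists>q\<ge>0. (\<integral>\<^sup>+l. vg_density (2 * m) (\<Sum>i\<in>J. l i) \<partial>PiM J (\<lambda>_. vg_pos_part a)) = ennreal q \<and>
     complex_of_real q = of_real (c_tilde ((real a + 1) / 2) ^ card J / 2) *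
       residue (\<lambda>x::complex. (contour_integral (linepath 0 x) (\<lambda>y. (sin y) ^ (a - 1))) ^ card J / (sin x) ^ (a * card J + 2 * m - 1)) 0"
proof -
  let ?M = "PiM J (\<lambda>_. vg_pos_part a)"
  let ?s = "\<lambda>l. \<Sum>i\<in>J. \<bar>l i\<bar>"
  let ?F = "\<lambda>x::complex. contour_integral (linepath 0 x) (\<lambda>y. (sin y) ^ (a - 1))"
  let ?c = "complex_of_real (c_tilde ((real a + 1) / 2))"
  interpret N: finite_measure "vg_pos_part a" using a by (rule finite_measure_vg_pos_part)
  interpret P: product_sigma_finite "\<lambda>_::'i. vg_pos_part a" ..
  interpret PJ: finite_product_sigma_finite "\<lambda>_::'i. vg_pos_part a" J by standard fact
  have fin: "emeasure ?M (space ?M) < \<infinity>"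
  proof -
    have "emeasure ?M (space ?M) = (\<Prod>i\<in>J. emeasure (vg_pos_part a) UNIV)"
      unfolding space_PiM using J by (subst P.emeasure_PiM) auto
    also have "\<dots> \<le> 1" using emeasure_vg_pos_part_le[OF a] by (simp add: power_le_one)
    finally show ?thesis using le_less_trans by fastforce
  qed
  have sm [measurable]: "?s \<in> borel_measurable ?M" by measurable
  have f2: "(\<integral>\<^sup>+l. ennreal (exp (- (?s l / 2))) \<partial>?M) < \<infinity>"
  proof -
    have "(\<integral>\<^sup>+l. ennreal (exp (- (?s l / 2))) \<partial>?M) \<le> (\<integral>\<^sup>+l. 1 \<partial>?M)"
      by (intro nn_integral_mono) (auto simp: sum_nonneg)
    then show ?thesis using fin by (auto intro: le_less_trans)
  qed
  have cF: "integrable ?M (\<lambda>l. contour_integral small_circle (\<lambda>x. exp (- (of_real (?s l) * cos x)) * (1 / sin x ^ (2 * m - 1))))"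
    "(LINT l|?M. contour_integral small_circle (\<lambda>x. exp (- (of_real (?s l) * cos x)) * (1 / sin x ^ (2 * m - 1))))
       = contour_integral small_circle (\<lambda>x. (LINT l|?M. exp (- (of_real (?s l) * cos x))) * (1 / sin x ^ (2 * m - 1)))"
    by (rule circle_Fubini[OF PJ.sigma_finite_measure_axioms sm _ f2 continuous_on_inverse_sin]; simp add: sum_nonneg)+
  have intQ: "integrable ?M (\<lambda>l. vg_contour m (?s l))" unfolding vg_contour_def using cF(1) by simp
  define q where "q = (\<lambda>l. Re (vg_contour m (?s l)))"
  have q: "q l \<ge> 0 \<and> vg_density (2 * m) (?s l) = ennreal (q l) \<and> vg_contour m (?s l) = of_real (q l)" for l
  proof -
    obtain q' where "q' \<ge> 0" "vg_density (2 * m) (?s l) = ennreal q'" and e: "of_real q' = vg_contour m (?s l)" 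
      using vg_density_eq_vg_contour[OF m, of "?s l"] by (auto simp: sum_nonneg)
    moreover have "q l = q'" unfolding q_def e[symmetric] by simp
    ultimately show ?thesis by simp
  qed
  have iq: "integrable ?M q" unfolding q_def using intQ by (rule integrable_Re)
  have "(\<integral>\<^sup>+l. vg_density (2 * m) (\<Sum>i\<in>J. l i) \<partial>?M) = (\<integral>\<^sup>+l. ennreal (q l) \<partial>?M)"
  proof (rule nn_integral_cong_AE)
    show "AE l in ?M. vg_density (2 * m) (\<Sum>i\<in>J. l i) = ennreal (q l)"
      using AE_PiM_all[OF N.sigma_finite_measure_axioms J AE_vg_pos_part]
    proof eventually_elim
      case (elim l)
      then have "(\<Sum>i\<in>J. l i) = ?s l" by (intro sum.cong) auto
      then show ?case using q[of l] by simp
    qed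
  qed
  also have "\<dots> = ennreal (LINT l|?M. q l)" using q by (intro nn_integral_eq_integral iq) auto
  finally have 1: "(\<integral>\<^sup>+l. vg_density (2 * m) (\<Sum>i\<in>J. l i) \<partial>?M) = ennreal (LINT l|?M. q l)" .
  have L: "(LINT l|?M. exp (- (of_real (?s l) * cos x))) * (1 / sin x ^ (2 * m - 1)) = ?c ^ card J * (?F x ^ card J / sin x ^ (a * card J + 2 * m - 1))"
    if x: "x \<in> sphere 0 (1/4)" for x :: complex
  proof -
    have "(LINT l|?M. exp (- (of_real (?s l) * cos x))) = (LINT l|?M. (\<Prod>i\<in>J. exp (- (of_real \<bar>l i\<bar> * cos x))))"
      using J by (simp add: exp_sum[symmetric] sum_negf sum_distrib_right)
    also have "\<dots> = (\<Prod>i\<in>J. LINT y|vg_pos_part a. exp (- (of_real \<bar>y\<bar> * cos x)))"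
      using x Re_cos_ge[of x] by (intro P.product_integral_prod J integrable_vg_laplace a) auto
    also have "\<dots> = vg_laplace a (cos x) ^ card J" by (simp add: vg_laplace_def)
    finally have e: "(LINT l|?M. exp (- (of_real (?s l) * cos x))) = vg_laplace a (cos x) ^ card J" .
    have s: "sin x \<noteq> 0" using x by (rule sin_sphere_nonzero)
    have "vg_laplace a (cos x) * sin x ^ a = ?c * ?F x" using x by (intro vg_laplace_cos a) auto
    then have "vg_laplace a (cos x) = ?c * ?F x / sin x ^ a" using s by (simp add: field_simps)
    moreover have "sin x ^ (a * card J + 2 * m - 1) = (sin x ^ a) ^ card J * sin x ^ (2 * m - 1)"
      using m by (simp add: power_mult[symmetric] power_add[symmetric])
    ultimately show ?thesis unfolding e by (simp add: power_divide power_mult_distrib)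
  qed
  have "complex_of_real (LINT l|?M. q l) = (LINT l|?M. complex_of_real (q l))" by simp
  also have "\<dots> = (LINT l|?M. vg_contour m (?s l))" using q by simp
  also have "\<dots> = contour_integral small_circle (\<lambda>x. (LINT l|?M. exp (- (of_real (?s l) * cos x))) * (1 / sin x ^ (2 * m - 1))) / (4 * of_real pi * \<i>)"
    unfolding vg_contour_def using cF(2) by simp
  also have "contour_integral small_circle (\<lambda>x. (LINT l|?M. exp (- (of_real (?s l) * cos x))) * (1 / sin x ^ (2 * m - 1)))
    = contour_integral small_circle (\<lambda>x. ?c ^ card J * (?F x ^ card J / sin x ^ (a * card J + 2 * m - 1)))"
    by (rule contour_integral_cong[OF refl]) (rule L, simp only: path_image_small_circle)
  also have "\<dots> = ?c ^ card J * contour_integral small_circle (\<lambda>x. ?F x ^ card J / sin x ^ (a * card J + 2 * m - 1))"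
  proof (rule contour_integral_lmul)
    obtain G where G: "\<And>x. (G has_field_derivative (sin x :: complex) ^ (a - 1)) (at x)"
      "\<And>x. contour_integral (linepath 0 x) (\<lambda>y. sin y ^ (a - 1)) = G x - G 0"
      using sin_primitive[of "a - 1"] by blast
    have "continuous_on A G" for A 
      using G(1) by (meson DERIV_isCont continuous_at_imp_continuous_on)
    then show "(\<lambda>x. ?F x ^ card J / sin x ^ (a * card J + 2 * m - 1)) contour_integrable_on small_circle"
      unfolding G(2) by (intro contour_integrable_continuous_circlepath continuous_intros) (use sin_sphere_nonzero in auto)
  qed
  also have "contour_integral small_circle (\<lambda>x. ?F x ^ card J / sin x ^ (a * card J + 2 * m - 1))
    = complex_of_real (2 * pi) * \<i> * residue (\<lambda>x. ?F x ^ card J / sin x ^ (a * card J + 2 * m - 1)) 0"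
  proof (rule contour_integral_unique, rule base_residue[where s = "ball 0 (1/2)"])
    obtain G where G: "\<And>x. (G has_field_derivative (sin x :: complex) ^ (a - 1)) (at x)"
      "\<And>x. contour_integral (linepath 0 x) (\<lambda>y. sin y ^ (a - 1)) = G x - G 0"
      using sin_primitive[of "a - 1"] by blast
    have hG: "G holomorphic_on A" for A
      using G(1) by (intro holomorphic_onI) (meson DERIV_subset field_differentiable_def has_field_derivative_at_within)
    show "(\<lambda>x. ?F x ^ card J / sin x ^ (a * card J + 2 * m - 1)) holomorphic_on ball 0 (1/2) - {0}"
      unfolding G(2) by (intro holomorphic_intros hG) (use sin_nonzero in \<open>auto intro: less_imp_le\<close>)
  qed (auto simp: subset_eq)
  finally have 2: "complex_of_real (LINT l|?M. q l) = of_real (c_tilde ((real a + 1) / 2) ^ card J / 2) *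
       residue (\<lambda>x::complex. ?F x ^ card J / (sin x) ^ (a * card J + 2 * m - 1)) 0"
    by (simp add: field_simps)
  have "0 \<le> (LINT l|?M. q l)" using q by (intro integral_nonneg_AE) auto
  with 1 2 show ?thesis by blast
qed

section \<open>Simplices and internal angles\<close>

lemma real_matrix_inverse:
  fixes a :: "nat \<Rightarrow> nat \<Rightarrow> real"
  assumes "Determinant.det (Matrix.mat d d (\<lambda>(i, j). a i j)) \<noteq> 0"
  shows "\<exists>B. (\<forall>i<d. \<forall>j<d. (\<Sum>k<d. B i k * a k j) = (if i = j then 1 else 0)) \<and>
             (\<forall>i<d. \<forall>j<d. (\<Sum>k<d. a i k * B k j) = (if i = j then 1 else 0))"
proof -
  let ?A = "Matrix.mat d d (\<lambda>(i, j). a i j)"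
  have A: "?A \<in> carrier_mat d d" by simp
  from det_non_zero_imp_unit[OF A assms, of undefined] obtain B where
    B: "B \<in> carrier_mat d d" "B * ?A = 1\<^sub>m d" "?A * B = 1\<^sub>m d"
    unfolding Units_def ring_mat_def by auto
  have "(\<Sum>k<d. B $$ (i, k) * a k j) = (if i = j then 1 else 0)" if "i < d" "j < d" for i j
  proof -
    have "(B * ?A) $$ (i, j) = (\<Sum>k<d. B $$ (i, k) * a k j)"
      using that B(1) by (simp add: scalar_prod_def atLeast0LessThan)
    then show ?thesis using that unfolding B(2) by simp
  qed
  moreover have "(\<Sum>k<d. a i k * B $$ (k, j)) = (if i = j then 1 else 0)" if "i < d" "j < d" for i j
  proof -
    have "(?A * B) $$ (i, j) = (\<Sum>k<d. a i k * B $$ (k, j))"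
      using that B(1) by (simp add: scalar_prod_def atLeast0LessThan)
    then show ?thesis using that unfolding B(3) by simp
  qed
  ultimately show ?thesis by (intro exI[of _ "\<lambda>i k. B $$ (i, k)"]) auto
qed

lemma real_matrix_singular:
  fixes a :: "nat \<Rightarrow> nat \<Rightarrow> real"
  assumes "Determinant.det (Matrix.mat d d (\<lambda>(i, j). a i j)) = 0"
  shows "\<exists>v. (\<exists>i<d. v i \<noteq> 0) \<and> (\<forall>i<d. (\<Sum>j<d. a i j * v j) = 0)"
proof -
  let ?A = "Matrix.mat d d (\<lambda>(i, j). a i j)"
  have A: "?A \<in> carrier_mat d d" by simp
  obtain v where v: "v \<in> carrier_vec d" "v \<noteq> 0\<^sub>v d" "?A *\<^sub>v v = 0\<^sub>v d"
    using det_0_iff_vec_prod_zero[OF A] assms by blast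
  have "\<exists>i<d. vec_index v i \<noteq> 0"
    using v(1,2) by (metis carrier_vecD eq_vecI index_zero_vec(1,2))
  moreover have "(\<Sum>j<d. a i j * vec_index v j) = 0" if "i < d" for i
  proof -
    have "vec_index (?A *\<^sub>v v) i = (\<Sum>j<d. a i j * vec_index v j)"
      using that v(1) by (simp add: scalar_prod_def atLeast0LessThan)
    then show ?thesis using that unfolding v(3) by simp
  qed
  ultimately show ?thesis by (intro exI[of _ "\<lambda>j. vec_index v j"]) auto
qed

lemma real_matrix_singular_left:
  fixes a :: "nat \<Rightarrow> nat \<Rightarrow> real"
  assumes "Determinant.det (Matrix.mat d d (\<lambda>(i, j). a i j)) = 0"
  shows "\<exists>v. (\<exists>i<d. v i \<noteq> 0) \<and> (\<forall>j<d. (\<Sum>i<d. v i * a i j) = 0)"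
proof -
  have "transpose_mat (Matrix.mat d d (\<lambda>(i, j). a i j)) = Matrix.mat d d (\<lambda>(i, j). a j i)"
    by (rule eq_matI) auto
  then have "Determinant.det (Matrix.mat d d (\<lambda>(i, j). a j i)) = 0"
    using assms Determinant.det_transpose[of "Matrix.mat d d (\<lambda>(i, j). a i j)" d] by simp
  from real_matrix_singular[OF this] show ?thesis by (simp add: mult.commute)
qed

text \<open>If the shifted matrix is singular then \<open>- t\<close> is an eigenvalue, hence a root
  of the monic characteristic polynomial.\<close>

lemma finite_singular_shifts:
  fixes a :: "nat \<Rightarrow> nat \<Rightarrow> real"
  shows "finite {t. Determinant.det (Matrix.mat d d (\<lambda>(i, j). a i j + (if i = j then t else 0))) = 0}"
proof -
  let ?A = "Matrix.mat d d (\<lambda>(i, j). a i j)"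
  have A: "?A \<in> carrier_mat d d" by simp
  have "char_poly ?A \<noteq> 0" using degree_monic_char_poly[OF A] by auto
  then have "finite {x. poly (char_poly ?A) x = 0}" by (rule poly_roots_finite)
  then have "finite (uminus ` {x. poly (char_poly ?A) x = 0})" by simp
  moreover have "{t. Determinant.det (Matrix.mat d d (\<lambda>(i, j). a i j + (if i = j then t else 0))) = 0} \<subseteq> uminus ` {x. poly (char_poly ?A) x = 0}"
  proof safe
    fix t assume "Determinant.det (Matrix.mat d d (\<lambda>(i, j). a i j + (if i = j then t else 0))) = 0"
    then obtain v where v: "\<exists>i<d. v i \<noteq> 0" "\<And>i. i < d \<Longrightarrow> (\<Sum>j<d. (a i j + (if i = j then t else 0)) * v j) = 0"
      using real_matrix_singular[of d "\<lambda>i j. a i j + (if i = j then t else 0)"] by auto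
    let ?v = "Matrix.vec d v"
    have "eigenvector ?A ?v (- t)" unfolding eigenvector_def
    proof (intro conjI)
      show "?v \<noteq> 0\<^sub>v (dim_row ?A)" using v(1) by (auto simp: vec_eq_iff)
      show "?A *\<^sub>v ?v = (- t) \<cdot>\<^sub>v ?v"
      proof (rule eq_vecI)
        fix i assume "i < dim_vec ((- t) \<cdot>\<^sub>v ?v)"
        then have i: "i < d" by simp
        have "(\<Sum>j<d. (a i j + (if i = j then t else 0)) * v j) = (\<Sum>j<d. a i j * v j) + (\<Sum>j<d. (if i = j then t * v j else 0))"
          unfolding sum.distrib[symmetric] by (intro sum.cong) (auto simp: algebra_simps)
        also have "(\<Sum>j<d. (if i = j then t * v j else 0)) = t * v i" using i by simp
        finally have "(\<Sum>j<d. a i j * v j) = - t * v i" using v(2)[OF i] by simp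
        then show "vec_index (?A *\<^sub>v ?v) i = vec_index ((- t) \<cdot>\<^sub>v ?v) i" using i by (simp add: scalar_prod_def atLeast0LessThan)
      qed simp
    qed simp
    then have "poly (char_poly ?A) (- t) = 0" using eigenvalue_root_char_poly[OF A] by (auto simp: eigenvalue_def)
    then show "t \<in> uminus ` {x. poly (char_poly ?A) x = 0}" by (intro image_eqI[of _ _ "- t"]) auto
  qed
  ultimately show ?thesis by (rule finite_subset[rotated])
qed

text \<open>Coefficients of an affine dependency sum to \<open>0\<close>; only those at indices \<open>\<ge> 1\<close> are stored, shifted down by one.\<close>

definition zero_sum_ext :: "nat \<Rightarrow> (nat \<Rightarrow> real) \<Rightarrow> nat \<Rightarrow> real" where
  "zero_sum_ext d l i = (case i of 0 \<Rightarrow> - (\<Sum>j<d. l j) | Suc j \<Rightarrow> l j)"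

lemma zero_sum_ext_simps [simp]: "zero_sum_ext d l 0 = - (\<Sum>j<d. l j)" "zero_sum_ext d l (Suc j) = l j"
  by (auto simp: zero_sum_ext_def)

lemma sum_ext_eq: "(\<Sum>i<Suc d. zero_sum_ext d l i * x i) = (\<Sum>i<d. l i * (x (Suc i) - x 0))"
  by (subst sum.lessThan_Suc_shift) (simp add: sum_distrib_right[symmetric] sum_subtractf algebra_simps)

lemma sum_ext: "(\<Sum>i<Suc d. zero_sum_ext d l i) = 0"
  using sum_ext_eq[of d l "\<lambda>_. 1"] by simp

text \<open>Zero total weight makes this a combination of the edge vectors issuing from point 0
  (\<open>sum_ext_eq\<close>). The form that is symmetric in all \<open>d + 1\<close> points is the
  one on which reflections of the index can act.\<close>

definition lincomb :: "nat \<Rightarrow> (nat \<Rightarrow> nat \<Rightarrow> real) \<Rightarrow> (nat \<Rightarrow> real) \<Rightarrow> nat \<Rightarrow> real" where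
  "lincomb d X l = (\<lambda>j\<in>{..<d}. \<Sum>i<Suc d. zero_sum_ext d l i * X i j)"

definition nondeg :: "nat \<Rightarrow> (nat \<Rightarrow> nat \<Rightarrow> real) \<Rightarrow> bool" where
  "nondeg d X \<longleftrightarrow> Determinant.det (Matrix.mat d d (\<lambda>(j, i). X (Suc i) j - X 0 j)) \<noteq> 0"

lemma space_lebesgue_d: "space (lebesgue_d d) = PiE {..<d} (\<lambda>_. UNIV)"
  by (simp add: lebesgue_d_def space_PiM)

lemma nondeg_inverse:
  assumes "nondeg d X"
  obtains B where "\<And>l. l \<in> space (lebesgue_d d) \<Longrightarrow> (\<lambda>i\<in>{..<d}. \<Sum>j<d. B i j * lincomb d X l j) = l"
    "\<And>v. v \<in> space (lebesgue_d d) \<Longrightarrow> lincomb d X (\<lambda>i\<in>{..<d}. \<Sum>j<d. B i j * v j) = v"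
proof -
  define a where "a = (\<lambda>j i. X (Suc i) j - X 0 j)"
  have lc: "lincomb d X l = (\<lambda>j\<in>{..<d}. \<Sum>i<d. a j i * l i)" for l
    unfolding lincomb_def by (intro restrict_ext, subst sum_ext_eq) (simp add: a_def mult.commute)
  have "Determinant.det (Matrix.mat d d (\<lambda>(i, j). a i j)) \<noteq> 0" using assms by (simp add: nondeg_def a_def)
  from real_matrix_inverse[OF this] obtain B where
    B: "\<And>i j. i < d \<Longrightarrow> j < d \<Longrightarrow> (\<Sum>k<d. B i k * a k j) = (if i = j then 1 else 0)"
       "\<And>i j. i < d \<Longrightarrow> j < d \<Longrightarrow> (\<Sum>k<d. a i k * B k j) = (if i = j then 1 else 0)" by blast
  show ?thesis
  proof (rule that[of B])
    fix l assume l: "l \<in> space (lebesgue_d d)"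
    have "(\<Sum>j<d. B i j * lincomb d X l j) = l i" if i: "i < d" for i
    proof -
      have "(\<Sum>j<d. B i j * lincomb d X l j) = (\<Sum>j<d. \<Sum>k<d. B i j * a j k * l k)"
        unfolding lc by (intro sum.cong) (auto simp: sum_distrib_left mult.assoc)
      also have "\<dots> = (\<Sum>k<d. (\<Sum>j<d. B i j * a j k) * l k)"
        by (subst sum.swap) (simp add: sum_distrib_right)
      also have "\<dots> = (\<Sum>k<d. (if i = k then 1 else 0) * l k)" using i by (intro sum.cong) (auto simp: B)
      also have "\<dots> = l i" using i by (simp add: if_distrib[of "\<lambda>u. u * _"] cong: if_cong)
      finally show ?thesis .
    qed
    then show "(\<lambda>i\<in>{..<d}. \<Sum>j<d. B i j * lincomb d X l j) = l"
      using l by (auto simp: fun_eq_iff space_lebesgue_d PiE_iff extensional_def)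
  next
    fix v assume v: "v \<in> space (lebesgue_d d)"
    have "(\<Sum>k<d. a j k * (\<Sum>m<d. B k m * v m)) = v j" if j: "j < d" for j
    proof -
      have "(\<Sum>k<d. a j k * (\<Sum>m<d. B k m * v m)) = (\<Sum>k<d. \<Sum>m<d. a j k * B k m * v m)"
        by (intro sum.cong) (auto simp: sum_distrib_left mult.assoc)
      also have "\<dots> = (\<Sum>m<d. (\<Sum>k<d. a j k * B k m) * v m)"
        by (subst sum.swap) (simp add: sum_distrib_right)
      also have "\<dots> = (\<Sum>m<d. (if j = m then 1 else 0) * v m)" using j by (intro sum.cong) (auto simp: B)
      also have "\<dots> = v j" using j by (simp add: if_distrib[of "\<lambda>u. u * _"] cong: if_cong)
      finally show ?thesis .
    qed
    then show "lincomb d X (\<lambda>i\<in>{..<d}. \<Sum>j<d. B i j * v j) = v"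
      unfolding lc using v by (auto simp: fun_eq_iff space_lebesgue_d PiE_iff extensional_def)
  qed
qed

lemma not_nondeg_normal:
  assumes "\<not> nondeg d X"
  shows "\<exists>w. (\<exists>j<d. w j \<noteq> 0) \<and> (\<forall>i<d. (\<Sum>j<d. w j * (X (Suc i) j - X 0 j)) = 0)"
  using assms real_matrix_singular_left[of d "\<lambda>j i. X (Suc i) j - X 0 j"] by (simp add: nondeg_def)

text \<open>Nondegeneracy in terms of \<open>lincomb\<close> alone, the form in which it passes
  through a reflection of the points.\<close>

lemma nondeg_iff_kernel:
  "nondeg d X \<longleftrightarrow> (\<forall>l\<in>space (lebesgue_d d). lincomb d X l = (\<lambda>j\<in>{..<d}. 0) \<longrightarrow> l = (\<lambda>j\<in>{..<d}. 0))"
proof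
  assume nd: "nondeg d X"
  obtain B where B: "\<And>l. l \<in> space (lebesgue_d d) \<Longrightarrow> (\<lambda>i\<in>{..<d}. \<Sum>j<d. B i j * lincomb d X l j) = l"
    using nondeg_inverse[OF nd] by blast
  show "\<forall>l\<in>space (lebesgue_d d). lincomb d X l = (\<lambda>j\<in>{..<d}. 0) \<longrightarrow> l = (\<lambda>j\<in>{..<d}. 0)"
  proof safe
    fix l assume "l \<in> space (lebesgue_d d)" "lincomb d X l = (\<lambda>j\<in>{..<d}. 0)"
    then show "l = (\<lambda>j\<in>{..<d}. 0)" using B[of l] by (simp cong: restrict_cong)
  qed
next
  assume ker: "\<forall>l\<in>space (lebesgue_d d). lincomb d X l = (\<lambda>j\<in>{..<d}. 0) \<longrightarrow> l = (\<lambda>j\<in>{..<d}. 0)"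
  show "nondeg d X"
  proof (rule ccontr)
    assume "\<not> nondeg d X"
    then have "Determinant.det (Matrix.mat d d (\<lambda>(j, i). X (Suc i) j - X 0 j)) = 0" by (simp add: nondeg_def)
    from real_matrix_singular[OF this] obtain v where
      v: "\<exists>i<d. v i \<noteq> 0" "\<And>j. j < d \<Longrightarrow> (\<Sum>i<d. (X (Suc i) j - X 0 j) * v i) = 0" by blast
    let ?l = "\<lambda>i\<in>{..<d}. v i"
    have "(\<Sum>i<Suc d. zero_sum_ext d ?l i * X i j) = 0" if "j < d" for j
      unfolding sum_ext_eq using v(2)[OF that] by (simp add: mult.commute)
    then have "lincomb d X ?l = (\<lambda>j\<in>{..<d}. 0)" unfolding lincomb_def by (intro restrict_ext) (simp del: sum.lessThan_Suc)
    then have "?l = (\<lambda>j\<in>{..<d}. 0)" using ker by (simp add: space_lebesgue_d)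
    then show False using v(1) by (metis lessThan_iff restrict_apply')
  qed
qed

section \<open>Configurations of \<open>d + 1\<close> points: measurability and null sets\<close>

abbreviation mat_space :: "nat \<Rightarrow> (nat \<Rightarrow> nat \<Rightarrow> real) measure" where
  "mat_space d \<equiv> PiM {..<Suc d} (\<lambda>_. lebesgue_d d)"

lemma measurable_entry:
  assumes "i < Suc d" "j < d" "f \<in> M \<rightarrow>\<^sub>M mat_space d"
  shows "(\<lambda>x. f x i j) \<in> borel_measurable M"
proof -
  have "(\<lambda>x. f x i) \<in> M \<rightarrow>\<^sub>M lebesgue_d d"
    using assms by (intro measurable_compose[OF assms(3)] measurable_component_singleton) auto
  then have "(\<lambda>x. f x i j) \<in> M \<rightarrow>\<^sub>M lborel"
    unfolding lebesgue_d_def by (rule measurable_compose) (use assms in \<open>auto intro!: measurable_component_singleton\<close>)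
  then show ?thesis by simp
qed

lemma measurable_coord:
  assumes "j < d" "f \<in> M \<rightarrow>\<^sub>M lebesgue_d d"
  shows "(\<lambda>x. f x j) \<in> borel_measurable M"
proof -
  have "(\<lambda>x. x j) \<in> lebesgue_d d \<rightarrow>\<^sub>M lborel"
    unfolding lebesgue_d_def using assms(1) by (intro measurable_component_singleton) auto
  from measurable_compose[OF assms(2) this] show ?thesis by simp
qed

text \<open>The Leibniz formula shows that the determinant is a polynomial in the entries.\<close>

lemma nondeg_measurable [measurable]: "Measurable.pred (mat_space d) (nondeg d)"
proof -
  have m: "(\<lambda>X. X i j) \<in> borel_measurable (mat_space d)" if "i < Suc d" "j < d" for i j
    by (rule measurable_entry[OF that measurable_ident_sets[OF refl]])
  have pm: "p i < d" if "p permutes {0..<d}" "i < d" for p i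
    using permutes_in_image[OF that(1), of i] that(2) by simp
  have "Determinant.det (Matrix.mat d d (\<lambda>(j, i). X (Suc i) j - X 0 j))
     = (\<Sum>p | p permutes {0..<d}. of_int (sign p) * (\<Prod>i = 0..<d. X (Suc (p i)) i - X 0 i))" for X :: "nat \<Rightarrow> nat \<Rightarrow> real"
    unfolding Determinant.det_def by (auto intro!: sum.cong prod.cong simp: pm)
  moreover have "(\<lambda>X. \<Sum>p | p permutes {0..<d}. of_int (sign p) * (\<Prod>i = 0..<d. X (Suc (p i)) i - X 0 i)) \<in> borel_measurable (mat_space d)"
    by (intro borel_measurable_sum borel_measurable_times borel_measurable_const borel_measurable_prod borel_measurable_diff m) (auto simp: pm)
  ultimately have "(\<lambda>X. Determinant.det (Matrix.mat d d (\<lambda>(j, i). X (Suc i) j - X 0 j))) \<in> borel_measurable (mat_space d)"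
    by simp
  then show ?thesis unfolding nondeg_def[abs_def] by measurable
qed

lemma measurable_lincomb [measurable (raw)]:
  assumes "X \<in> M \<rightarrow>\<^sub>M mat_space d" "l \<in> M \<rightarrow>\<^sub>M lebesgue_d d"
  shows "(\<lambda>x. lincomb d (X x) (l x)) \<in> M \<rightarrow>\<^sub>M lebesgue_d d"
  unfolding lincomb_def lebesgue_d_def
proof (rule measurable_restrict)
  fix j assume j: "j \<in> {..<d}"
  have "(\<lambda>x. \<Sum>i<Suc d. zero_sum_ext d (l x) i * X x i j) = (\<lambda>x. \<Sum>i<d. l x i * (X x (Suc i) j - X x 0 j))"
    by (simp only: sum_ext_eq)
  also have "\<dots> \<in> borel_measurable M"
    using j by (intro borel_measurable_sum borel_measurable_times borel_measurable_diff measurable_entry[OF _ _ assms(1)] measurable_coord[OF _ assms(2)]) auto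
  finally show "(\<lambda>x. \<Sum>i<Suc d. zero_sum_ext d (l x) i * X x i j) \<in> M \<rightarrow>\<^sub>M lborel" by simp
qed

lemma inv_measure_lebesgue_d:
  "inv_measure (lebesgue_d d) (\<lambda>x y. \<lambda>i\<in>{..<d}. x i + y i) (\<lambda>x. \<lambda>i\<in>{..<d}. - x i)"
  unfolding lebesgue_d_def by (rule inv_measure_PiM[OF inv_measure_lborel]) simp

lemma inv_measure_mat_space:
  "inv_measure (mat_space d) (\<lambda>X Y. \<lambda>i\<in>{..<Suc d}. \<lambda>j\<in>{..<d}. X i j + Y i j) (\<lambda>X. \<lambda>i\<in>{..<Suc d}. \<lambda>j\<in>{..<d}. - X i j)"
  by (rule inv_measure_PiM[OF inv_measure_lebesgue_d]) simp

text \<open>Shifting by \<open>t\<close> times the identity makes a square matrix singular for finitely many \<open>t\<close> only.\<close>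

lemma AE_nondeg: "AE X in mat_space d. nondeg d X"
proof -
  interpret inv_measure "mat_space d" "\<lambda>X Y. \<lambda>i\<in>{..<Suc d}. \<lambda>j\<in>{..<d}. X i j + Y i j" "\<lambda>X. \<lambda>i\<in>{..<Suc d}. \<lambda>j\<in>{..<d}. - X i j"
    by (rule inv_measure_mat_space)
  let ?A = "{X\<in>space (mat_space d). \<not> nondeg d X}"
  \<comment> \<open>Only coordinate \<open>j\<close> of point \<open>Suc j\<close> is shifted, so
    point 0 stays fixed and the matrix of edges changes by exactly \<open>t\<close> times the
    identity.\<close>
  define \<phi> :: "real \<Rightarrow> nat \<Rightarrow> nat \<Rightarrow> real" where "\<phi> = (\<lambda>t. \<lambda>i\<in>{..<Suc d}. \<lambda>j\<in>{..<d}. if i = Suc j then t else 0)"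
  have "emeasure (mat_space d) ?A = 0"
  proof (rule null_set_by_translates)
    show "?A \<in> sets (mat_space d)" by measurable
    show "\<phi> \<in> borel \<rightarrow>\<^sub>M mat_space d" unfolding \<phi>_def lebesgue_d_def
      by (intro measurable_restrict) (auto intro!: measurable_If)
    fix X assume "X \<in> space (mat_space d)"
    have eq: "Matrix.mat d d (\<lambda>(j, i). (\<lambda>i\<in>{..<Suc d}. \<lambda>j\<in>{..<d}. \<phi> t i j + X i j) (Suc i) j - (\<lambda>i\<in>{..<Suc d}. \<lambda>j\<in>{..<d}. \<phi> t i j + X i j) 0 j)
       = Matrix.mat d d (\<lambda>(i, j). (X (Suc j) i - X 0 i) + (if i = j then t else 0))" for t
      by (rule eq_matI) (auto simp: \<phi>_def)
    have "{t. (\<lambda>i\<in>{..<Suc d}. \<lambda>j\<in>{..<d}. \<phi> t i j + X i j) \<in> ?A} \<subseteq> {t. Determinant.det (Matrix.mat d d (\<lambda>(i, j). (X (Suc j) i - X 0 i) + (if i = j then t else 0))) = 0}"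
      by (rule subsetI) (simp only: nondeg_def mem_Collect_eq not_not eq)
    then show "countable {t. (\<lambda>i\<in>{..<Suc d}. \<lambda>j\<in>{..<d}. \<phi> t i j + X i j) \<in> ?A}"
      using finite_singular_shifts[of d "\<lambda>i j. X (Suc j) i - X 0 i"] by (meson countable_finite finite_subset)
  qed
  then show ?thesis by (intro AE_I[of _ _ ?A]) auto
qed

text \<open>Every line parallel to the axis \<open>j0\<close> meets the hyperplane in one point
  because \<open>w j0 \<noteq> 0\<close>.\<close>

lemma hyperplane_null:
  assumes "j0 < d" "w j0 \<noteq> 0"
  shows "emeasure (lebesgue_d d) {v\<in>space (lebesgue_d d). (\<Sum>j<d. w j * v j) = c} = 0"
proof -
  interpret inv_measure "lebesgue_d d" "\<lambda>x y. \<lambda>i\<in>{..<d}. x i + y i" "\<lambda>x. \<lambda>i\<in>{..<d}. - x i"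
    by (rule inv_measure_lebesgue_d)
  let ?A = "{v\<in>space (lebesgue_d d). (\<Sum>j<d. w j * v j) = c}"
  define \<phi> :: "real \<Rightarrow> nat \<Rightarrow> real" where "\<phi> = (\<lambda>t. \<lambda>j\<in>{..<d}. if j = j0 then t else 0)"
  show ?thesis
  proof (rule null_set_by_translates)
    have "(\<lambda>v. \<Sum>j<d. w j * v j) \<in> borel_measurable (lebesgue_d d)"
      by (intro borel_measurable_sum borel_measurable_times borel_measurable_const measurable_coord[OF _ measurable_ident_sets[OF refl]]) auto
    then show "?A \<in> sets (lebesgue_d d)" by measurable
    show "\<phi> \<in> borel \<rightarrow>\<^sub>M lebesgue_d d" unfolding \<phi>_def lebesgue_d_def
      by (intro measurable_restrict) (auto intro!: measurable_If)
    fix x assume "x \<in> space (lebesgue_d d)"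
    have e: "(\<Sum>j<d. w j * (\<lambda>i\<in>{..<d}. \<phi> t i + x i) j) = w j0 * t + (\<Sum>j<d. w j * x j)" for t
    proof -
      have "(\<Sum>j<d. w j * (\<lambda>i\<in>{..<d}. \<phi> t i + x i) j) = (\<Sum>j<d. (if j = j0 then w j * t else 0) + w j * x j)"
        by (intro sum.cong) (auto simp: \<phi>_def algebra_simps)
      then show ?thesis using assms by (simp add: sum.distrib)
    qed
    have "{t. (\<lambda>i\<in>{..<d}. \<phi> t i + x i) \<in> ?A} \<subseteq> {(c - (\<Sum>j<d. w j * x j)) / w j0}"
      unfolding mem_Collect_eq e using assms by (auto simp: field_simps)
    then show "countable {t. (\<lambda>i\<in>{..<d}. \<phi> t i + x i) \<in> ?A}" by (meson countable_subset countable_insert countable_empty)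
  qed
qed

section \<open>Tangent cones and angles as quotients of cone volumes\<close>

text \<open>Entry \<open>l i\<close> is the coefficient of point \<open>Suc i\<close>, so
  \<open>k \<le> Suc i\<close> selects the points off the face \<open>{..<k}\<close>; coefficients
  of points on the face may have any sign. For \<open>k \<ge> 1\<close> the implicit coefficient of
  point 0 belongs to the face, and for \<open>k = Suc d\<close> the cone is the whole space.\<close>

definition cone_set :: "nat \<Rightarrow> nat \<Rightarrow> (nat \<Rightarrow> real) set" where
  "cone_set d k = {l\<in>space (lebesgue_d d). \<forall>i<d. k \<le> Suc i \<longrightarrow> 0 \<le> l i}"

text \<open>The part of the tangent cone in the unit ball, measured by its coefficients. For a
  nondegenerate simplex it differs from the volume in the ambient space by a factor common to all
  \<open>k\<close>.\<close>

definition cone_vol :: "nat \<Rightarrow> nat \<Rightarrow> (nat \<Rightarrow> nat \<Rightarrow> real) \<Rightarrow> ennreal" where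
  "cone_vol d k X = (\<integral>\<^sup>+l. indicator (cone_set d k) l * indicator {v. eucl_norm d v < 1} (lincomb d X l) \<partial>lebesgue_d d)"

lemma measurable_coord_id: "j < d \<Longrightarrow> (\<lambda>x. x j) \<in> borel_measurable (lebesgue_d d)"
  by (rule measurable_coord[OF _ measurable_ident_sets[OF refl]])

lemma eucl_norm_measurable [measurable (raw)]:
  assumes "f \<in> M \<rightarrow>\<^sub>M lebesgue_d d"
  shows "(\<lambda>x. eucl_norm d (f x)) \<in> borel_measurable M"
proof -
  have [measurable]: "(\<lambda>x. \<Sum>i<d. (f x i)\<^sup>2) \<in> borel_measurable M"
    by (intro borel_measurable_sum borel_measurable_power measurable_coord[OF _ assms]) auto
  show ?thesis unfolding eucl_norm_def by measurable
qed

lemma cone_set_measurable [measurable]: "cone_set d k \<in> sets (lebesgue_d d)"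
proof -
  have "cone_set d k = {l\<in>space (lebesgue_d d). \<forall>i\<in>{i. i < d \<and> k \<le> Suc i}. 0 \<le> l i}"
    by (auto simp: cone_set_def)
  also have "\<dots> \<in> sets (lebesgue_d d)" 
  proof (rule sets.sets_Collect_finite_All)
    fix i assume "i \<in> {i. i < d \<and> k \<le> Suc i}"
    then have [measurable]: "(\<lambda>x. x i) \<in> borel_measurable (lebesgue_d d)" by (intro measurable_coord_id) simp
    show "{l\<in>space (lebesgue_d d). 0 \<le> l i} \<in> sets (lebesgue_d d)" by measurable
  qed simp
  finally show ?thesis .
qed

lemma cone_set_full: "Suc d \<le> k \<Longrightarrow> cone_set d k = space (lebesgue_d d)"
  by (auto simp: cone_set_def)

lemma eucl_norm_cong: "(\<And>j. j < d \<Longrightarrow> x j = y j) \<Longrightarrow> eucl_norm d x = eucl_norm d y"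
  unfolding eucl_norm_def by (intro arg_cong[where f = sqrt] sum.cong) auto

lemma eucl_norm_scale: "r \<ge> 0 \<Longrightarrow> eucl_norm d (\<lambda>j. r * x j) = r * eucl_norm d x"
  unfolding eucl_norm_def by (simp add: power_mult_distrib sum_distrib_left[symmetric] real_sqrt_mult)

lemma abs_le_eucl_norm: "j < d \<Longrightarrow> \<bar>x j\<bar> \<le> eucl_norm d x"
proof -
  assume "j < d"
  then have "(x j)\<^sup>2 \<le> (\<Sum>i<d. (x i)\<^sup>2)" by (intro member_le_sum) auto
  then show ?thesis unfolding eucl_norm_def using real_sqrt_le_mono[of "(x j)\<^sup>2"] by simp
qed

lemma eucl_norm_nonneg: "eucl_norm d x \<ge> 0"
  by (simp add: eucl_norm_def sum_nonneg)

lemma emeasure_unit_ball: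
  "emeasure (lebesgue_d d) {v\<in>space (lebesgue_d d). eucl_norm d v < 1} \<noteq> 0"
  "emeasure (lebesgue_d d) {v\<in>space (lebesgue_d d). eucl_norm d v < 1} \<noteq> \<infinity>"
proof -
  interpret P: product_sigma_finite "\<lambda>_::nat. lborel :: real measure" ..
  let ?B = "{v\<in>space (lebesgue_d d). eucl_norm d v < 1}"
  \<comment> \<open>The denominator \<open>d + 1\<close> keeps the inner cube inside the open ball,
    also in dimension 0.\<close>
  let ?S = "Pi\<^sub>E {..<d} (\<lambda>_. {0..1 / (real d + 1)})" and ?L = "Pi\<^sub>E {..<d} (\<lambda>_. {-1..1::real})"
  have "?S \<subseteq> ?B"
  proof
    fix v assume v: "v \<in> ?S"
    have "(\<Sum>i<d. (v i)\<^sup>2) \<le> (\<Sum>i<d. (1 / (real d + 1))\<^sup>2)" 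
    proof (rule sum_mono)
      fix i assume "i \<in> {..<d}"
      then have "v i \<in> {0..1 / (real d + 1)}" using v by (rule PiE_mem[rotated])
      then show "(v i)\<^sup>2 \<le> (1 / (real d + 1))\<^sup>2" by (intro power_mono) simp_all
    qed
    also have "\<dots> = real d / (real d + 1)\<^sup>2" by (simp add: power_divide)
    also have "\<dots> < 1"
    proof -
      have "real d < (real d + 1) * 1" by simp
      also have "\<dots> \<le> (real d + 1) * (real d + 1)" by (intro mult_left_mono) auto
      finally have "real d < (real d + 1)\<^sup>2" by (simp only: power2_eq_square)
      then show ?thesis by (subst divide_less_eq_1_pos) auto
    qed
    finally show "v \<in> ?B" using v by (auto simp: eucl_norm_def space_lebesgue_d PiE_iff)
  qed
  moreover have "?S \<in> sets (lebesgue_d d)" unfolding lebesgue_d_def by (intro sets_PiM_I_finite) auto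
  ultimately have "emeasure (lebesgue_d d) ?S \<le> emeasure (lebesgue_d d) ?B" by (intro emeasure_mono) auto
  moreover have "emeasure (lebesgue_d d) ?S = ennreal (1 / (real d + 1)) ^ d"
    unfolding lebesgue_d_def by (subst P.emeasure_PiM) auto
  moreover have "ennreal (1 / (real d + 1)) ^ d \<noteq> 0" by (simp add: ennreal_eq_0_iff not_le add_nonneg_pos)
  ultimately show "emeasure (lebesgue_d d) ?B \<noteq> 0" by (metis le_zero_eq)
  have "?B \<subseteq> ?L"
  proof
    fix v assume v: "v \<in> ?B"
    show "v \<in> ?L"
    proof (rule PiE_I)
      fix j assume "j \<in> {..<d}"
      then show "v j \<in> {-1..1}" using abs_le_eucl_norm[of j d v] v by auto
    qed (use v in \<open>auto simp: space_lebesgue_d PiE_iff extensional_def\<close>)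
  qed
  moreover have "?L \<in> sets (lebesgue_d d)" unfolding lebesgue_d_def by (intro sets_PiM_I_finite) auto
  ultimately have "emeasure (lebesgue_d d) ?B \<le> emeasure (lebesgue_d d) ?L" by (intro emeasure_mono) auto
  also have "\<dots> = ennreal 2 ^ d"
    unfolding lebesgue_d_def by (subst P.emeasure_PiM) auto
  also have "\<dots> < \<infinity>" by (simp add: ennreal_power power_less_top_ennreal)
  finally show "emeasure (lebesgue_d d) ?B \<noteq> \<infinity>" by simp
qed

lemma sum_zero_lincomb:
  assumes "(\<Sum>i<Suc d. c i) = 0"
  defines "l \<equiv> (\<lambda>i\<in>{..<d}. c (Suc i))"
  shows "\<And>i. i < Suc d \<Longrightarrow> zero_sum_ext d l i = c i" "lincomb d X l = (\<lambda>j\<in>{..<d}. \<Sum>i<Suc d. c i * X i j)" "l \<in> space (lebesgue_d d)"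
proof -
  have "c 0 + (\<Sum>i<d. c (Suc i)) = 0" using assms(1) by (subst (asm) sum.lessThan_Suc_shift) simp
  then have e: "zero_sum_ext d l i = c i" if "i < Suc d" for i
    using that by (cases i) (auto simp: l_def)
  then show "\<And>i. i < Suc d \<Longrightarrow> zero_sum_ext d l i = c i" .
  show "lincomb d X l = (\<lambda>j\<in>{..<d}. \<Sum>i<Suc d. c i * X i j)" unfolding lincomb_def
    by (intro restrict_ext sum.cong) (auto simp: e)
  show "l \<in> space (lebesgue_d d)" by (simp add: l_def space_lebesgue_d)
qed

text \<open>\<open>B\<close> is the inverse of the matrix of edges; fixing it turns the coefficients
  of a vector into a linear function \<open>S\<close>.\<close>

locale nondeg_simplex =
  fixes d :: nat and X :: "nat \<Rightarrow> nat \<Rightarrow> real" and B :: "nat \<Rightarrow> nat \<Rightarrow> real"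
  assumes X: "X \<in> space (mat_space d)"
    and BX: "\<And>l. l \<in> space (lebesgue_d d) \<Longrightarrow> (\<lambda>i\<in>{..<d}. \<Sum>j<d. B i j * lincomb d X l j) = l"
    and XB: "\<And>v. v \<in> space (lebesgue_d d) \<Longrightarrow> lincomb d X (\<lambda>i\<in>{..<d}. \<Sum>j<d. B i j * v j) = v"
begin

definition S :: "(nat \<Rightarrow> real) \<Rightarrow> nat \<Rightarrow> real" where "S v = (\<lambda>i\<in>{..<d}. \<Sum>j<d. B i j * v j)"

lemma S_closed: "S v \<in> space (lebesgue_d d)"
  by (simp add: S_def space_lebesgue_d)

lemma S_restrict: "S (\<lambda>j\<in>{..<d}. v j) = S v"
  unfolding S_def by (intro restrict_ext sum.cong) auto

lemma S_measurable: "S \<in> lebesgue_d d \<rightarrow>\<^sub>M lebesgue_d d"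
proof -
  have "(\<lambda>v. \<Sum>j<d. B i j * v j) \<in> lebesgue_d d \<rightarrow>\<^sub>M lborel" for i
    by (simp, intro borel_measurable_sum borel_measurable_times borel_measurable_const measurable_coord_id) simp
  then show ?thesis unfolding S_def[abs_def] by (subst (2) lebesgue_d_def) (intro measurable_restrict)
qed

lemma X_undefined: "i < Suc d \<Longrightarrow> \<not> j < d \<Longrightarrow> X i j = undefined"
  using X by (auto simp: space_PiM space_lebesgue_d PiE_iff extensional_def)

lemma coeff_bound: "\<exists>K>0. \<forall>v. \<forall>i<Suc d. \<bar>zero_sum_ext d (S v) i\<bar> \<le> K * eucl_norm d v"
proof -
  define b where "b = (\<lambda>i. \<Sum>j<d. \<bar>B i j\<bar>)"
  define K where "K = 1 + (\<Sum>i<d. b i)"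
  have b: "b i \<ge> 0" for i by (simp add: b_def sum_nonneg)
  have K: "K > 0" unfolding K_def using b by (intro add_pos_nonneg sum_nonneg) auto
  have S: "\<bar>S v i\<bar> \<le> b i * eucl_norm d v" if "i < d" for v i
  proof -
    have "\<bar>S v i\<bar> \<le> (\<Sum>j<d. \<bar>B i j * v j\<bar>)" using that by (simp add: S_def sum_abs)
    also have "\<dots> \<le> (\<Sum>j<d. \<bar>B i j\<bar> * eucl_norm d v)"
      by (intro sum_mono) (auto simp: abs_mult intro!: mult_left_mono abs_le_eucl_norm)
    finally show ?thesis by (simp add: b_def sum_distrib_right)
  qed
  have "\<bar>zero_sum_ext d (S v) i\<bar> \<le> K * eucl_norm d v" if i: "i < Suc d" for v i
  proof (cases i)
    case 0
    have "\<bar>zero_sum_ext d (S v) i\<bar> \<le> (\<Sum>j<d. \<bar>S v j\<bar>)" using 0 by (simp add: sum_abs)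
    also have "\<dots> \<le> (\<Sum>j<d. b j * eucl_norm d v)" by (intro sum_mono S) auto
    also have "\<dots> = (\<Sum>j<d. b j) * eucl_norm d v" by (simp add: sum_distrib_right)
    also have "\<dots> \<le> K * eucl_norm d v" by (intro mult_right_mono eucl_norm_nonneg) (simp add: K_def)
    finally show ?thesis .
  next
    case (Suc j)
    then have j: "j < d" using i by simp
    have "b j \<le> (\<Sum>i<d. b i)" using j b by (intro member_le_sum) auto
    then have "b j * eucl_norm d v \<le> K * eucl_norm d v" by (intro mult_right_mono eucl_norm_nonneg) (simp add: K_def)
    then show ?thesis using S[OF j, of v] Suc by simp
  qed
  with K show ?thesis by blast
qed

text \<open>Differences of affine combinations are zero-sum combinations, so this is how barycentric
  coefficients of two points are compared below.\<close>

lemma coeff_unique: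
  assumes "(\<Sum>i<Suc d. c i) = 0" "\<And>j. j < d \<Longrightarrow> (\<Sum>i<Suc d. c i * X i j) = v j" "i < Suc d"
  shows "c i = zero_sum_ext d (S v) i"
proof -
  let ?l = "\<lambda>i\<in>{..<d}. c (Suc i)"
  note sz = sum_zero_lincomb[OF assms(1)]
  have "lincomb d X ?l = (\<lambda>j\<in>{..<d}. v j)" unfolding sz(2) by (intro restrict_ext assms(2)) simp
  then have "S v = ?l" unfolding S_def using BX[OF sz(3)] by (auto simp: fun_eq_iff)
  then show ?thesis using sz(1)[OF assms(3)] by simp
qed

lemma coeff_lincomb:
  assumes "j < d"
  shows "(\<Sum>i<Suc d. zero_sum_ext d (S v) i * X i j) = v j"
proof -
  have "lincomb d X (S v) = lincomb d X (S (\<lambda>j\<in>{..<d}. v j))" by (simp only: S_restrict)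
  also have "\<dots> = (\<lambda>j\<in>{..<d}. v j)" using XB[of "\<lambda>j\<in>{..<d}. v j"] by (simp add: S_def space_lebesgue_d)
  finally have "lincomb d X (S v) j = v j" using assms by simp
  then show ?thesis using assms by (simp add: lincomb_def)
qed

text \<open>The barycentre of the face is an interior point: within distance
  \<open>1 / (k * K)\<close> of it no coefficient can drop by as much as \<open>1 / k\<close>. It
  guarantees that the \<open>SOME\<close> in \<open>internal_angle\<close> finds a point.\<close>

lemma relint_pts_nonempty:
  assumes k: "1 \<le> k" "k \<le> Suc d"
  shows "relint_pts d X {..<k} \<noteq> {}"
proof -
  obtain K where K: "K > 0" "\<And>v i. i < Suc d \<Longrightarrow> \<bar>zero_sum_ext d (S v) i\<bar> \<le> K * eucl_norm d v" using coeff_bound by blast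
  define z where "z = (\<lambda>j. \<Sum>i<k. (1 / real k) * X i j)"
  have "z \<in> relint_pts d X {..<k}" unfolding relint_pts_def
  proof (safe intro!: exI[of _ "1 / (real k * K)"])
    show "z \<in> conv_pts X {..<k}" unfolding conv_pts_def z_def using k by (intro CollectI exI[of _ "\<lambda>_. 1 / real k"]) auto
    show "0 < 1 / (real k * K)" using k K by simp
    fix y assume y: "y \<in> aff_pts X {..<k}" "eucl_norm d (\<lambda>j. y j - z j) < 1 / (real k * K)"
    then obtain m where m: "(\<Sum>i<k. m i) = 1" "y = (\<lambda>j. \<Sum>i<k. m i * X i j)" by (auto simp: aff_pts_def)
    define c where "c = (\<lambda>i. if i < k then m i - 1 / real k else 0)"
    have sub: "{..<Suc d} \<inter> {..<k} = {..<k}" using k by auto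
    have c0: "(\<Sum>i<Suc d. c i) = 0"
    proof -
      have "(\<Sum>i<Suc d. c i) = (\<Sum>i\<in>{..<Suc d} \<inter> {..<k}. m i - 1 / real k)"
        unfolding c_def by (subst sum.inter_restrict) (auto intro!: sum.cong)
      also have "\<dots> = 0" using k m(1) unfolding sub by (simp add: sum_subtractf)
      finally show ?thesis .
    qed
    have cX: "(\<Sum>i<Suc d. c i * X i j) = y j - z j" for j
    proof -
      have "(\<Sum>i<Suc d. c i * X i j) = (\<Sum>i\<in>{..<Suc d} \<inter> {..<k}. (m i - 1 / real k) * X i j)"
        unfolding c_def by (subst sum.inter_restrict) (auto intro!: sum.cong)
      also have "\<dots> = y j - z j" unfolding sub m(2) z_def by (simp add: sum_subtractf left_diff_distrib)
      finally show ?thesis .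
    qed
    have "m i \<ge> 0" if "i < k" for i
    proof -
      have "c i = zero_sum_ext d (S (\<lambda>j. y j - z j)) i" using c0 cX that k by (intro coeff_unique) auto
      then have "\<bar>c i\<bar> \<le> K * eucl_norm d (\<lambda>j. y j - z j)" using K(2)[of i "\<lambda>j. y j - z j"] that k by simp
      also have "\<dots> < K * (1 / (real k * K))" using y(2) K(1) by (intro mult_strict_left_mono)
      also have "\<dots> = 1 / real k" using K(1) by simp
      finally show ?thesis using that by (simp add: c_def)
    qed
    then show "y \<in> conv_pts X {..<k}" unfolding conv_pts_def using m by auto
  qed
  then show ?thesis by auto
qed

text \<open>If the coefficient of \<open>i0\<close> vanished, a small step along
  \<open>X i1 - X i0\<close> would stay in the affine hull while making that coefficient negative.
  By uniqueness of coefficients the new point would lie outside the face, contradicting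
  interiority.\<close>

lemma relint_pts_pos:
  assumes k: "1 \<le> k" "k \<le> Suc d" and z: "z \<in> relint_pts d X {..<k}"
  obtains L where "\<And>i. i < k \<Longrightarrow> L i > 0" "(\<Sum>i<k. L i) = 1" "z = (\<lambda>j. \<Sum>i<k. L i * X i j)"
proof -
  from z have "z \<in> conv_pts X {..<k}"
    and "\<exists>e>0. \<forall>y\<in>aff_pts X {..<k}. eucl_norm d (\<lambda>j. y j - z j) < e \<longrightarrow> y \<in> conv_pts X {..<k}"
    unfolding relint_pts_def by auto
  then obtain L e where L: "\<And>i. i < k \<Longrightarrow> L i \<ge> 0" "(\<Sum>i<k. L i) = 1" "z = (\<lambda>j. \<Sum>i<k. L i * X i j)"
    and e: "e > 0" "\<And>y. y \<in> aff_pts X {..<k} \<Longrightarrow> eucl_norm d (\<lambda>j. y j - z j) < e \<Longrightarrow> y \<in> conv_pts X {..<k}"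
    unfolding conv_pts_def by blast
  have "L i0 > 0" if i0: "i0 < k" for i0
  proof (rule ccontr)
    assume "\<not> L i0 > 0"
    with L(1)[OF i0] have L0: "L i0 = 0" by simp
    have "\<exists>i<k. L i \<noteq> 0" using L(2) by (metis sum.neutral lessThan_iff zero_neq_one)
    then obtain i1 where i1: "i1 < k" "L i1 \<noteq> 0" by auto
    with L0 have ne: "i1 \<noteq> i0" by auto
    define u where "u = (\<lambda>j. X i1 j - X i0 j)"
    \<comment> \<open>The step length \<open>t * eucl_norm d u\<close> stays below \<open>e\<close>;
      adding 1 in the denominator keeps the quotient defined when the norm is 0.\<close>
    define t where "t = e / (2 * (1 + eucl_norm d u))"
    have un: "1 + eucl_norm d u > 0" using eucl_norm_nonneg[of d u] by simp
    have t: "t > 0" using e(1) un by (simp add: t_def)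
    define m where "m = (\<lambda>i. L i + (if i = i1 then t else 0) - (if i = i0 then t else 0))"
    define y where "y = (\<lambda>j. \<Sum>i<k. m i * X i j)"
    have sm: "(\<Sum>i<k. m i) = 1" unfolding m_def using L(2) i0 i1 by (simp add: sum_subtractf sum.distrib)
    have yz: "y j - z j = t * u j" for j
    proof -
      have "y j = (\<Sum>i<k. L i * X i j + (if i = i1 then t * X i j else 0) - (if i = i0 then t * X i j else 0))"
        unfolding y_def m_def by (intro sum.cong) (auto simp: algebra_simps)
      also have "\<dots> = z j + t * X i1 j - t * X i0 j" using i0 i1 L(3) by (simp add: sum_subtractf sum.distrib)
      finally show ?thesis by (simp add: u_def algebra_simps)
    qed
    have "eucl_norm d (\<lambda>j. y j - z j) = t * eucl_norm d u" unfolding yz using t by (intro eucl_norm_scale) simp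
    also have "\<dots> < t * (2 * (1 + eucl_norm d u))" using t eucl_norm_nonneg[of d u] by (intro mult_strict_left_mono) auto
    also have "\<dots> = e" using un by (simp add: t_def)
    finally have ny: "eucl_norm d (\<lambda>j. y j - z j) < e" .
    have "y \<in> aff_pts X {..<k}" unfolding aff_pts_def y_def using sm by blast
    then have "y \<in> conv_pts X {..<k}" using ny by (rule e(2))
    then obtain m' where m': "\<And>i. i < k \<Longrightarrow> m' i \<ge> 0" "(\<Sum>i<k. m' i) = 1" "y = (\<lambda>j. \<Sum>i<k. m' i * X i j)"
      unfolding conv_pts_def by auto
    define c where "c = (\<lambda>i. if i < k then m' i - m i else 0)"
    have sub: "{..<Suc d} \<inter> {..<k} = {..<k}" using k by auto
    have c0: "(\<Sum>i<Suc d. c i) = 0"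
    proof -
      have "(\<Sum>i<Suc d. c i) = (\<Sum>i\<in>{..<Suc d} \<inter> {..<k}. m' i - m i)"
        unfolding c_def by (subst sum.inter_restrict) (auto intro!: sum.cong)
      then show ?thesis using sm m'(2) unfolding sub by (simp add: sum_subtractf)
    qed
    have cX: "(\<Sum>i<Suc d. c i * X i j) = 0" for j
    proof -
      have "(\<Sum>i<Suc d. c i * X i j) = (\<Sum>i\<in>{..<Suc d} \<inter> {..<k}. (m' i - m i) * X i j)"
        unfolding c_def by (subst sum.inter_restrict) (auto intro!: sum.cong)
      also have "\<dots> = y j - y j" unfolding sub by (subst (1) m'(3), subst y_def) (simp add: sum_subtractf left_diff_distrib)
      finally show ?thesis by simp
    qed
    have "c i0 = zero_sum_ext d (S (\<lambda>_. 0)) i0" using c0 cX i0 k by (intro coeff_unique) auto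
    also have "\<dots> = 0" by (cases i0) (use i0 k in \<open>auto simp: S_def\<close>)
    finally have "m' i0 = m i0" using i0 by (simp add: c_def)
    moreover have "m i0 = - t" using L0 ne by (simp add: m_def)
    ultimately show False using m'(1)[OF i0] t by simp
  qed
  then show ?thesis using L by (intro that) auto
qed

text \<open>Near a relatively interior point the constraints for the points on the face are
  inactive: their coefficients are at least \<open>mn\<close> and change by at most
  \<open>K * r\<close>. Only the signs of the other coefficients decide membership, and these cut
  out a cone.\<close>

lemma local_cone:
  assumes k: "1 \<le> k" "k \<le> Suc d" and z: "z \<in> relint_pts d X {..<k}"
  shows "\<exists>r0>0. \<forall>r<r0. ball_d d z r \<inter> conv_pts X {..<Suc d} = {y\<in>ball_d d z r. S (\<lambda>j. y j - z j) \<in> cone_set d k}"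
proof -
  obtain K where K: "K > 0" "\<And>v i. i < Suc d \<Longrightarrow> \<bar>zero_sum_ext d (S v) i\<bar> \<le> K * eucl_norm d v" using coeff_bound by blast
  obtain L where L: "\<And>i. i < k \<Longrightarrow> L i > 0" "(\<Sum>i<k. L i) = 1" "z = (\<lambda>j. \<Sum>i<k. L i * X i j)"
    using relint_pts_pos[OF k z] by blast
  define L' where "L' = (\<lambda>i. if i < k then L i else 0)"
  have sub: "{..<Suc d} \<inter> {..<k} = {..<k}" using k by auto
  have L'1: "(\<Sum>i<Suc d. L' i) = 1"
  proof -
    have "(\<Sum>i<Suc d. L' i) = (\<Sum>i\<in>{..<Suc d} \<inter> {..<k}. L i)"
      unfolding L'_def by (subst sum.inter_restrict) (auto intro!: sum.cong)
    then show ?thesis using L(2) sub by simp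
  qed
  have L'X: "(\<Sum>i<Suc d. L' i * X i j) = z j" for j
  proof -
    have "(\<Sum>i<Suc d. L' i * X i j) = (\<Sum>i\<in>{..<Suc d} \<inter> {..<k}. L i * X i j)"
      unfolding L'_def by (subst sum.inter_restrict) (auto intro!: sum.cong)
    then show ?thesis using L(3) sub by simp
  qed
  \<comment> \<open>Outside \<open>{..<d}\<close> every point takes the value
    \<open>undefined\<close>, and weights with sum 1 reproduce it, so affine combinations remain
    extensional.\<close>
  have zu: "z j = undefined" if "\<not> j < d" for j
  proof -
    have "z j = (\<Sum>i<k. L i * undefined)" unfolding L(3) using that k by (intro sum.cong) (auto simp: X_undefined)
    then show ?thesis using L(2) by (simp add: sum_distrib_right[symmetric])
  qed
  define mn where "mn = Min (L ` {..<k})"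
  have mn: "mn > 0" "\<And>i. i < k \<Longrightarrow> mn \<le> L i"
    unfolding mn_def using k L(1) by (auto simp: Min_gr_iff lessThan_empty_iff)
  show ?thesis
  proof (intro exI[of _ "mn / K"] conjI allI impI)
    show "0 < mn / K" using mn K by simp
    fix r assume r: "r < mn / K"
    show "ball_d d z r \<inter> conv_pts X {..<Suc d} = {y\<in>ball_d d z r. S (\<lambda>j. y j - z j) \<in> cone_set d k}"
    proof (intro Set.set_eqI iffI)
      fix y assume "y \<in> ball_d d z r \<inter> conv_pts X {..<Suc d}"
      then obtain m where y: "y \<in> ball_d d z r" and m: "\<And>i. i < Suc d \<Longrightarrow> m i \<ge> 0" "(\<Sum>i<Suc d. m i) = 1" "y = (\<lambda>j. \<Sum>i<Suc d. m i * X i j)"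
        unfolding conv_pts_def by auto
      have e: "m i - L' i = zero_sum_ext d (S (\<lambda>j. y j - z j)) i" if "i < Suc d" for i
        using that m(2) L'1 L'X m(3) by (intro coeff_unique) (auto simp: sum_subtractf left_diff_distrib simp del: sum.lessThan_Suc)
      have "0 \<le> S (\<lambda>j. y j - z j) i" if "i < d" "k \<le> Suc i" for i
        using e[of "Suc i"] m(1)[of "Suc i"] that by (simp add: L'_def)
      then show "y \<in> {y\<in>ball_d d z r. S (\<lambda>j. y j - z j) \<in> cone_set d k}" using y S_closed by (auto simp: cone_set_def)
    next
      fix y assume "y \<in> {y\<in>ball_d d z r. S (\<lambda>j. y j - z j) \<in> cone_set d k}"
      then have y: "y \<in> ball_d d z r" and c: "\<And>i. i < d \<Longrightarrow> k \<le> Suc i \<Longrightarrow> 0 \<le> S (\<lambda>j. y j - z j) i" by (auto simp: cone_set_def)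
      define m where "m = (\<lambda>i. L' i + zero_sum_ext d (S (\<lambda>j. y j - z j)) i)"
      have "m i \<ge> 0" if i: "i < Suc d" for i
      proof (cases "i < k")
        case True
        have "\<bar>zero_sum_ext d (S (\<lambda>j. y j - z j)) i\<bar> \<le> K * eucl_norm d (\<lambda>j. y j - z j)" using i by (rule K(2))
        also have "\<dots> \<le> K * (mn / K)" using y r K(1) by (intro mult_left_mono) (auto simp: ball_d_def)
        also have "\<dots> \<le> L i" using mn(2)[OF True] K(1) by simp
        finally show ?thesis using True by (simp add: m_def L'_def)
      next
        case False
        then obtain i' where "i = Suc i'" using k by (cases i) auto
        then show ?thesis using c[of i'] False i by (simp add: m_def L'_def)
      qed
      moreover have m1: "(\<Sum>i<Suc d. m i) = 1" unfolding m_def sum.distrib L'1 sum_ext by simp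
      moreover have "y = (\<lambda>j. \<Sum>i<Suc d. m i * X i j)"
      proof
        fix j
        show "y j = (\<Sum>i<Suc d. m i * X i j)"
        proof (cases "j < d")
          case True
          have "(\<Sum>i<Suc d. m i * X i j) = (\<Sum>i<Suc d. L' i * X i j) + (\<Sum>i<Suc d. zero_sum_ext d (S (\<lambda>j. y j - z j)) i * X i j)"
            unfolding m_def by (simp only: distrib_right sum.distrib)
          then show ?thesis unfolding L'X coeff_lincomb[OF True] by simp
        next
          case False
          have "(\<Sum>i<Suc d. m i * X i j) = (\<Sum>i<Suc d. m i * undefined)" using False by (intro sum.cong) (auto simp: X_undefined)
          also have "\<dots> = undefined" using m1 by (simp add: sum_distrib_right[symmetric] del: sum.lessThan_Suc)
          finally show ?thesis using y False by (auto simp: ball_d_def PiE_iff extensional_def)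
        qed
      qed
      ultimately show "y \<in> ball_d d z r \<inter> conv_pts X {..<Suc d}" using y unfolding conv_pts_def by auto
    qed
  qed
qed


text \<open>The bijection \<open>lincomb d X\<close> is additive, so it changes Lebesgue measure by
  a constant. What matters is that \<open>c\<close> stands before the quantifier over
  \<open>k\<close>: it cancels in the angle.\<close>

lemma cone_vol_eq:
  "\<exists>c. c \<noteq> 0 \<and> c \<noteq> \<infinity> \<and> (\<forall>k. cone_vol d k X = c * emeasure (lebesgue_d d) {v\<in>space (lebesgue_d d). eucl_norm d v < 1 \<and> S v \<in> cone_set d k})"
proof -
  interpret inv_measure "lebesgue_d d" "\<lambda>x y. \<lambda>i\<in>{..<d}. x i + y i" "\<lambda>x. \<lambda>i\<in>{..<d}. - x i"
    by (rule inv_measure_lebesgue_d)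
  note [measurable] = S_measurable
  have T: "lincomb d X \<in> lebesgue_d d \<rightarrow>\<^sub>M lebesgue_d d"
    using measurable_lincomb[OF measurable_const[OF X] measurable_ident_sets[OF refl]] by simp
  have "\<exists>c. c \<noteq> 0 \<and> c \<noteq> \<infinity> \<and> (\<forall>f\<in>borel_measurable (lebesgue_d d). (\<integral>\<^sup>+x. f (lincomb d X x) \<partial>lebesgue_d d) = c * (\<integral>\<^sup>+x. f x \<partial>lebesgue_d d))"
  proof (rule additive_automorphism[OF T S_measurable])
    show "lincomb d X (\<lambda>i\<in>{..<d}. x i + y i) = (\<lambda>i\<in>{..<d}. lincomb d X x i + lincomb d X y i)" for x y
    proof -
      have e: "zero_sum_ext d (\<lambda>i\<in>{..<d}. x i + y i) i = zero_sum_ext d x i + zero_sum_ext d y i" if "i < Suc d" for i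
        using that by (cases i) (auto simp: sum.distrib)
      have "(\<Sum>i<Suc d. zero_sum_ext d (\<lambda>i\<in>{..<d}. x i + y i) i * X i j) = (\<Sum>i<Suc d. (zero_sum_ext d x i + zero_sum_ext d y i) * X i j)" for j
        by (intro sum.cong) (auto simp: e)
      then show ?thesis unfolding lincomb_def
        by (intro restrict_ext) (simp add: distrib_right sum.distrib del: sum.lessThan_Suc)
    qed
  qed (auto simp: S_def BX XB)
  then obtain c where c: "c \<noteq> 0" "c \<noteq> \<infinity>" "\<And>f. f \<in> borel_measurable (lebesgue_d d) \<Longrightarrow> (\<integral>\<^sup>+x. f (lincomb d X x) \<partial>lebesgue_d d) = c * (\<integral>\<^sup>+x. f x \<partial>lebesgue_d d)"
    by blast
  have "cone_vol d k X = c * emeasure (lebesgue_d d) {v\<in>space (lebesgue_d d). eucl_norm d v < 1 \<and> S v \<in> cone_set d k}" for k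
  proof -
    let ?A = "{v\<in>space (lebesgue_d d). eucl_norm d v < 1 \<and> S v \<in> cone_set d k}"
    have A: "?A \<in> sets (lebesgue_d d)" by measurable
    have "cone_vol d k X = (\<integral>\<^sup>+l. indicator ?A (lincomb d X l) \<partial>lebesgue_d d)"
      unfolding cone_vol_def
    proof (rule nn_integral_cong)
      fix l assume l: "l \<in> space (lebesgue_d d)"
      have "lincomb d X l \<in> space (lebesgue_d d)" using measurable_space[OF T l] .
      moreover have "S (lincomb d X l) = l" using BX[OF l] by (simp add: S_def)
      ultimately show "indicator (cone_set d k) l * indicator {v. eucl_norm d v < 1} (lincomb d X l) = (indicator ?A (lincomb d X l) :: ennreal)"
        by (auto simp: indicator_def)
    qed
    also have "\<dots> = c * (\<integral>\<^sup>+v. indicator ?A v \<partial>lebesgue_d d)" using A by (intro c(3)) measurable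
    finally show ?thesis using A by simp
  qed
  with c(1,2) show ?thesis by blast
qed

end

text \<open>Translate \<open>z\<close> to the origin and scale by \<open>r\<close>. As
  \<open>A\<close> is a cone, the radius survives only in the factor \<open>r ^ d\<close>.\<close>

lemma emeasure_local_cone:
  assumes r: "r > 0" and A [measurable]: "A \<in> sets (lebesgue_d d)"
    and cone: "\<And>t v. t > 0 \<Longrightarrow> v \<in> space (lebesgue_d d) \<Longrightarrow> (\<lambda>j\<in>{..<d}. t * v j) \<in> A \<longleftrightarrow> v \<in> A"
  shows "{y\<in>ball_d d z r. (\<lambda>j\<in>{..<d}. y j - z j) \<in> A} \<in> sets (lebesgue_d d)"
    and "emeasure (lebesgue_d d) {y\<in>ball_d d z r. (\<lambda>j\<in>{..<d}. y j - z j) \<in> A}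
     = ennreal (r ^ d) * emeasure (lebesgue_d d) {v\<in>space (lebesgue_d d). eucl_norm d v < 1 \<and> v \<in> A}"
proof -
  interpret inv_measure "lebesgue_d d" "\<lambda>x y. \<lambda>i\<in>{..<d}. x i + y i" "\<lambda>x. \<lambda>i\<in>{..<d}. - x i"
    by (rule inv_measure_lebesgue_d)
  let ?w = "\<lambda>y. \<lambda>j\<in>{..<d}. y j - z j" and ?z = "\<lambda>j\<in>{..<d}. z j"
  let ?E = "{y\<in>ball_d d z r. ?w y \<in> A}"
  have w [measurable]: "?w \<in> lebesgue_d d \<rightarrow>\<^sub>M lebesgue_d d"
  proof -
    have "(\<lambda>y. y j - z j) \<in> lebesgue_d d \<rightarrow>\<^sub>M lborel" if "j \<in> {..<d}" for j
      using that measurable_coord_id[of j d] by simp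
    then show ?thesis by (subst (2) lebesgue_d_def) (intro measurable_restrict)
  qed
  have E: "?E = {y\<in>space (lebesgue_d d). eucl_norm d (?w y) < r \<and> ?w y \<in> A}"
    by (auto simp: ball_d_def space_lebesgue_d cong: eucl_norm_cong)
  show Em: "?E \<in> sets (lebesgue_d d)" unfolding E by measurable
  have ball_set_A: "{v\<in>space (lebesgue_d d). eucl_norm d v < 1 \<and> v \<in> A} \<in> sets (lebesgue_d d)" by measurable
  have "emeasure (lebesgue_d d) ?E = (\<integral>\<^sup>+y. indicator ?E y \<partial>lebesgue_d d)" using Em by simp
  also have "\<dots> = (\<integral>\<^sup>+v. indicator ?E (\<lambda>i\<in>{..<d}. ?z i + v i) \<partial>lebesgue_d d)"
  proof (rule nn_integral_translate[OF refl pl_invariant, where a = ?z, symmetric])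
    show "?z \<in> space (lebesgue_d d)" by (simp add: space_lebesgue_d)
    show "indicator ?E \<in> borel_measurable (lebesgue_d d)" using Em by simp
  qed
  also have "\<dots> = (\<integral>\<^sup>+v. indicator {v\<in>space (lebesgue_d d). eucl_norm d v < r \<and> v \<in> A} v \<partial>lebesgue_d d)"
  proof (rule nn_integral_cong)
    fix v assume v: "v \<in> space (lebesgue_d d)"
    have "?w (\<lambda>i\<in>{..<d}. ?z i + v i) = v" using v by (auto simp: fun_eq_iff space_lebesgue_d PiE_iff extensional_def)
    moreover have "(\<lambda>i\<in>{..<d}. ?z i + v i) \<in> space (lebesgue_d d)" by (simp add: space_lebesgue_d)
    ultimately have "(\<lambda>i\<in>{..<d}. ?z i + v i) \<in> ?E \<longleftrightarrow> v \<in> {v\<in>space (lebesgue_d d). eucl_norm d v < r \<and> v \<in> A}"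
      unfolding E using v by (simp only: mem_Collect_eq)
    then show "indicator ?E (\<lambda>i\<in>{..<d}. ?z i + v i) = (indicator {v\<in>space (lebesgue_d d). eucl_norm d v < r \<and> v \<in> A} v :: ennreal)"
      by (simp only: indicator_def)
  qed
  also have "\<dots> = ennreal (r ^ (1 * card {..<d})) * (\<integral>\<^sup>+v. indicator {v\<in>space (lebesgue_d d). eucl_norm d v < r \<and> v \<in> A} (\<lambda>i\<in>{..<d}. r * v i) \<partial>lebesgue_d d)"
  proof -
    have "{v\<in>space (lebesgue_d d). eucl_norm d v < r \<and> v \<in> A} \<in> sets (lebesgue_d d)" by measurable
    then show ?thesis
      unfolding lebesgue_d_def
      by (intro PiM_homogeneous[symmetric] lborel.sigma_finite_measure_axioms r lborel_homogeneous) (auto intro: borel_measurable_indicator)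
  qed
  also have "(\<integral>\<^sup>+v. indicator {v\<in>space (lebesgue_d d). eucl_norm d v < r \<and> v \<in> A} (\<lambda>i\<in>{..<d}. r * v i) \<partial>lebesgue_d d)
    = (\<integral>\<^sup>+v. indicator {v\<in>space (lebesgue_d d). eucl_norm d v < 1 \<and> v \<in> A} v \<partial>lebesgue_d d)"
  proof (rule nn_integral_cong)
    fix v assume v: "v \<in> space (lebesgue_d d)"
    have "eucl_norm d (\<lambda>i\<in>{..<d}. r * v i) = eucl_norm d (\<lambda>i. r * v i)" by (rule eucl_norm_cong) simp
    also have "\<dots> = r * eucl_norm d v" using r by (intro eucl_norm_scale) simp
    finally have "eucl_norm d (\<lambda>i\<in>{..<d}. r * v i) < r \<longleftrightarrow> eucl_norm d v < 1" using r by simp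
    moreover have "(\<lambda>i\<in>{..<d}. r * v i) \<in> space (lebesgue_d d)" by (simp add: space_lebesgue_d)
    ultimately show "indicator {v\<in>space (lebesgue_d d). eucl_norm d v < r \<and> v \<in> A} (\<lambda>i\<in>{..<d}. r * v i) = (indicator {v\<in>space (lebesgue_d d). eucl_norm d v < 1 \<and> v \<in> A} v :: ennreal)"
      using v cone[OF r v] by (simp add: indicator_def)
  qed
  finally show "emeasure (lebesgue_d d) ?E = ennreal (r ^ d) * emeasure (lebesgue_d d) {v\<in>space (lebesgue_d d). eucl_norm d v < 1 \<and> v \<in> A}"
    using Em by (simp only: card_lessThan mult_1 nn_integral_indicator ball_set_A)
qed

context nondeg_simplex begin

text \<open>For small radii the numerator and the denominator both scale by \<open>r ^ d\<close>, so
  the quotient under the limit is eventually constant, and the Jacobian cancels from it.\<close>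

lemma internal_angle_eq:
  assumes k: "1 \<le> k" "k \<le> Suc d"
  shows "internal_angle d X {..<k} {..<Suc d} = enn2real (cone_vol d k X / cone_vol d (Suc d) X)"
    and "cone_vol d (Suc d) X \<noteq> 0" "cone_vol d (Suc d) X \<noteq> \<infinity>"
proof -
  let ?V = "lebesgue_d d"
  note [measurable] = S_measurable
  \<comment> \<open>The argument below uses only that \<open>z\<close> lies in the relative
    interior, so the value is the same for every choice.\<close>
  define z where "z = (SOME z. z \<in> relint_pts d X {..<k})"
  have "\<exists>z. z \<in> relint_pts d X {..<k}" using relint_pts_nonempty[OF k] by blast
  then have z: "z \<in> relint_pts d X {..<k}" unfolding z_def by (rule someI_ex)
  define A where "A = (\<lambda>k. {v\<in>space ?V. S v \<in> cone_set d k})"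
  have Am [measurable]: "A k \<in> sets ?V" for k unfolding A_def by measurable
  have Ac: "(\<lambda>j\<in>{..<d}. t * v j) \<in> A k \<longleftrightarrow> v \<in> A k" if "t > 0" "v \<in> space ?V" for t v k
  proof -
    have "S (\<lambda>j\<in>{..<d}. t * v j) = (\<lambda>i\<in>{..<d}. t * S v i)"
      unfolding S_def by (intro restrict_ext) (auto simp: sum_distrib_left mult_ac intro!: sum.cong)
    then have "S (\<lambda>j\<in>{..<d}. t * v j) i = t * S v i" if "i < d" for i using that by simp
    then show ?thesis using that S_closed by (auto simp: A_def cone_set_def space_lebesgue_d zero_le_mult_iff)
  qed
  define m where "m = (\<lambda>k. emeasure ?V {v\<in>space ?V. eucl_norm d v < 1 \<and> v \<in> A k})"
  have An: "A (Suc d) = space ?V" unfolding A_def using S_closed by (auto simp: cone_set_full)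
  have mn: "m (Suc d) \<noteq> 0" "m (Suc d) \<noteq> \<infinity>"
    using emeasure_unit_ball[of d] by (auto simp: m_def An cong: conj_cong)
  have mle: "m k \<le> m (Suc d)" unfolding m_def An by (intro emeasure_mono) auto
  obtain c where c: "c \<noteq> 0" "c \<noteq> \<infinity>" and cv: "\<And>k. cone_vol d k X = c * m k"
    using cone_vol_eq unfolding m_def A_def by (auto cong: conj_cong)
  show "cone_vol d (Suc d) X \<noteq> 0" "cone_vol d (Suc d) X \<noteq> \<infinity>"
    unfolding cv using c mn by (auto simp: ennreal_mult_eq_top_iff)
  have ratio: "enn2real (cone_vol d k X / cone_vol d (Suc d) X) = enn2real (m k) / enn2real (m (Suc d))"
  proof -
    obtain c' where c': "c = ennreal c'" "c' > 0" using c by (cases c) (auto simp: less_le)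
    obtain n' where n': "m (Suc d) = ennreal n'" "n' > 0" using mn by (cases "m (Suc d)") (auto simp: less_le)
    obtain k' where k': "m k = ennreal k'" "k' \<ge> 0" using mle mn by (cases "m k") (auto simp: top_unique)
    have "cone_vol d k X / cone_vol d (Suc d) X = ennreal (c' * k') / ennreal (c' * n')"
      unfolding cv c' n' k' using c' n' k' by (simp add: ennreal_mult)
    also have "\<dots> = ennreal (c' * k' / (c' * n'))" using c' n' k' by (intro divide_ennreal) auto
    also have "c' * k' / (c' * n') = k' / n'" using c' by simp
    finally show ?thesis using k' n' by simp
  qed
  obtain r0 where r0: "r0 > 0" "\<And>r. r < r0 \<Longrightarrow> ball_d d z r \<inter> conv_pts X {..<Suc d} = {y\<in>ball_d d z r. S (\<lambda>j. y j - z j) \<in> cone_set d k}"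
    using local_cone[OF k z] by blast
  have "eventually (\<lambda>r. measure ?V (ball_d d z r \<inter> conv_pts X {..<Suc d}) / measure ?V (ball_d d z r) = enn2real (m k) / enn2real (m (Suc d))) (at_right 0)"
    unfolding eventually_at_right_field
  proof (intro exI[of _ r0] conjI allI impI)
    fix r assume r: "0 < r" "r < r0"
    have S: "S (\<lambda>j\<in>{..<d}. y j - z j) = S (\<lambda>j. y j - z j)" for y by (rule S_restrict)
    have em: "emeasure ?V {y\<in>ball_d d z r. (\<lambda>j\<in>{..<d}. y j - z j) \<in> A k} = ennreal (r ^ d) * m k" for k
      unfolding m_def by (rule emeasure_local_cone(2)[OF r(1) Am Ac])
    have enn: "enn2real (ennreal (r ^ d) * u) = r ^ d * enn2real u" for u using r by (simp add: enn2real_mult)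
    have eq1: "ball_d d z r \<inter> conv_pts X {..<Suc d} = {y\<in>ball_d d z r. (\<lambda>j\<in>{..<d}. y j - z j) \<in> A k}"
      unfolding r0(2)[OF r(2)] by (auto simp: A_def S space_lebesgue_d)
    have 1: "measure ?V (ball_d d z r \<inter> conv_pts X {..<Suc d}) = r ^ d * enn2real (m k)"
      unfolding eq1 measure_def em enn ..
    have eq2: "{y\<in>ball_d d z r. (\<lambda>j\<in>{..<d}. y j - z j) \<in> A (Suc d)} = ball_d d z r"
      by (auto simp: An space_lebesgue_d)
    have 2: "measure ?V (ball_d d z r) = r ^ d * enn2real (m (Suc d))"
      using em[of "Suc d"] unfolding eq2 measure_def by (simp only: enn)
    show "measure ?V (ball_d d z r \<inter> conv_pts X {..<Suc d}) / measure ?V (ball_d d z r) = enn2real (m k) / enn2real (m (Suc d))"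
      unfolding 1 2 using r by simp
  qed (use r0 in auto)
  then have "((\<lambda>r. measure ?V (ball_d d z r \<inter> conv_pts X {..<Suc d}) / measure ?V (ball_d d z r)) \<longlongrightarrow> enn2real (m k) / enn2real (m (Suc d))) (at_right 0)"
    by (rule tendsto_eventually)
  then have "Lim (at_right 0) (\<lambda>r. measure ?V (ball_d d z r \<inter> conv_pts X {..<Suc d}) / measure ?V (ball_d d z r)) = enn2real (m k) / enn2real (m (Suc d))"
    by (intro tendsto_Lim) auto
  then show "internal_angle d X {..<k} {..<Suc d} = enn2real (cone_vol d k X / cone_vol d (Suc d) X)"
    unfolding internal_angle_def z_def[symmetric] Let_def ratio .
qed

end

text \<open>The simplex lies in a hyperplane, so the numerator is 0 for every radius. With this case
  the angle agrees with the measurable \<open>angle_ratio\<close> at every configuration, and not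
  only almost everywhere.\<close>

lemma internal_angle_degenerate:
  assumes X: "X \<in> space (mat_space d)" and nd: "\<not> nondeg d X"
  shows "internal_angle d X {..<k} {..<Suc d} = 0"
proof -
  obtain w j0 where w: "j0 < d" "w j0 \<noteq> 0" "\<And>i. i < d \<Longrightarrow> (\<Sum>j<d. w j * (X (Suc i) j - X 0 j)) = 0"
    using not_nondeg_normal[OF nd] by blast
  define c where "c = (\<Sum>j<d. w j * X 0 j)"
  have wX: "(\<Sum>j<d. w j * X i j) = c" if "i < Suc d" for i
  proof (cases i)
    case (Suc i')
    then show ?thesis using w(3)[of i'] that by (simp add: c_def right_diff_distrib sum_subtractf)
  qed (simp add: c_def)
  have ext: "X i j = undefined" if "i < Suc d" "\<not> j < d" for i j
    using X that by (auto simp: space_PiM space_lebesgue_d PiE_iff extensional_def)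
  let ?H = "{v\<in>space (lebesgue_d d). (\<Sum>j<d. w j * v j) = c}"
  have sub: "conv_pts X {..<Suc d} \<subseteq> ?H"
  proof
    fix y assume "y \<in> conv_pts X {..<Suc d}"
    then obtain l where l: "(\<Sum>i<Suc d. l i) = 1" "y = (\<lambda>j. \<Sum>i<Suc d. l i * X i j)" unfolding conv_pts_def by auto
    have "y j = undefined" if "\<not> j < d" for j
    proof -
      have "y j = (\<Sum>i<Suc d. l i * undefined)" unfolding l(2) using that by (intro sum.cong) (auto simp: ext)
      then show ?thesis using l(1) by (simp add: sum_distrib_right[symmetric] del: sum.lessThan_Suc)
    qed
    moreover have "(\<Sum>j<d. w j * y j) = c"
    proof -
      have "(\<Sum>j<d. w j * y j) = (\<Sum>j<d. \<Sum>i<Suc d. l i * (w j * X i j))"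
        unfolding l(2) by (simp add: sum_distrib_left mult_ac del: sum.lessThan_Suc)
      also have "\<dots> = (\<Sum>i<Suc d. l i * (\<Sum>j<d. w j * X i j))"
        by (subst sum.swap) (simp only: sum_distrib_left)
      also have "\<dots> = (\<Sum>i<Suc d. l i * c)" by (intro sum.cong) (auto simp: wX)
      also have "\<dots> = c" using l(1) by (simp add: sum_distrib_right[symmetric] del: sum.lessThan_Suc)
      finally show ?thesis .
    qed
    ultimately show "y \<in> ?H" by (auto simp: space_lebesgue_d PiE_iff extensional_def)
  qed
  have "(\<lambda>v. \<Sum>j<d. w j * v j) \<in> borel_measurable (lebesgue_d d)"
    by (intro borel_measurable_sum borel_measurable_times borel_measurable_const measurable_coord_id) auto
  then have Hm: "?H \<in> sets (lebesgue_d d)" by measurable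
  have H0: "emeasure (lebesgue_d d) ?H = 0" using w by (intro hyperplane_null)
  have "measure (lebesgue_d d) (C \<inter> conv_pts X {..<Suc d}) = 0" for C
  proof -
    have "emeasure (lebesgue_d d) (C \<inter> conv_pts X {..<Suc d}) \<le> emeasure (lebesgue_d d) ?H"
      using sub Hm by (intro emeasure_mono) auto
    then show ?thesis using H0 by (simp add: measure_def)
  qed
  then show ?thesis unfolding internal_angle_def Let_def by (simp add: tendsto_Lim)
qed

definition angle_ratio :: "nat \<Rightarrow> nat \<Rightarrow> (nat \<Rightarrow> nat \<Rightarrow> real) \<Rightarrow> ennreal" where
  "angle_ratio d k X = (if nondeg d X then cone_vol d k X / cone_vol d (Suc d) X else 0)"

lemma internal_angle_eq_angle_ratio:
  assumes X: "X \<in> space (mat_space d)" and k: "1 \<le> k" "k \<le> Suc d"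
  shows "internal_angle d X {..<k} {..<Suc d} = enn2real (angle_ratio d k X)"
proof (cases "nondeg d X")
  case True
  obtain B where B: "\<And>l. l \<in> space (lebesgue_d d) \<Longrightarrow> (\<lambda>i\<in>{..<d}. \<Sum>j<d. B i j * lincomb d X l j) = l"
    "\<And>v. v \<in> space (lebesgue_d d) \<Longrightarrow> lincomb d X (\<lambda>i\<in>{..<d}. \<Sum>j<d. B i j * v j) = v"
    using nondeg_inverse[OF True] by blast
  interpret nondeg_simplex d X B by (rule nondeg_simplex.intro[OF X B])
  show ?thesis using internal_angle_eq(1)[OF k] True by (simp add: angle_ratio_def)
next
  case False
  then show ?thesis using internal_angle_degenerate[OF X False] by (simp add: angle_ratio_def)
qed

lemma angle_ratio_full:
  assumes X: "X \<in> space (mat_space d)" and nd: "nondeg d X"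
  shows "angle_ratio d (Suc d) X = 1" "cone_vol d (Suc d) X \<noteq> 0" "cone_vol d (Suc d) X \<noteq> \<infinity>"
proof -
  obtain B where B: "\<And>l. l \<in> space (lebesgue_d d) \<Longrightarrow> (\<lambda>i\<in>{..<d}. \<Sum>j<d. B i j * lincomb d X l j) = l"
    "\<And>v. v \<in> space (lebesgue_d d) \<Longrightarrow> lincomb d X (\<lambda>i\<in>{..<d}. \<Sum>j<d. B i j * v j) = v"
    using nondeg_inverse[OF nd] by blast
  interpret nondeg_simplex d X B by (rule nondeg_simplex.intro[OF X B])
  show "angle_ratio d (Suc d) X = 1" "cone_vol d (Suc d) X \<noteq> 0" "cone_vol d (Suc d) X \<noteq> \<infinity>"
    using internal_angle_eq(2,3)[of 1] nd by (auto simp: angle_ratio_def ennreal_divide_self less_top)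
qed

text \<open>A finite bound ensures that \<open>enn2real\<close> loses nothing when the expectation
  is computed in \<open>ennreal\<close>.\<close>

lemma angle_ratio_le_1:
  assumes X: "X \<in> space (mat_space d)"
  shows "angle_ratio d k X \<le> 1"
proof (cases "nondeg d X")
  case True
  have "cone_vol d k X \<le> cone_vol d (Suc d) X"
    unfolding cone_vol_def by (intro nn_integral_mono mult_right_mono) (auto simp: cone_set_full indicator_def cone_set_def)
  then have "cone_vol d k X / cone_vol d (Suc d) X \<le> cone_vol d (Suc d) X / cone_vol d (Suc d) X"
    by (rule divide_right_mono_ennreal)
  also have "\<dots> = 1" using angle_ratio_full(1)[OF X True] True by (simp add: angle_ratio_def)
  finally show ?thesis using True by (simp add: angle_ratio_def)
qed (simp add: angle_ratio_def)

lemma cone_vol_measurable [measurable]: "cone_vol d k \<in> borel_measurable (mat_space d)"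
proof -
  interpret inv_measure "lebesgue_d d" "\<lambda>x y. \<lambda>i\<in>{..<d}. x i + y i" "\<lambda>x. \<lambda>i\<in>{..<d}. - x i"
    by (rule inv_measure_lebesgue_d)
  have [measurable]: "(\<lambda>p. indicator {v. eucl_norm d v < 1} (lincomb d (fst p) (snd p)) :: ennreal) \<in> borel_measurable (mat_space d \<Otimes>\<^sub>M lebesgue_d d)"
  proof -
    have "(\<lambda>p. eucl_norm d (lincomb d (fst p) (snd p))) \<in> borel_measurable (mat_space d \<Otimes>\<^sub>M lebesgue_d d)" by measurable
    then have "(\<lambda>p. indicator {..<1} (eucl_norm d (lincomb d (fst p) (snd p))) :: ennreal) \<in> borel_measurable (mat_space d \<Otimes>\<^sub>M lebesgue_d d)" by measurable
    then show ?thesis by (simp add: indicator_def)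
  qed
  show ?thesis unfolding cone_vol_def[abs_def]
    by (rule borel_measurable_nn_integral) (simp add: split_beta', measurable)
qed

lemma angle_ratio_measurable [measurable]: "angle_ratio d k \<in> borel_measurable (mat_space d)"
  unfolding angle_ratio_def[abs_def] by measurable

section \<open>Orthogonal invariance\<close>

text \<open>Length of the vector with entries \<open>l i / r i\<close>, the coefficients of the
  dependency relative to the vectors \<open>r i * X i\<close>.\<close>

definition weighted_norm :: "nat \<Rightarrow> (nat \<Rightarrow> real) \<Rightarrow> (nat \<Rightarrow> real) \<Rightarrow> real" where
  "weighted_norm d r l = sqrt (\<Sum>i<Suc d. (zero_sum_ext d l i / r i)\<^sup>2)"

text \<open>Unnormalised joint density of the points \<open>N i / r i\<close> with
  \<open>N i\<close> independent standard Gaussian vectors.\<close>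

definition gauss_weight :: "nat \<Rightarrow> (nat \<Rightarrow> real) \<Rightarrow> (nat \<Rightarrow> nat \<Rightarrow> real) \<Rightarrow> real" where
  "gauss_weight d r X = exp (- ((\<Sum>i<Suc d. (r i)\<^sup>2 * (\<Sum>j<d. (X i j)\<^sup>2)) / 2))"

definition inv_vol :: "nat \<Rightarrow> (nat \<Rightarrow> nat \<Rightarrow> real) \<Rightarrow> ennreal" where
  "inv_vol d X = (if nondeg d X then inverse (cone_vol d (Suc d) X) else 0)"

text \<open>The contribution of one coefficient vector \<open>l\<close> to the mean angle, after
  integrating over configurations with fixed radii. Reflections will show that it depends on
  \<open>weighted_norm d r l\<close> alone.\<close>

definition radial :: "nat \<Rightarrow> (nat \<Rightarrow> real) \<Rightarrow> (nat \<Rightarrow> real) \<Rightarrow> ennreal" where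
  "radial d r l = (\<integral>\<^sup>+X. ennreal (gauss_weight d r X) * inv_vol d X * indicator {v. eucl_norm d v < 1} (lincomb d X l) \<partial>mat_space d)"

lemma gauss_weight_measurable [measurable]: "gauss_weight d r \<in> borel_measurable (mat_space d)"
proof -
  have "(\<lambda>X. \<Sum>i<Suc d. (r i)\<^sup>2 * (\<Sum>j<d. (X i j)\<^sup>2)) \<in> borel_measurable (mat_space d)"
    by (intro borel_measurable_sum borel_measurable_times borel_measurable_const borel_measurable_power measurable_entry[OF _ _ measurable_ident_sets[OF refl]]) auto
  then show ?thesis unfolding gauss_weight_def[abs_def] by measurable
qed

lemma inv_vol_measurable [measurable]: "inv_vol d \<in> borel_measurable (mat_space d)"
  unfolding inv_vol_def[abs_def] by measurable

lemma indicator_ball_lincomb_measurable [measurable (raw)]: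
  assumes "X \<in> M \<rightarrow>\<^sub>M mat_space d" "l \<in> M \<rightarrow>\<^sub>M lebesgue_d d"
  shows "(\<lambda>x. indicator {v. eucl_norm d v < 1} (lincomb d (X x) (l x)) :: ennreal) \<in> borel_measurable M"
proof -
  note [measurable] = assms
  have "(\<lambda>x. indicator {..<1} (eucl_norm d (lincomb d (X x) (l x))) :: ennreal) \<in> borel_measurable M" by measurable
  then show ?thesis by (simp add: indicator_def)
qed

lemma sigma_finite_lebesgue_d: "sigma_finite_measure (lebesgue_d d)"
  using inv_measure_lebesgue_d[of d] by (simp add: inv_measure_def)

lemma sigma_finite_mat_space: "sigma_finite_measure (mat_space d)"
  using inv_measure_mat_space[of d] by (simp add: inv_measure_def)

lemma radial_measurable [measurable]: "radial d r \<in> borel_measurable (lebesgue_d d)"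
proof -
  interpret sigma_finite_measure "mat_space d" by (rule sigma_finite_mat_space)
  show ?thesis unfolding radial_def[abs_def] by measurable
qed

lemma angle_ratio_eq: "angle_ratio d k X = inv_vol d X * cone_vol d k X"
  by (simp add: angle_ratio_def inv_vol_def divide_ennreal_def mult.commute)

text \<open>Tonelli with the coefficients on the outside: there the cone is deterministic, and only
  the ball condition and \<open>inv_vol\<close> involve the points.\<close>

lemma nn_integral_gauss_weight_angle_ratio:
  "(\<integral>\<^sup>+X. ennreal (gauss_weight d r X) * angle_ratio d k X \<partial>mat_space d) = (\<integral>\<^sup>+l. indicator (cone_set d k) l * radial d r l \<partial>lebesgue_d d)"
proof -
  interpret L: sigma_finite_measure "lebesgue_d d" by (rule sigma_finite_lebesgue_d)
  interpret X: sigma_finite_measure "mat_space d" by (rule sigma_finite_mat_space)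
  interpret P: pair_sigma_finite "mat_space d" "lebesgue_d d" ..
  have "(\<integral>\<^sup>+X. ennreal (gauss_weight d r X) * angle_ratio d k X \<partial>mat_space d)
    = (\<integral>\<^sup>+X. \<integral>\<^sup>+l. (ennreal (gauss_weight d r X) * inv_vol d X) * (indicator (cone_set d k) l * indicator {v. eucl_norm d v < 1} (lincomb d X l)) \<partial>lebesgue_d d \<partial>mat_space d)"
  proof (rule nn_integral_cong)
    fix X assume [measurable]: "X \<in> space (mat_space d)"
    show "ennreal (gauss_weight d r X) * angle_ratio d k X = (\<integral>\<^sup>+l. (ennreal (gauss_weight d r X) * inv_vol d X) * (indicator (cone_set d k) l * indicator {v. eucl_norm d v < 1} (lincomb d X l)) \<partial>lebesgue_d d)"
      unfolding angle_ratio_eq cone_vol_def by (subst nn_integral_cmult) (auto simp: mult.assoc)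
  qed
  also have "\<dots> = (\<integral>\<^sup>+l. \<integral>\<^sup>+X. (ennreal (gauss_weight d r X) * inv_vol d X) * (indicator (cone_set d k) l * indicator {v. eucl_norm d v < 1} (lincomb d X l)) \<partial>mat_space d \<partial>lebesgue_d d)"
    by (rule P.Fubini'[symmetric]) measurable
  also have "\<dots> = (\<integral>\<^sup>+l. indicator (cone_set d k) l * radial d r l \<partial>lebesgue_d d)"
  proof (rule nn_integral_cong)
    fix l assume [measurable]: "l \<in> space (lebesgue_d d)"
    show "(\<integral>\<^sup>+X. (ennreal (gauss_weight d r X) * inv_vol d X) * (indicator (cone_set d k) l * indicator {v. eucl_norm d v < 1} (lincomb d X l)) \<partial>mat_space d) = indicator (cone_set d k) l * radial d r l"
      unfolding radial_def by (subst nn_integral_cmult[symmetric]) (auto simp: mult_ac)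
  qed
  finally show ?thesis .
qed

text \<open>The reflection along \<open>w\<close> acts on the index \<open>i\<close>: on the
  Gaussian vectors \<open>r i * X i\<close> through \<open>H\<close>, and on the vector
  \<open>l i / r i\<close> through \<open>h\<close>. Orthogonality of \<open>w\<close> to
  \<open>r\<close> keeps the coefficients summing to 0, since their sum is the inner product of
  \<open>l i / r i\<close> with \<open>r\<close>.\<close>

locale householder =
  fixes d :: nat and r w :: "nat \<Rightarrow> real"
  assumes r: "\<And>i. i < Suc d \<Longrightarrow> r i > 0"
    and wr: "(\<Sum>i<Suc d. w i * r i) = 0" and w: "(\<Sum>i<Suc d. (w i)\<^sup>2) > 0"
begin

definition c :: real where "c = 2 / (\<Sum>i<Suc d. (w i)\<^sup>2)"

text \<open>The usual formula \<open>N - c * w * (w . N)\<close> for \<open>N i = r i * X i\<close>,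
  divided by \<open>r i\<close>; \<open>h\<close> is the same formula for \<open>l i / r i\<close>,
  multiplied by \<open>r i\<close>.\<close>

definition H :: "(nat \<Rightarrow> nat \<Rightarrow> real) \<Rightarrow> nat \<Rightarrow> nat \<Rightarrow> real" where
  "H X = (\<lambda>i\<in>{..<Suc d}. \<lambda>j\<in>{..<d}. X i j - c * (w i / r i) * (\<Sum>m<Suc d. w m * r m * X m j))"

definition b :: "(nat \<Rightarrow> real) \<Rightarrow> real" where "b l = (\<Sum>m<Suc d. zero_sum_ext d l m / r m * w m)"

definition h :: "(nat \<Rightarrow> real) \<Rightarrow> nat \<Rightarrow> real" where
  "h l = (\<lambda>i\<in>{..<d}. l i - c * b l * (w (Suc i) * r (Suc i)))"

lemma cw: "c * (\<Sum>i<Suc d. (w i)\<^sup>2) = 2"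
  using w by (simp add: c_def del: sum.lessThan_Suc)

text \<open>For coefficient 0, which \<open>h\<close> does not store, the formula holds because
  \<open>w\<close> is orthogonal to \<open>r\<close>.\<close>

lemma ext_h: "i < Suc d \<Longrightarrow> zero_sum_ext d (h l) i = zero_sum_ext d l i - c * b l * (w i * r i)"
proof (cases i)
  case 0
  have "w 0 * r 0 = - (\<Sum>i<d. w (Suc i) * r (Suc i))"
    using wr by (subst (asm) sum.lessThan_Suc_shift) simp
  moreover have "(\<Sum>j<d. h l j) = (\<Sum>j<d. l j) - c * b l * (\<Sum>j<d. w (Suc j) * r (Suc j))"
    by (simp add: h_def sum_subtractf sum_distrib_left)
  ultimately show ?thesis using 0 by simp
qed (auto simp: h_def)

lemma b_h: "b (h l) = - b l"
proof -
  have "b (h l) = (\<Sum>m<Suc d. zero_sum_ext d l m / r m * w m - c * b l * (w m)\<^sup>2)"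
    unfolding b_def[of "h l"]
  proof (rule sum.cong[OF refl])
    fix m assume "m \<in> {..<Suc d}"
    then have m: "m < Suc d" by simp
    show "zero_sum_ext d (h l) m / r m * w m = zero_sum_ext d l m / r m * w m - c * b l * (w m)\<^sup>2"
      using r[OF m] unfolding ext_h[OF m] by (simp add: field_simps power2_eq_square)
  qed
  also have "\<dots> = b l - c * b l * (\<Sum>m<Suc d. (w m)\<^sup>2)"
    by (simp only: sum_subtractf sum_distrib_left[symmetric] b_def[symmetric])
  also have "\<dots> = b l - b l * (c * (\<Sum>m<Suc d. (w m)\<^sup>2))" by (simp only: mult_ac)
  finally show ?thesis unfolding cw by simp
qed

lemma h_h: "l \<in> space (lebesgue_d d) \<Longrightarrow> h (h l) = l"
proof -
  assume l: "l \<in> space (lebesgue_d d)"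
  have "h (h l) i = l i" for i
  proof (cases "i < d")
    case True
    then show ?thesis unfolding h_def[of "h l"] b_h by (simp add: h_def)
  next
    case False
    then show ?thesis using l by (auto simp: h_def space_lebesgue_d PiE_iff extensional_def)
  qed
  then show ?thesis by auto
qed

lemma h_closed: "h l \<in> space (lebesgue_d d)"
  by (simp add: h_def space_lebesgue_d)

lemma ext_measurable: "i < Suc d \<Longrightarrow> (\<lambda>l. zero_sum_ext d l i) \<in> borel_measurable (lebesgue_d d)"
  by (cases i) (auto intro!: borel_measurable_uminus borel_measurable_sum measurable_coord_id)

lemma b_measurable: "b \<in> borel_measurable (lebesgue_d d)"
  unfolding b_def[abs_def]
  by (intro borel_measurable_sum borel_measurable_times borel_measurable_divide borel_measurable_const ext_measurable) auto

lemma h_measurable: "h \<in> lebesgue_d d \<rightarrow>\<^sub>M lebesgue_d d"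
proof -
  have "(\<lambda>l. l i - c * b l * (w (Suc i) * r (Suc i))) \<in> lebesgue_d d \<rightarrow>\<^sub>M lborel" if "i \<in> {..<d}" for i
    using that b_measurable measurable_coord_id[of i d] by simp
  then show ?thesis unfolding h_def[abs_def] by (subst (2) lebesgue_d_def) (intro measurable_restrict)
qed

lemma h_add: "h (\<lambda>i\<in>{..<d}. x i + y i) = (\<lambda>i\<in>{..<d}. h x i + h y i)"
proof -
  have e: "zero_sum_ext d (\<lambda>i\<in>{..<d}. x i + y i) i = zero_sum_ext d x i + zero_sum_ext d y i" if "i < Suc d" for i
    using that by (cases i) (auto simp: sum.distrib)
  have "b (\<lambda>i\<in>{..<d}. x i + y i) = (\<Sum>m<Suc d. zero_sum_ext d x m / r m * w m + zero_sum_ext d y m / r m * w m)"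
    unfolding b_def by (intro sum.cong) (auto simp: e add_divide_distrib distrib_right)
  then have "b (\<lambda>i\<in>{..<d}. x i + y i) = b x + b y" by (simp add: b_def sum.distrib del: sum.lessThan_Suc)
  then show ?thesis unfolding h_def by (intro restrict_ext) (simp add: algebra_simps)
qed

lemma h_invariant: "f \<in> borel_measurable (lebesgue_d d) \<Longrightarrow> (\<integral>\<^sup>+l. f (h l) \<partial>lebesgue_d d) = (\<integral>\<^sup>+l. f l \<partial>lebesgue_d d)"
  by (rule inv_measure.additive_involution[OF inv_measure_lebesgue_d h_measurable]) (auto simp: h_h h_add)

lemma H_apply: "i < Suc d \<Longrightarrow> j < d \<Longrightarrow> H X i j = X i j - c * (w i / r i) * (\<Sum>m<Suc d. w m * r m * X m j)"
  by (simp add: H_def)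

lemma sum_H: "j < d \<Longrightarrow> (\<Sum>m<Suc d. w m * r m * H X m j) = - (\<Sum>m<Suc d. w m * r m * X m j)"
proof -
  assume j: "j < d"
  let ?P = "\<Sum>m<Suc d. w m * r m * X m j"
  have "(\<Sum>m<Suc d. w m * r m * H X m j) = (\<Sum>m<Suc d. w m * r m * X m j - c * ?P * (w m)\<^sup>2)"
  proof (rule sum.cong[OF refl])
    fix m assume "m \<in> {..<Suc d}"
    then have m: "m < Suc d" by simp
    have "r m \<noteq> 0" using r[OF m] by simp
    then have "w m * r m * (c * (w m / r m) * ?P) = c * ?P * (w m)\<^sup>2" by (simp add: power2_eq_square del: sum.lessThan_Suc)
    then show "w m * r m * H X m j = w m * r m * X m j - c * ?P * (w m)\<^sup>2"
      unfolding H_apply[OF m j] by (simp add: right_diff_distrib del: sum.lessThan_Suc)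
  qed
  also have "\<dots> = ?P - c * ?P * (\<Sum>m<Suc d. (w m)\<^sup>2)"
    by (simp only: sum_subtractf sum_distrib_left[symmetric])
  also have "\<dots> = ?P - ?P * (c * (\<Sum>m<Suc d. (w m)\<^sup>2))" by (simp only: mult_ac)
  finally show ?thesis unfolding cw by simp
qed

lemma H_H: "X \<in> space (mat_space d) \<Longrightarrow> H (H X) = X"
proof -
  assume X: "X \<in> space (mat_space d)"
  have "H (H X) i j = X i j" if "i < Suc d" "j < d" for i j
    unfolding H_apply[OF that] sum_H[OF that(2)] by (simp del: sum.lessThan_Suc)
  moreover have "H (H X) i j = X i j" if "i < Suc d" "\<not> j < d" for i j
    using X that by (auto simp: H_def space_PiM space_lebesgue_d PiE_iff extensional_def)
  moreover have "H (H X) i = X i" if "\<not> i < Suc d" for i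
    using X that by (auto simp: H_def space_PiM PiE_iff extensional_def)
  ultimately show ?thesis by (intro ext) metis
qed

lemma H_measurable: "H \<in> mat_space d \<rightarrow>\<^sub>M mat_space d"
proof -
  have m: "(\<lambda>X. X i j) \<in> borel_measurable (mat_space d)" if "i < Suc d" "j < d" for i j
    by (rule measurable_entry[OF that measurable_ident_sets[OF refl]])
  have "(\<lambda>X. X i j - c * (w i / r i) * (\<Sum>m<Suc d. w m * r m * X m j)) \<in> mat_space d \<rightarrow>\<^sub>M lborel" if "i \<in> {..<Suc d}" "j \<in> {..<d}" for i j
    using that unfolding measurable_lborel1 by (intro borel_measurable_diff borel_measurable_times borel_measurable_const borel_measurable_sum m) auto
  then have "(\<lambda>X. \<lambda>j\<in>{..<d}. X i j - c * (w i / r i) * (\<Sum>m<Suc d. w m * r m * X m j)) \<in> mat_space d \<rightarrow>\<^sub>M lebesgue_d d" if "i \<in> {..<Suc d}" for i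
    using that by (subst (2) lebesgue_d_def) (intro measurable_restrict)
  then show ?thesis unfolding H_def[abs_def] by (intro measurable_restrict)
qed

lemma H_add: "H (\<lambda>i\<in>{..<Suc d}. \<lambda>j\<in>{..<d}. X i j + Y i j) = (\<lambda>i\<in>{..<Suc d}. \<lambda>j\<in>{..<d}. H X i j + H Y i j)"
proof -
  have "(\<Sum>m<Suc d. w m * r m * (\<lambda>i\<in>{..<Suc d}. \<lambda>j\<in>{..<d}. X i j + Y i j) m j) = (\<Sum>m<Suc d. w m * r m * X m j) + (\<Sum>m<Suc d. w m * r m * Y m j)" if "j < d" for j
    unfolding sum.distrib[symmetric] using that by (intro sum.cong) (auto simp: distrib_left)
  then show ?thesis unfolding H_def by (intro restrict_ext) (simp add: algebra_simps del: sum.lessThan_Suc)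
qed

lemma H_invariant: "f \<in> borel_measurable (mat_space d) \<Longrightarrow> (\<integral>\<^sup>+X. f (H X) \<partial>mat_space d) = (\<integral>\<^sup>+X. f X \<partial>mat_space d)"
  by (rule inv_measure.additive_involution[OF inv_measure_mat_space H_measurable]) (auto simp: H_H H_add)

text \<open>In each coordinate \<open>j\<close> the weight depends on the length of the vector
  \<open>r i * X i j\<close> over \<open>i\<close>, which a reflection preserves.\<close>

lemma gauss_weight_H: "gauss_weight d r (H X) = gauss_weight d r X"
proof -
  have *: "(\<Sum>i<Suc d. (r i)\<^sup>2 * (H X i j)\<^sup>2) = (\<Sum>i<Suc d. (r i)\<^sup>2 * (X i j)\<^sup>2)" if j: "j < d" for j
  proof -
    let ?P = "\<Sum>m<Suc d. w m * r m * X m j"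
    have "(\<Sum>i<Suc d. (r i)\<^sup>2 * (H X i j)\<^sup>2) = (\<Sum>i<Suc d. (r i)\<^sup>2 * (X i j)\<^sup>2 - 2 * c * ?P * (w i * r i * X i j) + c\<^sup>2 * ?P\<^sup>2 * (w i)\<^sup>2)"
    proof (rule sum.cong[OF refl])
      fix i assume "i \<in> {..<Suc d}"
      then have i: "i < Suc d" by simp
      have r0: "r i \<noteq> 0" using r[OF i] by simp
      have "r i * H X i j = r i * X i j - c * w i * ?P" unfolding H_apply[OF i j] using r0 by (simp add: right_diff_distrib del: sum.lessThan_Suc)
      then have "(r i * H X i j)\<^sup>2 = (r i * X i j - c * w i * ?P)\<^sup>2" by simp
      then show "(r i)\<^sup>2 * (H X i j)\<^sup>2 = (r i)\<^sup>2 * (X i j)\<^sup>2 - 2 * c * ?P * (w i * r i * X i j) + c\<^sup>2 * ?P\<^sup>2 * (w i)\<^sup>2"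
        unfolding power_mult_distrib power2_diff by (simp add: power_mult_distrib mult_ac del: sum.lessThan_Suc)
    qed
    also have "\<dots> = (\<Sum>i<Suc d. (r i)\<^sup>2 * (X i j)\<^sup>2) - 2 * c * ?P * ?P + c\<^sup>2 * ?P\<^sup>2 * (\<Sum>i<Suc d. (w i)\<^sup>2)"
      by (simp only: sum.distrib sum_subtractf sum_distrib_left[symmetric])
    also have "c\<^sup>2 * ?P\<^sup>2 * (\<Sum>i<Suc d. (w i)\<^sup>2) = c * ?P\<^sup>2 * (c * (\<Sum>i<Suc d. (w i)\<^sup>2))" by (simp only: power2_eq_square mult_ac)
    finally show ?thesis unfolding cw by (simp add: power2_eq_square del: sum.lessThan_Suc)
  qed
  have "(\<Sum>i<Suc d. (r i)\<^sup>2 * (\<Sum>j<d. (H X i j)\<^sup>2)) = (\<Sum>j<d. \<Sum>i<Suc d. (r i)\<^sup>2 * (H X i j)\<^sup>2)"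
    by (simp only: sum_distrib_left sum.swap[of _ "{..<Suc d}"])
  also have "\<dots> = (\<Sum>j<d. \<Sum>i<Suc d. (r i)\<^sup>2 * (X i j)\<^sup>2)" by (intro sum.cong refl *) auto
  also have "\<dots> = (\<Sum>i<Suc d. (r i)\<^sup>2 * (\<Sum>j<d. (X i j)\<^sup>2))"
    by (simp only: sum_distrib_left sum.swap[of _ "{..<Suc d}"])
  finally show ?thesis by (simp only: gauss_weight_def)
qed

text \<open>A reflection is self-adjoint, so it can be moved from the points to the coefficients.
  This turns invariance of the integral over \<open>X\<close> into invariance of
  \<open>radial\<close> in \<open>l\<close>.\<close>

lemma lincomb_H: "lincomb d (H X) l = lincomb d X (h l)"
  unfolding lincomb_def
proof (rule restrict_ext)
  fix j assume "j \<in> {..<d}"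
  then have j: "j < d" by simp
  let ?P = "\<Sum>m<Suc d. w m * r m * X m j"
  have "(\<Sum>i<Suc d. zero_sum_ext d l i * H X i j) = (\<Sum>i<Suc d. zero_sum_ext d l i * X i j - c * ?P * (zero_sum_ext d l i / r i * w i))"
    by (rule sum.cong[OF refl]) (auto simp: H_apply[OF _ j] algebra_simps simp del: sum.lessThan_Suc)
  also have "\<dots> = (\<Sum>i<Suc d. zero_sum_ext d l i * X i j) - c * ?P * b l"
    by (simp only: sum_subtractf sum_distrib_left[symmetric] b_def)
  also have "\<dots> = (\<Sum>i<Suc d. zero_sum_ext d l i * X i j - c * b l * (w i * r i * X i j))"
    by (simp only: sum_subtractf sum_distrib_left[symmetric]) (simp add: mult_ac del: sum.lessThan_Suc)
  also have "\<dots> = (\<Sum>i<Suc d. zero_sum_ext d (h l) i * X i j)"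
    by (rule sum.cong[OF refl]) (auto simp: ext_h algebra_simps)
  finally show "(\<Sum>i<Suc d. zero_sum_ext d l i * H X i j) = (\<Sum>i<Suc d. zero_sum_ext d (h l) i * X i j)" .
qed

lemma nondeg_H: "nondeg d X \<Longrightarrow> nondeg d (H X)"
  unfolding nondeg_iff_kernel lincomb_H
proof safe
  fix l assume k: "\<forall>l\<in>space (lebesgue_d d). lincomb d X l = (\<lambda>j\<in>{..<d}. 0) \<longrightarrow> l = (\<lambda>j\<in>{..<d}. 0)"
    and l: "l \<in> space (lebesgue_d d)" "lincomb d X (h l) = (\<lambda>j\<in>{..<d}. 0)"
  have z: "(\<lambda>j\<in>{..<d}. 0::real) \<in> space (lebesgue_d d)" by (simp add: space_lebesgue_d)
  have h0: "h (\<lambda>j\<in>{..<d}. 0) = (\<lambda>j\<in>{..<d}. 0)"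
  proof -
    have "zero_sum_ext d (\<lambda>j\<in>{..<d}. 0) i = 0" if "i < Suc d" for i using that by (cases i) auto
    then have "b (\<lambda>j\<in>{..<d}. 0) = 0" unfolding b_def by (intro sum.neutral) auto
    then show ?thesis unfolding h_def by (intro restrict_ext) simp
  qed
  have "h l = (\<lambda>j\<in>{..<d}. 0)" using k h_closed l(2) by blast
  then have "h (h l) = (\<lambda>j\<in>{..<d}. 0)" using h0 by simp
  then show "l = (\<lambda>j\<in>{..<d}. 0)" using h_h[OF l(1)] by simp
qed

lemma inv_vol_H: "X \<in> space (mat_space d) \<Longrightarrow> inv_vol d (H X) = inv_vol d X"
proof -
  assume X [measurable]: "X \<in> space (mat_space d)"
  have n: "nondeg d (H X) \<longleftrightarrow> nondeg d X" using nondeg_H[of X] nondeg_H[of "H X"] H_H[OF X] by auto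
  have "cone_vol d (Suc d) (H X) = (\<integral>\<^sup>+l. indicator {v. eucl_norm d v < 1} (lincomb d X (h l)) \<partial>lebesgue_d d)"
    unfolding cone_vol_def lincomb_H by (intro nn_integral_cong) (simp add: cone_set_full)
  also have "\<dots> = (\<integral>\<^sup>+l. indicator {v. eucl_norm d v < 1} (lincomb d X l) \<partial>lebesgue_d d)"
    by (rule h_invariant[of "\<lambda>l. indicator {v. eucl_norm d v < 1} (lincomb d X l)"]) measurable
  also have "\<dots> = cone_vol d (Suc d) X"
    unfolding cone_vol_def by (intro nn_integral_cong) (simp add: cone_set_full)
  finally show ?thesis by (simp add: inv_vol_def n)
qed

lemma radial_h:
  assumes [measurable]: "l \<in> space (lebesgue_d d)"
  shows "radial d r (h l) = radial d r l"
proof -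
  let ?f = "\<lambda>X. ennreal (gauss_weight d r X) * inv_vol d X * indicator {v. eucl_norm d v < 1} (lincomb d X l)"
  have "radial d r l = (\<integral>\<^sup>+X. ?f (H X) \<partial>mat_space d)" unfolding radial_def by (rule H_invariant[symmetric]) measurable
  also have "\<dots> = radial d r (h l)" unfolding radial_def
    by (intro nn_integral_cong) (simp add: gauss_weight_H inv_vol_H lincomb_H)
  finally show ?thesis by simp
qed

end

text \<open>The Householder reflection exchanging the two vectors \<open>(l\<^sub>i / r\<^sub>i)\<^sub>i\<close> of equal length.\<close>

lemma radial_cong:
  assumes r: "\<And>i. i < Suc d \<Longrightarrow> r i > 0" and l: "l \<in> space (lebesgue_d d)" "l' \<in> space (lebesgue_d d)"
    and eq: "weighted_norm d r l = weighted_norm d r l'"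
  shows "radial d r l = radial d r l'"
proof (cases "l = l'")
  case False
  define u where "u = (\<lambda>i. zero_sum_ext d l i / r i)"
  define u' where "u' = (\<lambda>i. zero_sum_ext d l' i / r i)"
  \<comment> \<open>The direction exchanging \<open>u\<close> and \<open>u'\<close>. Its inner
    product with \<open>r\<close> is the difference of two zero sums.\<close>
  define w where "w = (\<lambda>i. u i - u' i)"
  have wr': "w i * r i = zero_sum_ext d l i - zero_sum_ext d l' i" if "i < Suc d" for i
    using r[OF that] by (simp add: w_def u_def u'_def field_simps)
  have "(\<Sum>i<Suc d. (u i)\<^sup>2) = (\<Sum>i<Suc d. (u' i)\<^sup>2)"
    using eq by (simp add: weighted_norm_def u_def u'_def del: sum.lessThan_Suc)
  have "\<exists>i<d. l i \<noteq> l' i"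
  proof (rule ccontr)
    assume "\<not> ?thesis"
    then have "l = l'" using l by (intro ext) (metis PiE_arb lessThan_iff space_lebesgue_d)
    with False show False by simp
  qed
  then obtain i where i: "i < d" "l i \<noteq> l' i" by auto
  have "w (Suc i) \<noteq> 0" using wr'[of "Suc i"] i by auto
  then have wpos: "(\<Sum>i<Suc d. (w i)\<^sup>2) > 0" using i by (intro sum_pos2[of _ "Suc i"]) auto
  interpret householder d r w
  proof
    have "(\<Sum>i<Suc d. w i * r i) = (\<Sum>i<Suc d. zero_sum_ext d l i - zero_sum_ext d l' i)" by (intro sum.cong) (auto simp: wr')
    then show "(\<Sum>i<Suc d. w i * r i) = 0" unfolding sum_subtractf sum_ext by simp
  qed (use r wpos in auto)
  \<comment> \<open>As \<open>u\<close> and \<open>u'\<close> have equal length, the inner product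
    of \<open>u\<close> with \<open>u - u'\<close> is half the squared length of
    \<open>u - u'\<close>; hence \<open>c * b l = 1\<close> and the reflection subtracts exactly
    \<open>w\<close> from \<open>u\<close>.\<close>
  have "2 * b l = (\<Sum>i<Suc d. (w i)\<^sup>2)"
  proof -
    have "(\<Sum>i<Suc d. (w i)\<^sup>2) = (\<Sum>i<Suc d. 2 * (u i * w i) - (u i)\<^sup>2 + (u' i)\<^sup>2)"
      by (intro sum.cong) (auto simp: w_def power2_eq_square algebra_simps)
    also have "\<dots> = 2 * (\<Sum>i<Suc d. u i * w i) - (\<Sum>i<Suc d. (u i)\<^sup>2) + (\<Sum>i<Suc d. (u' i)\<^sup>2)"
      by (simp only: sum.distrib sum_subtractf sum_distrib_left)
    also have "(\<Sum>i<Suc d. u i * w i) = b l" by (simp only: b_def u_def)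
    finally show ?thesis using \<open>(\<Sum>i<Suc d. (u i)\<^sup>2) = (\<Sum>i<Suc d. (u' i)\<^sup>2)\<close> by simp
  qed
  then have cb: "c * b l = 1" using cw wpos by (simp add: c_def del: sum.lessThan_Suc)
  have "h l = l'"
  proof
    fix i
    show "h l i = l' i"
    proof (cases "i < d")
      case True
      then show ?thesis using wr'[of "Suc i"] by (simp add: h_def cb)
    next
      case False
      then show ?thesis using l(2) by (auto simp: h_def space_lebesgue_d PiE_iff extensional_def)
    qed
  qed
  then show ?thesis using radial_h[OF l(1)] by simp
qed simp

section \<open>Exchanging the radial weight for a Gaussian on zero-sum vectors\<close>

text \<open>Joint density of independent centred Gaussians with deviations \<open>r i\<close>,
  evaluated at a zero-sum vector. Its total integral is the density of their sum at 0 rather than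
  1.\<close>

definition gauss_prod :: "nat \<Rightarrow> (nat \<Rightarrow> real) \<Rightarrow> (nat \<Rightarrow> real) \<Rightarrow> ennreal" where
  "gauss_prod d r l = (\<Prod>i<Suc d. ennreal (normal_density 0 (r i) (zero_sum_ext d l i)))"

lemma ext_measurable2:
  assumes "f \<in> M \<rightarrow>\<^sub>M lebesgue_d d" "i < Suc d"
  shows "(\<lambda>x. zero_sum_ext d (f x) i) \<in> borel_measurable M"
  using assms(2) by (cases i) (auto intro!: borel_measurable_uminus borel_measurable_sum measurable_coord[OF _ assms(1)])

lemma gauss_prod_measurable [measurable]: "gauss_prod d r \<in> borel_measurable (lebesgue_d d)"
  unfolding gauss_prod_def[abs_def]
  by (intro borel_measurable_prod_ennreal measurable_compose[OF _ measurable_ennreal] measurable_normal_density2 borel_measurable_const ext_measurable2[OF measurable_ident_sets[OF refl]]) auto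

lemma exp_weighted_norm_eq_gauss_prod:
  assumes r: "\<And>i. i < Suc d \<Longrightarrow> r i > 0"
  shows "ennreal (exp (- ((weighted_norm d r l)\<^sup>2 / 2))) = ennreal (\<Prod>i<Suc d. sqrt (2 * pi) * r i) * gauss_prod d r l"
proof -
  have "exp (- ((weighted_norm d r l)\<^sup>2 / 2)) = exp (\<Sum>i<Suc d. - ((zero_sum_ext d l i / r i)\<^sup>2 / 2))"
    by (simp only: weighted_norm_def real_sqrt_pow2[OF sum_nonneg[OF zero_le_power2]] sum_negf sum_divide_distrib)
  also have "\<dots> = (\<Prod>i<Suc d. exp (- ((zero_sum_ext d l i / r i)\<^sup>2 / 2)))" by (rule exp_sum) simp
  also have "\<dots> = (\<Prod>i<Suc d. (sqrt (2 * pi) * r i) * normal_density 0 (r i) (zero_sum_ext d l i))"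
  proof (rule prod.cong[OF refl])
    fix i assume "i \<in> {..<Suc d}"
    then have "r i > 0" using r by auto
    then show "exp (- ((zero_sum_ext d l i / r i)\<^sup>2 / 2)) = (sqrt (2 * pi) * r i) * normal_density 0 (r i) (zero_sum_ext d l i)"
      by (simp add: normal_density_def real_sqrt_mult power_divide mult.commute)
  qed
  also have "\<dots> = (\<Prod>i<Suc d. sqrt (2 * pi) * r i) * (\<Prod>i<Suc d. normal_density 0 (r i) (zero_sum_ext d l i))"
    by (rule prod.distrib)
  finally show ?thesis unfolding gauss_prod_def
    by (subst prod_ennreal) (auto intro!: ennreal_mult' prod_nonneg mult_nonneg_nonneg less_imp_le[OF r] simp del: prod.lessThan_Suc zero_le_mult_iff)
qed

lemma nn_integral_gauss_prod:
  assumes r: "\<And>i. i < Suc d \<Longrightarrow> r i > 0"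
  shows "(\<integral>\<^sup>+l. gauss_prod d r l \<partial>lebesgue_d d) = ennreal (1 / (sqrt (2 * pi) * sqrt (\<Sum>i<Suc d. (r i)\<^sup>2)))"
proof -
  have "(\<integral>\<^sup>+l. gauss_prod d r l \<partial>lebesgue_d d) = (\<integral>\<^sup>+l. (\<Prod>i<d. ennreal (normal_density 0 (r (Suc i)) (l i))) * ennreal (normal_density 0 (r 0) (0 - (\<Sum>i<d. l i))) \<partial>PiM {..<d} (\<lambda>_. lborel))"
    unfolding gauss_prod_def lebesgue_d_def by (subst prod.lessThan_Suc_shift) (simp add: mult.commute)
  also have "\<dots> = ennreal (normal_density 0 (sqrt ((r 0)\<^sup>2 + (\<Sum>i<d. (r (Suc i))\<^sup>2))) 0)"
    by (rule normal_density_multi_conv) (use r in auto)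
  also have "(r 0)\<^sup>2 + (\<Sum>i<d. (r (Suc i))\<^sup>2) = (\<Sum>i<Suc d. (r i)\<^sup>2)" by (subst sum.lessThan_Suc_shift) simp
  also have "normal_density 0 (sqrt (\<Sum>i<Suc d. (r i)\<^sup>2)) 0 = 1 / (sqrt (2 * pi) * sqrt (\<Sum>i<Suc d. (r i)\<^sup>2))"
    by (simp add: normal_density_def real_sqrt_mult sum_nonneg del: sum.lessThan_Suc)
  finally show ?thesis .
qed

lemma weighted_norm_scale:
  assumes "t \<ge> 0"
  shows "weighted_norm d r (\<lambda>i\<in>{..<d}. t * l i) = t * weighted_norm d r l"
proof -
  have e: "zero_sum_ext d (\<lambda>i\<in>{..<d}. t * l i) i = t * zero_sum_ext d l i" if "i < Suc d" for i
    using that by (cases i) (auto simp: sum_distrib_left)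
  have "(\<Sum>i<Suc d. (zero_sum_ext d (\<lambda>i\<in>{..<d}. t * l i) i / r i)\<^sup>2) = (\<Sum>i<Suc d. t\<^sup>2 * (zero_sum_ext d l i / r i)\<^sup>2)"
    by (intro sum.cong) (auto simp: e power_mult_distrib power_divide)
  then show ?thesis using assms unfolding weighted_norm_def by (simp only: sum_distrib_left[symmetric] real_sqrt_mult real_sqrt_abs abs_of_nonneg)
qed

lemma weighted_norm_pos:
  assumes r: "\<And>i. i < Suc d \<Longrightarrow> r i > 0" and i: "i < d" "l i \<noteq> 0"
  shows "weighted_norm d r l > 0"
proof -
  have "(\<Sum>i<Suc d. (zero_sum_ext d l i / r i)\<^sup>2) > 0"
    using r[of "Suc i"] i by (intro sum_pos2[of _ "Suc i"]) auto
  then show ?thesis unfolding weighted_norm_def by (simp only: real_sqrt_gt_0_iff)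
qed

lemma weighted_norm_measurable [measurable]: "weighted_norm d r \<in> borel_measurable (lebesgue_d d)"
proof -
  have "(\<lambda>l. \<Sum>i<Suc d. (zero_sum_ext d l i / r i)\<^sup>2) \<in> borel_measurable (lebesgue_d d)"
    by (intro borel_measurable_sum borel_measurable_power borel_measurable_divide borel_measurable_const ext_measurable2[OF measurable_ident_sets[OF refl]]) auto
  then show ?thesis unfolding weighted_norm_def[abs_def] by measurable
qed

lemma scale_measurable: "(\<lambda>p. \<lambda>i\<in>{..<d}. fst p * snd p i) \<in> borel \<Otimes>\<^sub>M lebesgue_d d \<rightarrow>\<^sub>M lebesgue_d d"
proof -
  have "(\<lambda>p. fst p * snd p i) \<in> borel \<Otimes>\<^sub>M lebesgue_d d \<rightarrow>\<^sub>M lborel" if "i \<in> {..<d}" for i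
    unfolding measurable_lborel1 using that by (intro borel_measurable_times measurable_coord[of i d snd]) auto
  then show ?thesis by (subst (2) lebesgue_d_def) (intro measurable_restrict)
qed

lemma lebesgue_d_scale:
  assumes "t > 0" "h \<in> borel_measurable (lebesgue_d d)"
  shows "ennreal (t ^ d) * (\<integral>\<^sup>+x. h (\<lambda>i\<in>{..<d}. t * x i) \<partial>lebesgue_d d) = (\<integral>\<^sup>+x. h x \<partial>lebesgue_d d)"
  using PiM_homogeneous[OF lborel.sigma_finite_measure_axioms, of "{..<d}" t 1 h] assms lborel_homogeneous[OF assms(1)]
  by (simp add: lebesgue_d_def)

lemma cone_set_scale:
  assumes "t > 0" "x \<in> space (lebesgue_d d)"
  shows "(\<lambda>i\<in>{..<d}. t * x i) \<in> cone_set d k \<longleftrightarrow> x \<in> cone_set d k"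
  using assms by (auto simp: cone_set_def space_lebesgue_d zero_le_mult_iff)

text \<open>As \<open>radial\<close> is a function of the weighted norm, the polar formula writes
  the integral for each \<open>k\<close> as a Gaussian cone integral times a common factor
  \<open>?T\<close>. Comparison with \<open>Suc d\<close>, where the cone is everything, eliminates
  \<open>?T\<close>.\<close>

lemma radial_polar:
  assumes d: "d \<ge> 1" and r: "\<And>i. i < Suc d \<Longrightarrow> r i > 0"
  shows "(\<integral>\<^sup>+X. ennreal (gauss_weight d r X) * angle_ratio d k X \<partial>mat_space d)
    = (\<integral>\<^sup>+X. ennreal (gauss_weight d r X) * angle_ratio d (Suc d) X \<partial>mat_space d) *
      (ennreal (sqrt (2 * pi) * sqrt (\<Sum>i<Suc d. (r i)\<^sup>2)) * (\<integral>\<^sup>+l. indicator (cone_set d k) l * gauss_prod d r l \<partial>lebesgue_d d))"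
proof -
  \<comment> \<open>The unit vector \<open>e\<close> obtained from \<open>e0\<close> serves to read
    off the profile \<open>wt\<close> along one ray; a nonzero vector exists because
    \<open>d \<ge> 1\<close>.\<close>
  define e0 :: "nat \<Rightarrow> real" where "e0 = (\<lambda>i\<in>{..<d}. 1)"
  have e0: "weighted_norm d r e0 > 0" by (rule weighted_norm_pos[OF r, where i = 0]) (use d in \<open>auto simp: e0_def\<close>)
  define e where "e = (\<lambda>i\<in>{..<d}. (1 / weighted_norm d r e0) * e0 i)"
  have e1: "weighted_norm d r e = 1" unfolding e_def using e0 by (subst weighted_norm_scale) auto
  have es: "e \<in> space (lebesgue_d d)" by (simp add: e_def space_lebesgue_d)
  define wt where "wt = (\<lambda>\<tau>. radial d r (\<lambda>i\<in>{..<d}. \<tau> * e i))"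
  have "(\<lambda>\<tau>. \<lambda>i\<in>{..<d}. fst (\<tau>, e) * snd (\<tau>, e) i) \<in> borel \<rightarrow>\<^sub>M lebesgue_d d"
    by (rule measurable_compose[OF _ scale_measurable]) (use es in measurable)
  then have wtm: "wt \<in> borel_measurable borel" unfolding wt_def
    by (intro measurable_compose[OF _ radial_measurable]) simp
  have wt: "radial d r l = wt (weighted_norm d r l)" if l: "l \<in> space (lebesgue_d d)" for l
  proof -
    have "weighted_norm d r l \<ge> 0" unfolding weighted_norm_def by (simp add: sum_nonneg del: sum.lessThan_Suc)
    then have "weighted_norm d r (\<lambda>i\<in>{..<d}. weighted_norm d r l * e i) = weighted_norm d r l" by (subst weighted_norm_scale) (auto simp: e1)
    then show ?thesis unfolding wt_def using l by (intro radial_cong r) (auto simp: space_lebesgue_d)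
  qed
  let ?T = "\<integral>\<^sup>+t. ennreal (t ^ (d - 1)) * wt t * indicator {0<..} t \<partial>lborel"
  let ?E = "\<lambda>k. \<integral>\<^sup>+l. indicator (cone_set d k) l * ennreal (exp (- ((weighted_norm d r l)\<^sup>2 / 2))) \<partial>lebesgue_d d"
  let ?I = "\<lambda>k. \<integral>\<^sup>+X. ennreal (gauss_weight d r X) * angle_ratio d k X \<partial>mat_space d"
  let ?G = "\<lambda>k. \<integral>\<^sup>+l. indicator (cone_set d k) l * gauss_prod d r l \<partial>lebesgue_d d"
  have polar: "ennreal (chi_moment d) * ?I k = ?E k * ?T" for k
  proof -
    have "?I k = (\<integral>\<^sup>+l. indicator (cone_set d k) l * wt (weighted_norm d r l) \<partial>lebesgue_d d)"
      unfolding nn_integral_gauss_weight_angle_ratio by (intro nn_integral_cong) (simp add: wt)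
    also have "ennreal (chi_moment d) * \<dots> = ?E k * ?T"
    proof (rule homogeneous_polar[OF sigma_finite_lebesgue_d d scale_measurable weighted_norm_measurable _ wtm])
      show "ennreal (t ^ d) * (\<integral>\<^sup>+x. h (\<lambda>i\<in>{..<d}. t * x i) \<partial>lebesgue_d d) = (\<integral>\<^sup>+x. h x \<partial>lebesgue_d d)"
        if "t > 0" "h \<in> borel_measurable (lebesgue_d d)" for t h using that by (rule lebesgue_d_scale)
      show "weighted_norm d r (\<lambda>i\<in>{..<d}. t * x i) = t * weighted_norm d r x" if "t > 0" for t x using that by (intro weighted_norm_scale) simp
      show "AE x in lebesgue_d d. 0 < weighted_norm d r x"
      proof -
        have "AE x in lebesgue_d d. \<exists>i\<in>{..<d}. x i \<noteq> 0"
          unfolding lebesgue_d_def using d by (intro AE_PiM_nonzero lborel.sigma_finite_measure_axioms) (auto simp: lessThan_empty_iff)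
        then show ?thesis by eventually_elim (auto intro: weighted_norm_pos[OF r])
      qed
      show "indicator (cone_set d k) (\<lambda>i\<in>{..<d}. t * x i) = (indicator (cone_set d k) x :: ennreal)" if "t > 0" "x \<in> space (lebesgue_d d)" for t x
        using cone_set_scale[OF that, of k] by (simp add: indicator_def)
    qed measurable
    finally show ?thesis .
  qed
  define cr where "cr = (\<Prod>i<Suc d. sqrt (2 * pi) * r i)"
  have cr: "cr > 0" unfolding cr_def by (intro prod_pos) (use r in auto)
  have E: "?E k = ennreal cr * ?G k" for k
  proof -
    have "ennreal (exp (- ((weighted_norm d r l)\<^sup>2 / 2))) = ennreal cr * gauss_prod d r l" for l
      unfolding cr_def by (rule exp_weighted_norm_eq_gauss_prod[OF r])
    then have "?E k = (\<integral>\<^sup>+l. ennreal cr * (indicator (cone_set d k) l * gauss_prod d r l) \<partial>lebesgue_d d)"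
      by (intro nn_integral_cong) (simp add: mult_ac)
    also have "\<dots> = ennreal cr * ?G k" by (rule nn_integral_cmult) measurable
    finally show ?thesis .
  qed
  define N where "N = sqrt (2 * pi) * sqrt (\<Sum>i<Suc d. (r i)\<^sup>2)"
  have N: "N > 0"
  proof -
    have "(\<Sum>i<Suc d. (r i)\<^sup>2) > 0" using r[of 0] by (intro sum_pos2[of _ 0]) auto
    then show ?thesis unfolding N_def by (intro mult_pos_pos) (simp_all only: real_sqrt_gt_0_iff, simp)
  qed
  have Gn: "?G (Suc d) = ennreal (1 / N)"
  proof -
    have "?G (Suc d) = (\<integral>\<^sup>+l. gauss_prod d r l \<partial>lebesgue_d d)" by (intro nn_integral_cong) (simp add: cone_set_full)
    then show ?thesis using nn_integral_gauss_prod[OF r] by (simp only: N_def)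
  qed
  have chi_moment: "chi_moment d > 0" using d by (rule chi_moment_pos)
  have inv: "ennreal (1 / a) * ennreal a = 1" if "a > 0" for a :: real using that by (simp add: ennreal_mult'[symmetric])
  \<comment> \<open>Cancelling \<open>?T\<close> would require it to be finite and nonzero, so the
    two polar identities are multiplied crosswise and only known constants are divided out.\<close>
  have "?I k = (ennreal (1 / chi_moment d) * ennreal (chi_moment d)) * ?I k * ((ennreal (1 / N) * ennreal N) * (ennreal (1 / cr) * ennreal cr))"
    using inv[OF chi_moment] inv[OF N] inv[OF cr] by simp
  also have "\<dots> = ennreal (1 / chi_moment d) * (ennreal (chi_moment d) * ?I k) * (ennreal cr * ennreal (1 / N)) * (ennreal (1 / cr) * ennreal N)"
    by (simp only: mult_ac)
  also have "\<dots> = ennreal (1 / chi_moment d) * (?E k * ?T) * ?E (Suc d) * (ennreal (1 / cr) * ennreal N)"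
    unfolding polar E[of "Suc d"] Gn ..
  also have "\<dots> = ennreal (1 / chi_moment d) * (?E (Suc d) * ?T) * ?E k * (ennreal (1 / cr) * ennreal N)"
    by (simp only: mult_ac)
  also have "\<dots> = ennreal (1 / chi_moment d) * (ennreal (chi_moment d) * ?I (Suc d)) * (ennreal cr * ?G k) * (ennreal (1 / cr) * ennreal N)"
    unfolding polar E[of k] ..
  also have "\<dots> = (ennreal (1 / chi_moment d) * ennreal (chi_moment d)) * (ennreal (1 / cr) * ennreal cr) * (?I (Suc d) * (ennreal N * ?G k))"
    by (simp only: mult_ac)
  finally show ?thesis using inv[OF chi_moment] inv[OF cr] by (simp add: N_def)
qed

section \<open>Gaussian normalisation and the beta' density as a mixture\<close>

lemma nn_integral_gauss:
  assumes r: "r > 0"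
  shows "(\<integral>\<^sup>+x. ennreal (exp (- (r\<^sup>2 * x\<^sup>2 / 2))) \<partial>lborel) = ennreal (sqrt (2 * pi) / r)"
proof -
  have "exp (- (r\<^sup>2 * x\<^sup>2 / 2)) = sqrt (2 * pi) / r * normal_density 0 (1 / r) x" for x
    using r by (simp add: normal_density_def real_sqrt_mult real_sqrt_divide power_divide field_simps)
  then have "(\<integral>\<^sup>+x. ennreal (exp (- (r\<^sup>2 * x\<^sup>2 / 2))) \<partial>lborel) = (\<integral>\<^sup>+x. ennreal (sqrt (2 * pi) / r) * ennreal (normal_density 0 (1 / r) x) \<partial>lborel)"
    using r by (intro nn_integral_cong) (simp add: ennreal_mult'[symmetric])
  also have "\<dots> = ennreal (sqrt (2 * pi) / r) * (\<integral>\<^sup>+x. ennreal (normal_density 0 (1 / r) x) \<partial>lborel)"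
    by (rule nn_integral_cmult) measurable
  also have "(\<integral>\<^sup>+x. ennreal (normal_density 0 (1 / r) x) \<partial>lborel) = 1"
    using r integral_normal_density[of "1 / r" 0] integrable_normal_density[of "1 / r" 0] by (subst nn_integral_eq_integral) auto
  finally show ?thesis by simp
qed

text \<open>The ratio for \<open>Suc d\<close> is 1 off the null set of degenerate configurations,
  so the integral is a product of one-dimensional Gaussian integrals.\<close>

lemma nn_integral_gauss_weight:
  assumes r: "\<And>i. i < Suc d \<Longrightarrow> r i > 0"
  shows "(\<integral>\<^sup>+X. ennreal (gauss_weight d r X) * angle_ratio d (Suc d) X \<partial>mat_space d) = (\<Prod>i<Suc d. ennreal ((sqrt (2 * pi) / r i) ^ d))"
proof -
  interpret P: product_sigma_finite "\<lambda>_::nat. lebesgue_d d" by (simp add: product_sigma_finite_def sigma_finite_lebesgue_d)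
  interpret L: product_sigma_finite "\<lambda>_::nat. lborel :: real measure" ..
  have g: "ennreal (gauss_weight d r X) = (\<Prod>i<Suc d. \<Prod>j<d. ennreal (exp (- ((r i)\<^sup>2 * (X i j)\<^sup>2 / 2))))" for X
  proof -
    have "gauss_weight d r X = exp (\<Sum>i<Suc d. \<Sum>j<d. - ((r i)\<^sup>2 * (X i j)\<^sup>2 / 2))"
      unfolding gauss_weight_def by (simp only: sum_negf sum_divide_distrib sum_distrib_left)
    also have "\<dots> = (\<Prod>i<Suc d. \<Prod>j<d. exp (- ((r i)\<^sup>2 * (X i j)\<^sup>2 / 2)))" by (subst exp_sum, simp)+ simp
    finally show ?thesis by (simp add: prod_ennreal prod_nonneg del: prod.lessThan_Suc)
  qed
  have m: "(\<lambda>x. \<Prod>j<d. ennreal (exp (- ((r i)\<^sup>2 * (x j)\<^sup>2 / 2)))) \<in> borel_measurable (lebesgue_d d)" for i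
    unfolding lebesgue_d_def by measurable
  have "(\<integral>\<^sup>+X. ennreal (gauss_weight d r X) * angle_ratio d (Suc d) X \<partial>mat_space d) = (\<integral>\<^sup>+X. ennreal (gauss_weight d r X) \<partial>mat_space d)"
  proof (rule nn_integral_cong_AE)
    show "AE X in mat_space d. ennreal (gauss_weight d r X) * angle_ratio d (Suc d) X = ennreal (gauss_weight d r X)"
      using AE_nondeg AE_space by eventually_elim (simp add: angle_ratio_full)
  qed
  also have "\<dots> = (\<integral>\<^sup>+X. (\<Prod>i<Suc d. (\<lambda>x. \<Prod>j<d. ennreal (exp (- ((r i)\<^sup>2 * (x j)\<^sup>2 / 2)))) (X i)) \<partial>mat_space d)"
    unfolding g ..
  also have "\<dots> = (\<Prod>i<Suc d. \<integral>\<^sup>+x. (\<Prod>j<d. ennreal (exp (- ((r i)\<^sup>2 * (x j)\<^sup>2 / 2)))) \<partial>lebesgue_d d)"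
    by (rule P.product_nn_integral_prod) (auto intro: m)
  also have "\<dots> = (\<Prod>i<Suc d. ennreal ((sqrt (2 * pi) / r i) ^ d))"
  proof (rule prod.cong[OF refl])
    fix i assume "i \<in> {..<Suc d}"
    then have ri: "r i > 0" using r by auto
    have "(\<integral>\<^sup>+x. (\<Prod>j<d. ennreal (exp (- ((r i)\<^sup>2 * (x j)\<^sup>2 / 2)))) \<partial>lebesgue_d d) = (\<Prod>j<d. \<integral>\<^sup>+x. ennreal (exp (- ((r i)\<^sup>2 * x\<^sup>2 / 2))) \<partial>lborel)"
      unfolding lebesgue_d_def by (rule L.product_nn_integral_prod) auto
    also have "\<dots> = ennreal ((sqrt (2 * pi) / r i) ^ d)" using ri by (simp add: nn_integral_gauss ennreal_power)
    finally show "(\<integral>\<^sup>+x. (\<Prod>j<d. ennreal (exp (- ((r i)\<^sup>2 * (x j)\<^sup>2 / 2)))) \<partial>lebesgue_d d) = ennreal ((sqrt (2 * pi) / r i) ^ d)" .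
  qed
  finally show ?thesis .
qed

lemma c_tilde_d_eq:
  assumes a: "a \<ge> 1"
  shows "c_tilde_d d ((real a + real d) / 2) = chi_moment (a + d) / (chi_moment a * sqrt (2 * pi) ^ d)"
proof -
  have 1: "(real a + real d) / 2 - real d / 2 = real a / 2" by (simp add: field_simps)
  have 2: "sqrt (2 * pi) ^ d = 2 powr (real d / 2) * pi powr (real d / 2)"
    by (simp add: powr_half_sqrt[symmetric] powr_realpow[symmetric] powr_powr powr_mult)
  have 3: "2 powr (real (a + d) / 2 - 1) = 2 powr (real a / 2 - 1) * 2 powr (real d / 2)"
    by (simp add: powr_add[symmetric] field_simps)
  have G: "Gamma (real a / 2) > 0" using a by (intro Gamma_real_pos) auto
  have p: "2 powr (real a / 2 - 1) > (0::real)" "2 powr (real d / 2) > (0::real)" "pi powr (real d / 2) > 0" by auto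
  show ?thesis unfolding c_tilde_d_def chi_moment_def 1 2 3 using G p by (simp add: field_simps)
qed

text \<open>The factor \<open>(r / sqrt (2 * pi)) ^ d\<close> normalises a Gaussian of deviation
  \<open>1 / r\<close>. It raises the power of \<open>r\<close> to index \<open>a + d\<close>, and
  \<open>gauss_moment\<close> with \<open>c = 1 + N\<close> then yields the beta' profile.\<close>

lemma f_tilde_mixture:
  assumes a: "a \<ge> 1"
  shows "ennreal (f_tilde d ((real a + real d) / 2) x) = (\<integral>\<^sup>+r. ennreal (1 / chi_moment a * (r / sqrt (2 * pi)) ^ d * exp (- (r\<^sup>2 / 2)) * exp (- (r\<^sup>2 * (\<Sum>j<d. (x j)\<^sup>2) / 2))) \<partial>power_measure a)"
proof -
  define N where "N = (\<Sum>j<d. (x j)\<^sup>2)"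
  have N: "N \<ge> 0" by (simp add: N_def sum_nonneg)
  have chi_moment: "chi_moment a > 0" "chi_moment (a + d) > 0" using a by (auto intro!: chi_moment_pos)
  define \<kappa> where "\<kappa> = 1 / (chi_moment a * sqrt (2 * pi) ^ d)"
  have \<kappa>: "\<kappa> \<ge> 0" using chi_moment by (simp add: \<kappa>_def)
  have "(\<integral>\<^sup>+r. ennreal (1 / chi_moment a * (r / sqrt (2 * pi)) ^ d * exp (- (r\<^sup>2 / 2)) * exp (- (r\<^sup>2 * N / 2))) \<partial>power_measure a)
    = (\<integral>\<^sup>+r. ennreal \<kappa> * (ennreal (r ^ (a + d - 1) * exp (- ((1 + N) * r\<^sup>2 / 2))) * indicator {0<..} r) \<partial>lborel)"
  proof (subst nn_integral_power_measure, measurable, rule nn_integral_cong)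
    fix r :: real
    have "r ^ (a + d - 1) = r ^ (a - 1) * r ^ d" using a by (simp add: power_add[symmetric])
    moreover have "exp (- ((1 + N) * r\<^sup>2 / 2)) = exp (- (r\<^sup>2 / 2)) * exp (- (r\<^sup>2 * N / 2))"
      unfolding exp_add[symmetric] by (simp add: field_simps)
    ultimately show "ennreal (r ^ (a - 1)) * indicator {0<..} r * ennreal (1 / chi_moment a * (r / sqrt (2 * pi)) ^ d * exp (- (r\<^sup>2 / 2)) * exp (- (r\<^sup>2 * N / 2)))
      = ennreal \<kappa> * (ennreal (r ^ (a + d - 1) * exp (- ((1 + N) * r\<^sup>2 / 2))) * indicator {0<..} r)"
      using \<kappa> by (cases "r > 0") (auto simp: ennreal_mult'[symmetric] \<kappa>_def power_divide mult_ac)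
  qed
  also have "\<dots> = ennreal \<kappa> * ennreal (chi_moment (a + d) * (1 + N) powr (- real (a + d) / 2))"
    using a N by (subst nn_integral_cmult, measurable, subst gauss_moment) auto
  also have "\<dots> = ennreal (\<kappa> * (chi_moment (a + d) * (1 + N) powr (- real (a + d) / 2)))" using \<kappa> by (simp add: ennreal_mult')
  also have "\<kappa> * (chi_moment (a + d) * (1 + N) powr (- real (a + d) / 2)) = f_tilde d ((real a + real d) / 2) x"
  proof -
    have e: "- real (a + d) / 2 = - ((real a + real d) / 2)" by (simp add: add_divide_distrib diff_divide_distrib)
    show ?thesis unfolding e using N by (simp add: f_tilde_def c_tilde_d_eq[OF a] \<kappa>_def eucl_norm_def N_def[symmetric])
  qed
  finally show ?thesis by (simp only: N_def)
qed

section \<open>The expected angle\<close>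

text \<open>For \<open>k \<ge> 1\<close>, the density at 0 of the sum of \<open>d + 1\<close>
  independent variance-gamma variables, restricted to the event that those of index at least
  \<open>k\<close> are nonnegative.\<close>

definition cone_integral :: "nat \<Rightarrow> nat \<Rightarrow> nat \<Rightarrow> ennreal" where
  "cone_integral a d k = (\<integral>\<^sup>+l. indicator (cone_set d k) l * (\<Prod>i<Suc d. vg_density a (zero_sum_ext d l i)) \<partial>lebesgue_d d)"

lemma prod_vg_density_measurable [measurable]: "(\<lambda>l. \<Prod>i<Suc d. vg_density a (zero_sum_ext d l i)) \<in> borel_measurable (lebesgue_d d)"
  by (intro borel_measurable_prod_ennreal measurable_compose[OF _ vg_density_measurable] ext_measurable2[OF measurable_ident_sets[OF refl]]) auto

lemma sigma_finite_beta_prime: "sigma_finite_measure (beta_prime_d d \<beta>)"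
proof -
  interpret sigma_finite_measure "lebesgue_d d" by (rule sigma_finite_lebesgue_d)
  have "f_tilde d \<beta> \<in> borel_measurable (lebesgue_d d)" unfolding f_tilde_def[abs_def] by measurable
  then show ?thesis unfolding beta_prime_d_def by (subst sigma_finite_iff_density_finite) auto
qed

text \<open>The mixture is applied to all points at once and the radii are put on the outside, so
  that the inner integral is one for fixed radii.\<close>

lemma nn_integral_beta_prime:
  assumes a: "a \<ge> 1" and [measurable]: "F \<in> borel_measurable (mat_space d)"
  shows "(\<integral>\<^sup>+X. F X \<partial>PiM {..<Suc d} (\<lambda>_. beta_prime_d d ((real a + real d) / 2)))
    = (\<integral>\<^sup>+r. (\<Prod>i<Suc d. ennreal (1 / chi_moment a * (r i / sqrt (2 * pi)) ^ d * exp (- ((r i)\<^sup>2 / 2)))) * (\<integral>\<^sup>+X. ennreal (gauss_weight d r X) * F X \<partial>mat_space d) \<partial>PiM {..<Suc d} (\<lambda>_. power_measure a))"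
proof -
  let ?\<beta> = "(real a + real d) / 2" and ?R = "PiM {..<Suc d} (\<lambda>_::nat. power_measure a)"
  interpret P: product_sigma_finite "\<lambda>_::nat. power_measure a" by (simp add: product_sigma_finite_def sigma_finite_power_measure)
  interpret R: finite_product_sigma_finite "\<lambda>_::nat. power_measure a" "{..<Suc d}" by standard auto
  interpret X: sigma_finite_measure "mat_space d" by (rule sigma_finite_mat_space)
  interpret RX: pair_sigma_finite ?R "mat_space d" ..
  have chi_moment: "chi_moment a > 0" using a by (rule chi_moment_pos)
  have fm [measurable]: "f_tilde d ?\<beta> \<in> borel_measurable (lebesgue_d d)" unfolding f_tilde_def[abs_def] by measurable
  let ?k = "\<lambda>r x. 1 / chi_moment a * (r / sqrt (2 * pi)) ^ d * exp (- (r\<^sup>2 / 2)) * exp (- (r\<^sup>2 * (\<Sum>j<d. (x j)\<^sup>2) / 2))"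
  let ?C = "\<lambda>r. \<Prod>i<Suc d. ennreal (1 / chi_moment a * (r i / sqrt (2 * pi)) ^ d * exp (- ((r i)\<^sup>2 / 2)))"
  have prodf: "(\<Prod>i<Suc d. ennreal (f_tilde d ?\<beta> (X i))) = (\<integral>\<^sup>+r. ?C r * ennreal (gauss_weight d r X) \<partial>?R)" for X
  proof -
    have "(\<Prod>i<Suc d. ennreal (f_tilde d ?\<beta> (X i))) = (\<Prod>i<Suc d. \<integral>\<^sup>+r. ennreal (?k r (X i)) \<partial>power_measure a)"
      by (simp only: f_tilde_mixture[OF a])
    also have "\<dots> = (\<integral>\<^sup>+r. (\<Prod>i<Suc d. ennreal (?k (r i) (X i))) \<partial>?R)"
      by (rule P.product_nn_integral_prod[symmetric]) auto
    also have "\<dots> = (\<integral>\<^sup>+r. ?C r * ennreal (gauss_weight d r X) \<partial>?R)"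
    proof (rule nn_integral_cong)
      fix r :: "nat \<Rightarrow> real"
      have "gauss_weight d r X = (\<Prod>i<Suc d. exp (- ((r i)\<^sup>2 * (\<Sum>j<d. (X i j)\<^sup>2) / 2)))"
        unfolding gauss_weight_def by (subst exp_sum[symmetric]) (simp_all only: finite_lessThan sum_negf sum_divide_distrib)
      then have "ennreal (gauss_weight d r X) = (\<Prod>i<Suc d. ennreal (exp (- ((r i)\<^sup>2 * (\<Sum>j<d. (X i j)\<^sup>2) / 2))))"
        by (simp only: prod_ennreal exp_ge_zero)
      then have "?C r * ennreal (gauss_weight d r X) = (\<Prod>i<Suc d. ennreal (1 / chi_moment a * (r i / sqrt (2 * pi)) ^ d * exp (- ((r i)\<^sup>2 / 2))) * ennreal (exp (- ((r i)\<^sup>2 * (\<Sum>j<d. (X i j)\<^sup>2) / 2))))"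
        by (simp only: prod.distrib)
      also have "\<dots> = (\<Prod>i<Suc d. ennreal (?k (r i) (X i)))"
        by (intro prod.cong refl ennreal_mult''[symmetric]) auto
      finally show "(\<Prod>i<Suc d. ennreal (?k (r i) (X i))) = ?C r * ennreal (gauss_weight d r X)" ..
    qed
    finally show ?thesis .
  qed
  have Cm [measurable]: "?C \<in> borel_measurable ?R" by measurable
  have gm [measurable]: "(\<lambda>p. gauss_weight d (fst p) (snd p)) \<in> borel_measurable (?R \<Otimes>\<^sub>M mat_space d)"
  proof -
    have "(\<lambda>p. fst p i) \<in> borel_measurable (?R \<Otimes>\<^sub>M mat_space d)" if "i < Suc d" for i
    proof -
      have "(\<lambda>r. r i) \<in> ?R \<rightarrow>\<^sub>M power_measure a" using that by (intro measurable_component_singleton) auto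
      then have "(\<lambda>r. r i) \<in> borel_measurable ?R" by (simp only: measurable_cong_sets[OF refl sets_power_measure])
      then show ?thesis by (rule measurable_compose[OF measurable_fst])
    qed
    then have "(\<lambda>p. \<Sum>i<Suc d. (fst p i)\<^sup>2 * (\<Sum>j<d. (snd p i j)\<^sup>2)) \<in> borel_measurable (?R \<Otimes>\<^sub>M mat_space d)"
      by (intro borel_measurable_sum borel_measurable_times borel_measurable_power measurable_entry[OF _ _ measurable_snd]) auto
    then show ?thesis unfolding gauss_weight_def by measurable
  qed
  have "(\<integral>\<^sup>+X. F X \<partial>PiM {..<Suc d} (\<lambda>_. beta_prime_d d ?\<beta>)) = (\<integral>\<^sup>+X. F X \<partial>density (mat_space d) (\<lambda>X. \<Prod>i<Suc d. ennreal (f_tilde d ?\<beta> (X i))))"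
    unfolding beta_prime_d_def
    by (subst PiM_density) (use sigma_finite_lebesgue_d sigma_finite_beta_prime[of d ?\<beta>] in \<open>auto simp: beta_prime_d_def simp del: prod.lessThan_Suc\<close>)
  also have "\<dots> = (\<integral>\<^sup>+X. (\<Prod>i<Suc d. ennreal (f_tilde d ?\<beta> (X i))) * F X \<partial>mat_space d)"
    by (rule nn_integral_density) measurable
  also have "\<dots> = (\<integral>\<^sup>+X. \<integral>\<^sup>+r. ?C r * ennreal (gauss_weight d r X) * F X \<partial>?R \<partial>mat_space d)"
  proof (rule nn_integral_cong)
    fix X assume X [measurable]: "X \<in> space (mat_space d)"
    have [measurable]: "(\<lambda>r. gauss_weight d r X) \<in> borel_measurable ?R"
      using measurable_compose[OF _ gm, of "\<lambda>r. (r, X)" ?R] by simp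
    show "(\<Prod>i<Suc d. ennreal (f_tilde d ?\<beta> (X i))) * F X = (\<integral>\<^sup>+r. ?C r * ennreal (gauss_weight d r X) * F X \<partial>?R)"
      unfolding prodf by (rule nn_integral_multc[symmetric]) measurable
  qed
  also have "\<dots> = (\<integral>\<^sup>+r. \<integral>\<^sup>+X. ?C r * ennreal (gauss_weight d r X) * F X \<partial>mat_space d \<partial>?R)"
    by (rule RX.Fubini') measurable
  also have "\<dots> = (\<integral>\<^sup>+r. ?C r * (\<integral>\<^sup>+X. ennreal (gauss_weight d r X) * F X \<partial>mat_space d) \<partial>?R)"
    by (intro nn_integral_cong) (simp only: mult.assoc, subst nn_integral_cmult, auto)
  finally show ?thesis .
qed

lemma gauss_prod_measurable_pair:
  "(\<lambda>p. gauss_prod d (fst p) (snd p)) \<in> borel_measurable (PiM {..<Suc d} (\<lambda>_. power_measure a) \<Otimes>\<^sub>M lebesgue_d d)"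
proof -
  let ?R = "PiM {..<Suc d} (\<lambda>_::nat. power_measure a)"
  have "(\<lambda>p. fst p i) \<in> borel_measurable (?R \<Otimes>\<^sub>M lebesgue_d d)" if "i < Suc d" for i
  proof -
    have "(\<lambda>r. r i) \<in> ?R \<rightarrow>\<^sub>M power_measure a" using that by (intro measurable_component_singleton) auto
    then have "(\<lambda>r. r i) \<in> borel_measurable ?R" by (simp only: measurable_cong_sets[OF refl sets_power_measure])
    then show ?thesis by (rule measurable_compose[OF measurable_fst])
  qed
  then show ?thesis unfolding gauss_prod_def
    by (intro borel_measurable_prod_ennreal measurable_compose[OF _ measurable_ennreal] measurable_normal_density2 ext_measurable2[OF measurable_snd]) auto
qed

text \<open>Scale \<open>r\<close> and \<open>l\<close> together: the \<open>Suc d\<close> densities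
  contribute \<open>1 / t\<close> each and Lebesgue measure contributes \<open>t ^ d\<close>, so the
  degree in \<open>r\<close> is -1.\<close>

lemma nn_integral_cone_gauss_prod_scale:
  assumes t: "t > 0"
  shows "(\<integral>\<^sup>+l. indicator (cone_set d k) l * gauss_prod d (\<lambda>i\<in>{..<Suc d}. t * r i) l \<partial>lebesgue_d d) = ennreal (1 / t) * (\<integral>\<^sup>+l. indicator (cone_set d k) l * gauss_prod d r l \<partial>lebesgue_d d)"
proof -
  have nd: "normal_density 0 (t * s) (t * y) = 1 / t * normal_density 0 s y" for s y
  proof -
    have "(t * y)\<^sup>2 / (2 * (t * s)\<^sup>2) = y\<^sup>2 / (2 * s\<^sup>2)" using t by (simp add: power_mult_distrib)
    moreover have "sqrt (2 * pi * (t * s)\<^sup>2) = t * sqrt (2 * pi * s\<^sup>2)" using t by (simp add: power_mult_distrib real_sqrt_mult)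
    ultimately show ?thesis by (simp add: normal_density_def)
  qed
  have e: "zero_sum_ext d (\<lambda>i\<in>{..<d}. t * l i) i = t * zero_sum_ext d l i" if "i < Suc d" for i l
    using that by (cases i) (auto simp: sum_distrib_left)
  have g: "gauss_prod d (\<lambda>i\<in>{..<Suc d}. t * r i) (\<lambda>i\<in>{..<d}. t * l i) = ennreal ((1 / t) ^ Suc d) * gauss_prod d r l" for l
  proof -
    have "gauss_prod d (\<lambda>i\<in>{..<Suc d}. t * r i) (\<lambda>i\<in>{..<d}. t * l i) = (\<Prod>i<Suc d. ennreal (1 / t) * ennreal (normal_density 0 (r i) (zero_sum_ext d l i)))"
      unfolding gauss_prod_def
    proof (rule prod.cong[OF refl])
      fix i assume "i \<in> {..<Suc d}"
      then show "ennreal (normal_density 0 ((\<lambda>i\<in>{..<Suc d}. t * r i) i) (zero_sum_ext d (\<lambda>i\<in>{..<d}. t * l i) i)) = ennreal (1 / t) * ennreal (normal_density 0 (r i) (zero_sum_ext d l i))"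
        using t nd[of "r i" "zero_sum_ext d l i"] by (simp add: e ennreal_mult'[symmetric])
    qed
    also have "\<dots> = (\<Prod>i<Suc d. ennreal (1 / t)) * gauss_prod d r l" unfolding gauss_prod_def by (rule prod.distrib)
    also have "(\<Prod>i<Suc d. ennreal (1 / t)) = ennreal ((1 / t) ^ Suc d)" using t by (simp only: prod_constant card_lessThan ennreal_power divide_nonneg_pos zero_le_one)
    finally show ?thesis .
  qed
  have "(\<integral>\<^sup>+l. indicator (cone_set d k) l * gauss_prod d (\<lambda>i\<in>{..<Suc d}. t * r i) l \<partial>lebesgue_d d)
    = ennreal (t ^ d) * (\<integral>\<^sup>+l. indicator (cone_set d k) (\<lambda>i\<in>{..<d}. t * l i) * gauss_prod d (\<lambda>i\<in>{..<Suc d}. t * r i) (\<lambda>i\<in>{..<d}. t * l i) \<partial>lebesgue_d d)"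
    by (rule lebesgue_d_scale[OF t, symmetric]) measurable
  also have "(\<integral>\<^sup>+l. indicator (cone_set d k) (\<lambda>i\<in>{..<d}. t * l i) * gauss_prod d (\<lambda>i\<in>{..<Suc d}. t * r i) (\<lambda>i\<in>{..<d}. t * l i) \<partial>lebesgue_d d)
    = (\<integral>\<^sup>+l. ennreal ((1 / t) ^ Suc d) * (indicator (cone_set d k) l * gauss_prod d r l) \<partial>lebesgue_d d)"
  proof (rule nn_integral_cong)
    fix l assume "l \<in> space (lebesgue_d d)"
    from cone_set_scale[OF t this, of k] have "indicator (cone_set d k) (\<lambda>i\<in>{..<d}. t * l i) = (indicator (cone_set d k) l :: ennreal)" by (simp only: indicator_def)
    then show "indicator (cone_set d k) (\<lambda>i\<in>{..<d}. t * l i) * gauss_prod d (\<lambda>i\<in>{..<Suc d}. t * r i) (\<lambda>i\<in>{..<d}. t * l i) = ennreal ((1 / t) ^ Suc d) * (indicator (cone_set d k) l * gauss_prod d r l)"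
      unfolding g by (simp only: mult_ac)
  qed
  also have "\<dots> = ennreal ((1 / t) ^ Suc d) * (\<integral>\<^sup>+l. indicator (cone_set d k) l * gauss_prod d r l \<partial>lebesgue_d d)"
    by (rule nn_integral_cmult) measurable
  also have "ennreal (t ^ d) * \<dots> = ennreal (t ^ d * (1 / t) ^ Suc d) * (\<integral>\<^sup>+l. indicator (cone_set d k) l * gauss_prod d r l \<partial>lebesgue_d d)"
    using t by (simp only: ennreal_mult' zero_le_power less_imp_le mult.assoc)
  also have "t ^ d * (1 / t) ^ Suc d = 1 / t" using t by (simp add: power_divide)
  finally show ?thesis .
qed

text \<open>For fixed radii the mean angle is \<open>sqrt (2 * pi) * ?N r * ?G r\<close>, and the
  length \<open>?N r\<close> does not factor over the points. But \<open>?N r * ?G r\<close> has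
  degree 0, so the polar formula allows \<open>?N r\<close> to be replaced by the constant
  \<open>chi_moment ?n / chi_moment (?n - 1)\<close>; then averaging over the radii factors into
  variance-gamma densities.\<close>

lemma expected_angle_ratio:
  assumes a: "a \<ge> 1" and d: "d \<ge> 1"
  shows "(\<integral>\<^sup>+X. angle_ratio d k X \<partial>PiM {..<Suc d} (\<lambda>_. beta_prime_d d ((real a + real d) / 2)))
    = ennreal (2 * pi * c_tilde (real (a * Suc d) / 2)) * cone_integral a d k"
proof -
  let ?R = "PiM {..<Suc d} (\<lambda>_::nat. power_measure a)"
  let ?n = "a * Suc d"
  let ?G = "\<lambda>r. \<integral>\<^sup>+l. indicator (cone_set d k) l * gauss_prod d r l \<partial>lebesgue_d d"
  let ?N = "\<lambda>r::nat\<Rightarrow>real. sqrt (\<Sum>i<Suc d. (r i)\<^sup>2)"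
  let ?e = "\<lambda>r::nat\<Rightarrow>real. exp (- ((\<Sum>i<Suc d. (r i)\<^sup>2) / 2))"
  interpret P: product_sigma_finite "\<lambda>_::nat. power_measure a" by (simp add: product_sigma_finite_def sigma_finite_power_measure)
  interpret R: finite_product_sigma_finite "\<lambda>_::nat. power_measure a" "{..<Suc d}" by standard auto
  interpret L: sigma_finite_measure "lebesgue_d d" by (rule sigma_finite_lebesgue_d)
  interpret RL: pair_sigma_finite ?R "lebesgue_d d" ..
  note [measurable] = gauss_prod_measurable_pair[of d a]
  have n2: "?n \<ge> 2" using mult_le_mono[OF a, of 2 "Suc d"] d by simp
  have pw: "t ^ (N - 1) = t * t ^ (N - 1 - 1)" if "N \<ge> 2" for N and t :: real using that by (simp add: power_eq_if)
  have chi_moment: "chi_moment a > 0" "chi_moment ?n > 0" "chi_moment (?n - 1) > 0" using a n2 by (auto intro!: chi_moment_pos)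
  have Gm [measurable]: "?G \<in> borel_measurable ?R" by measurable
  have em [measurable]: "?e \<in> borel_measurable ?R" "?N \<in> borel_measurable ?R" by measurable
  have "(\<integral>\<^sup>+X. angle_ratio d k X \<partial>PiM {..<Suc d} (\<lambda>_. beta_prime_d d ((real a + real d) / 2)))
    = (\<integral>\<^sup>+r. ennreal (sqrt (2 * pi) * (1 / chi_moment a) ^ Suc d) * ((ennreal (?N r) * ?G r) * ennreal (?e r)) \<partial>?R)"
    unfolding nn_integral_beta_prime[OF a angle_ratio_measurable]
  proof (rule nn_integral_cong_AE)
    show "AE r in ?R. (\<Prod>i<Suc d. ennreal (1 / chi_moment a * (r i / sqrt (2 * pi)) ^ d * exp (- ((r i)\<^sup>2 / 2)))) * (\<integral>\<^sup>+X. ennreal (gauss_weight d r X) * angle_ratio d k X \<partial>mat_space d)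
      = ennreal (sqrt (2 * pi) * (1 / chi_moment a) ^ Suc d) * ((ennreal (?N r) * ?G r) * ennreal (?e r))"
      using AE_PiM_all[OF sigma_finite_power_measure finite_lessThan AE_power_measure_pos]
    proof eventually_elim
      case (elim r)
      then have r: "r i > 0" if "i < Suc d" for i using that by auto
      \<comment> \<open>The Gaussian normalisations of the mixture cancel against those of the
        integral over the points, leaving the chi weights alone.\<close>
      have "(\<Prod>i<Suc d. ennreal (1 / chi_moment a * (r i / sqrt (2 * pi)) ^ d * exp (- ((r i)\<^sup>2 / 2)))) * (\<Prod>i<Suc d. ennreal ((sqrt (2 * pi) / r i) ^ d))
        = (\<Prod>i<Suc d. ennreal (1 / chi_moment a * exp (- ((r i)\<^sup>2 / 2))))"
        unfolding prod.distrib[symmetric]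
      proof (rule prod.cong[OF refl])
        fix i assume "i \<in> {..<Suc d}"
        then have ri: "r i > 0" using r by auto
        have "(r i / sqrt (2 * pi)) ^ d * (sqrt (2 * pi) / r i) ^ d = 1" using ri by (simp add: power_mult_distrib[symmetric])
        then have "1 / chi_moment a * (r i / sqrt (2 * pi)) ^ d * exp (- ((r i)\<^sup>2 / 2)) * (sqrt (2 * pi) / r i) ^ d = 1 / chi_moment a * exp (- ((r i)\<^sup>2 / 2))"
        proof -
          have "m * A * E * B = m * E * (A * B)" for m A E B :: real by (simp only: mult_ac)
          then show ?thesis by (simp only: \<open>(r i / sqrt (2 * pi)) ^ d * (sqrt (2 * pi) / r i) ^ d = 1\<close> mult_1_right)
        qed
        moreover have "ennreal A * ennreal ((sqrt (2 * pi) / r i) ^ d) = ennreal (A * (sqrt (2 * pi) / r i) ^ d)" for A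
          using ri by (intro ennreal_mult''[symmetric]) simp
        ultimately show "ennreal (1 / chi_moment a * (r i / sqrt (2 * pi)) ^ d * exp (- ((r i)\<^sup>2 / 2))) * ennreal ((sqrt (2 * pi) / r i) ^ d) = ennreal (1 / chi_moment a * exp (- ((r i)\<^sup>2 / 2)))"
          by (simp only:)
      qed
      also have "\<dots> = ennreal (\<Prod>i<Suc d. 1 / chi_moment a * exp (- ((r i)\<^sup>2 / 2)))" using chi_moment by (intro prod_ennreal) auto
      also have "(\<Prod>i<Suc d. 1 / chi_moment a * exp (- ((r i)\<^sup>2 / 2))) = (1 / chi_moment a) ^ Suc d * ?e r"
      proof -
        have "?e r = (\<Prod>i<Suc d. exp (- ((r i)\<^sup>2 / 2)))" by (subst exp_sum[symmetric]) (simp_all only: finite_lessThan sum_negf sum_divide_distrib)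
        then show ?thesis by (simp only: prod.distrib prod_constant card_lessThan)
      qed
      finally have C: "(\<Prod>i<Suc d. ennreal (1 / chi_moment a * (r i / sqrt (2 * pi)) ^ d * exp (- ((r i)\<^sup>2 / 2)))) * (\<Prod>i<Suc d. ennreal ((sqrt (2 * pi) / r i) ^ d))
        = ennreal ((1 / chi_moment a) ^ Suc d * ?e r)" .
      have Np: "?N r \<ge> 0" by (rule real_sqrt_ge_zero, rule sum_nonneg) simp
      have "(\<integral>\<^sup>+X. ennreal (gauss_weight d r X) * angle_ratio d k X \<partial>mat_space d) = (\<Prod>i<Suc d. ennreal ((sqrt (2 * pi) / r i) ^ d)) * (ennreal (sqrt (2 * pi) * ?N r) * ?G r)"
      proof -
        have 1: "(\<integral>\<^sup>+X. ennreal (gauss_weight d r X) * angle_ratio d (Suc d) X \<partial>mat_space d) = (\<Prod>i<Suc d. ennreal ((sqrt (2 * pi) / r i) ^ d))"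
          by (rule nn_integral_gauss_weight) (rule r)
        show ?thesis unfolding 1[symmetric] by (rule radial_polar[OF d]) (rule r)
      qed
      then have "(\<Prod>i<Suc d. ennreal (1 / chi_moment a * (r i / sqrt (2 * pi)) ^ d * exp (- ((r i)\<^sup>2 / 2)))) * (\<integral>\<^sup>+X. ennreal (gauss_weight d r X) * angle_ratio d k X \<partial>mat_space d)
        = ennreal ((1 / chi_moment a) ^ Suc d * ?e r) * (ennreal (sqrt (2 * pi) * ?N r) * ?G r)"
        unfolding C[symmetric] by (simp only: mult.assoc)
      also have "\<dots> = ennreal ((1 / chi_moment a) ^ Suc d * ?e r) * ennreal (sqrt (2 * pi) * ?N r) * ?G r" by (simp only: mult.assoc)
      also have "ennreal ((1 / chi_moment a) ^ Suc d * ?e r) * ennreal (sqrt (2 * pi) * ?N r) = ennreal (sqrt (2 * pi) * (1 / chi_moment a) ^ Suc d) * (ennreal (?N r) * ennreal (?e r))"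
        using chi_moment Np by (simp add: ennreal_mult'[symmetric] mult_ac del: sum.lessThan_Suc power_Suc)
      finally show ?case by (simp only: mult_ac)
    qed
  qed
  also have "\<dots> = ennreal (sqrt (2 * pi) * (1 / chi_moment a) ^ Suc d) * (\<integral>\<^sup>+r. (ennreal (?N r) * ?G r) * ennreal (?e r) \<partial>?R)"
    by (rule nn_integral_cmult) measurable
  also have "(\<integral>\<^sup>+r. (ennreal (?N r) * ?G r) * ennreal (?e r) \<partial>?R) = ennreal (chi_moment ?n / chi_moment (?n - 1)) * (\<integral>\<^sup>+r. ?G r * ennreal (?e r) \<partial>?R)"
  proof -
    \<comment> \<open>The factor \<open>1 / t\<close> removes \<open>?N r\<close> on one side of the
      polar formula; on the other it lowers the radial power by one, which gives
      \<open>chi_moment (?n - 1)\<close>.\<close>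
    let ?w = "\<lambda>t::real. ennreal (1 / t * exp (- (t\<^sup>2 / 2)))"
    have pol: "ennreal (chi_moment (a * card {..<Suc d})) * (\<integral>\<^sup>+r. (ennreal (?N r) * ?G r) * ?w (?N r) \<partial>?R)
      = (\<integral>\<^sup>+r. (ennreal (?N r) * ?G r) * ennreal (?e r) \<partial>?R) * (\<integral>\<^sup>+t. ennreal (t ^ (a * card {..<Suc d} - 1)) * ?w t * indicator {0<..} t \<partial>lborel)"
    proof (rule power_measure_polar[OF a])
      fix t :: real and x :: "nat \<Rightarrow> real" assume t: "t > 0"
      have "(\<Sum>i<Suc d. ((\<lambda>i\<in>{..<Suc d}. t * x i) i)\<^sup>2) = (\<Sum>i<Suc d. t\<^sup>2 * (x i)\<^sup>2)"
        by (intro sum.cong) (auto simp: power_mult_distrib)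
      then have "?N (\<lambda>i\<in>{..<Suc d}. t * x i) = t * ?N x"
        using t by (simp only: sum_distrib_left[symmetric] real_sqrt_mult real_sqrt_abs abs_of_pos)
      then have "ennreal (?N (\<lambda>i\<in>{..<Suc d}. t * x i)) * ?G (\<lambda>i\<in>{..<Suc d}. t * x i) = (ennreal (t * ?N x) * ennreal (1 / t)) * ?G x"
        by (simp only: nn_integral_cone_gauss_prod_scale[OF t] mult.assoc)
      also have "ennreal (t * ?N x) * ennreal (1 / t) = ennreal (?N x)" using t by (simp add: ennreal_mult''[symmetric] del: sum.lessThan_Suc)
      finally show "ennreal (?N (\<lambda>i\<in>{..<Suc d}. t * x i)) * ?G (\<lambda>i\<in>{..<Suc d}. t * x i) = ennreal (?N x) * ?G x" .
    qed (auto simp: lessThan_empty_iff simp del: sum.lessThan_Suc)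
    have "(\<integral>\<^sup>+r. (ennreal (?N r) * ?G r) * ?w (?N r) \<partial>?R) = (\<integral>\<^sup>+r. ?G r * ennreal (?e r) \<partial>?R)"
    proof (rule nn_integral_cong_AE)
      show "AE r in ?R. (ennreal (?N r) * ?G r) * ?w (?N r) = ?G r * ennreal (?e r)"
        using AE_PiM_all[OF sigma_finite_power_measure finite_lessThan AE_power_measure_pos]
      proof eventually_elim
        case (elim r)
        have "r 0 > 0" using elim by simp
        then have S: "(\<Sum>i<Suc d. (r i)\<^sup>2) > 0" by (intro sum_pos2[of _ 0]) auto
        then have N: "?N r > 0" by (simp only: real_sqrt_gt_0_iff)
        have "(?N r)\<^sup>2 = (\<Sum>i<Suc d. (r i)\<^sup>2)" by (rule real_sqrt_pow2[OF less_imp_le[OF S]])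
        then have "ennreal (?N r) * ?w (?N r) = ennreal (?e r)" using N by (simp add: ennreal_mult'[symmetric] del: sum.lessThan_Suc)
        then have "?G r * (ennreal (?N r) * ?w (?N r)) = ?G r * ennreal (?e r)" by (simp only:)
        then show ?case by (simp only: mult_ac)
      qed
    qed
    moreover have "(\<integral>\<^sup>+t. ennreal (t ^ (a * card {..<Suc d} - 1)) * ?w t * indicator {0<..} t \<partial>lborel) = ennreal (chi_moment (?n - 1))"
    proof -
      have "(\<integral>\<^sup>+t. ennreal (t ^ (a * card {..<Suc d} - 1)) * ?w t * indicator {0<..} t \<partial>lborel) = (\<integral>\<^sup>+t. ennreal (t ^ (?n - 1 - 1) * exp (- (t\<^sup>2 / 2))) * indicator {0<..} t \<partial>lborel)"
      proof (rule nn_integral_cong)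
        fix t :: real
        have "t ^ (?n - 1) = t * t ^ (?n - 1 - 1)" using n2 by (rule pw)
        then show "ennreal (t ^ (a * card {..<Suc d} - 1)) * ?w t * indicator {0<..} t = ennreal (t ^ (?n - 1 - 1) * exp (- (t\<^sup>2 / 2))) * indicator {0<..} t"
          by (cases "t > 0") (auto simp: ennreal_mult'[symmetric] simp del: mult_Suc_right One_nat_def)
      qed
      also have "\<dots> = ennreal (chi_moment (?n - 1))" by (rule gauss_moment1) (use n2 in simp)
      finally show ?thesis .
    qed
    ultimately have eq: "ennreal (chi_moment ?n) * (\<integral>\<^sup>+r. ?G r * ennreal (?e r) \<partial>?R) = (\<integral>\<^sup>+r. (ennreal (?N r) * ?G r) * ennreal (?e r) \<partial>?R) * ennreal (chi_moment (?n - 1))"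
      using pol by (simp only: card_lessThan)
    have "ennreal (chi_moment ?n / chi_moment (?n - 1)) * (\<integral>\<^sup>+r. ?G r * ennreal (?e r) \<partial>?R) = ennreal (1 / chi_moment (?n - 1)) * (ennreal (chi_moment ?n) * (\<integral>\<^sup>+r. ?G r * ennreal (?e r) \<partial>?R))"
    proof -
      have "ennreal (chi_moment ?n / chi_moment (?n - 1)) = ennreal (1 / chi_moment (?n - 1)) * ennreal (chi_moment ?n)" using chi_moment by (subst ennreal_mult'[symmetric]) (auto simp del: mult_Suc_right)
      then show ?thesis by (simp only: mult.assoc)
    qed
    also have "\<dots> = (ennreal (1 / chi_moment (?n - 1)) * ennreal (chi_moment (?n - 1))) * (\<integral>\<^sup>+r. (ennreal (?N r) * ?G r) * ennreal (?e r) \<partial>?R)"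
      unfolding eq by (simp only: mult_ac)
    also have "ennreal (1 / chi_moment (?n - 1)) * ennreal (chi_moment (?n - 1)) = 1" using chi_moment by (subst ennreal_mult'[symmetric]) (auto simp del: mult_Suc_right)
    finally show ?thesis by simp
  qed
  also have "(\<integral>\<^sup>+r. ?G r * ennreal (?e r) \<partial>?R) = ennreal (chi_moment a ^ Suc d) * cone_integral a d k"
  proof -
    let ?u = "\<lambda>r l. \<Prod>i<Suc d. ennreal (exp (- ((r i)\<^sup>2 / 2)) * normal_density 0 (r i) (zero_sum_ext d l i))"
    have u: "gauss_prod d r l * ennreal (?e r) = ?u r l" for r l
    proof -
      have "?e r = (\<Prod>i<Suc d. exp (- ((r i)\<^sup>2 / 2)))" by (subst exp_sum[symmetric]) (simp_all only: finite_lessThan sum_negf sum_divide_distrib)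
      then have "ennreal (?e r) = (\<Prod>i<Suc d. ennreal (exp (- ((r i)\<^sup>2 / 2))))" by (simp only: prod_ennreal exp_ge_zero)
      then show ?thesis unfolding gauss_prod_def
        by (simp only: prod.distrib[symmetric]) (intro prod.cong refl, simp add: ennreal_mult' mult.commute)
    qed
    have "(\<integral>\<^sup>+r. ?G r * ennreal (?e r) \<partial>?R) = (\<integral>\<^sup>+r. \<integral>\<^sup>+l. (indicator (cone_set d k) l * gauss_prod d r l) * ennreal (?e r) \<partial>lebesgue_d d \<partial>?R)"
      by (intro nn_integral_cong nn_integral_multc[symmetric]) measurable
    also have "\<dots> = (\<integral>\<^sup>+l. \<integral>\<^sup>+r. (indicator (cone_set d k) l * gauss_prod d r l) * ennreal (?e r) \<partial>?R \<partial>lebesgue_d d)"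
      by (rule RL.Fubini'[symmetric]) measurable
    also have "\<dots> = (\<integral>\<^sup>+l. ennreal (chi_moment a ^ Suc d) * (indicator (cone_set d k) l * (\<Prod>i<Suc d. vg_density a (zero_sum_ext d l i))) \<partial>lebesgue_d d)"
    proof (rule nn_integral_cong)
      fix l assume l: "l \<in> space (lebesgue_d d)"
      have "(\<integral>\<^sup>+r. (indicator (cone_set d k) l * gauss_prod d r l) * ennreal (?e r) \<partial>?R) = (\<integral>\<^sup>+r. indicator (cone_set d k) l * ?u r l \<partial>?R)"
        by (intro nn_integral_cong) (simp only: mult.assoc u)
      also have "\<dots> = indicator (cone_set d k) l * (\<integral>\<^sup>+r. ?u r l \<partial>?R)" by (rule nn_integral_cmult) measurable
      also have "(\<integral>\<^sup>+r. ?u r l \<partial>?R) = (\<Prod>i<Suc d. \<integral>\<^sup>+r. ennreal (exp (- (r\<^sup>2 / 2)) * normal_density 0 r (zero_sum_ext d l i)) \<partial>power_measure a)"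
        by (rule P.product_nn_integral_prod) auto
      also have "\<dots> = (\<Prod>i<Suc d. ennreal (chi_moment a) * vg_density a (zero_sum_ext d l i))"
      proof (rule prod.cong[OF refl])
        fix i
        have "ennreal (chi_moment a) * vg_density a (zero_sum_ext d l i) = (ennreal (chi_moment a) * ennreal (1 / chi_moment a)) * (\<integral>\<^sup>+r. ennreal (exp (- (r\<^sup>2 / 2)) * normal_density 0 r (zero_sum_ext d l i)) \<partial>power_measure a)"
          unfolding vg_density_def by (simp only: mult.assoc)
        also have "ennreal (chi_moment a) * ennreal (1 / chi_moment a) = 1" using chi_moment by (subst ennreal_mult'[symmetric]) auto
        finally show "(\<integral>\<^sup>+r. ennreal (exp (- (r\<^sup>2 / 2)) * normal_density 0 r (zero_sum_ext d l i)) \<partial>power_measure a) = ennreal (chi_moment a) * vg_density a (zero_sum_ext d l i)" by simp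
      qed
      also have "\<dots> = ennreal (chi_moment a ^ Suc d) * (\<Prod>i<Suc d. vg_density a (zero_sum_ext d l i))"
        by (simp only: prod.distrib prod_constant card_lessThan ennreal_power[OF less_imp_le[OF chi_moment(1)]])
      finally show "(\<integral>\<^sup>+r. (indicator (cone_set d k) l * gauss_prod d r l) * ennreal (?e r) \<partial>?R) = ennreal (chi_moment a ^ Suc d) * (indicator (cone_set d k) l * (\<Prod>i<Suc d. vg_density a (zero_sum_ext d l i)))"
        by (simp only: mult_ac)
    qed
    also have "\<dots> = ennreal (chi_moment a ^ Suc d) * cone_integral a d k"
      unfolding cone_integral_def by (rule nn_integral_cmult) measurable
    finally show ?thesis .
  qed
  also have "ennreal (sqrt (2 * pi) * (1 / chi_moment a) ^ Suc d) * (ennreal (chi_moment ?n / chi_moment (?n - 1)) * (ennreal (chi_moment a ^ Suc d) * cone_integral a d k))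
    = ennreal (sqrt (2 * pi) * (1 / chi_moment a) ^ Suc d * (chi_moment ?n / chi_moment (?n - 1)) * chi_moment a ^ Suc d) * cone_integral a d k"
    using chi_moment by (subst ennreal_mult', simp add: less_imp_le del: mult_Suc_right power_Suc)+ (simp only: mult.assoc)
  also have "sqrt (2 * pi) * (1 / chi_moment a) ^ Suc d * (chi_moment ?n / chi_moment (?n - 1)) * chi_moment a ^ Suc d = 2 * pi * c_tilde (real ?n / 2)"
  proof -
    have "(1 / chi_moment a) ^ Suc d * chi_moment a ^ Suc d = 1" using chi_moment by (simp add: power_mult_distrib[symmetric] del: power_Suc)
    moreover have "2 * pi * c_tilde (real ?n / 2) = sqrt (2 * pi) * (chi_moment ?n / chi_moment (?n - 1))"
    proof -
      have alg: "2 * pi * (A / (s * B)) = (2 * pi / s) * (A / B)" for A B s :: real by simp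
      have "2 * pi / sqrt (2 * pi) = sqrt (2 * pi)" by (rule real_div_sqrt) simp
      then show ?thesis unfolding c_tilde_eq_chi_moment[OF n2] alg by (simp only:)
    qed
    moreover have "s * u * v * u' = s * v * (u * u')" for s u v u' :: real by (simp only: mult_ac)
    ultimately show ?thesis by (simp only: mult_1_right)
  qed
  finally show ?thesis .
qed

section \<open>Reduction to the residue formula\<close>

text \<open>Point 0 together with the coefficients \<open>i < k - 1\<close> are the \<open>k\<close>
  variables of the face. They convolve to index \<open>a * k\<close>, evaluated at minus the sum of
  the others, and the density is even.\<close>

lemma cone_integral_eq:
  assumes a: "a \<ge> 1" and k: "1 \<le> k" "k \<le> d"
  shows "cone_integral a d k = (\<integral>\<^sup>+l. vg_density (a * k) (\<Sum>i\<in>{k-1..<d}. l i) \<partial>PiM {k-1..<d} (\<lambda>_. vg_pos_part a))"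
proof -
  let ?I = "{..<k-1}" and ?J = "{k-1..<d}"
  interpret L: product_sigma_finite "\<lambda>_::nat. lborel :: real measure" ..
  interpret F: finite_measure "vg_pos_part a" using a by (rule finite_measure_vg_pos_part)
  have IJ: "?J \<union> ?I = {..<d}" "?J \<inter> ?I = {}" using k by auto
  define f where "f = (\<lambda>l::nat\<Rightarrow>real. indicator (cone_set d k) l * (\<Prod>i<Suc d. vg_density a (zero_sum_ext d l i)))"
  have fm: "f \<in> borel_measurable (PiM (?J \<union> ?I) (\<lambda>_. lborel))"
  proof -
    have "f \<in> borel_measurable (lebesgue_d d)" unfolding f_def by measurable
    then show ?thesis unfolding IJ lebesgue_d_def .
  qed
  have "cone_integral a d k = (\<integral>\<^sup>+l. f l \<partial>PiM (?J \<union> ?I) (\<lambda>_. lborel))"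
    unfolding cone_integral_def f_def IJ lebesgue_d_def ..
  also have "\<dots> = (\<integral>\<^sup>+x. \<integral>\<^sup>+y. f (merge ?J ?I (x, y)) \<partial>PiM ?I (\<lambda>_. lborel) \<partial>PiM ?J (\<lambda>_. lborel))"
    by (rule L.product_nn_integral_fold[OF IJ(2) _ _ fm]) auto
  also have "\<dots> = (\<integral>\<^sup>+x. (\<Prod>i\<in>?J. vg_density a (x i) * indicator {0<..} (x i)) * vg_density (a * k) (\<Sum>i\<in>?J. x i) \<partial>PiM ?J (\<lambda>_. lborel))"
  proof (rule nn_integral_cong_AE)
    \<comment> \<open>\<open>cone_set\<close> admits the value 0 and \<open>vg_pos_part\<close> does
      not; the two conditions differ on a null set.\<close>
    have "AE x in PiM ?J (\<lambda>_. lborel). \<forall>i\<in>?J. x i \<noteq> (0::real)"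
      by (rule AE_PiM_all) (auto simp: lborel.sigma_finite_measure_axioms AE_lborel_singleton)
    then show "AE x in PiM ?J (\<lambda>_. lborel). (\<integral>\<^sup>+y. f (merge ?J ?I (x, y)) \<partial>PiM ?I (\<lambda>_. lborel)) = (\<Prod>i\<in>?J. vg_density a (x i) * indicator {0<..} (x i)) * vg_density (a * k) (\<Sum>i\<in>?J. x i)"
    proof eventually_elim
      case (elim x)
      let ?s = "\<Sum>i\<in>?J. x i"
      have "(\<integral>\<^sup>+y. f (merge ?J ?I (x, y)) \<partial>PiM ?I (\<lambda>_. lborel)) = (\<integral>\<^sup>+y. (\<Prod>i\<in>?J. vg_density a (x i) * indicator {0<..} (x i)) * ((\<Prod>i\<in>?I. vg_density a (y i)) * vg_density a (- ?s - (\<Sum>i\<in>?I. y i))) \<partial>PiM ?I (\<lambda>_. lborel))"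
      proof (rule nn_integral_cong)
        fix y :: "nat \<Rightarrow> real"
        let ?l = "merge ?J ?I (x, y)"
        have lJ: "?l i = x i" if "i \<in> ?J" for i using that by (simp add: merge_def)
        have lI: "?l i = y i" if "i \<in> ?I" for i using that IJ(2) by (auto simp: merge_def)
        have ls: "?l \<in> space (lebesgue_d d)" using k by (auto simp: space_lebesgue_d merge_def PiE_iff extensional_def)
        have sum: "(\<Sum>i<d. ?l i) = ?s + (\<Sum>i\<in>?I. y i)"
        proof -
          have "(\<Sum>i<d. ?l i) = (\<Sum>i\<in>?J. ?l i) + (\<Sum>i\<in>?I. ?l i)"
            unfolding IJ(1)[symmetric] by (rule sum.union_disjoint) (use IJ(2) in auto)
          then show ?thesis by (simp only: sum.cong[OF refl lJ] sum.cong[OF refl lI])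
        qed
        have prod: "(\<Prod>i<d. vg_density a (?l i)) = (\<Prod>i\<in>?J. vg_density a (x i)) * (\<Prod>i\<in>?I. vg_density a (y i))"
        proof -
          have "(\<Prod>i<d. vg_density a (?l i)) = (\<Prod>i\<in>?J. vg_density a (?l i)) * (\<Prod>i\<in>?I. vg_density a (?l i))"
            unfolding IJ(1)[symmetric] by (rule prod.union_disjoint) (use IJ(2) in auto)
          also have "(\<Prod>i\<in>?J. vg_density a (?l i)) = (\<Prod>i\<in>?J. vg_density a (x i))" by (intro prod.cong refl) (simp only: lJ)
          also have "(\<Prod>i\<in>?I. vg_density a (?l i)) = (\<Prod>i\<in>?I. vg_density a (y i))" by (intro prod.cong refl) (simp only: lI)
          finally show ?thesis .
        qed
        have ind: "indicator (cone_set d k) ?l = (\<Prod>i\<in>?J. indicator {0<..} (x i) :: ennreal)"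
        proof (cases "\<forall>i\<in>?J. x i > 0")
          case True
          then have "?l \<in> cone_set d k" using ls lJ by (auto simp: cone_set_def intro!: less_imp_le)
          moreover have "(\<Prod>i\<in>?J. indicator {0<..} (x i) :: ennreal) = 1" using True by (intro prod.neutral) auto
          ultimately show ?thesis by simp
        next
          case False
          then obtain i where i: "i \<in> ?J" "\<not> x i > 0" by auto
          with elim have "x i < 0" by force
          then have "?l \<notin> cone_set d k" using i lJ[of i] k by (auto simp: cone_set_def)
          moreover have "(\<Prod>i\<in>?J. indicator {0<..} (x i) :: ennreal) = 0" using i by (intro prod_zero bexI[of _ i]) auto
          ultimately show ?thesis by simp
        qed
        have "f ?l = indicator (cone_set d k) ?l * (vg_density a (- (\<Sum>i<d. ?l i)) * (\<Prod>i<d. vg_density a (?l i)))"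
          unfolding f_def by (subst prod.lessThan_Suc_shift) simp
        also have "- (\<Sum>i<d. ?l i) = - ?s - (\<Sum>i\<in>?I. y i)" unfolding sum by simp
        finally show "f ?l = (\<Prod>i\<in>?J. vg_density a (x i) * indicator {0<..} (x i)) * ((\<Prod>i\<in>?I. vg_density a (y i)) * vg_density a (- ?s - (\<Sum>i\<in>?I. y i)))"
          unfolding ind prod by (simp only: prod.distrib mult_ac)
      qed
      also have "\<dots> = (\<Prod>i\<in>?J. vg_density a (x i) * indicator {0<..} (x i)) * (\<integral>\<^sup>+y. (\<Prod>i\<in>?I. vg_density a (y i)) * vg_density a (- ?s - (\<Sum>i\<in>?I. y i)) \<partial>PiM ?I (\<lambda>_. lborel))"
        by (rule nn_integral_cmult) measurable
      also have "(\<integral>\<^sup>+y. (\<Prod>i\<in>?I. vg_density a (y i)) * vg_density a (- ?s - (\<Sum>i\<in>?I. y i)) \<partial>PiM ?I (\<lambda>_. lborel)) = vg_density (a * (card ?I + 1)) (- ?s)"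
        by (rule vg_density_multi_conv[where j = "k - 1"]) (use a in auto)
      also have "\<dots> = vg_density (a * k) ?s" using k by (simp add: vg_density_minus)
      finally show ?case .
    qed
  qed
  also have "\<dots> = (\<integral>\<^sup>+x. vg_density (a * k) (\<Sum>i\<in>?J. x i) \<partial>PiM ?J (\<lambda>_. vg_pos_part a))"
  proof -
    have "PiM ?J (\<lambda>_. vg_pos_part a) = density (PiM ?J (\<lambda>_. lborel)) (\<lambda>x. \<Prod>i\<in>?J. vg_density a (x i) * indicator {0<..} (x i))"
      unfolding vg_pos_part_def
      by (rule PiM_density) (use F.sigma_finite_measure_axioms in \<open>auto simp: vg_pos_part_def lborel.sigma_finite_measure_axioms\<close>)
    then show ?thesis by (simp only:) (rule nn_integral_density[symmetric], measurable)
  qed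
  finally show ?thesis .
qed

theorem theorem1p7:
  fixes \<alpha> n k :: nat
  assumes "\<alpha> \<ge> 1" and "n \<ge> 1" and "1 \<le> k" and "k \<le> n" and "even (\<alpha> * k)"
  shows "complex_of_real (J_tilde n k ((real \<alpha> + real n - 1) / 2)) =
    of_real (real (n choose k) * c_tilde (real \<alpha> * real n / 2)
             * (c_tilde ((real \<alpha> + 1) / 2)) ^ (n - k) * pi)
    * residue (\<lambda>x::complex. (contour_integral (linepath 0 x) (\<lambda>y. (sin y) ^ (\<alpha> - 1))) ^ (n - k)
                             / (sin x) ^ (\<alpha> * n - 1)) 0"
proof -
  let ?res = "residue (\<lambda>x::complex. (contour_integral (linepath 0 x) (\<lambda>y. (sin y) ^ (\<alpha> - 1))) ^ (n - k) / (sin x) ^ (\<alpha> * n - 1)) 0"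
  obtain m where m: "\<alpha> * k = 2 * m" using assms(5) by blast
  have m1: "m \<ge> 1" using m assms by (cases m) auto
  have an: "\<alpha> * n \<ge> 2" using m m1 mult_le_mono2[OF assms(4), of \<alpha>] by linarith
  have c0: "c_tilde (real \<alpha> * real n / 2) > 0"
  proof -
    have "chi_moment (\<alpha> * n) > 0" "chi_moment (\<alpha> * n - 1) > 0" by (rule chi_moment_pos, use an in linarith)+
    then show ?thesis using c_tilde_eq_chi_moment[OF an] by simp
  qed
  show ?thesis
  proof (cases "k = n")
    case True
    \<comment> \<open>\<open>J_tilde\<close> is 1 by convention, so the right-hand side must be
      evaluated: with no remaining variables the residue is twice
      \<open>vg_density (2 * m) 0\<close>, which is known in closed form.\<close>
    have "\<exists>q\<ge>0. vg_density (2 * m) 0 = ennreal q \<and> complex_of_real q = of_real (1 / 2) * ?res"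
      using residue_formula[OF assms(1) m1, of "{} :: nat set"] True m by (simp add: PiM_empty nn_integral_count_space_finite)
    then obtain q where q: "q \<ge> 0" "vg_density (2 * m) 0 = ennreal q" "complex_of_real q = of_real (1 / 2) * ?res" by blast
    have "vg_density (2 * m) 0 = ennreal (1 / (2 * pi * c_tilde (real \<alpha> * real n / 2)))"
      using vg_density_at_0[of "2 * m"] m1 m True by (metis an of_nat_mult)
    then have "q = 1 / (2 * pi * c_tilde (real \<alpha> * real n / 2))" using q c0 by simp
    then have "c_tilde (real \<alpha> * real n / 2) * pi * (2 * q) = 1" using c0 by simp
    moreover have "?res = of_real (2 * q)"
    proof -
      have "?res = 2 * (of_real (1 / 2) * ?res)" by simp
      also have "\<dots> = of_real (2 * q)" unfolding q(3)[symmetric] by simp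
      finally show ?thesis .
    qed
    ultimately have "complex_of_real (c_tilde (real \<alpha> * real n / 2) * pi) * ?res = 1"
      by (simp only: of_real_mult[symmetric]) simp
    then show ?thesis using True by (simp add: J_tilde_def)
  next
    case False
    \<comment> \<open>The dimension is \<open>d = n - 1\<close>; now
      \<open>1 \<le> k \<le> d\<close>, so the polar arguments for \<open>d \<ge> 1\<close>
      apply.\<close>
    then obtain d where d: "n = Suc d" and kd: "k \<le> d" using assms by (cases n) auto
    have d1: "d \<ge> 1" using kd assms by simp
    let ?J = "{k-1..<d}"
    have cJ: "card ?J = n - k" using d kd assms by simp
    have bet: "(real \<alpha> + real n - 1) / 2 = (real \<alpha> + real d) / 2" by (simp add: d)
    have ex: "\<alpha> * (n - k) + 2 * m - 1 = \<alpha> * n - 1"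
      unfolding m[symmetric] using assms(4) by (simp add: distrib_left[symmetric])
    obtain q where q: "q \<ge> 0" "cone_integral \<alpha> d k = ennreal q" "complex_of_real q = of_real (c_tilde ((real \<alpha> + 1) / 2) ^ (n - k) / 2) * ?res"
      using residue_formula[OF assms(1) m1, of ?J] cone_integral_eq[OF assms(1,3) kd] unfolding cJ ex m by auto
    let ?M = "PiM {..<Suc d} (\<lambda>_. beta_prime_d d ((real \<alpha> + real d) / 2))"
    have sM: "sets ?M = sets (mat_space d)" by (intro sets_PiM_cong) (auto simp: beta_prime_d_def)
    have spM: "space ?M = space (mat_space d)" using sets_eq_imp_space_eq[OF sM] .
    \<comment> \<open>Equality at every configuration, so the angle inherits measurability from
      \<open>angle_ratio\<close>.\<close>
    have "(LINT X|?M. internal_angle d X {..<k} {..<Suc d}) = (LINT X|?M. enn2real (angle_ratio d k X))"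
      using assms(3) kd by (intro Bochner_Integration.integral_cong refl) (simp add: spM internal_angle_eq_angle_ratio)
    also have "\<dots> = enn2real (\<integral>\<^sup>+X. ennreal (enn2real (angle_ratio d k X)) \<partial>?M)"
    proof (rule integral_eq_nn_integral)
      have "(\<lambda>X. enn2real (angle_ratio d k X)) \<in> borel_measurable (mat_space d)" by measurable
      then show "(\<lambda>X. enn2real (angle_ratio d k X)) \<in> borel_measurable ?M" by (simp only: measurable_cong_sets[OF sM refl])
    qed simp
    also have "(\<integral>\<^sup>+X. ennreal (enn2real (angle_ratio d k X)) \<partial>?M) = (\<integral>\<^sup>+X. angle_ratio d k X \<partial>?M)"
    proof (rule nn_integral_cong)
      fix X assume "X \<in> space ?M"
      then have "angle_ratio d k X \<le> 1" unfolding spM by (rule angle_ratio_le_1)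
      then show "ennreal (enn2real (angle_ratio d k X)) = angle_ratio d k X"
        by (intro ennreal_enn2real) (simp add: le_less_trans)
    qed
    also have "\<dots> = ennreal (2 * pi * c_tilde (real (\<alpha> * Suc d) / 2)) * ennreal q"
      unfolding expected_angle_ratio[OF assms(1) d1] q(2) ..
    also have "enn2real \<dots> = 2 * pi * c_tilde (real \<alpha> * real n / 2) * q"
      using q(1) c0 by (simp add: enn2real_mult d del: mult_Suc_right of_nat_Suc)
    finally have E: "(LINT X|?M. internal_angle d X {..<k} {..<Suc d}) = 2 * pi * c_tilde (real \<alpha> * real n / 2) * q" .
    have "J_tilde n k ((real \<alpha> + real n - 1) / 2) = real (n choose k) * (2 * pi * c_tilde (real \<alpha> * real n / 2) * q)"
      using False unfolding J_tilde_def bet by (simp add: d E[unfolded d] del: of_nat_Suc)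
    then have "complex_of_real (J_tilde n k ((real \<alpha> + real n - 1) / 2)) = of_real (real (n choose k) * (2 * pi * c_tilde (real \<alpha> * real n / 2))) * complex_of_real q"
      by (simp only: of_real_mult mult.assoc)
    \<comment> \<open>The 1/2 contained in \<open>q\<close> reduces \<open>2 * pi\<close> to
      \<open>pi\<close>.\<close>
    also have "\<dots> = of_real (real (n choose k) * c_tilde (real \<alpha> * real n / 2) * (c_tilde ((real \<alpha> + 1) / 2)) ^ (n - k) * pi) * ?res"
      unfolding q(3) by (simp add: mult_ac)
    finally show ?thesis .
  qed
qed

end
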